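(* Let $d\ge1$ and let $\mathcal Q_d,\mathcal Q^0_d\subset\mathbb{R}^d$ be built from $m$ independent Gaussian walks in $\mathbb{R}^d$ with $n_1,\dots,n_m$ steps. Then $$\mathbb E|\mathcal Q_d|=\frac{\Gamma(\frac{d+1}2)}{d\sqrt\pi\,\Gamma(\frac d2)}\sum_{\text{configs of size }d+1}\frac{s}{2^{(d+1)/2-1}\Gamma(\frac{d+1}2)}\prod_{l:k_l>0}\Big[\sqrt{i^{(l)}_1}\,\Delta_l^{-1/2}c_l\Big]J_{(-\infty,\infty)},$$ $$\mathbb E|\mathcal Q^0_d|=\frac{\Gamma(\frac{d+1}2)}{d\sqrt\pi\,\Gamma(\frac d2)}\Bigg(\sum_{\text{configs of size }d+1}\frac{s}{2^{(d+1)/2-1}\Gamma(\frac{d+1}2)}\prod_{l:k_l>0}\Big[\sqrt{i^{(l)}_1}\,\Delta_l^{-1/2}c_l\Big]J_{(0,\infty)}+\sum_{\text{configs of size }d}\frac{\sqrt{2\pi}}{2^{(d+1)/2-1}\Gamma(\frac{d+1}2)}\prod_{l=1}^m e_l\Bigg),$$ where $e_l=(i^{(l)}_1\Delta_l)^{-1/2}c_l$ if $k_l>0$ and $e_l=\frac{(2n_l-1)!!}{(2n_l)!!}$ if $k_l=0$, and $s,\Delta_l,c_l,J$ are computed for the configuration being summed. (Equivalently, $\mathbb E|\mathcal Q_d|=\frac{\Gamma(\frac{d+1}2)}{d\sqrt\pi\,\Gamma(\frac d2)}\mathbb E|\mathrm{bd}\,\mathcal Q_{d+1}|$ and likewise for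 $\mathcal Q^0$, where $\mathcal Q_{d+1}$ is the analogous hull of $m$ independent Gaussian walks in $\mathbb{R}^{d+1}$ with the same step numbers.)
   Context: Setting. Fix integers $m\ge1$, $n_1,\dots,n_m\ge1$. For a dimension $D$, let $X^{(l)}_i$ ($1\le l\le m$, $1\le i\le n_l$) be independent standard Gaussian vectors in $\mathbb{R}^D$, $S^{(l)}_i=X^{(l)}_1+\dots+X^{(l)}_i$, $\mathcal Q_D=\mathrm{conv}\{S^{(l)}_i\}$, $\mathcal Q^0_D=\mathrm{conv}(\{0\}\cup\{S^{(l)}_i\})$. $|\cdot|$ denotes $d$-dimensional volume; $|\mathrm{bd}\,K|$ denotes surface area. An index configuration of size $k$ consists of nonnegative integers $k_1,\dots,k_m$ with $k_l\le n_l$ and $\sum_l k_l=k$, together with, for each $l$ with $k_l>0$, indices $1\le i^{(l)}_1<\dots<i^{(l)}_{k_l}\le n_l$. Persistence probabilities: with $N_1,N_2,\dots$ i.i.d. standard Gaussian real variables, $p_n(r)=\mathbb P[\sum_{i=1}^kN_i\le r,\ k=1,\dots,n]$ and $q_n(r)=\mathbb P[\sum_{i=1}^kN_i\le r,\ k=1,\dots,n\mid \sum_{i=1}^nN_i=r]$ (so $q_1\equiv1$). Notation: for $l$ with $k_l>0$, $\Delta_l=(i^{(l)}_2-i^{(l)}_1)\cdots(i^{(l)}_{k_l}-i^{(l)}_{k_l-1})$ (empty product $=1$), $c_l=\frac{(2(n_l-i^{(l)}_{k_l})-1)!!}{(2(n_l-i^{(l)}_{k_l}))!!}$ with $(-1)!!=0!!=1$;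 $s=\sum_{l:k_l>0}1/i^{(l)}_1$; $J_{(a,b)}=\int_a^b e^{-sr^2/2}\prod_{l:k_l=0}p_{n_l}(r)\prod_{l:k_l>0}q_{i^{(l)}_1}(r)\,dr$. *)

theory Defs
  imports "HOL-Probability.Probability"
begin

definition std_gauss :: "(real^'d) measure" where
  "std_gauss = density lborel
     (\<lambda>x. ennreal ((2 * pi) powr (- real CARD('d) / 2) * exp (- (norm x)\<^sup>2 / 2)))"

definition steps :: "nat \<Rightarrow> (nat \<Rightarrow> nat) \<Rightarrow> (nat \<times> nat) set" where
  "steps m n = {(l, i). l \<in> {1..m} \<and> i \<in> {1..n l}}"

definition steps_law :: "nat \<Rightarrow> (nat \<Rightarrow> nat) \<Rightarrow> (nat \<times> nat \<Rightarrow> real^'d) measure" where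
  "steps_law m n = PiM (steps m n) (\<lambda>_. std_gauss)"

definition walk_pt :: "(nat \<times> nat \<Rightarrow> real^'d) \<Rightarrow> nat \<Rightarrow> nat \<Rightarrow> real^'d" where
  "walk_pt X l i = (\<Sum>j = 1..i. X (l, j))"

definition hullQ :: "nat \<Rightarrow> (nat \<Rightarrow> nat) \<Rightarrow> (nat \<times> nat \<Rightarrow> real^'d) \<Rightarrow> (real^'d) set" where
  "hullQ m n X = convex hull {walk_pt X l i | l i. (l, i) \<in> steps m n}"

definition hullQ0 :: "nat \<Rightarrow> (nat \<Rightarrow> nat) \<Rightarrow> (nat \<times> nat \<Rightarrow> real^'d) \<Rightarrow> (real^'d) set" where
  "hullQ0 m n X = convex hull (insert 0 {walk_pt X l i | l i. (l, i) \<in> steps m n})"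

definition normals :: "nat \<Rightarrow> (nat \<Rightarrow> real) measure" where
  "normals n = PiM {1..n} (\<lambda>_. std_normal_distribution)"

definition pers_p :: "nat \<Rightarrow> real \<Rightarrow> real" where
  "pers_p n r = measure (normals n) {N \<in> space (normals n). \<forall>k\<in>{1..n}. (\<Sum>i=1..k. N i) \<le> r}"

text \<open>Bridge persistence probability q_n(r): conditional on sum_{i<=n} N_i = r. We use the
  (continuous) regular version given by the Gaussian bridge: conditional on S_n = r, the walk
  (S_k) has the law of (S_k - (k/n) S_n + (k/n) r).\<close>
definition pers_q :: "nat \<Rightarrow> real \<Rightarrow> real" where
  "pers_q n r = measure (normals n) {N \<in> space (normals n). \<forall>k\<in>{1..n}.
      (\<Sum>i=1..k. N i) - real k / real n * (\<Sum>i=1..n. N i) + real k / real n * r \<le> r}"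

definition odd_dfact :: "nat \<Rightarrow> real" where
  "odd_dfact j = (\<Prod>i=1..j. real (2 * i - 1))"

definition even_dfact :: "nat \<Rightarrow> real" where
  "even_dfact j = (\<Prod>i=1..j. real (2 * i))"

text \<open>Index configurations of size k: K l is the set {i^(l)_1 < ... < i^(l)_{k_l}} (empty iff k_l = 0).\<close>
definition configs :: "nat \<Rightarrow> (nat \<Rightarrow> nat) \<Rightarrow> nat \<Rightarrow> (nat \<Rightarrow> nat set) set" where
  "configs m n k = {K. (\<forall>l. K l \<subseteq> (if l \<in> {1..m} then {1..n l} else {})) \<and>
                        (\<Sum>l=1..m. card (K l)) = k}"

definition cfg_Delta :: "nat set \<Rightarrow> real" where
  "cfg_Delta A = (\<Prod>i\<in>A - {Min A}. real (i - Max {j\<in>A. j < i}))"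

definition cfg_c :: "nat \<Rightarrow> nat set \<Rightarrow> real" where
  "cfg_c nl A = odd_dfact (nl - Max A) / even_dfact (nl - Max A)"

definition cfg_s :: "nat \<Rightarrow> (nat \<Rightarrow> nat set) \<Rightarrow> real" where
  "cfg_s m K = (\<Sum>l\<in>{l\<in>{1..m}. K l \<noteq> {}}. 1 / real (Min (K l)))"

definition cfg_integrand :: "nat \<Rightarrow> (nat \<Rightarrow> nat) \<Rightarrow> (nat \<Rightarrow> nat set) \<Rightarrow> real \<Rightarrow> real" where
  "cfg_integrand m n K r = exp (- cfg_s m K * r\<^sup>2 / 2)
      * (\<Prod>l\<in>{l\<in>{1..m}. K l = {}}. pers_p (n l) r)
      * (\<Prod>l\<in>{l\<in>{1..m}. K l \<noteq> {}}. pers_q (Min (K l)) r)"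

definition cfg_J_full :: "nat \<Rightarrow> (nat \<Rightarrow> nat) \<Rightarrow> (nat \<Rightarrow> nat set) \<Rightarrow> real" where
  "cfg_J_full m n K = (LINT r|lborel. cfg_integrand m n K r)"

definition cfg_J_pos :: "nat \<Rightarrow> (nat \<Rightarrow> nat) \<Rightarrow> (nat \<Rightarrow> nat set) \<Rightarrow> real" where
  "cfg_J_pos m n K = (LINT r:{0<..}|lborel. cfg_integrand m n K r)"

definition cfg_weight :: "nat \<Rightarrow> (nat \<Rightarrow> nat) \<Rightarrow> (nat \<Rightarrow> nat set) \<Rightarrow> real" where
  "cfg_weight m n K = (\<Prod>l\<in>{l\<in>{1..m}. K l \<noteq> {}}.
      sqrt (real (Min (K l))) * cfg_Delta (K l) powr (-1/2) * cfg_c (n l) (K l))"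

definition cfg_e :: "(nat \<Rightarrow> nat) \<Rightarrow> (nat \<Rightarrow> nat set) \<Rightarrow> nat \<Rightarrow> real" where
  "cfg_e n K l = (if K l \<noteq> {}
      then (real (Min (K l)) * cfg_Delta (K l)) powr (-1/2) * cfg_c (n l) (K l)
      else odd_dfact (n l) / even_dfact (n l))"

end

theory Submission
  imports Defs
begin

text \<open>
  Lift the vertices of the hull by independent one-dimensional Gaussian walks. The upper faces of the
  lifted configuration triangulate the hull (a regular triangulation, generic for almost all heights),
  so its volume is the sum, over all sets of \<open>d + 1\<close> vertices, of the simplex volume times
  the probability that the simplex is an upper face. For a fixed simplex, replace the heights by the
  slope \<open>a\<close>, the offset \<open>r\<close> and the vertical gaps of the supporting hyperplane: the Jacobian
  is again the simplex determinant, and after scaling the gaps by \<open>sqrt (1 + |a|\<^sup>2)\<close> the Gaussian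
  steps separate from the gaps. What remains is a product of the second moment of a Gaussian
  determinant (a Gram determinant), the integral of \<open>(1 + |a|\<^sup>2)\<close> to the power \<open>- (d + 2) / 2\<close>,
  and, for each walk, the density that a nonnegative scalar walk started at \<open>r\<close> vanishes at the
  prescribed times. The latter factors into \<open>p\<close>, \<open>q\<close> and the values \<open>q(0) = 1 / n\<close> (cyclic
  shifts) and \<open>p(0) = (2n - 1)!! / (2n)!!\<close>. When the hull also contains the origin, whose height is \<open>0\<close>, faces
  missing it contribute \<open>r > 0\<close> and faces through it force \<open>r = 0\<close>.
\<close>

section \<open>Product measures and linear substitutions\<close>

text \<open>The obstacle is that the volume of a simplex, the event of being an upper face and the
  densities all depend on the same steps. Two facts untie them. The simplex determinant occurs
  twice, as volume and as Jacobian, so only its square has to be averaged; that is a polynomial, and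
  its mean is \<open>d!\<close> times a Gram determinant, the factorial cancelling against the
  volume. And all vertices of the face lie on the hyperplane, so the scaled height increments are
  orthogonal to the coefficient vectors of the edges: the recentring of the steps along
  \<open>a\<close> cancels in the determinant. The power of \<open>1 + |a|^2\<close> is a count: the
  Jacobian supplies one factor \<open>\<sigma> = sqrt (1 + |a|^2)\<close> for each height beyond
  \<open>d\<close>, every step a factor \<open>1 / \<sigma>\<close>, the squared determinant
  \<open>1 / \<sigma>^2\<close>. Each gap \<open>g\<close> between consecutive contacts of a walk
  contributes \<open>g\<close> to the Gram determinant and \<open>g^(-3/2)\<close> to the density,
  which leaves the \<open>\<Delta>^(-1/2)\<close> of the formula. Nonnegative integrals carry the
  main line, so that integrals can be exchanged without integrability.\<close>

lemma borel_measurable_vec_lambda [measurable (raw)]: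
  fixes f :: "'a \<Rightarrow> 'n::finite \<Rightarrow> real"
  assumes "\<And>k. (\<lambda>x. f x k) \<in> borel_measurable M"
  shows "(\<lambda>x. \<chi> k. f x k) \<in> borel_measurable M"
  by (subst borel_measurable_euclidean_space)
     (auto simp: Basis_vec_def inner_axis assms)

lemma measurable_PiM_coordinate:
  assumes "\<And>i. i \<in> I \<Longrightarrow> sets (M i) = sets borel"
  shows "(\<lambda>x. x j) \<in> borel_measurable (PiM I M)"
proof (cases "j \<in> I")
  case True
  have "(\<lambda>x. x j) \<in> measurable (PiM I M) (M j)"
    using True by (rule measurable_component_singleton)
  then show ?thesis using assms[OF True] measurable_cong_sets by blast
next
  case False
  then show ?thesis
    by (subst measurable_cong[where g="\<lambda>_. undefined"]) (auto simp: space_PiM PiE_def extensional_def)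
qed

lemma measurable_PiM_lborel_coordinate [measurable (raw)]:
  "(\<lambda>x. x j) \<in> borel_measurable (PiM I (\<lambda>_. lborel))"
  by (rule measurable_PiM_coordinate) simp

lemma measurable_PiM_lborel_vec [measurable (raw)]:
  "(\<lambda>t. \<chi> k. t (\<beta> k) :: real^'n::finite) \<in> borel_measurable (PiM I (\<lambda>_. lborel))"
  by (intro borel_measurable_vec_lambda measurable_PiM_lborel_coordinate)

lemma product_sigma_finite_lborel: "product_sigma_finite (\<lambda>_::'i. lborel :: 'a::euclidean_space measure)"
  by standard

text \<open>One-dimensional substitutions with Jacobian \<open>u i\<close>, carried out one
  coordinate at a time by Fubini. Densities (\<open>h\<close> the identity), affine maps and
  reflections (\<open>u\<close> constant) are its later instances.\<close>

lemma nn_integral_PiM_transfer: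
  fixes M :: "'i \<Rightarrow> 'a measure" and N :: "'i \<Rightarrow> 'b measure" and g :: "('i \<Rightarrow> 'a) \<Rightarrow> ennreal"
  assumes M: "product_sigma_finite M" and N: "product_sigma_finite N" and "finite R"
    and h: "\<And>i. i \<in> R \<Longrightarrow> h i \<in> measurable (N i) (M i)"
    and u: "\<And>i. i \<in> R \<Longrightarrow> u i \<in> borel_measurable (N i)"
    and eq: "\<And>i f. i \<in> R \<Longrightarrow> f \<in> borel_measurable (M i) \<Longrightarrow>
               (\<integral>\<^sup>+x. f x \<partial>M i) = (\<integral>\<^sup>+y. u i y * f (h i y) \<partial>N i)"
    and "g \<in> borel_measurable (PiM R M)"
  shows "(\<integral>\<^sup>+x. g x \<partial>PiM R M) = (\<integral>\<^sup>+y. (\<Prod>i\<in>R. u i (y i)) * g (\<lambda>i\<in>R. h i (y i)) \<partial>PiM R N)"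
  using assms(3-)
proof (induction R arbitrary: g rule: finite_induct)
  case empty
  interpret M: product_sigma_finite M by (rule M)
  interpret N: product_sigma_finite N by (rule N)
  show ?case
    by (subst M.nn_integral_empty, simp, subst N.nn_integral_empty) (simp_all add: restrict_def)
next
  case (insert i R)
  interpret M: product_sigma_finite M by (rule M)
  interpret N: product_sigma_finite N by (rule N)
  have hm [measurable]: "h j \<in> measurable (N j) (M j)" if "j \<in> insert i R" for j using insert.prems(1) that by blast
  have um [measurable]: "u j \<in> borel_measurable (N j)" if "j \<in> insert i R" for j using insert.prems(2) that by blast
  note [measurable] = hm[OF insertI1] um[OF insertI1]
  have IH: "(\<integral>\<^sup>+x. g x \<partial>PiM R M) = (\<integral>\<^sup>+y. (\<Prod>i\<in>R. u i (y i)) * g (\<lambda>i\<in>R. h i (y i)) \<partial>PiM R N)"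
    if "g \<in> borel_measurable (PiM R M)" for g
    by (rule insert.IH) (use insert.prems that in auto)
  have hc: "(\<lambda>y. h j (y j)) \<in> measurable (PiM I N) (M j)"
    and uc: "(\<lambda>y. u j (y j)) \<in> borel_measurable (PiM I N)" if "j \<in> I" "I \<subseteq> insert i R" for j I
    using that measurable_compose[OF measurable_component_singleton[OF that(1)] hm]
      measurable_compose[OF measurable_component_singleton[OF that(1)] um] by auto
  \<comment> \<open>The new coordinate is integrated out in its substituted form, so the induction
    hypothesis sees a function of the remaining coordinates only.\<close>
  define G where "G x = (\<integral>\<^sup>+y. u i y * g (x(i := h i y)) \<partial>N i)" for x
  have gm: "(\<lambda>(x, y). g (x(i := h i y))) \<in> borel_measurable (PiM R M \<Otimes>\<^sub>M N i)"
    unfolding split_beta' by (rule measurable_compose[OF measurable_fun_upd[where J=R] insert.prems(4)]) auto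
  then have "(\<lambda>(x, y). u i y * g (x(i := h i y))) \<in> borel_measurable (PiM R M \<Otimes>\<^sub>M N i)"
    by (simp add: split_beta')
  then have [measurable]: "G \<in> borel_measurable (PiM R M)"
    unfolding G_def by (rule sigma_finite_measure.borel_measurable_nn_integral[OF N.sigma_finite_measures])
  have hR [measurable]: "(\<lambda>y. \<lambda>j\<in>R. h j (y j)) \<in> measurable (PiM R N) (PiM R M)"
    by (intro measurable_restrict) (auto intro!: hc)
  have uR [measurable]: "(\<lambda>y. \<Prod>j\<in>R. u j (y j)) \<in> borel_measurable (PiM R N)"
    by (intro borel_measurable_prod_ennreal) (auto intro!: uc)
  have hR': "(\<lambda>y. \<lambda>j\<in>insert i R. h j (y j)) \<in> measurable (PiM (insert i R) N) (PiM (insert i R) M)"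
    by (intro measurable_restrict) (auto intro!: hc)
  have uR': "(\<lambda>y. \<Prod>j\<in>insert i R. u j (y j)) \<in> borel_measurable (PiM (insert i R) N)"
    by (intro borel_measurable_prod_ennreal) (auto intro!: uc)
  have "(\<integral>\<^sup>+x. g x \<partial>PiM (insert i R) M) = (\<integral>\<^sup>+x. \<integral>\<^sup>+y. g (x(i := y)) \<partial>M i \<partial>PiM R M)"
    using insert by (subst M.product_nn_integral_insert) auto
  also have "\<dots> = (\<integral>\<^sup>+x. G x \<partial>PiM R M)"
    unfolding G_def
  proof (intro nn_integral_cong)
    fix x assume "x \<in> space (PiM R M)"
    then show "(\<integral>\<^sup>+y. g (x(i := y)) \<partial>M i) = (\<integral>\<^sup>+y. u i y * g (x(i := h i y)) \<partial>N i)"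
      by (intro insert.prems(3) measurable_compose[OF measurable_fun_upd[where J=R] insert.prems(4)]) auto
  qed
  also have "\<dots> = (\<integral>\<^sup>+y. (\<Prod>j\<in>R. u j (y j)) * G (\<lambda>j\<in>R. h j (y j)) \<partial>PiM R N)"
    by (rule IH) measurable
  also have "\<dots> = (\<integral>\<^sup>+y. \<integral>\<^sup>+z. (\<Prod>j\<in>R. u j (y j)) * (u i z * g ((\<lambda>j\<in>R. h j (y j))(i := h i z))) \<partial>N i \<partial>PiM R N)"
    unfolding G_def
  proof (intro nn_integral_cong nn_integral_cmult[symmetric])
    fix y assume "y \<in> space (PiM R N)"
    then have "(\<lambda>j\<in>R. h j (y j)) \<in> space (PiM R M)" using measurable_space[OF hR] by blast
    then show "(\<lambda>z. u i z * g ((\<lambda>j\<in>R. h j (y j))(i := h i z))) \<in> borel_measurable (N i)"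
      by (intro borel_measurable_times_ennreal measurable_compose[OF measurable_fun_upd[where J=R] insert.prems(4)]) auto
  qed
  also have "\<dots> = (\<integral>\<^sup>+y. \<integral>\<^sup>+z. (\<Prod>j\<in>insert i R. u j ((y(i := z)) j)) * g (\<lambda>j\<in>insert i R. h j ((y(i := z)) j)) \<partial>N i \<partial>PiM R N)"
  proof (intro nn_integral_cong)
    fix y z
    have "(\<Prod>j\<in>R. u j ((y(i := z)) j)) = (\<Prod>j\<in>R. u j (y j))"
      using insert.hyps by (intro prod.cong) auto
    moreover have "(\<lambda>j\<in>insert i R. h j ((y(i := z)) j)) = (\<lambda>j\<in>R. h j (y j))(i := h i z)"
      using insert.hyps by (auto simp: fun_eq_iff)
    ultimately show "(\<Prod>j\<in>R. u j (y j)) * (u i z * g ((\<lambda>j\<in>R. h j (y j))(i := h i z)))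
      = (\<Prod>j\<in>insert i R. u j ((y(i := z)) j)) * g (\<lambda>j\<in>insert i R. h j ((y(i := z)) j))"
      using insert.hyps by (simp add: mult_ac)
  qed
  also have "\<dots> = (\<integral>\<^sup>+y. (\<Prod>j\<in>insert i R. u j (y j)) * g (\<lambda>j\<in>insert i R. h j (y j)) \<partial>PiM (insert i R) N)"
    by (subst N.product_nn_integral_insert)
       (use insert.hyps in \<open>auto intro!: borel_measurable_times_ennreal uR' measurable_compose[OF hR' insert.prems(4)]\<close>)
  finally show ?case .
qed

text \<open>The sign makes \<open>V j\<close> the gap, in units of \<open>s\<close>, by which the
  value at \<open>j\<close> stays below the level \<open>c j\<close>. With \<open>s = 1\<close> it
  serves to reflect walks.\<close>

lemma nn_integral_PiM_affine:
  fixes g :: "('i \<Rightarrow> real) \<Rightarrow> ennreal" and s :: real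
  assumes "finite R" "s > 0" "g \<in> borel_measurable (PiM R (\<lambda>_. lborel))"
  shows "(\<integral>\<^sup>+T. g T \<partial>PiM R (\<lambda>_. lborel))
       = ennreal (s ^ card R) * (\<integral>\<^sup>+V. g (\<lambda>j\<in>R. c j - s * V j) \<partial>PiM R (\<lambda>_. lborel))"
proof -
  have [measurable]: "(\<lambda>V. \<lambda>j\<in>R. c j - s * V j) \<in> measurable (PiM R (\<lambda>_. lborel)) (PiM R (\<lambda>_. lborel))"
    by (intro measurable_restrict) simp
  note [measurable] = assms(3)
  have "(\<integral>\<^sup>+T. g T \<partial>PiM R (\<lambda>_. lborel))
      = (\<integral>\<^sup>+V. (\<Prod>i\<in>R. ennreal s) * g (\<lambda>j\<in>R. c j - s * V j) \<partial>PiM R (\<lambda>_. lborel))"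
  proof (rule nn_integral_PiM_transfer[OF product_sigma_finite_lborel product_sigma_finite_lborel])
    fix i and f :: "real \<Rightarrow> ennreal" assume "f \<in> borel_measurable lborel"
    then show "(\<integral>\<^sup>+x. f x \<partial>lborel) = (\<integral>\<^sup>+y. ennreal s * f (c i - s * y) \<partial>lborel)"
      using assms(2) by (subst nn_integral_real_affine[where c="-s" and t="c i"]) (auto simp: nn_integral_cmult)
  qed (use assms in auto)
  then show ?thesis
    using assms(2) by (simp add: nn_integral_cmult ennreal_power)
qed

lemma nn_integral_PiM_density:
  fixes w :: "'a::euclidean_space \<Rightarrow> ennreal" and g :: "('i \<Rightarrow> 'a) \<Rightarrow> ennreal"
  assumes "finite R" "w \<in> borel_measurable borel" "sigma_finite_measure (density lborel w)"
    and "g \<in> borel_measurable (PiM R (\<lambda>_. density lborel w))"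
  shows "(\<integral>\<^sup>+X. g X \<partial>PiM R (\<lambda>_. density lborel w))
       = (\<integral>\<^sup>+X. (\<Prod>i\<in>R. w (X i)) * g X \<partial>PiM R (\<lambda>_. lborel))"
proof -
  have "(\<integral>\<^sup>+X. g X \<partial>PiM R (\<lambda>_. density lborel w))
       = (\<integral>\<^sup>+X. (\<Prod>i\<in>R. w (X i)) * g (\<lambda>i\<in>R. X i) \<partial>PiM R (\<lambda>_. lborel))"
    by (rule nn_integral_PiM_transfer[OF _ product_sigma_finite_lborel])
       (use assms in \<open>auto simp: product_sigma_finite_def nn_integral_density\<close>)
  also have "\<dots> = (\<integral>\<^sup>+X. (\<Prod>i\<in>R. w (X i)) * g X \<partial>PiM R (\<lambda>_. lborel))"
  proof (rule nn_integral_cong)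
    fix X :: "'i \<Rightarrow> 'a" assume "X \<in> space (PiM R (\<lambda>_. lborel))"
    then have "(\<lambda>i\<in>R. X i) = X" by (auto simp: space_PiM PiE_def extensional_restrict)
    then show "(\<Prod>i\<in>R. w (X i)) * g (\<lambda>i\<in>R. X i) = (\<Prod>i\<in>R. w (X i)) * g X" by simp
  qed
  finally show ?thesis .
qed

lemma prod_Basis_vec:
  fixes f :: "real^'n \<Rightarrow> 'b::comm_monoid_mult"
  shows "(\<Prod>b\<in>Basis. f b) = (\<Prod>k\<in>UNIV. f (axis k 1))"
proof -
  have eq: "Basis = range (\<lambda>k::'n. axis k (1::real))" by (auto simp: Basis_vec_def)
  have "inj (\<lambda>k::'n. axis k (1::real))" by (auto simp: inj_on_def axis_eq_axis)
  then show ?thesis unfolding eq by (subst prod.reindex) auto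
qed

text \<open>Checked on boxes. Labelling the coordinates by an arbitrary index type lets a chosen
  family of heights be read as one vector, to which a matrix can be applied.\<close>

lemma lborel_vec_eq_distr_PiM:
  fixes \<beta> :: "'n::finite \<Rightarrow> 'i"
  assumes \<beta>: "inj \<beta>"
  shows "(lborel :: (real^'n) measure) = distr (PiM (range \<beta>) (\<lambda>_. lborel)) borel (\<lambda>t. \<chi> k. t (\<beta> k))"
proof (rule lborel_eqI)
  interpret product_sigma_finite "\<lambda>_::'i. lborel :: real measure" by (rule product_sigma_finite_lborel)
  fix l u :: "real^'n"
  assume *: "\<And>b. b \<in> Basis \<Longrightarrow> l \<bullet> b \<le> u \<bullet> b"
  have le: "l $ k \<le> u $ k" for k
    using *[of "axis k 1"] by (simp add: inner_axis)
  have eq: "(\<lambda>t. \<chi> k. t (\<beta> k)) -` box l u \<inter> space (PiM (range \<beta>) (\<lambda>_. lborel :: real measure))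
    = PiE (range \<beta>) (\<lambda>i. {l $ inv \<beta> i <..< u $ inv \<beta> i})"
  proof (rule set_eqI)
    fix t :: "'i \<Rightarrow> real"
    have "(\<forall>i\<in>range \<beta>. t i \<in> {l $ inv \<beta> i <..< u $ inv \<beta> i}) \<longleftrightarrow> (\<forall>k. l $ k < t (\<beta> k) \<and> t (\<beta> k) < u $ k)"
      using \<beta> by simp
    then show "t \<in> (\<lambda>t. \<chi> k. t (\<beta> k)) -` box l u \<inter> space (PiM (range \<beta>) (\<lambda>_. lborel :: real measure))
      \<longleftrightarrow> t \<in> PiE (range \<beta>) (\<lambda>i. {l $ inv \<beta> i <..< u $ inv \<beta> i})"
      unfolding PiE_iff by (simp add: space_PiM mem_box_cart PiE_iff)
  qed
  show "emeasure (distr (PiM (range \<beta>) (\<lambda>_. lborel)) borel (\<lambda>t. \<chi> k. t (\<beta> k))) (box l u) = (\<Prod>b\<in>Basis. (u - l) \<bullet> b)"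
  proof -
    have "emeasure (distr (PiM (range \<beta>) (\<lambda>_. lborel)) borel (\<lambda>t. \<chi> k. t (\<beta> k))) (box l u)
      = emeasure (PiM (range \<beta>) (\<lambda>_. lborel)) (PiE (range \<beta>) (\<lambda>i. {l $ inv \<beta> i <..< u $ inv \<beta> i}))"
      by (subst emeasure_distr[OF measurable_PiM_lborel_vec]) (simp_all add: eq)
    also have "\<dots> = (\<Prod>i\<in>range \<beta>. emeasure lborel {l $ inv \<beta> i <..< u $ inv \<beta> i})"
      by (rule emeasure_PiM) auto
    also have "\<dots> = (\<Prod>k\<in>UNIV. ennreal ((u - l) $ k))"
      using \<beta> le by (subst prod.reindex) (auto intro!: prod.cong)
    also have "\<dots> = (\<Prod>b\<in>Basis. (u - l) \<bullet> b)"
      using le by (simp add: prod_Basis_vec inner_axis prod_ennreal)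
    finally show ?thesis .
  qed
qed simp

lemma nn_integral_lborel_vec:
  fixes f :: "real^'n::finite \<Rightarrow> ennreal" and \<beta> :: "'n \<Rightarrow> 'i"
  assumes [measurable]: "f \<in> borel_measurable borel" and \<beta>: "inj \<beta>"
  shows "(\<integral>\<^sup>+v. f v \<partial>lborel) = (\<integral>\<^sup>+t. f (\<chi> k. t (\<beta> k)) \<partial>PiM (range \<beta>) (\<lambda>_. lborel))"
proof -
  have "(\<integral>\<^sup>+v. f v \<partial>lborel) = (\<integral>\<^sup>+v. f v \<partial>distr (PiM (range \<beta>) (\<lambda>_. lborel)) borel (\<lambda>t. \<chi> k. t (\<beta> k)))"
    using lborel_vec_eq_distr_PiM[OF \<beta>] by (rule arg_cong)
  also have "\<dots> = (\<integral>\<^sup>+t. f (\<chi> k. t (\<beta> k)) \<partial>PiM (range \<beta>) (\<lambda>_. lborel))"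
    by (rule nn_integral_distr) (simp_all add: measurable_PiM_lborel_vec)
  finally show ?thesis .
qed

section \<open>Linear substitutions in Lebesgue integrals\<close>

lemma borel_measurable_matrix_vector_mult [measurable]:
  fixes A :: "real^'n^'m"
  shows "(\<lambda>x. A *v x) \<in> borel_measurable borel"
  by (intro borel_measurable_continuous_onI linear_continuous_on matrix_vector_mul_bounded_linear)

text \<open>Induction over the generation of all matrices by products of elementary ones. The
  determinant condition and \<open>f\<close> are moved into the claim, because matrices with a zero
  row occur in the induction and a product applies the rule to \<open>f\<close> composed with its
  left factor.\<close>

lemma nn_integral_lborel_matrix:
  fixes A :: "real^'n^'n" and f :: "real^'n \<Rightarrow> ennreal"
  assumes "det A \<noteq> 0" "f \<in> borel_measurable borel"
  shows "(\<integral>\<^sup>+v. f v \<partial>lborel) = ennreal \<bar>det A\<bar> * (\<integral>\<^sup>+v. f (A *v v) \<partial>lborel)"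
proof -
  have "det A \<noteq> 0 \<longrightarrow> (\<forall>f. f \<in> borel_measurable borel \<longrightarrow>
      (\<integral>\<^sup>+v. f v \<partial>lborel) = ennreal \<bar>det A\<bar> * (\<integral>\<^sup>+v. f (A *v v) \<partial>lborel))"
  proof (induction A rule: induct_matrix_elementary_alt)
    case (1 A B)
    show ?case
    proof (intro impI allI)
      fix f :: "real^'n \<Rightarrow> ennreal"
      assume d: "det (A ** B) \<noteq> 0" and [measurable]: "f \<in> borel_measurable borel"
      have "(\<integral>\<^sup>+v. f v \<partial>lborel) = ennreal \<bar>det A\<bar> * (\<integral>\<^sup>+v. f (A *v v) \<partial>lborel)"
        by (rule 1(1)[rule_format]) (use d in \<open>auto simp: det_mul\<close>)
      also have "(\<integral>\<^sup>+v. f (A *v v) \<partial>lborel) = ennreal \<bar>det B\<bar> * (\<integral>\<^sup>+v. f (A *v (B *v v)) \<partial>lborel)"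
        by (rule 1(2)[rule_format]) (use d in \<open>auto simp: det_mul\<close>)
      finally show "(\<integral>\<^sup>+v. f v \<partial>lborel) = ennreal \<bar>det (A ** B)\<bar> * (\<integral>\<^sup>+v. f (A ** B *v v) \<partial>lborel)"
        by (simp add: det_mul abs_mult ennreal_mult' matrix_vector_mul_assoc mult.assoc)
    qed
  next
    case (2 A i)
    then show ?case by (simp add: det_zero_row)
  next
    case (3 A)
    have d: "det A = (\<Prod>i\<in>UNIV. A$i$i)" using 3 by (rule det_diagonal)
    show ?case
    proof (intro impI allI)
      fix f :: "real^'n \<Rightarrow> ennreal"
      assume nz: "det A \<noteq> 0" and [measurable]: "f \<in> borel_measurable borel"
      \<comment> \<open>\<open>lborel_affine_euclidean\<close> takes its coefficients indexed by
        basis vectors; \<open>c\<close> inverts \<open>axis k 1\<close> to read off the diagonal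
        entry.\<close>
      define c where "c b = (SOME x. \<exists>k. b = axis k 1 \<and> x = A$k$k)" for b :: "real^'n"
      have c: "c (axis k 1) = A$k$k" for k unfolding c_def
        by (rule some_equality) (auto simp: axis_eq_axis)
      have T: "0 + (\<Sum>j\<in>Basis. (c j * (x \<bullet> j)) *\<^sub>R j) = A *v x" for x :: "real^'n"
      proof -
        have eq: "Basis = range (\<lambda>k::'n. axis k (1::real))" by (auto simp: Basis_vec_def)
        have "inj (\<lambda>k::'n. axis k (1::real))" by (auto simp: inj_on_def axis_eq_axis)
        then have "(\<Sum>j\<in>Basis. (c j * (x \<bullet> j)) *\<^sub>R j) = (\<Sum>k\<in>UNIV. (A$k$k * x$k) *\<^sub>R axis k 1)"
          unfolding eq by (subst sum.reindex) (auto simp: c inner_axis)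
        also have "\<dots> = A *v x"
        proof (subst vec_eq_iff, rule allI)
          fix i
          have "(A *v x) $ i = (\<Sum>j\<in>UNIV. if i = j then A$i$i * x$i else 0)"
            unfolding matrix_vector_mult_def vec_lambda_beta using 3 by (intro sum.cong) auto
          then show "(\<Sum>k\<in>UNIV. (A$k$k * x$k) *\<^sub>R axis k 1) $ i = (A *v x) $ i"
            by (simp add: axis_def if_distrib cong: if_cong)
        qed
        finally show ?thesis by simp
      qed
      have "lborel = density (distr lborel borel (\<lambda>x. A *v x)) (\<lambda>_. ennreal \<bar>det A\<bar>)"
      proof -
        have "c j \<noteq> 0" if "j \<in> Basis" for j
          using that nz by (auto simp: Basis_vec_def c d)
        from lborel_affine_euclidean[of c 0, OF this] show ?thesis
          unfolding T by (simp add: prod_Basis_vec c d abs_prod)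
      qed
      then have "(\<integral>\<^sup>+v. f v \<partial>lborel) = (\<integral>\<^sup>+v. f v \<partial>density (distr lborel borel (\<lambda>x. A *v x)) (\<lambda>_. ennreal \<bar>det A\<bar>))"
        by simp
      then show "(\<integral>\<^sup>+v. f v \<partial>lborel) = ennreal \<bar>det A\<bar> * (\<integral>\<^sup>+v. f (A *v v) \<partial>lborel)"
        by (simp add: nn_integral_density nn_integral_distr nn_integral_cmult)
    qed
  next
    case (4 m n)
    let ?P = "\<chi> i j. mat 1 $ i $ Transposition.transpose m n j :: real^'n^'n"
    have d: "\<bar>det ?P\<bar> = 1"
      by (simp add: det_permute_columns permutes_swap_id sign_swap_id abs_mult)
    have P: "?P *v v = (\<chi> k. v $ Transposition.transpose m n k)" for v :: "real^'n"
    proof (subst vec_eq_iff, rule allI)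
      fix i
      have "(?P *v v) $ i = (\<Sum>j\<in>UNIV. if j = Transposition.transpose m n i then v $ j else 0)"
        unfolding matrix_vector_mult_def vec_lambda_beta mat_def by (intro sum.cong) auto
      then show "(?P *v v) $ i = (\<chi> k. v $ Transposition.transpose m n k) $ i" by simp
    qed
    show ?case
    proof (intro impI allI)
      fix f :: "real^'n \<Rightarrow> ennreal"
      assume [measurable]: "f \<in> borel_measurable borel"
      have inj: "inj (Transposition.transpose m n)" by simp
      have "(\<integral>\<^sup>+v. f v \<partial>lborel) = (\<integral>\<^sup>+t. f (\<chi> k. t (Transposition.transpose m n k)) \<partial>PiM UNIV (\<lambda>_. lborel))"
        using nn_integral_lborel_vec[OF _ inj, of f] by simp
      also have "\<dots> = (\<integral>\<^sup>+v. f (?P *v v) \<partial>lborel)"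
        unfolding P using nn_integral_lborel_vec[of "\<lambda>v. f (\<chi> k. v $ Transposition.transpose m n k)" "\<lambda>k. k"]
        by simp
      finally show "(\<integral>\<^sup>+v. f v \<partial>lborel) = ennreal \<bar>det ?P\<bar> * (\<integral>\<^sup>+v. f (?P *v v) \<partial>lborel)"
        unfolding d by simp
    qed
  next
    case (5 m n)
    let ?P = "\<chi> i j. of_bool (i = m \<and> j = n \<or> i = j) :: real^'n^'n"
    have "?P = (\<chi> k. if k = m then row m (mat 1) + 1 *s row n (mat 1) else row k (mat 1))"
      using 5 by (auto simp: vec_eq_iff row_def mat_def)
    then have d: "det ?P = 1"
      by (simp only: det_row_operation[OF 5, of "mat 1 :: real^'n^'n" 1] det_I)
    have P: "?P *v v = (\<chi> k. if k = m then v $ m + v $ n else v $ k)" for v :: "real^'n"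
    proof -
      have "(\<Sum>j\<in>UNIV. of_bool (i = m \<and> j = n \<or> i = j) * v $ j) = (if i = m then v $ m + v $ n else v $ i)" for i
      proof -
        have "(\<Sum>j\<in>UNIV. of_bool (i = m \<and> j = n \<or> i = j) * v $ j)
            = (\<Sum>j\<in>UNIV. (if j = n then if i = m then v $ j else 0 else 0) + (if j = i then v $ j else 0))"
          using 5 by (intro sum.cong) auto
        then show ?thesis by (simp add: sum.distrib)
      qed
      then show ?thesis by (simp add: vec_eq_iff matrix_vector_mult_def)
    qed
    show ?case
    proof (intro impI allI)
      interpret product_sigma_finite "\<lambda>_::'n. lborel :: real measure" by (rule product_sigma_finite_lborel)
      fix f :: "real^'n \<Rightarrow> ennreal"
      assume [measurable]: "f \<in> borel_measurable borel"
      have "(\<integral>\<^sup>+v. f (?P *v v) \<partial>lborel) = (\<integral>\<^sup>+t. f (\<chi> k. if k = m then t m + t n else t k) \<partial>PiM (insert m (UNIV - {m})) (\<lambda>_. lborel))"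
        unfolding P using nn_integral_lborel_vec[of "\<lambda>v. f (\<chi> k. if k = m then v $ m + v $ n else v $ k)" "\<lambda>k. k"]
        by (simp cong: if_cong)
      also have "\<dots> = (\<integral>\<^sup>+t. \<integral>\<^sup>+y. f (\<chi> k. if k = m then y + t n else t k) \<partial>lborel \<partial>PiM (UNIV - {m}) (\<lambda>_. lborel))"
      proof (subst product_nn_integral_insert)
        show "(\<lambda>t. f (\<chi> k. if k = m then t m + t n else t k)) \<in> borel_measurable (PiM (insert m (UNIV - {m})) (\<lambda>_. lborel))"
          by measurable
      qed (use 5 in \<open>auto intro!: nn_integral_cong arg_cong[where f=f] simp: vec_eq_iff\<close>)
      \<comment> \<open>With the other coordinates fixed, adding coordinate \<open>n\<close> to
        coordinate \<open>m\<close> is a translation.\<close>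
      also have "\<dots> = (\<integral>\<^sup>+t. \<integral>\<^sup>+y. f (\<chi> k. if k = m then y else t k) \<partial>lborel \<partial>PiM (UNIV - {m}) (\<lambda>_. lborel))"
      proof (rule nn_integral_cong)
        fix t :: "'n \<Rightarrow> real"
        show "(\<integral>\<^sup>+y. f (\<chi> k. if k = m then y + t n else t k) \<partial>lborel) = (\<integral>\<^sup>+y. f (\<chi> k. if k = m then y else t k) \<partial>lborel)"
          using nn_integral_real_affine[of "\<lambda>y. f (\<chi> k. if k = m then y else t k)" 1 "t n"]
          by (simp add: add.commute[of _ "t n"] cong: if_cong)
      qed
      also have "\<dots> = (\<integral>\<^sup>+t. f (\<chi> k. t k) \<partial>PiM (insert m (UNIV - {m})) (\<lambda>_. lborel))"
      proof (subst product_nn_integral_insert)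
        show "(\<lambda>t. f (\<chi> k. t k)) \<in> borel_measurable (PiM (insert m (UNIV - {m})) (\<lambda>_. lborel))"
          by measurable
      qed (auto intro!: nn_integral_cong arg_cong[where f=f] simp: vec_eq_iff)
      also have "\<dots> = (\<integral>\<^sup>+v. f v \<partial>lborel)"
        using nn_integral_lborel_vec[of f "\<lambda>k. k"] by simp
      finally show "(\<integral>\<^sup>+v. f v \<partial>lborel) = ennreal \<bar>det ?P\<bar> * (\<integral>\<^sup>+v. f (?P *v v) \<partial>lborel)"
        unfolding d by simp
    qed
  qed
  then show ?thesis using assms by blast
qed

section \<open>Determinants and simplices\<close>

text \<open>A permutation with nonzero product never raises the rank \<open>r\<close> and lowers it
  somewhere unless it is the identity, while the total rank is invariant under permutations. So only
  the identity survives in the Leibniz sum.\<close>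

lemma det_unipotent:
  fixes L :: "real^'n^'n" and r :: "'n \<Rightarrow> nat"
  assumes diag: "\<And>k. L $ k $ k = 1" and off: "\<And>j k. j \<noteq> k \<Longrightarrow> L $ j $ k \<noteq> 0 \<Longrightarrow> r k < r j"
  shows "det L = 1"
proof -
  have zero: "(\<Prod>j\<in>UNIV. L $ j $ p j) = 0" if p: "p permutes UNIV" "p \<noteq> id" for p
  proof (rule ccontr)
    assume "(\<Prod>j\<in>UNIV. L $ j $ p j) \<noteq> 0"
    then have nz: "L $ j $ p j \<noteq> 0" for j by auto
    have le: "r (p j) \<le> r j" for j
      using off[of j "p j"] nz[of j] by (cases "p j = j") auto
    obtain j0 where "p j0 \<noteq> j0" using p(2) by (auto simp: fun_eq_iff)
    then have "r (p j0) < r j0" using off[of j0 "p j0"] nz[of j0] by auto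
    then have "(\<Sum>j\<in>UNIV. r (p j)) < (\<Sum>j\<in>UNIV. r j)"
      using le by (intro sum_strict_mono_ex1) auto
    moreover have "(\<Sum>j\<in>UNIV. r (p j)) = (\<Sum>j\<in>UNIV. r j)"
      using sum.permute[OF p(1), of r] by (simp add: comp_def)
    ultimately show False by simp
  qed
  have "det L = (\<Sum>p\<in>{p. p permutes (UNIV :: 'n set)}. if p = id then 1 else 0)"
    unfolding det_def by (intro sum.cong) (auto simp: zero diag sign_id)
  also have "\<dots> = 1" by (simp add: permutes_id)
  finally show ?thesis .
qed

lemma rank_one_update_mult_vector:
  fixes u :: "real^'n"
  shows "(\<chi> i j. of_bool (i = j) + c * u $ i * u $ j) *v x = x + (c * (u \<bullet> x)) *\<^sub>R u"
proof (subst vec_eq_iff, rule allI)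
  fix i
  have "(\<Sum>j\<in>UNIV. (of_bool (i = j) + c * u $ i * u $ j) * x $ j)
     = (\<Sum>j\<in>UNIV. (if j = i then x $ j else 0) + c * u $ i * (u $ j * x $ j))"
    by (intro sum.cong) (auto simp: algebra_simps)
  also have "\<dots> = x $ i + c * u $ i * (\<Sum>j\<in>UNIV. u $ j * x $ j)"
    by (simp add: sum.distrib sum_distrib_left)
  finally show "((\<chi> i j. of_bool (i = j) + c * u $ i * u $ j) *v x) $ i = (x + (c * (u \<bullet> x)) *\<^sub>R u) $ i"
    by (simp add: matrix_vector_mult_def inner_vec_def)
qed

text \<open>An orthogonal change of basis turns \<open>u\<close> into a multiple of one axis vector;
  the matrix becomes diagonal, with all entries but one equal to 1.\<close>

lemma det_rank_one_update:
  fixes u :: "real^'n"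
  shows "det (\<chi> i j. of_bool (i = j) + c * u $ i * u $ j) = 1 + c * (u \<bullet> u)"
proof -
  let ?M = "\<lambda>u::real^'n. \<chi> i j. of_bool (i = j) + c * u $ i * u $ j"
  obtain k :: 'n where True by blast
  obtain f :: "real^'n \<Rightarrow> real^'n" where f: "orthogonal_transformation f" "f u = norm u *\<^sub>R axis k 1"
    using orthogonal_transformation_exists[of u "norm u *\<^sub>R axis k 1 :: real^'n"] by (auto simp: norm_axis_1)
  define R where "R = matrix f"
  have R: "orthogonal_matrix R" "R *v u = norm u *\<^sub>R axis k 1"
    using f matrix_works[of f u] unfolding R_def orthogonal_transformation_matrix by auto
  define v where "v = R *v u"
  have RMR: "R ** ?M u ** transpose R = ?M v"
  proof (subst matrix_eq, rule allI)
    fix x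
    have RT: "R *v (transpose R *v x) = x"
      using R(1) by (simp add: orthogonal_matrix_def matrix_vector_mul_assoc del: transpose_matrix_vector)
    have "u \<bullet> (transpose R *v x) = v \<bullet> x"
      unfolding v_def by (subst (1 2) inner_commute) (simp add: dot_lmul_matrix)
    then show "R ** ?M u ** transpose R *v x = ?M v *v x"
      by (simp add: matrix_vector_mul_assoc[symmetric] rank_one_update_mult_vector matrix_vector_right_distrib
          matrix_vector_mult_scaleR RT v_def del: transpose_matrix_vector)
  qed
  have "det R * det (?M u) * det R = det (?M v)"
    unfolding RMR[symmetric] by (simp only: det_mul det_transpose)
  moreover have "det R * det R = 1" using det_orthogonal_matrix[OF R(1)] by auto
  moreover have "det R * det (?M u) * det R = (det R * det R) * det (?M u)" by simp
  ultimately have "det (?M u) = det (?M v)" by simp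
  also have "det (?M v) = (\<Prod>i\<in>UNIV. ?M v $ i $ i)"
    by (rule det_diagonal) (auto simp: v_def R axis_def)
  also have "\<dots> = (\<Prod>i\<in>UNIV. if i = k then 1 + c * (u \<bullet> u) else 1)"
    by (intro prod.cong) (auto simp: v_def R axis_def power2_norm_eq_inner[symmetric] power2_eq_square)
  finally show ?thesis by simp
qed

text \<open>The simplex is an affine image of the standard simplex. Its edge vectors are the rows of
  the matrix, hence the transpose \<open>T\<close>; if the determinant vanishes, the image is
  negligible.\<close>

lemma measure_simplex:
  fixes y :: "'n::finite \<Rightarrow> real^'n" and y0 :: "real^'n"
  shows "measure lborel (convex hull (insert y0 (range y))) = \<bar>det (\<chi> k. y k - y0)\<bar> / fact CARD('n)"
proof -
  define A where "A = (\<chi> k. y k - y0)"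
  define T where "T = transpose A"
  have det_T: "det T = det A" unfolding T_def by simp
  define std where "std = convex hull (insert 0 Basis :: (real^'n) set)"
  define C where "C = convex hull (insert y0 (range y))"
  have Bas: "Basis = range (\<lambda>k::'n. axis k (1::real))" by (auto simp: Basis_vec_def)
  have col: "T *v axis k 1 = y k - y0" for k
    unfolding T_def A_def by (simp add: matrix_vector_mult_basis column_def Finite_Cartesian_Product.transpose_def vec_eq_iff del: transpose_matrix_vector)
  have "(\<lambda>v. T *v v) ` std = convex hull ((\<lambda>v. T *v v) ` insert 0 Basis)"
    unfolding std_def by (rule convex_hull_linear_image) auto
  moreover have "(\<lambda>v. y0 + v) ` (\<lambda>v. T *v v) ` insert 0 Basis = insert y0 (range y)"
    by (simp add: Bas image_image col)
  ultimately have "(\<lambda>v. y0 + v) ` ((\<lambda>v. T *v v) ` std) = C"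
    unfolding C_def by (simp only: convex_hull_translation[symmetric])
  then have C: "C = (\<lambda>v. y0 + v) ` ((\<lambda>v. T *v v) ` std)" by simp
  have std: "compact std" unfolding std_def by (intro finite_imp_compact_convex_hull) simp
  have Cc: "compact C" unfolding C_def by (intro finite_imp_compact_convex_hull) simp
  then have Cb: "C \<in> sets borel" by (simp add: borel_compact)
  have stdb: "std \<in> sets borel" using std by (simp add: borel_compact)
  show ?thesis
  proof (cases "det A = 0")
    case True
    then have "\<not> inj ((*v) T)"
      using det_nz_iff_inj[of "(*v) T"] det_T by simp
    then have "negligible ((\<lambda>v. T *v v) ` std)"
      by (intro negligible_linear_singular_image) auto
    then have "negligible C" unfolding C by (rule negligible_translation)
    then have "measure lebesgue C = 0" by (rule negligible_imp_measure0)
    then show ?thesis using True Cb unfolding C_def[symmetric] A_def[symmetric] by simp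
  next
    case False
    have inj: "inj ((*v) T)" using det_nz_iff_inj[of "(*v) T"] det_T False by simp
    have mem: "y0 + T *v v \<in> C \<longleftrightarrow> v \<in> std" for v
      unfolding C using inj by (auto simp: inj_def image_iff)
    have "emeasure lborel C = (\<integral>\<^sup>+v. indicator C v \<partial>lborel)" using Cb by simp
    also have "\<dots> = (\<integral>\<^sup>+v. indicator C v \<partial>distr lborel borel ((+) y0))"
      by (simp add: lborel_distr_plus)
    also have "\<dots> = (\<integral>\<^sup>+v. indicator C (y0 + v) \<partial>lborel)"
      using Cb by (subst nn_integral_distr) auto
    also have "\<dots> = ennreal \<bar>det T\<bar> * (\<integral>\<^sup>+v. indicator C (y0 + T *v v) \<partial>lborel)"
      using Cb False det_T by (subst nn_integral_lborel_matrix[of "T"]) auto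
    also have "(\<integral>\<^sup>+v. indicator C (y0 + T *v v) \<partial>lborel) = (\<integral>\<^sup>+v. indicator std v \<partial>lborel)"
      by (intro nn_integral_cong) (simp add: indicator_def mem)
    also have "\<dots> = emeasure lborel std" using stdb by simp
    finally have "measure lborel C = \<bar>det A\<bar> * measure lborel std"
      by (simp add: measure_def enn2real_mult det_T)
    then show ?thesis unfolding C_def[symmetric] A_def[symmetric]
      by (simp add: std_def content_std_simplex)
  qed
qed

section \<open>Gaussian integrals\<close>

definition gauss_density :: "real^'d \<Rightarrow> real" where
  "gauss_density x = (2 * pi) powr (- real CARD('d) / 2) * exp (- (norm x)\<^sup>2 / 2)"

lemma gauss_density_nonneg [simp]: "gauss_density x \<ge> 0"
  by (simp add: gauss_density_def)

lemma borel_measurable_gauss_density [measurable]: "gauss_density \<in> borel_measurable borel"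
  unfolding gauss_density_def by measurable

lemma std_gauss_eq_density: "std_gauss = density lborel (\<lambda>x. ennreal (gauss_density x))"
  by (simp add: std_gauss_def gauss_density_def)

lemma sets_std_gauss [simp, measurable_cong]: "sets std_gauss = sets borel"
  and space_std_gauss [simp]: "space std_gauss = UNIV"
  by (simp_all add: std_gauss_def)

lemma gauss_density_eq_prod: "gauss_density x = (\<Prod>k\<in>UNIV. std_normal_density (x $ k))"
proof -
  have "(2 * pi) powr (- real CARD('a) / 2) = ((2 * pi) powr (- 1 / 2)) ^ CARD('a)"
    by (simp add: powr_power)
  also have "(2 * pi) powr (- 1 / 2) = 1 / sqrt (2 * pi)"
    by (simp add: powr_minus_divide powr_half_sqrt)
  finally have 1: "(2 * pi) powr (- real CARD('a) / 2) = (1 / sqrt (2 * pi)) ^ CARD('a)" .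
  have "(norm x)\<^sup>2 = (\<Sum>k\<in>UNIV. (x $ k)\<^sup>2)"
    by (subst power2_norm_eq_inner) (simp add: inner_vec_def power2_eq_square)
  then have 2: "exp (- (norm x)\<^sup>2 / 2) = (\<Prod>k\<in>UNIV. exp (- (x $ k)\<^sup>2 / 2))"
    by (simp add: exp_sum[symmetric] sum_negf sum_divide_distrib)
  show ?thesis
    unfolding gauss_density_def 1 2 std_normal_density_def prod.distrib by simp
qed

lemma prob_space_std_normal: "prob_space std_normal_distribution"
  by (rule prob_space_normal_density) simp

lemma nn_integral_std_normal_density: "(\<integral>\<^sup>+x. ennreal (std_normal_density x) \<partial>lborel) = 1"
  using prob_space.emeasure_space_1[OF prob_space_std_normal] by (simp add: emeasure_density)

lemma std_gauss_eq_distr: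
  "(std_gauss :: (real^'d) measure)
     = distr (PiM UNIV (\<lambda>_. std_normal_distribution)) borel (\<lambda>t. \<chi> k. t k)"
proof (rule measure_eqI)
  have [measurable]: "(\<lambda>t. \<chi> k. t k :: real^'d) \<in> borel_measurable (PiM UNIV (\<lambda>_. std_normal_distribution))"
    by (intro borel_measurable_vec_lambda measurable_PiM_coordinate) simp
  fix A :: "(real^'d) set" assume "A \<in> sets std_gauss"
  then have [measurable]: "A \<in> sets borel" by simp
  have "emeasure std_gauss A = (\<integral>\<^sup>+x. ennreal (gauss_density x) * indicator A x \<partial>lborel)"
    by (simp add: std_gauss_eq_density emeasure_density)
  also have "\<dots> = (\<integral>\<^sup>+t. ennreal (gauss_density (\<chi> k. t k :: real^'d)) * indicator A (\<chi> k. t k) \<partial>PiM UNIV (\<lambda>_. lborel))"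
    using nn_integral_lborel_vec[of "\<lambda>x::real^'d. ennreal (gauss_density x) * indicator A x" "\<lambda>k. k"] by simp
  also have "\<dots> = (\<integral>\<^sup>+t. (\<Prod>k\<in>UNIV. ennreal (std_normal_density (t k))) * indicator A (\<chi> k. t k) \<partial>PiM UNIV (\<lambda>_. lborel))"
    by (simp add: gauss_density_eq_prod prod_ennreal)
  also have "\<dots> = (\<integral>\<^sup>+t. indicator A (\<chi> k. t k) \<partial>PiM UNIV (\<lambda>_::'d. std_normal_distribution))"
    by (rule nn_integral_PiM_density[symmetric])
       (auto intro!: prob_space_imp_sigma_finite prob_space_std_normal)
  also have "\<dots> = emeasure (distr (PiM UNIV (\<lambda>_. std_normal_distribution)) borel (\<lambda>t. \<chi> k. t k)) A"
    by (simp add: emeasure_distr nn_integral_distr[symmetric] flip: nn_integral_indicator)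
  finally show "emeasure std_gauss A = emeasure (distr (PiM UNIV (\<lambda>_. std_normal_distribution)) borel (\<lambda>t. \<chi> k. t k)) A" .
qed simp

lemma prob_space_std_gauss: "prob_space std_gauss"
  unfolding std_gauss_eq_distr
  by (intro prob_space.prob_space_distr prob_space_PiM prob_space_std_normal
      borel_measurable_vec_lambda measurable_PiM_coordinate) simp

lemma product_sigma_finite_std_gauss: "product_sigma_finite (\<lambda>_. std_gauss)"
  by (simp add: product_sigma_finite_def prob_space_imp_sigma_finite prob_space_std_gauss)

section \<open>Moments of Gaussian linear forms and determinants\<close>

definition normal_moment :: "nat \<Rightarrow> real" where
  "normal_moment j = (\<integral>x. x ^ j \<partial>std_normal_distribution)"

lemma integrable_std_normal_power: "integrable std_normal_distribution (\<lambda>x. x ^ j)"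
  by (subst integrable_real_density) (auto simp: integrable_std_normal_moment)

text \<open>Orders up to two suffice: in \<open>gauss_bilinear_moments\<close> every coordinate of
  every vector occurs at most twice in a monomial.\<close>

lemma normal_moment_simps: "normal_moment 0 = 1" "normal_moment (Suc 0) = 0" "normal_moment 2 = 1"
proof -
  have eq: "normal_moment j = (\<integral>x. std_normal_density x * x ^ j \<partial>lborel)" for j
    unfolding normal_moment_def by (subst integral_real_density) auto
  show "normal_moment 0 = 1" "normal_moment (Suc 0) = 0" "normal_moment 2 = 1"
    using integral_std_normal_moment_even[of 0] integral_std_normal_moment_odd[of 0] integral_std_normal_moment_even[of 1]
    by (simp_all add: eq fact_numeral)
qed

lemma std_gauss_moments:
  fixes n :: "'d::finite \<Rightarrow> nat"
  shows "integrable std_gauss (\<lambda>x. \<Prod>k\<in>UNIV. x $ k ^ n k)"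
    and "(\<integral>x. (\<Prod>k\<in>UNIV. x $ k ^ n k) \<partial>std_gauss) = (\<Prod>k\<in>UNIV. normal_moment (n k))"
proof -
  interpret product_sigma_finite "\<lambda>_::'d. std_normal_distribution"
    by (simp add: product_sigma_finite_def prob_space_imp_sigma_finite prob_space_std_normal)
  have m: "(\<lambda>t. \<chi> k. t k :: real^'d) \<in> borel_measurable (PiM UNIV (\<lambda>_. std_normal_distribution))"
    by (intro borel_measurable_vec_lambda measurable_PiM_coordinate) simp
  have p: "(\<lambda>x::real^'d. \<Prod>k\<in>UNIV. x $ k ^ n k) \<in> borel_measurable borel" by measurable
  show "integrable std_gauss (\<lambda>x. \<Prod>k\<in>UNIV. x $ k ^ n k)"
    unfolding std_gauss_eq_distr integrable_distr_eq[OF m p]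
    using product_integrable_prod[of UNIV "\<lambda>k x. x ^ n k"] by (simp add: integrable_std_normal_power)
  show "(\<integral>x. (\<Prod>k\<in>UNIV. x $ k ^ n k) \<partial>std_gauss) = (\<Prod>k\<in>UNIV. normal_moment (n k))"
    unfolding std_gauss_eq_distr integral_distr[OF m p] normal_moment_def
    using product_integral_prod[of UNIV "\<lambda>k x. x ^ n k"] by (simp add: integrable_std_normal_power)
qed

text \<open>Multiplying out selects, for every coordinate \<open>k\<close>, a pair of vectors. The
  resulting monomial has mean 1 if the two vectors agree for every \<open>k\<close>; otherwise some
  variable occurs to the first power and the mean is 0.\<close>

lemma gauss_bilinear_moments:
  fixes a b :: "'d::finite \<Rightarrow> 'e \<Rightarrow> real"
  assumes E: "finite E"
  defines "P X \<equiv> \<Prod>k\<in>UNIV. (\<Sum>e\<in>E. a k e * X e $ k) * (\<Sum>e\<in>E. b k e * X e $ k)"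
  shows "integrable (PiM E (\<lambda>_. std_gauss)) P"
    and "(\<integral>X. P X \<partial>PiM E (\<lambda>_. std_gauss)) = (\<Prod>k\<in>UNIV. \<Sum>e\<in>E. a k e * b k e)"
proof -
  interpret product_sigma_finite "\<lambda>_::'e. std_gauss :: (real^'d) measure" by (rule product_sigma_finite_std_gauss)
  let ?G = "PiE UNIV (\<lambda>_::'d. E \<times> E)"
  \<comment> \<open>\<open>nn g e k\<close> is the exponent of coordinate \<open>k\<close> of vector
    \<open>e\<close> in the monomial selected by \<open>g\<close>.\<close>
  define nn where "nn g e k = (of_bool (e = fst (g k)) + of_bool (e = snd (g k)) :: nat)" for g :: "'d \<Rightarrow> 'e \<times> 'e" and e k
  define c where "c g = (\<Prod>k\<in>UNIV. a k (fst (g k)) * b k (snd (g k)))" for g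
  define Q where "Q g X = (\<Prod>e\<in>E. \<Prod>k\<in>UNIV. X e $ k ^ nn g e k)" for g and X :: "'e \<Rightarrow> real^'d"
  have del: "(\<Prod>e\<in>E. (f e :: real) ^ of_bool (e = e0)) = f e0" if "e0 \<in> E" for f e0
  proof -
    have "(\<Prod>e\<in>E. f e ^ of_bool (e = e0)) = (\<Prod>e\<in>E. if e = e0 then f e else 1)"
      by (intro prod.cong) auto
    then show ?thesis using that E by simp
  qed
  have P: "P X = (\<Sum>g\<in>?G. c g * Q g X)" for X
  proof -
    have "P X = (\<Prod>k\<in>UNIV. \<Sum>p\<in>E \<times> E. (a k (fst p) * b k (snd p)) * (X (fst p) $ k * X (snd p) $ k))"
      unfolding P_def by (simp add: sum_product sum.cartesian_product case_prod_beta mult_ac)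
    also have "\<dots> = (\<Sum>g\<in>?G. \<Prod>k\<in>UNIV. (a k (fst (g k)) * b k (snd (g k))) * (X (fst (g k)) $ k * X (snd (g k)) $ k))"
      using E by (subst prod_sum_PiE) auto
    also have "\<dots> = (\<Sum>g\<in>?G. c g * Q g X)"
    proof (intro sum.cong refl)
      fix g assume "g \<in> ?G"
      then have g: "fst (g k) \<in> E" "snd (g k) \<in> E" for k by (auto simp: PiE_def Pi_def mem_Times_iff)
      have "Q g X = (\<Prod>k\<in>UNIV. X (fst (g k)) $ k * X (snd (g k)) $ k)"
        unfolding Q_def nn_def by (subst prod.swap) (simp add: power_add prod.distrib del g)
      then show "(\<Prod>k\<in>UNIV. (a k (fst (g k)) * b k (snd (g k))) * (X (fst (g k)) $ k * X (snd (g k)) $ k)) = c g * Q g X"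
        by (simp add: c_def prod.distrib)
    qed
    finally show ?thesis .
  qed
  have Qi: "integrable (PiM E (\<lambda>_. std_gauss)) (Q g)" for g
    unfolding Q_def by (rule product_integrable_prod[OF E]) (rule std_gauss_moments)
  have QI: "(\<integral>X. Q g X \<partial>PiM E (\<lambda>_. std_gauss)) = (\<Prod>k\<in>UNIV. of_bool (fst (g k) = snd (g k)))" if "g \<in> ?G" for g
  proof -
    have g: "fst (g k) \<in> E" "snd (g k) \<in> E" for k using that by (auto simp: PiE_def Pi_def mem_Times_iff)
    have "(\<integral>X. Q g X \<partial>PiM E (\<lambda>_. std_gauss)) = (\<Prod>e\<in>E. \<Prod>k\<in>UNIV. normal_moment (nn g e k))"
      unfolding Q_def by (subst product_integral_prod[OF E]) (simp_all add: std_gauss_moments)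
    also have "\<dots> = (\<Prod>k\<in>UNIV. \<Prod>e\<in>E. normal_moment (nn g e k))" by (rule prod.swap)
    also have "\<dots> = (\<Prod>k\<in>UNIV. of_bool (fst (g k) = snd (g k)))"
    proof (intro prod.cong refl)
      fix k
      show "(\<Prod>e\<in>E. normal_moment (nn g e k)) = of_bool (fst (g k) = snd (g k))"
      proof (cases "fst (g k) = snd (g k)")
        case True
        have "(\<Prod>e\<in>E. normal_moment (nn g e k)) = (\<Prod>e\<in>E. 1)"
          by (intro prod.cong) (auto simp: nn_def True normal_moment_simps numeral_2_eq_2[symmetric])
        then show ?thesis by (simp add: True)
      next
        case False
        then have "normal_moment (nn g (fst (g k)) k) = 0" by (simp add: nn_def normal_moment_simps)
        then show ?thesis using g[of k] E False by (auto intro!: prod_zero)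
      qed
    qed
    finally show ?thesis .
  qed
  show "integrable (PiM E (\<lambda>_. std_gauss)) P"
    unfolding P by (intro Bochner_Integration.integrable_sum integrable_mult_right Qi)
  have "(\<integral>X. P X \<partial>PiM E (\<lambda>_. std_gauss)) = (\<Sum>g\<in>?G. c g * (\<Prod>k\<in>UNIV. of_bool (fst (g k) = snd (g k))))"
    unfolding P by (subst Bochner_Integration.integral_sum) (auto simp: Qi QI intro!: sum.cong)
  also have "\<dots> = (\<Sum>g\<in>?G. \<Prod>k\<in>UNIV. (a k (fst (g k)) * b k (snd (g k))) * of_bool (fst (g k) = snd (g k)))"
    by (simp add: c_def prod.distrib)
  also have "\<dots> = (\<Prod>k\<in>UNIV. \<Sum>p\<in>E \<times> E. (a k (fst p) * b k (snd p)) * of_bool (fst p = snd p))"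
    using E by (subst prod_sum_PiE) auto
  also have "\<dots> = (\<Prod>k\<in>UNIV. \<Sum>e\<in>E. a k e * b k e)"
  proof (intro prod.cong refl)
    fix k
    have "(\<Sum>p\<in>E \<times> E. (a k (fst p) * b k (snd p)) * of_bool (fst p = snd p))
       = (\<Sum>e\<in>E. \<Sum>e'\<in>E. if e' = e then a k e * b k e' else 0)"
      by (subst sum.cartesian_product) (auto intro!: sum.cong)
    then show "(\<Sum>p\<in>E \<times> E. (a k (fst p) * b k (snd p)) * of_bool (fst p = snd p)) = (\<Sum>e\<in>E. a k e * b k e)"
      using E by simp
  qed
  finally show "(\<integral>X. P X \<partial>PiM E (\<lambda>_. std_gauss)) = (\<Prod>k\<in>UNIV. \<Sum>e\<in>E. a k e * b k e)" .
qed

text \<open>The square is a double sum over permutations whose terms are products of bilinear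
  expressions in independent coordinates, so their means are products of entries of the Gram matrix
  \<open>G\<close>.\<close>

lemma second_moment_gauss_det:
  fixes D :: "'d::finite \<Rightarrow> 'e \<Rightarrow> real"
  assumes E: "finite E"
  shows "(\<integral>\<^sup>+X. ennreal ((det (\<chi> k. \<Sum>e\<in>E. D k e *\<^sub>R X e :: real^'d^'d))\<^sup>2) \<partial>PiM E (\<lambda>_. std_gauss))
       = ennreal (fact CARD('d) * det (\<chi> j k. \<Sum>e\<in>E. D j e * D k e))"
proof -
  let ?M = "PiM E (\<lambda>_. std_gauss :: (real^'d) measure)"
  let ?\<Pi> = "{p. p permutes (UNIV :: 'd set)}"
  define G where "G = (\<chi> j k. \<Sum>e\<in>E. D j e * D k e :: real^'d^'d)"
  define P where "P p q X = (\<Prod>k\<in>UNIV. (\<Sum>e\<in>E. D (p k) e * X e $ k) * (\<Sum>e\<in>E. D (q k) e * X e $ k))"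
    for p q and X :: "'e \<Rightarrow> real^'d"
  \<comment> \<open>Leibniz expansion of the transpose: the factors then belong to different
    coordinates \<open>k\<close> of the Gaussian vectors, as \<open>gauss_bilinear_moments\<close>
    requires.\<close>
  have det: "det (\<chi> k. \<Sum>e\<in>E. D k e *\<^sub>R X e :: real^'d^'d)
     = (\<Sum>p\<in>?\<Pi>. of_int (sign p) * (\<Prod>k\<in>UNIV. \<Sum>e\<in>E. D (p k) e * X e $ k))" for X
    by (subst det_transpose[symmetric])
       (simp add: det_def Finite_Cartesian_Product.transpose_def)
  have sq: "(det (\<chi> k. \<Sum>e\<in>E. D k e *\<^sub>R X e :: real^'d^'d))\<^sup>2
     = (\<Sum>p\<in>?\<Pi>. \<Sum>q\<in>?\<Pi>. of_int (sign p) * of_int (sign q) * P p q X)" for X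
    unfolding det power2_eq_square P_def prod.distrib
    by (subst sum_product) (intro sum.cong refl, simp only: mult_ac)
  have Pi: "integrable ?M (P p q)" for p q
    unfolding P_def by (rule gauss_bilinear_moments[OF E])
  have PI: "(\<integral>X. P p q X \<partial>?M) = (\<Prod>k\<in>UNIV. G $ p k $ q k)" for p q
    unfolding P_def G_def by (subst gauss_bilinear_moments[OF E]) simp
  have int: "integrable ?M (\<lambda>X. (det (\<chi> k. \<Sum>e\<in>E. D k e *\<^sub>R X e :: real^'d^'d))\<^sup>2)"
    unfolding sq by (intro Bochner_Integration.integrable_sum integrable_mult_right Pi)
  have "(\<integral>X. (det (\<chi> k. \<Sum>e\<in>E. D k e *\<^sub>R X e :: real^'d^'d))\<^sup>2 \<partial>?M)
      = (\<Sum>p\<in>?\<Pi>. \<Sum>q\<in>?\<Pi>. of_int (sign p) * of_int (sign q) * (\<Prod>k\<in>UNIV. G $ p k $ q k))"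
    unfolding sq by (simp add: Bochner_Integration.integral_sum Bochner_Integration.integrable_sum Pi PI)
  \<comment> \<open>For fixed \<open>p\<close> the sum over \<open>q\<close> is, up to the sign of
    \<open>p\<close>, the determinant of \<open>G\<close> with rows permuted by \<open>p\<close>;
    the two signs cancel.\<close>
  also have "\<dots> = (\<Sum>p\<in>?\<Pi>. det G)"
  proof (intro sum.cong refl)
    fix p assume p: "p \<in> ?\<Pi>"
    have "(\<Sum>q\<in>?\<Pi>. of_int (sign p) * of_int (sign q) * (\<Prod>k\<in>UNIV. G $ p k $ q k))
       = of_int (sign p) * det (\<chi> k. G $ p k)"
      by (simp add: det_def sum_distrib_left mult.assoc)
    also have "\<dots> = of_int (sign p) * (of_int (sign p) * det G)"
      using p by (subst det_permute_rows) auto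
    also have "\<dots> = det G"
      by (simp add: mult.assoc[symmetric] sign_def)
    finally show "(\<Sum>q\<in>?\<Pi>. of_int (sign p) * of_int (sign q) * (\<Prod>k\<in>UNIV. G $ p k $ q k)) = det G" .
  qed
  also have "\<dots> = fact CARD('d) * det G" by (simp add: card_permutations)
  finally show ?thesis
    using nn_integral_eq_integral[OF int] by (simp add: G_def)
qed

section \<open>The slope of the supporting hyperplane\<close>

lemma nn_integral_lborel_affine_matrix:
  fixes B :: "real^'n^'n" and f :: "real^'n \<Rightarrow> ennreal"
  assumes "det B \<noteq> 0" and [measurable]: "f \<in> borel_measurable borel"
  shows "(\<integral>\<^sup>+x. f x \<partial>lborel) = ennreal \<bar>det B\<bar> * (\<integral>\<^sup>+y. f (c + B *v y) \<partial>lborel)"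
proof -
  have "(\<integral>\<^sup>+x. f x \<partial>lborel) = (\<integral>\<^sup>+x. f x \<partial>distr lborel borel ((+) c))"
    by (simp add: lborel_distr_plus)
  also have "\<dots> = (\<integral>\<^sup>+x. f (c + x) \<partial>lborel)"
    by (subst nn_integral_distr) auto
  also have "\<dots> = ennreal \<bar>det B\<bar> * (\<integral>\<^sup>+y. f (c + B *v y) \<partial>lborel)"
    by (subst nn_integral_lborel_matrix[OF assms(1)]) auto
  finally show ?thesis .
qed

text \<open>Length of the normal vector \<open>(a, -1)\<close> of the graph of an affine function
  with slope \<open>a\<close>; dividing a vertical gap by it gives the distance to the
  hyperplane.\<close>

definition slope_norm :: "real^'n \<Rightarrow> real" where
  "slope_norm a = sqrt (1 + a \<bullet> a)"

lemma slope_norm_pos [simp]: "slope_norm a > 0"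
  by (simp add: slope_norm_def add_pos_nonneg)

lemma slope_norm_square: "(slope_norm a)\<^sup>2 = 1 + a \<bullet> a"
  by (simp add: slope_norm_def)

lemma borel_measurable_slope_norm [measurable]: "slope_norm \<in> borel_measurable borel"
  unfolding slope_norm_def by measurable

text \<open>The inverse square root of the matrix \<open>I + a a\<^sup>T\<close>.\<close>

definition shear :: "real^'n \<Rightarrow> real^'n^'n" where
  "shear a = (\<chi> i j. of_bool (i = j) + (- 1 / (slope_norm a * (slope_norm a + 1))) * a $ i * a $ j)"

lemma shear_mult_vector: "shear a *v x = x - ((a \<bullet> x) / (slope_norm a * (slope_norm a + 1))) *\<^sub>R a"
  unfolding shear_def by (subst rank_one_update_mult_vector) simp

text \<open>Both sides are the eigenvalue of \<open>shear a\<close> in the direction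
  \<open>a\<close>; on the orthogonal complement of \<open>a\<close> the matrix is the identity, so
  this is also its determinant.\<close>

lemma slope_norm_fraction:
  "1 - (a \<bullet> a) / (slope_norm a * (slope_norm a + 1)) = 1 / slope_norm a"
proof -
  have eq: "a \<bullet> a = (slope_norm a - 1) * (slope_norm a + 1)"
    using slope_norm_square[of a] by (simp add: power2_eq_square algebra_simps)
  have nz: "slope_norm a + 1 \<noteq> 0" "slope_norm a \<noteq> 0" using slope_norm_pos[of a] by linarith+
  have "(a \<bullet> a) / (slope_norm a * (slope_norm a + 1)) = (slope_norm a - 1) / slope_norm a"
    unfolding eq using nz by simp
  then show ?thesis using nz by (simp add: diff_divide_distrib)
qed

lemma det_shear: "det (shear a) = 1 / slope_norm a"
  unfolding shear_def det_rank_one_update using slope_norm_fraction[of a] by simp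

text \<open>Completing the square in \<open>x\<close>: the quadratic part is
  \<open>I + a a^T\<close>, the minimum lies at \<open>(w / \<sigma>) a\<close> and equals
  \<open>w^2\<close>, and \<open>shear a\<close> turns the remainder into the square of the norm of
  \<open>y\<close>.\<close>

lemma shear_quadratic_form:
  fixes a y :: "real^'n" and w :: real
  defines "\<sigma> \<equiv> slope_norm a" and "x \<equiv> (w / slope_norm a) *\<^sub>R a + shear a *v y"
  shows "(norm x)\<^sup>2 + (a \<bullet> x - \<sigma> * w)\<^sup>2 = (norm y)\<^sup>2 + w\<^sup>2"
proof -
  \<comment> \<open>With \<open>\<kappa>\<close>, \<open>q\<close>, \<open>N\<close> and later
    \<open>t\<close> as atoms, the claim is a polynomial identity modulo
    \<open>t * \<sigma> = 1\<close>, \<open>\<kappa> * (\<sigma>^2 - 1) = 1 - t\<close> and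
    \<open>\<kappa> * (1 + t) = t^2\<close>.\<close>
  define \<kappa> where "\<kappa> = 1 / (\<sigma> * (\<sigma> + 1))"
  define q where "q = a \<bullet> y"
  define N where "N = a \<bullet> a"
  have pos: "\<sigma> > 0" unfolding \<sigma>_def by simp
  then have \<kappa>: "\<kappa> * (\<sigma> * (\<sigma> + 1)) = 1" unfolding \<kappa>_def by simp
  have N: "N = \<sigma>\<^sup>2 - 1" using slope_norm_square[of a] unfolding \<sigma>_def N_def by simp
  have x: "x = (w / \<sigma>) *\<^sub>R a + (y - (\<kappa> * q) *\<^sub>R a)"
    unfolding x_def shear_mult_vector \<sigma>_def[symmetric] \<kappa>_def q_def by simp
  have ax: "a \<bullet> x = w / \<sigma> * N + (q - \<kappa> * q * N)"
    unfolding x by (simp add: inner_add_right inner_diff_right N_def q_def)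
  have x': "x = (w / \<sigma> - \<kappa> * q) *\<^sub>R a + y" unfolding x by (simp add: algebra_simps)
  have nx: "(norm x)\<^sup>2 = (w / \<sigma> - \<kappa> * q)\<^sup>2 * N + 2 * (w / \<sigma> - \<kappa> * q) * q + (norm y)\<^sup>2"
    unfolding x' power2_norm_eq_inner N_def q_def
    by (simp add: inner_add_left inner_add_right inner_commute[of y a] power2_eq_square algebra_simps)
  define t where "t = 1 / \<sigma>"
  have t: "t * \<sigma> = 1" using pos by (simp add: t_def)
  have \<sigma>1: "\<sigma> + 1 > 0" using pos by simp
  have \<kappa>N: "\<kappa> * (\<sigma>\<^sup>2 - 1) = 1 - t"
  proof -
    have "\<kappa> * (\<sigma>\<^sup>2 - 1) = (\<sigma> - 1) * (\<sigma> + 1) / (\<sigma> * (\<sigma> + 1))"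
      unfolding \<kappa>_def by (simp add: power2_eq_square algebra_simps)
    also have "\<dots> = (\<sigma> - 1) / \<sigma>" using \<sigma>1 by simp
    finally show ?thesis using pos by (simp add: t_def diff_divide_distrib)
  qed
  have 1: "a \<bullet> x - \<sigma> * w = (q - w) * t"
  proof -
    have "a \<bullet> x - \<sigma> * w = w * (t * \<sigma>) * \<sigma> - w * t + q - q * (\<kappa> * (\<sigma>\<^sup>2 - 1)) - \<sigma> * w"
      unfolding ax N t_def by (simp add: power2_eq_square algebra_simps)
    also have "\<dots> = (q - w) * t" unfolding \<kappa>N t by (simp add: algebra_simps)
    finally show ?thesis .
  qed
  have "\<kappa> * (1 + t) = t\<^sup>2"
  proof -
    have "\<kappa> * (1 + t) = \<kappa> * ((\<sigma> + 1) * t)" using t by (simp add: algebra_simps)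
    also have "\<dots> = t * t" using \<sigma>1 by (simp add: \<kappa>_def t_def)
    finally show ?thesis by (simp add: power2_eq_square)
  qed
  have "(w * t - \<kappa> * q)\<^sup>2 * (\<sigma>\<^sup>2 - 1) + 2 * (w * t - \<kappa> * q) * q + ((q - w) * t)\<^sup>2 = w\<^sup>2"
  proof -
    have "(w * t - \<kappa> * q)\<^sup>2 * (\<sigma>\<^sup>2 - 1)
        = w\<^sup>2 * ((t * \<sigma>)\<^sup>2 - t\<^sup>2) - 2 * w * q * t * (\<kappa> * (\<sigma>\<^sup>2 - 1)) + q\<^sup>2 * \<kappa> * (\<kappa> * (\<sigma>\<^sup>2 - 1))"
      by (simp add: power2_eq_square algebra_simps)
    also have "\<dots> = w\<^sup>2 * (1 - t\<^sup>2) - 2 * w * q * t * (1 - t) + q\<^sup>2 * \<kappa> * (1 - t)"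
      unfolding \<kappa>N t by simp
    finally have "(w * t - \<kappa> * q)\<^sup>2 * (\<sigma>\<^sup>2 - 1) + 2 * (w * t - \<kappa> * q) * q + ((q - w) * t)\<^sup>2
      = w\<^sup>2 + q\<^sup>2 * (t\<^sup>2 - \<kappa> * (1 + t))"
      by (simp add: power2_eq_square algebra_simps)
    then show ?thesis using \<open>\<kappa> * (1 + t) = t\<^sup>2\<close> by simp
  qed
  then show ?thesis unfolding 1 nx N by (simp add: t_def)
qed

lemma gauss_density_shear:
  "gauss_density ((w / slope_norm a) *\<^sub>R a + shear a *v y)
     * std_normal_density (a \<bullet> ((w / slope_norm a) *\<^sub>R a + shear a *v y) - slope_norm a * w)
   = gauss_density y * std_normal_density w"
proof -
  let ?x = "(w / slope_norm a) *\<^sub>R a + shear a *v y"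
  have "exp (- (norm ?x)\<^sup>2 / 2) * exp (- (a \<bullet> ?x - slope_norm a * w)\<^sup>2 / 2) = exp (- (norm y)\<^sup>2 / 2) * exp (- w\<^sup>2 / 2)"
    using shear_quadratic_form[where a=a and y=y and w=w]
    by (simp add: exp_add[symmetric] add_divide_distrib[symmetric])
  then show ?thesis by (simp add: gauss_density_def std_normal_density_def)
qed

text \<open>Weighting the steps by the density of the height increments recentres them at multiples
  of \<open>a\<close> and contracts them along \<open>a\<close>. After this substitution the steps
  are standard Gaussian again and the \<open>w e\<close> appear in densities of their own; each step
  costs \<open>det (shear a)\<close>, that is \<open>1 / slope_norm a\<close>.\<close>

lemma gaussian_shear:
  fixes a :: "real^'d" and w :: "'e \<Rightarrow> real" and F :: "('e \<Rightarrow> real^'d) \<Rightarrow> ennreal"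
  assumes E: "finite E" and F: "F \<in> borel_measurable (PiM E (\<lambda>_. std_gauss))"
  shows "(\<integral>\<^sup>+X. F X * (\<Prod>e\<in>E. ennreal (std_normal_density (a \<bullet> X e - slope_norm a * w e))) \<partial>PiM E (\<lambda>_. std_gauss))
    = ennreal ((1 / slope_norm a) ^ card E) * (\<Prod>e\<in>E. ennreal (std_normal_density (w e)))
      * (\<integral>\<^sup>+Y. F (\<lambda>e\<in>E. (w e / slope_norm a) *\<^sub>R a + shear a *v Y e) \<partial>PiM E (\<lambda>_. std_gauss))"
proof -
  let ?\<phi> = "\<lambda>x. ennreal (std_normal_density x)" and ?\<gamma> = "\<lambda>x::real^'d. ennreal (gauss_density x)"
  let ?h = "\<lambda>e y. (w e / slope_norm a) *\<^sub>R a + shear a *v y"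
  have sg: "sigma_finite_measure (density lborel ?\<gamma>)"
    using prob_space_std_gauss prob_space_imp_sigma_finite unfolding std_gauss_eq_density by blast
  have sets: "sets (PiM E (\<lambda>_. std_gauss :: (real^'d) measure)) = sets (PiM E (\<lambda>_. lborel))"
    by (intro sets_PiM_cong) auto
  note Fl = F[unfolded measurable_cong_sets[OF sets refl]]
  have co: "(\<lambda>X. X e) \<in> borel_measurable (PiM E (\<lambda>_. lborel :: (real^'d) measure))" for e
    by (rule measurable_PiM_coordinate) simp
  have hm: "(\<lambda>Y. \<lambda>e\<in>E. ?h e (Y e)) \<in> measurable (PiM E (\<lambda>_. lborel)) (PiM E (\<lambda>_. lborel :: (real^'d) measure))"
    by (intro measurable_restrict) (auto intro!: borel_measurable_add measurable_compose[OF co borel_measurable_matrix_vector_mult])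
  have m1: "(\<lambda>X. F X * (\<Prod>e\<in>E. ?\<phi> (a \<bullet> X e - slope_norm a * w e))) \<in> borel_measurable (PiM E (\<lambda>_. lborel))"
    using co by (intro borel_measurable_times_ennreal Fl borel_measurable_prod_ennreal) measurable
  have m2: "(\<lambda>X. (\<Prod>e\<in>E. ?\<gamma> (X e)) * (F X * (\<Prod>e\<in>E. ?\<phi> (a \<bullet> X e - slope_norm a * w e)))) \<in> borel_measurable (PiM E (\<lambda>_. lborel))"
    using co by (intro borel_measurable_times_ennreal m1 borel_measurable_prod_ennreal) measurable
  have m3: "(\<lambda>Y. F (\<lambda>e\<in>E. ?h e (Y e))) \<in> borel_measurable (PiM E (\<lambda>_. lborel))"
    by (rule measurable_compose[OF hm Fl])
  have "(\<integral>\<^sup>+X. F X * (\<Prod>e\<in>E. ?\<phi> (a \<bullet> X e - slope_norm a * w e)) \<partial>PiM E (\<lambda>_. std_gauss))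
     = (\<integral>\<^sup>+X. (\<Prod>e\<in>E. ?\<gamma> (X e)) * (F X * (\<Prod>e\<in>E. ?\<phi> (a \<bullet> X e - slope_norm a * w e))) \<partial>PiM E (\<lambda>_. lborel))"
    unfolding std_gauss_eq_density
    by (rule nn_integral_PiM_density[OF E _ sg]) (use m1 sets in \<open>auto simp: std_gauss_eq_density cong: measurable_cong_sets\<close>)
  also have "\<dots> = (\<integral>\<^sup>+Y. (\<Prod>e\<in>E. ennreal (1 / slope_norm a)) * ((\<Prod>e\<in>E. ?\<gamma> ((\<lambda>e\<in>E. ?h e (Y e)) e))
      * (F (\<lambda>e\<in>E. ?h e (Y e)) * (\<Prod>e\<in>E. ?\<phi> (a \<bullet> (\<lambda>e\<in>E. ?h e (Y e)) e - slope_norm a * w e)))) \<partial>PiM E (\<lambda>_. lborel))"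
  proof (rule nn_integral_PiM_transfer[OF product_sigma_finite_lborel product_sigma_finite_lborel E])
    fix e and f :: "real^'d \<Rightarrow> ennreal" assume "f \<in> borel_measurable lborel"
    then have [measurable]: "f \<in> borel_measurable borel" by simp
    show "(\<integral>\<^sup>+x. f x \<partial>lborel) = (\<integral>\<^sup>+y. ennreal (1 / slope_norm a) * f (?h e y) \<partial>lborel)"
      using slope_norm_pos[of a]
      by (subst nn_integral_lborel_affine_matrix[of "shear a" _ "(w e / slope_norm a) *\<^sub>R a"])
         (auto simp: det_shear nn_integral_cmult less_imp_le less_imp_neq[THEN not_sym])
  qed (use m2 in auto)
  also have "\<dots> = (\<integral>\<^sup>+Y. ennreal ((1 / slope_norm a) ^ card E) * (\<Prod>e\<in>E. ?\<phi> (w e))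
        * ((\<Prod>e\<in>E. ?\<gamma> (Y e)) * F (\<lambda>e\<in>E. ?h e (Y e))) \<partial>PiM E (\<lambda>_. lborel))"
  proof (intro nn_integral_cong)
    fix Y :: "'e \<Rightarrow> real^'d"
    have "(\<Prod>e\<in>E. ?\<gamma> ((\<lambda>e\<in>E. ?h e (Y e)) e)) * (\<Prod>e\<in>E. ?\<phi> (a \<bullet> (\<lambda>e\<in>E. ?h e (Y e)) e - slope_norm a * w e))
      = (\<Prod>e\<in>E. ?\<gamma> (Y e) * ?\<phi> (w e))"
      unfolding prod.distrib[symmetric]
    proof (intro prod.cong refl)
      fix e assume e: "e \<in> E"
      show "?\<gamma> ((\<lambda>e\<in>E. ?h e (Y e)) e) * ?\<phi> (a \<bullet> (\<lambda>e\<in>E. ?h e (Y e)) e - slope_norm a * w e) = ?\<gamma> (Y e) * ?\<phi> (w e)"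
        using e gauss_density_shear[of "w e" a "Y e"] by (simp add: ennreal_mult'[symmetric])
    qed
    moreover have "(\<Prod>e\<in>E. ennreal (1 / slope_norm a)) = ennreal ((1 / slope_norm a) ^ card E)"
      using slope_norm_pos[of a] by (simp add: ennreal_power less_imp_le)
    ultimately show "(\<Prod>e\<in>E. ennreal (1 / slope_norm a)) * ((\<Prod>e\<in>E. ?\<gamma> ((\<lambda>e\<in>E. ?h e (Y e)) e))
      * (F (\<lambda>e\<in>E. ?h e (Y e)) * (\<Prod>e\<in>E. ?\<phi> (a \<bullet> (\<lambda>e\<in>E. ?h e (Y e)) e - slope_norm a * w e))))
      = ennreal ((1 / slope_norm a) ^ card E) * (\<Prod>e\<in>E. ?\<phi> (w e)) * ((\<Prod>e\<in>E. ?\<gamma> (Y e)) * F (\<lambda>e\<in>E. ?h e (Y e)))"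
      by (simp add: prod.distrib mult_ac)
  qed
  also have "\<dots> = ennreal ((1 / slope_norm a) ^ card E) * (\<Prod>e\<in>E. ?\<phi> (w e))
        * (\<integral>\<^sup>+Y. (\<Prod>e\<in>E. ?\<gamma> (Y e)) * F (\<lambda>e\<in>E. ?h e (Y e)) \<partial>PiM E (\<lambda>_. lborel))"
    using co by (intro nn_integral_cmult borel_measurable_times_ennreal m3 borel_measurable_prod_ennreal) measurable
  also have "(\<integral>\<^sup>+Y. (\<Prod>e\<in>E. ?\<gamma> (Y e)) * F (\<lambda>e\<in>E. ?h e (Y e)) \<partial>PiM E (\<lambda>_. lborel))
     = (\<integral>\<^sup>+Y. F (\<lambda>e\<in>E. ?h e (Y e)) \<partial>PiM E (\<lambda>_. std_gauss))"
    unfolding std_gauss_eq_density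
    by (rule nn_integral_PiM_density[OF E _ sg, symmetric]) (use m3 sets in \<open>auto simp: std_gauss_eq_density cong: measurable_cong_sets\<close>)
  finally show ?thesis .
qed

lemma nn_integral_exp_square_norm:
  fixes t :: real assumes "t > 0"
  shows "(\<integral>\<^sup>+(a::real^'d). ennreal (exp (- t * (a \<bullet> a))) \<partial>lborel) = ennreal ((pi / t) powr (real CARD('d) / 2))"
proof -
  \<comment> \<open>Scaling by \<open>c\<close> turns the exponent of the standard Gaussian density
    into \<open>- t * (a \<bullet> a)\<close>, so its normalisation gives the value.\<close>
  define c where "c = sqrt (2 * t)"
  have c: "c > 0" "c\<^sup>2 = 2 * t" using assms by (auto simp: c_def)
  have "1 = (\<integral>\<^sup>+(x::real^'d). ennreal (gauss_density x) \<partial>lborel)"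
    using prob_space.emeasure_space_1[OF prob_space_std_gauss]
    by (simp add: std_gauss_eq_density emeasure_density)
  also have "\<dots> = (\<integral>\<^sup>+(x::real^'d). ennreal (gauss_density x) \<partial>density (distr lborel borel (\<lambda>x. 0 + c *\<^sub>R x)) (\<lambda>_. \<bar>c\<bar>^DIM(real^'d)))"
    using c by (subst lborel_affine[of c "0::real^'d"]) auto
  also have "\<dots> = ennreal (c ^ CARD('d)) * (\<integral>\<^sup>+(x::real^'d). ennreal (gauss_density (c *\<^sub>R x)) \<partial>lborel)"
    using c by (simp add: nn_integral_density nn_integral_distr nn_integral_cmult)
  also have "(\<integral>\<^sup>+(x::real^'d). ennreal (gauss_density (c *\<^sub>R x)) \<partial>lborel)
     = ennreal ((2 * pi) powr (- real CARD('d) / 2)) * (\<integral>\<^sup>+(a::real^'d). ennreal (exp (- t * (a \<bullet> a))) \<partial>lborel)"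
    using c by (subst nn_integral_cmult[symmetric])
      (auto simp: gauss_density_def ennreal_mult'[symmetric] power_mult_distrib power2_norm_eq_inner)
  finally have eq: "1 = ennreal (c ^ CARD('d)) * (ennreal ((2 * pi) powr (- real CARD('d) / 2)) * (\<integral>\<^sup>+(a::real^'d). ennreal (exp (- t * (a \<bullet> a))) \<partial>lborel))" .
  have "c ^ CARD('d) * (2 * pi) powr (- real CARD('d) / 2) * (pi / t) powr (real CARD('d) / 2) = 1"
  proof -
    have 1: "c ^ CARD('d) = (2 * t) powr (real CARD('d) / 2)"
      using assms c by (simp add: c_def powr_half_sqrt[symmetric] powr_power powr_realpow[symmetric] powr_powr)
    have 2: "(2 * pi) powr (- real CARD('d) / 2) = inverse ((2 * pi) powr (real CARD('d) / 2))"
      by (simp add: powr_minus)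
    have 3: "(2 * t) powr (real CARD('d) / 2) * (pi / t) powr (real CARD('d) / 2) = (2 * pi) powr (real CARD('d) / 2)"
      using assms by (subst powr_mult[symmetric]) auto
    have "c ^ CARD('d) * (2 * pi) powr (- real CARD('d) / 2) * (pi / t) powr (real CARD('d) / 2)
        = ((2 * t) powr (real CARD('d) / 2) * (pi / t) powr (real CARD('d) / 2)) * inverse ((2 * pi) powr (real CARD('d) / 2))"
      unfolding 1 2 by (simp only: mult_ac)
    also have "\<dots> = 1" unfolding 3 by simp
    finally show ?thesis .
  qed
  then have one: "ennreal ((pi / t) powr (real CARD('d) / 2)) * (ennreal (c ^ CARD('d)) * ennreal ((2 * pi) powr (- real CARD('d) / 2))) = 1"
    using c by (simp add: ennreal_mult'[symmetric] mult_ac)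
  have "(\<integral>\<^sup>+(a::real^'d). ennreal (exp (- t * (a \<bullet> a))) \<partial>lborel)
     = (ennreal ((pi / t) powr (real CARD('d) / 2)) * (ennreal (c ^ CARD('d)) * ennreal ((2 * pi) powr (- real CARD('d) / 2)))) * (\<integral>\<^sup>+(a::real^'d). ennreal (exp (- t * (a \<bullet> a))) \<partial>lborel)"
    unfolding one by simp
  also have "\<dots> = ennreal ((pi / t) powr (real CARD('d) / 2)) * 1"
    unfolding eq by (simp only: mult.assoc)
  finally show ?thesis by simp
qed

text \<open>Write \<open>v^(-s)\<close> with \<open>v = 1 + a \<bullet> a\<close> as a Gamma
  integral of \<open>t^(s-1) exp (-t v)\<close> divided by \<open>Gamma s\<close>, and exchange the
  integrals. The Gaussian integral over \<open>a\<close> gives \<open>(pi / t)^(d/2)\<close>, and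
  since \<open>s = d/2 + 1\<close> the powers of \<open>t\<close> cancel, leaving the integral of
  \<open>exp (-t)\<close>.\<close>

lemma nn_integral_slope_norm_power:
  "(\<integral>\<^sup>+(a::real^'d). ennreal ((1 / slope_norm a) ^ (CARD('d) + 2)) \<partial>lborel)
     = ennreal (pi powr (real CARD('d) / 2) / Gamma (real CARD('d) / 2 + 1))"
proof -
  define s where "s = real CARD('d) / 2 + 1"
  have s: "s > 0" by (simp add: s_def add_nonneg_pos)
  define g where "g = (\<lambda>t. ennreal (indicator {0..} t * t powr (s - 1) / exp t))"
  have [measurable]: "g \<in> borel_measurable borel" unfolding g_def by measurable
  have G: "ennreal (Gamma s) = (\<integral>\<^sup>+t. g t \<partial>lborel)"
    unfolding g_def by (rule Gamma_conv_nn_integral_real[OF s])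
  define k where "k t a = ennreal (indicator {0..} t * t powr (s - 1)) * ennreal (exp (- t * (1 + a \<bullet> a)))" for t and a :: "real^'d"
  have [measurable]: "(\<lambda>(a, t). k t a) \<in> borel_measurable (lborel \<Otimes>\<^sub>M lborel)"
    unfolding k_def by measurable
  have scale: "ennreal (Gamma s) * ennreal ((1 / slope_norm a) ^ (CARD('d) + 2)) = (\<integral>\<^sup>+t. k t a \<partial>lborel)" for a :: "real^'d"
  proof -
    define v where "v = 1 + a \<bullet> a"
    have v: "v > 0" by (simp add: v_def add_pos_nonneg)
    have p: "(1 / slope_norm a) ^ (CARD('d) + 2) * (v * v powr (s - 1)) = 1"
    proof -
      have "slope_norm a = v powr (1 / 2)"
        using v unfolding slope_norm_def v_def[symmetric] by (simp add: powr_half_sqrt)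
      then have "(slope_norm a) ^ (CARD('d) + 2) = v powr (1 / 2 * real (CARD('d) + 2))"
        using v by (simp only: powr_power) simp
      also have "1 / 2 * real (CARD('d) + 2) = s" by (simp add: s_def)
      finally have "(slope_norm a) ^ (CARD('d) + 2) = v powr s" .
      moreover have "v * v powr (s - 1) = v powr s" using v by (simp add: powr_mult_base)
      ultimately show ?thesis using v by (simp add: power_one_over)
    qed
    have "ennreal (Gamma s) = ennreal v * (\<integral>\<^sup>+t. g (v * t) \<partial>lborel)"
      unfolding G using v by (subst nn_integral_real_affine[where c=v and t=0]) auto
    also have "(\<integral>\<^sup>+t. g (v * t) \<partial>lborel) = (\<integral>\<^sup>+t. ennreal (v powr (s - 1)) * k t a \<partial>lborel)"
      using v by (intro nn_integral_cong)
        (auto simp: g_def k_def v_def[symmetric] indicator_def zero_le_mult_iff powr_mult ennreal_mult'[symmetric] exp_minus field_simps)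
    also have "\<dots> = ennreal (v powr (s - 1)) * (\<integral>\<^sup>+t. k t a \<partial>lborel)"
      by (rule nn_integral_cmult) (simp add: k_def)
    finally have "ennreal (Gamma s) * ennreal q = ennreal (q * (v * v powr (s - 1))) * (\<integral>\<^sup>+t. k t a \<partial>lborel)" if "q \<ge> 0" for q
      using v that by (simp add: ennreal_mult less_imp_le mult_ac)
    from this[of "(1 / slope_norm a) ^ (CARD('d) + 2)"]
    have "ennreal (Gamma s) * ennreal ((1 / slope_norm a) ^ (CARD('d) + 2))
       = ennreal ((1 / slope_norm a) ^ (CARD('d) + 2) * (v * v powr (s - 1))) * (\<integral>\<^sup>+t. k t a \<partial>lborel)"
      using slope_norm_pos[of a] by (simp add: less_imp_le del: power_add power_Suc)
    then show ?thesis unfolding p by simp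
  qed
  have inner: "(\<integral>\<^sup>+a. k t a \<partial>lborel) = ennreal (pi powr (real CARD('d) / 2)) * ennreal (indicator {0<..} t * exp (- t))"
    if "t \<noteq> 0" for t
  proof (cases "t > 0")
    case True
    have "(\<integral>\<^sup>+a. k t a \<partial>lborel) = (\<integral>\<^sup>+(a::real^'d). ennreal (t powr (s - 1) * exp (- t)) * ennreal (exp (- t * (a \<bullet> a))) \<partial>lborel)"
      using True by (intro nn_integral_cong) (auto simp: k_def ennreal_mult'[symmetric] exp_add[symmetric] distrib_left mult.assoc)
    also have "\<dots> = ennreal (t powr (s - 1) * exp (- t)) * ennreal ((pi / t) powr (real CARD('d) / 2))"
      using nn_integral_exp_square_norm[OF True, where 'd='d] by (subst nn_integral_cmult) simp_all
    also have "\<dots> = ennreal (t powr (s - 1) * exp (- t) * (pi / t) powr (real CARD('d) / 2))"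
      by (simp add: ennreal_mult')
    also have "t powr (s - 1) * exp (- t) * (pi / t) powr (real CARD('d) / 2) = pi powr (real CARD('d) / 2) * exp (- t)"
      using True by (simp add: s_def powr_divide)
    finally show ?thesis using True by (simp add: ennreal_mult')
  qed (use that in \<open>auto simp: k_def indicator_def\<close>)
  have "ennreal (Gamma s) * (\<integral>\<^sup>+(a::real^'d). ennreal ((1 / slope_norm a) ^ (CARD('d) + 2)) \<partial>lborel)
     = (\<integral>\<^sup>+a. \<integral>\<^sup>+t. k t a \<partial>lborel \<partial>lborel)"
    unfolding scale[symmetric] by (rule nn_integral_cmult[symmetric]) measurable
  also have "\<dots> = (\<integral>\<^sup>+t. \<integral>\<^sup>+a. k t a \<partial>lborel \<partial>lborel)"
    by (rule lborel_pair.Fubini'[symmetric]) measurable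
  also have "\<dots> = (\<integral>\<^sup>+t. ennreal (pi powr (real CARD('d) / 2)) * ennreal (indicator {0<..} t * exp (- t)) \<partial>lborel)"
    by (intro nn_integral_cong_AE) (use AE_lborel_singleton[of 0] in \<open>auto simp: inner elim!: eventually_mono\<close>)
  also have "\<dots> = ennreal (pi powr (real CARD('d) / 2)) * (\<integral>\<^sup>+t. ennreal (indicator {0<..} t * exp (- t)) \<partial>lborel)"
    by (rule nn_integral_cmult) measurable
  also have "(\<integral>\<^sup>+t. ennreal (indicator {0<..} t * exp (- t)) \<partial>lborel) = (\<integral>\<^sup>+t. ennreal (indicator {0..} t * t powr (1 - 1) / exp t) \<partial>lborel)"
    by (intro nn_integral_cong_AE) (use AE_lborel_singleton[of 0] in \<open>auto simp: indicator_def exp_minus field_simps elim!: eventually_mono\<close>)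
  also have "\<dots> = 1"
    using Gamma_conv_nn_integral_real[of 1] by simp
  finally have eq: "ennreal (Gamma s) * (\<integral>\<^sup>+(a::real^'d). ennreal ((1 / slope_norm a) ^ (CARD('d) + 2)) \<partial>lborel) = ennreal (pi powr (real CARD('d) / 2))"
    by simp
  have "(\<integral>\<^sup>+(a::real^'d). ennreal ((1 / slope_norm a) ^ (CARD('d) + 2)) \<partial>lborel) = ennreal (1 / Gamma s) * (ennreal (Gamma s) * (\<integral>\<^sup>+(a::real^'d). ennreal ((1 / slope_norm a) ^ (CARD('d) + 2)) \<partial>lborel))"
    using Gamma_real_pos[OF s] by (simp add: mult.assoc[symmetric] ennreal_mult'[symmetric])
  then show ?thesis unfolding eq using Gamma_real_pos[OF s] by (simp add: ennreal_mult'[symmetric] s_def)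
qed

section \<open>Killed walks and contact times\<close>

text \<open>Density at time \<open>k + 1\<close> of a Gaussian walk from \<open>r\<close> whose
  position at each earlier time \<open>i\<close> is integrated against \<open>\<nu> i\<close>:
  Lebesgue measure for a free walk, the half line for a killed one, a point mass for a prescribed
  zero. Index \<open>k\<close> counts the earlier positions.\<close>

primrec chain :: "(nat \<Rightarrow> real measure) \<Rightarrow> real \<Rightarrow> nat \<Rightarrow> real \<Rightarrow> ennreal" where
  "chain \<nu> r 0 u = ennreal (std_normal_density (u - r))"
| "chain \<nu> r (Suc k) u = (\<integral>\<^sup>+v. chain \<nu> r k v * ennreal (std_normal_density (u - v)) \<partial>\<nu> (Suc k))"

lemma chain_measurable_pair:
  assumes "\<And>i. sigma_finite_measure (\<nu> i)" "\<And>i. sets (\<nu> i) = sets borel"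
  shows "(\<lambda>p. chain \<nu> (fst p) k (snd p)) \<in> borel_measurable (borel \<Otimes>\<^sub>M borel)"
proof (induction k)
  case 0
  show ?case by simp
next
  case (Suc k)
  interpret sigma_finite_measure "\<nu> (Suc k)" by (rule assms)
  have [measurable_cong]: "sets (\<nu> (Suc k)) = sets borel" by (rule assms)
  have [measurable]: "(\<lambda>q::(real \<times> real) \<times> real. chain \<nu> (fst (fst q)) k (snd q)) \<in> borel_measurable ((borel \<Otimes>\<^sub>M borel) \<Otimes>\<^sub>M \<nu> (Suc k))"
    by (rule measurable_compose[of "\<lambda>q. (fst (fst q), snd q)", OF _ Suc, simplified]) measurable
  show ?case by simp
qed

lemma chain_measurable:
  assumes "\<And>i. sigma_finite_measure (\<nu> i)" "\<And>i. sets (\<nu> i) = sets borel"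
  shows "chain \<nu> r k \<in> borel_measurable borel"
  using measurable_compose[of "\<lambda>u. (r, u)", OF _ chain_measurable_pair[OF assms]] by simp

text \<open>The map \<open>\<kappa>\<close> places the times of one walk among the coordinates of
  all walks; the position before time 1 is the start \<open>r\<close>.\<close>

definition walk_weight :: "real \<Rightarrow> (nat \<Rightarrow> 'i) \<Rightarrow> ('i \<Rightarrow> real) \<Rightarrow> nat \<Rightarrow> ennreal" where
  "walk_weight r \<kappa> U i = ennreal (std_normal_density (U (\<kappa> i) - (if i = 1 then r else U (\<kappa> (i - 1)))))"

lemma measurable_walk_weight:
  assumes "\<And>i. sets (M i) = sets borel"
  shows "(\<lambda>U. walk_weight r \<kappa> U i) \<in> borel_measurable (PiM I M)"
proof -
  have [measurable]: "(\<lambda>U. U j) \<in> borel_measurable (PiM I M)" for j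
    by (rule measurable_PiM_coordinate) (rule assms)
  show ?thesis unfolding walk_weight_def by (cases "i = 1") simp_all
qed

text \<open>\<open>G\<close> carries everything that depends on other walks, so walks can be
  integrated out one after another. The test function \<open>h\<close> is arbitrary because
  integrating out the last position turns \<open>h\<close> into the test function \<open>H\<close>
  of the position before.\<close>

lemma chain_integral:
  fixes M :: "'i \<Rightarrow> real measure"
  assumes psf: "product_sigma_finite M" and sets: "\<And>i. sets (M i) = sets borel" and S: "finite S"
    and G: "G \<in> borel_measurable (PiM S M)" "\<And>x y. (\<And>j. j \<in> S \<Longrightarrow> x j = y j) \<Longrightarrow> G x = G y"
    and \<kappa>: "inj_on \<kappa> {1..Suc k}" "\<kappa> ` {1..Suc k} \<inter> S = {}"
    and h: "h \<in> borel_measurable borel"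
  shows "(\<integral>\<^sup>+U. G U * (\<Prod>i=1..Suc k. walk_weight r \<kappa> U i) * h (U (\<kappa> (Suc k))) \<partial>PiM (S \<union> \<kappa> ` {1..Suc k}) M)
       = (\<integral>\<^sup>+U. G U \<partial>PiM S M) * (\<integral>\<^sup>+v. chain (\<lambda>i. M (\<kappa> i)) r k v * h v \<partial>M (\<kappa> (Suc k)))"
  using \<kappa> h
proof (induction k arbitrary: h)
  case (0 h)
  interpret product_sigma_finite M by (rule psf)
  have [measurable]: "h \<in> borel_measurable (M (\<kappa> 1))" "(\<lambda>y. ennreal (std_normal_density (y - r))) \<in> borel_measurable (M (\<kappa> 1))"
    using 0 sets[of "\<kappa> 1"] by (simp_all cong: measurable_cong_sets)
  let ?p = "\<kappa> 1"
  have p: "?p \<notin> S" using 0 by auto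
  have co: "(\<lambda>U. U j) \<in> borel_measurable (PiM I M)" for j I
    by (rule measurable_PiM_coordinate) (rule sets)
  have Gm: "G \<in> borel_measurable (PiM (insert ?p S) M)"
  proof -
    have "(\<lambda>x. G (restrict x S)) \<in> borel_measurable (PiM (insert ?p S) M)"
      by (rule measurable_compose[OF measurable_restrict_subset G(1)]) auto
    moreover have "G (restrict x S) = G x" for x by (rule G(2)) simp
    ultimately show ?thesis by simp
  qed
  have "(\<integral>\<^sup>+U. G U * walk_weight r \<kappa> U 1 * h (U ?p) \<partial>PiM (insert ?p S) M)
      = (\<integral>\<^sup>+x. \<integral>\<^sup>+y. G (x(?p := y)) * walk_weight r \<kappa> (x(?p := y)) 1 * h ((x(?p := y)) ?p) \<partial>M ?p \<partial>PiM S M)"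
    by (rule product_nn_integral_insert[OF S p])
       (intro borel_measurable_times_ennreal Gm measurable_walk_weight sets measurable_compose[OF co 0(3)])
  also have "\<dots> = (\<integral>\<^sup>+x. G x * (\<integral>\<^sup>+y. chain (\<lambda>i. M (\<kappa> i)) r 0 y * h y \<partial>M ?p) \<partial>PiM S M)"
  proof (intro nn_integral_cong)
    fix x
    have "G (x(?p := y)) = G x" for y by (rule G(2)) (use p in auto)
    then have "(\<integral>\<^sup>+y. G (x(?p := y)) * walk_weight r \<kappa> (x(?p := y)) 1 * h ((x(?p := y)) ?p) \<partial>M ?p)
       = (\<integral>\<^sup>+y. G x * (ennreal (std_normal_density (y - r)) * h y) \<partial>M ?p)"
      by (simp add: walk_weight_def mult.assoc)
    also have "\<dots> = G x * (\<integral>\<^sup>+y. ennreal (std_normal_density (y - r)) * h y \<partial>M ?p)"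
      by (rule nn_integral_cmult) measurable
    finally show "(\<integral>\<^sup>+y. G (x(?p := y)) * walk_weight r \<kappa> (x(?p := y)) 1 * h ((x(?p := y)) ?p) \<partial>M ?p)
       = G x * (\<integral>\<^sup>+y. chain (\<lambda>i. M (\<kappa> i)) r 0 y * h y \<partial>M ?p)" by simp
  qed
  also have "\<dots> = (\<integral>\<^sup>+U. G U \<partial>PiM S M) * (\<integral>\<^sup>+y. chain (\<lambda>i. M (\<kappa> i)) r 0 y * h y \<partial>M ?p)"
    by (rule nn_integral_multc[OF G(1)])
  finally show ?case by simp
next
  case (Suc k h)
  interpret product_sigma_finite M by (rule psf)
  let ?p = "\<kappa> (Suc (Suc k))" and ?q = "\<kappa> (Suc k)" and ?I = "S \<union> \<kappa> ` {1..Suc k}"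
  let ?W = "\<lambda>U. \<Prod>i=1..Suc k. walk_weight r \<kappa> U i"
  have hp [measurable]: "h \<in> borel_measurable (M ?p)" using Suc.prems(3) sets[of ?p] by (simp cong: measurable_cong_sets)
  have sp [measurable_cong]: "sets (M ?p) = sets borel" "sets (M ?q) = sets borel" by (rule sets)+
  have \<kappa>eq: "\<kappa> i = \<kappa> j \<longleftrightarrow> i = j" if "i \<in> {1..Suc (Suc k)}" "j \<in> {1..Suc (Suc k)}" for i j
    using Suc.prems(1) that by (auto simp: inj_on_def)
  have "?p \<in> \<kappa> ` {1..Suc (Suc k)}" by auto
  then have "?p \<notin> S" using Suc.prems(2) by blast
  then have p: "?p \<notin> ?I" using \<kappa>eq by auto
  have I: "finite ?I" using S by simp
  have Ieq: "S \<union> \<kappa> ` {1..Suc (Suc k)} = insert ?p ?I" by (simp add: atLeastAtMostSuc_conv)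
  have co: "(\<lambda>U. U j) \<in> borel_measurable (PiM I M)" for j I
    by (rule measurable_PiM_coordinate) (rule sets)
  have Gm: "G \<in> borel_measurable (PiM (insert ?p ?I) M)"
  proof -
    have "(\<lambda>x. G (restrict x S)) \<in> borel_measurable (PiM (insert ?p ?I) M)"
      by (rule measurable_compose[OF measurable_restrict_subset G(1)]) auto
    moreover have "G (restrict x S) = G x" for x by (rule G(2)) simp
    ultimately show ?thesis by simp
  qed
  define H where "H v = (\<integral>\<^sup>+y. ennreal (std_normal_density (y - v)) * h y \<partial>M ?p)" for v
  interpret p: sigma_finite_measure "M ?p" by (rule sigma_finite_measures)
  have [measurable]: "H \<in> borel_measurable borel" unfolding H_def by measurable
  have "(\<integral>\<^sup>+U. G U * (\<Prod>i=1..Suc (Suc k). walk_weight r \<kappa> U i) * h (U ?p) \<partial>PiM (insert ?p ?I) M)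
      = (\<integral>\<^sup>+x. \<integral>\<^sup>+y. G (x(?p := y)) * (\<Prod>i=1..Suc (Suc k). walk_weight r \<kappa> (x(?p := y)) i) * h ((x(?p := y)) ?p) \<partial>M ?p \<partial>PiM ?I M)"
    by (rule product_nn_integral_insert[OF I p])
       (intro borel_measurable_times_ennreal borel_measurable_prod_ennreal Gm measurable_walk_weight sets measurable_compose[OF co Suc.prems(3)])
  also have "\<dots> = (\<integral>\<^sup>+x. G x * ?W x * H (x ?q) \<partial>PiM ?I M)"
  proof (intro nn_integral_cong)
    fix x
    have 1: "G (x(?p := y)) = G x" for y by (rule G(2)) (use p in auto)
    have 2: "?W (x(?p := y)) = ?W x" for y
    proof (intro prod.cong refl)
      fix i assume "i \<in> {1..Suc k}"
      moreover have "i = 1 \<or> i - 1 \<in> {1..Suc k}" using calculation by auto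
      ultimately have "\<kappa> i \<noteq> ?p" "i = 1 \<or> \<kappa> (i - 1) \<noteq> ?p"
        using \<kappa>eq[of i "Suc (Suc k)"] \<kappa>eq[of "i - 1" "Suc (Suc k)"] by auto
      then show "walk_weight r \<kappa> (x(?p := y)) i = walk_weight r \<kappa> x i"
        by (auto simp: walk_weight_def)
    qed
    have 3: "walk_weight r \<kappa> (x(?p := y)) (Suc (Suc k)) = ennreal (std_normal_density (y - x ?q))" for y
      using \<kappa>eq[of "Suc k" "Suc (Suc k)"] by (simp add: walk_weight_def)
    have "(\<integral>\<^sup>+y. G (x(?p := y)) * (\<Prod>i=1..Suc (Suc k). walk_weight r \<kappa> (x(?p := y)) i) * h ((x(?p := y)) ?p) \<partial>M ?p)
       = (\<integral>\<^sup>+y. (G x * ?W x) * (ennreal (std_normal_density (y - x ?q)) * h y) \<partial>M ?p)"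
    proof (intro nn_integral_cong)
      fix y
      have "(\<Prod>i=1..Suc (Suc k). walk_weight r \<kappa> (x(?p := y)) i) = ?W (x(?p := y)) * walk_weight r \<kappa> (x(?p := y)) (Suc (Suc k))"
        by (subst prod.nat_ivl_Suc') (simp_all add: mult.commute)
      then show "G (x(?p := y)) * (\<Prod>i=1..Suc (Suc k). walk_weight r \<kappa> (x(?p := y)) i) * h ((x(?p := y)) ?p)
         = (G x * ?W x) * (ennreal (std_normal_density (y - x ?q)) * h y)"
        unfolding 1 2 3 by (simp add: mult.assoc)
    qed
    also have "\<dots> = G x * ?W x * H (x ?q)"
      unfolding H_def by (rule nn_integral_cmult) measurable
    finally show "(\<integral>\<^sup>+y. G (x(?p := y)) * (\<Prod>i=1..Suc (Suc k). walk_weight r \<kappa> (x(?p := y)) i) * h ((x(?p := y)) ?p) \<partial>M ?p)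
       = G x * ?W x * H (x ?q)" .
  qed
  also have "\<dots> = (\<integral>\<^sup>+U. G U \<partial>PiM S M) * (\<integral>\<^sup>+v. chain (\<lambda>i. M (\<kappa> i)) r k v * H v \<partial>M ?q)"
  proof (rule Suc.IH)
    show "inj_on \<kappa> {1..Suc k}" by (rule inj_on_subset[OF Suc.prems(1)]) auto
    have "\<kappa> ` {1..Suc k} \<subseteq> \<kappa> ` {1..Suc (Suc k)}" by (intro image_mono) auto
    then show "\<kappa> ` {1..Suc k} \<inter> S = {}" using Suc.prems(2) by blast
  qed simp
  also have "(\<integral>\<^sup>+v. chain (\<lambda>i. M (\<kappa> i)) r k v * H v \<partial>M ?q) = (\<integral>\<^sup>+y. chain (\<lambda>i. M (\<kappa> i)) r (Suc k) y * h y \<partial>M ?p)"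
  proof -
    interpret q: sigma_finite_measure "M ?q" by (rule sigma_finite_measures)
    interpret pq: pair_sigma_finite "M ?p" "M ?q" ..
    have cm [measurable]: "chain (\<lambda>i. M (\<kappa> i)) r k \<in> borel_measurable borel"
      by (rule chain_measurable) (rule sigma_finite_measures sets)+
    have "(\<integral>\<^sup>+v. chain (\<lambda>i. M (\<kappa> i)) r k v * H v \<partial>M ?q)
       = (\<integral>\<^sup>+v. \<integral>\<^sup>+y. chain (\<lambda>i. M (\<kappa> i)) r k v * (ennreal (std_normal_density (y - v)) * h y) \<partial>M ?p \<partial>M ?q)"
      unfolding H_def by (intro nn_integral_cong nn_integral_cmult[symmetric]) measurable
    also have "\<dots> = (\<integral>\<^sup>+y. \<integral>\<^sup>+v. chain (\<lambda>i. M (\<kappa> i)) r k v * (ennreal (std_normal_density (y - v)) * h y) \<partial>M ?q \<partial>M ?p)"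
      by (rule pq.Fubini') measurable
    also have "\<dots> = (\<integral>\<^sup>+y. chain (\<lambda>i. M (\<kappa> i)) r (Suc k) y * h y \<partial>M ?p)"
    proof (intro nn_integral_cong)
      fix y
      have "(\<integral>\<^sup>+v. chain (\<lambda>i. M (\<kappa> i)) r k v * (ennreal (std_normal_density (y - v)) * h y) \<partial>M ?q)
         = (\<integral>\<^sup>+v. chain (\<lambda>i. M (\<kappa> i)) r k v * ennreal (std_normal_density (y - v)) * h y \<partial>M ?q)"
        by (simp add: mult.assoc)
      also have "\<dots> = chain (\<lambda>i. M (\<kappa> i)) r (Suc k) y * h y"
        by (subst nn_integral_multc) simp_all
      finally show "(\<integral>\<^sup>+v. chain (\<lambda>i. M (\<kappa> i)) r k v * (ennreal (std_normal_density (y - v)) * h y) \<partial>M ?q)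
         = chain (\<lambda>i. M (\<kappa> i)) r (Suc k) y * h y" .
    qed
    finally show ?thesis .
  qed
  finally show ?case unfolding Ieq .
qed

section \<open>Killed walks and their prescribed zeros\<close>

definition halfline :: "real measure" where
  "halfline = density lborel (indicator {0..})"

lemma sets_halfline [simp, measurable_cong]: "sets halfline = sets borel"
  and space_halfline [simp]: "space halfline = UNIV"
  by (simp_all add: halfline_def)

lemma sigma_finite_halfline: "sigma_finite_measure halfline"
  unfolding halfline_def by (subst sigma_finite_measure.sigma_finite_iff_density_finite) (auto simp: indicator_def intro: lborel.sigma_finite_measure_axioms)

lemma sigma_finite_return_borel: "sigma_finite_measure (return borel (x::real))"
  by (intro prob_space_imp_sigma_finite prob_space_return) simp

text \<open>The positions at times 1 to \<open>n - 1\<close> are kept nonnegative, the end point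
  \<open>u\<close> at time \<open>n\<close> is free; meaningful for
  \<open>n \<ge> 1\<close>.\<close>

definition walk_kernel :: "nat \<Rightarrow> real \<Rightarrow> real \<Rightarrow> ennreal" where
  "walk_kernel n r u = chain (\<lambda>_. halfline) r (n - 1) u"

lemma walk_kernel_Suc:
  assumes "n \<ge> 1"
  shows "walk_kernel (Suc n) r u = (\<integral>\<^sup>+v. walk_kernel n r v * ennreal (std_normal_density (u - v)) \<partial>halfline)"
  using assms by (cases n) (simp_all add: walk_kernel_def)

lemma walk_kernel_1: "walk_kernel (Suc 0) r u = ennreal (std_normal_density (u - r))"
  by (simp add: walk_kernel_def)

lemma walk_kernel_measurable_pair:
  "(\<lambda>p. walk_kernel n (fst p) (snd p)) \<in> borel_measurable (borel \<Otimes>\<^sub>M borel)"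
  unfolding walk_kernel_def by (rule chain_measurable_pair) (auto intro: sigma_finite_halfline)

lemma walk_kernel_measurable [measurable]: "walk_kernel n r \<in> borel_measurable borel"
  unfolding walk_kernel_def by (rule chain_measurable) (auto intro: sigma_finite_halfline)

definition contact_measure :: "nat set \<Rightarrow> nat \<Rightarrow> real measure" where
  "contact_measure A i = (if i \<in> A then return borel 0 else halfline)"

lemma sets_contact_measure [simp]: "sets (contact_measure A i) = sets borel"
  by (simp add: contact_measure_def)

lemma sigma_finite_contact_measure: "sigma_finite_measure (contact_measure A i)"
  by (simp add: contact_measure_def sigma_finite_halfline sigma_finite_return_borel)

definition contact_gap :: "nat set \<Rightarrow> nat \<Rightarrow> nat" where
  "contact_gap A i = i - Max {j\<in>A. j < i}"

text \<open>Density for the walk from \<open>r\<close> to be at 0 at every time in \<open>A\<close>,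
  kept nonnegative up to the last of these times.\<close>

definition contact_weight :: "nat set \<Rightarrow> real \<Rightarrow> ennreal" where
  "contact_weight A r = walk_kernel (Min A) r 0 * (\<Prod>i\<in>A - {Min A}. walk_kernel (contact_gap A i) 0 0)"

lemma contact_weight_singleton: "contact_weight {i} r = walk_kernel i r 0"
  by (simp add: contact_weight_def)

text \<open>The path regenerates at every contact time.\<close>

lemma contact_weight_insert:
  assumes "finite A" "A \<noteq> {}" "\<And>j. j \<in> A \<Longrightarrow> j < i"
  shows "contact_weight (insert i A) r = contact_weight A r * walk_kernel (i - Max A) 0 0"
proof -
  have Min: "Min (insert i A) = Min A"
    by (subst Min_insert[OF assms(1,2)])
       (rule min_absorb2, rule less_imp_le, rule assms(3)[OF Min_in[OF assms(1,2)]])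
  have "i \<notin> A" "i \<noteq> Min A" using assms(3)[of i] assms(3)[of "Min A"] Min_in[OF assms(1,2)] by auto
  then have "insert i A - {Min A} = insert i (A - {Min A})" by auto
  then have "(\<Prod>j\<in>insert i A - {Min A}. walk_kernel (contact_gap (insert i A) j) 0 0)
    = walk_kernel (contact_gap (insert i A) i) 0 0 * (\<Prod>j\<in>A - {Min A}. walk_kernel (contact_gap (insert i A) j) 0 0)"
    using assms(1) \<open>i \<notin> A\<close> by simp
  moreover have "{j \<in> insert i A. j < i} = A" using assms(3) by auto
  then have "contact_gap (insert i A) i = i - Max A" by (simp add: contact_gap_def)
  moreover have "contact_gap (insert i A) j = contact_gap A j" if "j \<in> A" for j
  proof -
    have "{k \<in> insert i A. k < j} = {k \<in> A. k < j}" using assms(3)[OF that] by auto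
    then show ?thesis by (simp add: contact_gap_def)
  qed
  ultimately show ?thesis by (simp add: contact_weight_def Min mult_ac)
qed

text \<open>Until the first contact the chain is a killed walk from \<open>r\<close>; afterwards it
  is a killed walk restarted at 0 at the latest contact. Only contacts up to \<open>k\<close> count,
  because \<open>chain\<close> at index \<open>k\<close> is the density at time \<open>k + 1\<close>
  before the measure of that time is applied.\<close>

lemma chain_contact:
  assumes A: "\<And>i. i \<in> A \<Longrightarrow> i \<ge> 1"
  shows "({i\<in>A. i \<le> k} = {} \<longrightarrow> chain (contact_measure A) r k u = walk_kernel (Suc k) r u)
    \<and> ({i\<in>A. i \<le> k} \<noteq> {} \<longrightarrow> chain (contact_measure A) r k u
          = contact_weight {i\<in>A. i \<le> k} r * walk_kernel (Suc k - Max {i\<in>A. i \<le> k}) 0 u)"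
proof (induction k arbitrary: u)
  case 0
  have "{i\<in>A. i \<le> 0} = {}" using A by fastforce
  then show ?case by (simp add: walk_kernel_1)
next
  case (Suc k)
  define B where "B = {i\<in>A. i \<le> k}"
  have fin: "finite B" by (simp add: B_def)
  have lt: "j < Suc k" if "j \<in> B" for j using that by (simp add: B_def)
  have IH1: "chain (contact_measure A) r k u = walk_kernel (Suc k) r u" if "B = {}" for u
    using Suc[of u] that unfolding B_def by blast
  have IH2: "chain (contact_measure A) r k u = contact_weight B r * walk_kernel (Suc k - Max B) 0 u" if "B \<noteq> {}" for u
    using Suc[of u] that unfolding B_def by blast
  show ?case
  proof (cases "Suc k \<in> A")
    case True
    then have BS: "{i\<in>A. i \<le> Suc k} = insert (Suc k) B" by (auto simp: le_Suc_eq B_def)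
    have Mx: "Max (insert (Suc k) B) = Suc k" using fin lt by (intro Max_eqI) (auto intro: less_imp_le)
    have [measurable]: "chain (contact_measure A) r k \<in> borel_measurable borel"
      by (rule chain_measurable) (auto intro: sigma_finite_contact_measure)
    have "chain (contact_measure A) r (Suc k) u = chain (contact_measure A) r k 0 * ennreal (std_normal_density u)"
      using True by (simp add: contact_measure_def[of A "Suc k"] nn_integral_return)
    also have "chain (contact_measure A) r k 0 = contact_weight (insert (Suc k) B) r"
    proof (cases "B = {}")
      case True
      then show ?thesis by (simp add: IH1 contact_weight_singleton)
    next
      case False
      then show ?thesis by (simp add: IH2 contact_weight_insert[OF fin False lt])
    qed
    finally show ?thesis unfolding BS Mx by (simp add: walk_kernel_1)
  next
    case False
    then have BS: "{i\<in>A. i \<le> Suc k} = B" by (auto simp: le_Suc_eq B_def)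
    have eq: "chain (contact_measure A) r (Suc k) u
       = (\<integral>\<^sup>+v. chain (contact_measure A) r k v * ennreal (std_normal_density (u - v)) \<partial>halfline)"
      using False by (simp add: contact_measure_def[of A "Suc k"])
    show ?thesis
    proof (cases "B = {}")
      case True
      then show ?thesis unfolding BS eq by (simp add: IH1 walk_kernel_Suc[of "Suc k"])
    next
      case False
      then have "Max B \<le> k" using Max_in[OF fin False] by (simp add: B_def)
      have "chain (contact_measure A) r (Suc k) u
        = (\<integral>\<^sup>+v. contact_weight B r * (walk_kernel (Suc k - Max B) 0 v * ennreal (std_normal_density (u - v))) \<partial>halfline)"
        unfolding eq using False by (simp add: IH2 mult.assoc)
      also have "\<dots> = contact_weight B r * walk_kernel (Suc (Suc k - Max B)) 0 u"
        using \<open>Max B \<le> k\<close> by (subst nn_integral_cmult) (auto simp: walk_kernel_Suc)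
      also have "Suc (Suc k - Max B) = Suc (Suc k) - Max B" using \<open>Max B \<le> k\<close> by simp
      finally show ?thesis unfolding BS using False by blast
    qed
  qed
qed

text \<open>The value 1 at \<open>n = 0\<close> covers a walk whose last contact is at its final
  time.\<close>

definition survival :: "nat \<Rightarrow> real \<Rightarrow> ennreal" where
  "survival n r = (if n = 0 then 1 else \<integral>\<^sup>+v. walk_kernel n r v \<partial>halfline)"

text \<open>Applies the measure of the final time: a point mass completes the last contact, the half
  line lets the walk survive from its last contact to the end.\<close>

lemma chain_contact_total:
  assumes A: "A \<subseteq> {1..Suc k}"
  shows "(\<integral>\<^sup>+v. chain (contact_measure A) r k v \<partial>contact_measure A (Suc k))
     = (if A = {} then survival (Suc k) r else contact_weight A r * survival (Suc k - Max A) 0)"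
proof -
  define B where "B = {i\<in>A. i \<le> k}"
  have A1: "i \<ge> 1" if "i \<in> A" for i using A that by auto
  have fin: "finite B" "finite A" using A finite_subset by (auto simp: B_def)
  have lt: "j < Suc k" if "j \<in> B" for j using that by (simp add: B_def)
  have c1: "chain (contact_measure A) r k u = walk_kernel (Suc k) r u" if "B = {}" for u
    using chain_contact[where A=A and r=r and k=k and u=u] A1 that unfolding B_def by blast
  have c2: "chain (contact_measure A) r k u = contact_weight B r * walk_kernel (Suc k - Max B) 0 u" if "B \<noteq> {}" for u
    using chain_contact[where A=A and r=r and k=k and u=u] A1 that unfolding B_def by blast
  show ?thesis
  proof (cases "Suc k \<in> A")
    case True
    then have B: "A = insert (Suc k) B" using A by (auto simp: le_Suc_eq B_def)
    have Mx: "Max A = Suc k" using A True fin by (intro Max_eqI) auto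
    have [measurable]: "chain (contact_measure A) r k \<in> borel_measurable borel"
      by (rule chain_measurable) (auto intro: sigma_finite_contact_measure)
    have "(\<integral>\<^sup>+v. chain (contact_measure A) r k v \<partial>contact_measure A (Suc k)) = chain (contact_measure A) r k 0"
      using True by (simp add: contact_measure_def[of A "Suc k"] nn_integral_return)
    also have "\<dots> = contact_weight (insert (Suc k) B) r"
    proof (cases "B = {}")
      case True
      then show ?thesis by (simp add: c1 contact_weight_singleton)
    next
      case False
      then show ?thesis by (simp add: c2 contact_weight_insert[OF fin(1) False lt])
    qed
    also have "\<dots> = contact_weight A r" using B by simp
    finally show ?thesis using True by (auto simp: Mx survival_def)
  next
    case False
    then have B: "B = A" using A by (auto simp: le_Suc_eq B_def)
    have eq: "(\<integral>\<^sup>+v. chain (contact_measure A) r k v \<partial>contact_measure A (Suc k)) = (\<integral>\<^sup>+v. chain (contact_measure A) r k v \<partial>halfline)"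
      using False by (simp add: contact_measure_def[of A "Suc k"])
    show ?thesis
    proof (cases "A = {}")
      case True
      then have "(\<integral>\<^sup>+v. chain (contact_measure A) r k v \<partial>halfline) = (\<integral>\<^sup>+v. walk_kernel (Suc k) r v \<partial>halfline)"
        by (intro nn_integral_cong) (rule c1[unfolded B])
      then show ?thesis unfolding eq using True by (simp add: survival_def)
    next
      case nonempty: False
      then have "Max A \<le> k" using Max_in[OF fin(2)] B by (auto simp: B_def)
      have "(\<integral>\<^sup>+v. chain (contact_measure A) r k v \<partial>halfline) = (\<integral>\<^sup>+v. contact_weight A r * walk_kernel (Suc k - Max A) 0 v \<partial>halfline)"
        by (intro nn_integral_cong) (rule c2[unfolded B, OF nonempty])
      then show ?thesis unfolding eq using nonempty \<open>Max A \<le> k\<close>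
        by (simp add: nn_integral_cmult survival_def)
    qed
  qed
qed

section \<open>Persistence probabilities as kernels\<close>

lemma product_sigma_finite_std_normal: "product_sigma_finite (\<lambda>_. std_normal_distribution)"
  by (simp add: product_sigma_finite_def prob_space_imp_sigma_finite prob_space_std_normal)

lemma nn_integral_std_normal:
  "f \<in> borel_measurable borel \<Longrightarrow> (\<integral>\<^sup>+x. f x \<partial>std_normal_distribution) = (\<integral>\<^sup>+x. ennreal (std_normal_density x) * f x \<partial>lborel)"
  by (simp add: nn_integral_density)

lemma std_normal_density_minus [simp]: "std_normal_density (- x) = std_normal_density x"
  by (simp add: std_normal_density_def)

lemma nn_integral_std_normal_shift:
  assumes [measurable]: "f \<in> borel_measurable borel"
  shows "(\<integral>\<^sup>+x. f (c + x) \<partial>std_normal_distribution) = (\<integral>\<^sup>+t. ennreal (std_normal_density (t - c)) * f t \<partial>lborel)"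
proof -
  have "(\<integral>\<^sup>+x. f (c + x) \<partial>std_normal_distribution) = (\<integral>\<^sup>+x. ennreal (std_normal_density x) * f (c + x) \<partial>lborel)"
    by (rule nn_integral_std_normal) measurable
  also have "\<dots> = (\<integral>\<^sup>+t. ennreal (std_normal_density (t - c)) * f t \<partial>lborel)"
    by (subst nn_integral_real_affine[where c=1 and t=c, of "\<lambda>t. ennreal (std_normal_density (t - c)) * f t"]) auto
  finally show ?thesis .
qed

text \<open>Passing from steps to partial sums is triangular with unit Jacobian. It is done one step
  at a time: with the earlier ones fixed, the last partial sum is a translate of the last
  step.\<close>

lemma normals_positions:
  assumes "\<Phi> \<in> borel_measurable (PiM {1..n} (\<lambda>_. lborel))"
  shows "(\<integral>\<^sup>+x. \<Phi> (\<lambda>k\<in>{1..n}. \<Sum>i=1..k. x i) \<partial>normals n)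
       = (\<integral>\<^sup>+T. (\<Prod>i=1..n. walk_weight 0 (\<lambda>i. i) T i) * \<Phi> T \<partial>PiM {1..n} (\<lambda>_. lborel))"
  using assms
proof (induction n arbitrary: \<Phi>)
  case (0 \<Phi>)
  interpret N: product_sigma_finite "\<lambda>_::nat. std_normal_distribution" by (rule product_sigma_finite_std_normal)
  interpret L: product_sigma_finite "\<lambda>_::nat. lborel :: real measure" by (rule product_sigma_finite_lborel)
  have e: "{1..0::nat} = {}" by simp
  show ?case unfolding normals_def e
    by (subst N.nn_integral_empty, simp, subst L.nn_integral_empty) (simp_all add: restrict_def)
next
  case (Suc n \<Phi>)
  interpret N: product_sigma_finite "\<lambda>_::nat. std_normal_distribution" by (rule product_sigma_finite_std_normal)
  interpret L: product_sigma_finite "\<lambda>_::nat. lborel :: real measure" by (rule product_sigma_finite_lborel)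
  let ?L = "\<lambda>n. PiM {1..n} (\<lambda>_. lborel :: real measure)" and ?N = "\<lambda>n::nat. PiM {1..n} (\<lambda>_. std_normal_distribution)"
  have ins: "{1..Suc n} = insert (Suc n) {1..n}" by auto
  have sets: "sets (?N n) = sets (?L n)" for n by (intro sets_PiM_cong) auto
  have coN: "(\<lambda>x. x j) \<in> borel_measurable (?N n)" for j n by (rule measurable_PiM_coordinate) simp
  have coL: "(\<lambda>x. x j) \<in> borel_measurable (?L n)" for j n by (rule measurable_PiM_coordinate) simp
  \<comment> \<open>The position before the new step. Before the first step it is the start 0, since
    time 0 is not a coordinate.\<close>
  define P where "P T = (if n = 0 then 0 else T n)" for T :: "nat \<Rightarrow> real"
  have Pm [measurable]: "P \<in> borel_measurable (?L n)" unfolding P_def using coL by (cases "n = 0") simp_all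
  define \<Psi> where "\<Psi> T = (\<integral>\<^sup>+t. ennreal (std_normal_density (t - P T)) * \<Phi> (T(Suc n := t)) \<partial>lborel)" for T
  have upd: "(\<lambda>p. \<Phi> ((fst p)(Suc n := snd p))) \<in> borel_measurable (?L n \<Otimes>\<^sub>M borel)"
    by (rule measurable_compose[OF measurable_fun_upd[where J="{1..n}"] Suc.prems]) (auto simp: ins)
  note [measurable] = upd
  have upd1: "(\<lambda>t. \<Phi> (T(Suc n := t))) \<in> borel_measurable borel" if "T \<in> space (?L n)" for T
    by (rule measurable_compose[OF measurable_fun_upd[where J="{1..n}"] Suc.prems]) (use that in \<open>auto simp: ins\<close>)
  have \<Psi>m: "\<Psi> \<in> borel_measurable (?L n)"
  proof -
    have "(\<lambda>(T, t). ennreal (std_normal_density (t - P T)) * \<Phi> (T(Suc n := t))) \<in> borel_measurable (?L n \<Otimes>\<^sub>M lborel)"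
      unfolding split_beta' by measurable
    then show ?thesis unfolding \<Psi>_def by (rule lborel.borel_measurable_nn_integral)
  qed
  have pm: "(\<lambda>x. \<lambda>k\<in>{1..n}. \<Sum>i=1..k. x i) \<in> measurable (?N n) (?L n)" for n
    by (intro measurable_restrict) (simp add: coN)
  have "(\<integral>\<^sup>+x. \<Phi> (\<lambda>k\<in>{1..Suc n}. \<Sum>i=1..k. x i) \<partial>normals (Suc n))
      = (\<integral>\<^sup>+x. \<integral>\<^sup>+y. \<Phi> (\<lambda>k\<in>{1..Suc n}. \<Sum>i=1..k. (x(Suc n := y)) i) \<partial>std_normal_distribution \<partial>?N n)"
    unfolding normals_def ins
    by (rule N.product_nn_integral_insert[OF _ _ measurable_compose[OF pm[of "Suc n", unfolded ins] Suc.prems[unfolded ins]]]) auto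
  also have "\<dots> = (\<integral>\<^sup>+x. \<Psi> (\<lambda>k\<in>{1..n}. \<Sum>i=1..k. x i) \<partial>?N n)"
  proof (intro nn_integral_cong)
    fix x assume x: "x \<in> space (?N n)"
    let ?T = "\<lambda>k\<in>{1..n}. \<Sum>i=1..k. x i"
    have PT: "P ?T = (\<Sum>i=1..n. x i)" by (simp add: P_def)
    have "(\<lambda>k\<in>{1..Suc n}. \<Sum>i=1..k. (x(Suc n := y)) i) = ?T(Suc n := P ?T + y)" for y
    proof
      fix k
      show "(\<lambda>k\<in>{1..Suc n}. \<Sum>i=1..k. (x(Suc n := y)) i) k = (?T(Suc n := P ?T + y)) k"
      proof (cases "k \<in> {1..n}")
        case True
        then have "(\<Sum>i=1..k. (x(Suc n := y)) i) = (\<Sum>i=1..k. x i)" by (intro sum.cong) auto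
        then show ?thesis using True by simp
      next
        case False
        have "(\<Sum>i=1..n. (x(Suc n := y)) i) = (\<Sum>i=1..n. x i)" by (intro sum.cong) auto
        then show ?thesis using False by (cases "k = Suc n") (auto simp: PT[simplified])
      qed
    qed
    then have "(\<integral>\<^sup>+y. \<Phi> (\<lambda>k\<in>{1..Suc n}. \<Sum>i=1..k. (x(Suc n := y)) i) \<partial>std_normal_distribution)
       = (\<integral>\<^sup>+y. \<Phi> (?T(Suc n := P ?T + y)) \<partial>std_normal_distribution)" by simp
    also have "\<dots> = \<Psi> ?T"
      unfolding \<Psi>_def by (rule nn_integral_std_normal_shift) (rule upd1, rule measurable_space[OF pm x])
    finally show "(\<integral>\<^sup>+y. \<Phi> (\<lambda>k\<in>{1..Suc n}. \<Sum>i=1..k. (x(Suc n := y)) i) \<partial>std_normal_distribution) = \<Psi> ?T" .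
  qed
  also have "\<dots> = (\<integral>\<^sup>+T. (\<Prod>i=1..n. walk_weight 0 (\<lambda>i. i) T i) * \<Psi> T \<partial>?L n)"
    using Suc.IH[OF \<Psi>m] unfolding normals_def .
  also have "\<dots> = (\<integral>\<^sup>+T. \<integral>\<^sup>+t. (\<Prod>i=1..Suc n. walk_weight 0 (\<lambda>i. i) (T(Suc n := t)) i) * \<Phi> (T(Suc n := t)) \<partial>lborel \<partial>?L n)"
  proof (intro nn_integral_cong)
    fix T assume T: "T \<in> space (?L n)"
    have 1: "(\<Prod>i=1..n. walk_weight 0 (\<lambda>i. i) (T(Suc n := t)) i) = (\<Prod>i=1..n. walk_weight 0 (\<lambda>i. i) T i)" for t
      by (intro prod.cong) (auto simp: walk_weight_def)
    have 2: "walk_weight 0 (\<lambda>i. i) (T(Suc n := t)) (Suc n) = ennreal (std_normal_density (t - P T))" for t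
      by (simp add: walk_weight_def P_def)
    have "(\<Prod>i=1..n. walk_weight 0 (\<lambda>i. i) T i) * \<Psi> T
       = (\<integral>\<^sup>+t. (\<Prod>i=1..n. walk_weight 0 (\<lambda>i. i) T i) * (ennreal (std_normal_density (t - P T)) * \<Phi> (T(Suc n := t))) \<partial>lborel)"
      unfolding \<Psi>_def using upd1[OF T] by (intro nn_integral_cmult[symmetric]) simp
    also have "\<dots> = (\<integral>\<^sup>+t. (\<Prod>i=1..Suc n. walk_weight 0 (\<lambda>i. i) (T(Suc n := t)) i) * \<Phi> (T(Suc n := t)) \<partial>lborel)"
    proof (intro nn_integral_cong)
      fix t
      have "(\<Prod>i=1..Suc n. walk_weight 0 (\<lambda>i. i) (T(Suc n := t)) i)
        = (\<Prod>i=1..n. walk_weight 0 (\<lambda>i. i) T i) * ennreal (std_normal_density (t - P T))"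
        unfolding 1[of t, symmetric] 2[symmetric] by (subst prod.nat_ivl_Suc') (simp_all add: mult.commute)
      then show "(\<Prod>i=1..n. walk_weight 0 (\<lambda>i. i) T i) * (ennreal (std_normal_density (t - P T)) * \<Phi> (T(Suc n := t)))
        = (\<Prod>i=1..Suc n. walk_weight 0 (\<lambda>i. i) (T(Suc n := t)) i) * \<Phi> (T(Suc n := t))"
        by (simp add: mult.assoc)
    qed
    finally show "(\<Prod>i=1..n. walk_weight 0 (\<lambda>i. i) T i) * \<Psi> T
       = (\<integral>\<^sup>+t. (\<Prod>i=1..Suc n. walk_weight 0 (\<lambda>i. i) (T(Suc n := t)) i) * \<Phi> (T(Suc n := t)) \<partial>lborel)" .
  qed
  also have "\<dots> = (\<integral>\<^sup>+T. (\<Prod>i=1..Suc n. walk_weight 0 (\<lambda>i. i) T i) * \<Phi> T \<partial>?L (Suc n))"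
    unfolding ins
    by (rule L.product_nn_integral_insert[symmetric])
       (use Suc.prems[unfolded ins] in \<open>auto intro!: borel_measurable_times_ennreal borel_measurable_prod_ennreal measurable_walk_weight\<close>)
  finally show ?case .
qed

lemma prob_space_normals: "prob_space (normals n)"
  unfolding normals_def by (intro prob_space_PiM prob_space_std_normal)

lemma normals_measurable_coordinate [measurable (raw)]: "(\<lambda>x. x j) \<in> borel_measurable (normals n)"
  unfolding normals_def by (rule measurable_PiM_coordinate) simp

lemma emeasure_normals_positions:
  assumes "Measurable.pred (PiM {1..n} (\<lambda>_. lborel)) Q"
  shows "emeasure (normals n) {x \<in> space (normals n). Q (\<lambda>k\<in>{1..n}. \<Sum>i=1..k. x i)}
       = (\<integral>\<^sup>+T. (\<Prod>i=1..n. walk_weight 0 (\<lambda>i. i) T i) * of_bool (Q T) \<partial>PiM {1..n} (\<lambda>_. lborel))"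
proof -
  have pm: "(\<lambda>x. \<lambda>k\<in>{1..n}. \<Sum>i=1..k. x i) \<in> measurable (normals n) (PiM {1..n} (\<lambda>_. lborel))"
    by (intro measurable_restrict) simp
  have m: "{x \<in> space (normals n). Q (\<lambda>k\<in>{1..n}. \<Sum>i=1..k. x i)} \<in> sets (normals n)"
    using measurable_compose[OF pm assms] by (simp add: pred_def)
  have "emeasure (normals n) {x \<in> space (normals n). Q (\<lambda>k\<in>{1..n}. \<Sum>i=1..k. x i)}
     = (\<integral>\<^sup>+x. of_bool (Q (\<lambda>k\<in>{1..n}. \<Sum>i=1..k. x i)) \<partial>normals n)"
    unfolding nn_integral_indicator[OF m, symmetric] by (intro nn_integral_cong) (simp add: indicator_def)
  also have "\<dots> = (\<integral>\<^sup>+T. (\<Prod>i=1..n. walk_weight 0 (\<lambda>i. i) T i) * of_bool (Q T) \<partial>PiM {1..n} (\<lambda>_. lborel))"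
    by (rule normals_positions) (use assms in measurable)
  finally show ?thesis .
qed

lemma nn_integral_halfline_PiM:
  assumes "finite I" "g \<in> borel_measurable (PiM I (\<lambda>_. lborel))"
  shows "(\<integral>\<^sup>+U. g U * of_bool (\<forall>i\<in>I. U i \<ge> 0) \<partial>PiM I (\<lambda>_. lborel)) = (\<integral>\<^sup>+U. g U \<partial>PiM I (\<lambda>_. halfline))"
proof -
  have s: "sets (PiM I (\<lambda>_. density lborel (indicator {0..}))) = sets (PiM I (\<lambda>_. lborel :: real measure))"
    by (intro sets_PiM_cong) auto
  have "(\<integral>\<^sup>+U. g U \<partial>PiM I (\<lambda>_. halfline)) = (\<integral>\<^sup>+U. (\<Prod>i\<in>I. indicator {0..} (U i)) * g U \<partial>PiM I (\<lambda>_. lborel))"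
    unfolding halfline_def
    by (rule nn_integral_PiM_density)
       (use assms s sigma_finite_halfline in \<open>auto simp: halfline_def cong: measurable_cong_sets\<close>)
  also have "\<dots> = (\<integral>\<^sup>+U. g U * of_bool (\<forall>i\<in>I. U i \<ge> 0) \<partial>PiM I (\<lambda>_. lborel))"
  proof (intro nn_integral_cong)
    fix U :: "'a \<Rightarrow> real"
    have "(\<Prod>i\<in>I. indicator {0..} (U i) :: ennreal) = of_bool (\<forall>i\<in>I. U i \<ge> 0)"
      using assms(1) by (auto simp: indicator_def intro!: prod.neutral)
    then show "(\<Prod>i\<in>I. indicator {0..} (U i)) * g U = g U * of_bool (\<forall>i\<in>I. U i \<ge> 0)"
      by (simp add: mult.commute)
  qed
  finally show ?thesis by simp
qed

lemma walk_kernel_path_integral: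
  assumes [measurable]: "h \<in> borel_measurable borel"
  shows "(\<integral>\<^sup>+U. (\<Prod>i=1..Suc k. walk_weight r (\<lambda>i. i) U i) * h (U (Suc k)) * of_bool (\<forall>i\<in>{1..Suc k}. U i \<ge> 0) \<partial>PiM {1..Suc k} (\<lambda>_. lborel))
    = (\<integral>\<^sup>+v. walk_kernel (Suc k) r v * h v \<partial>halfline)"
proof -
  have psf: "product_sigma_finite (\<lambda>_::nat. halfline)"
    by (simp add: product_sigma_finite_def sigma_finite_halfline)
  interpret product_sigma_finite "\<lambda>_::nat. halfline" by (rule psf)
  have "(\<integral>\<^sup>+U. (\<Prod>i=1..Suc k. walk_weight r (\<lambda>i. i) U i) * h (U (Suc k)) * of_bool (\<forall>i\<in>{1..Suc k}. U i \<ge> 0) \<partial>PiM {1..Suc k} (\<lambda>_. lborel))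
     = (\<integral>\<^sup>+U. (\<Prod>i=1..Suc k. walk_weight r (\<lambda>i. i) U i) * h (U (Suc k)) \<partial>PiM {1..Suc k} (\<lambda>_. halfline))"
    by (rule nn_integral_halfline_PiM)
       (auto intro!: borel_measurable_times_ennreal borel_measurable_prod_ennreal measurable_walk_weight measurable_compose[OF measurable_PiM_lborel_coordinate])
  also have "\<dots> = (\<integral>\<^sup>+v. walk_kernel (Suc k) r v * h v \<partial>halfline)"
    using chain_integral[OF psf _ finite.emptyI, of "\<lambda>_. 1" "\<lambda>i. i" k h r]
    by (simp add: walk_kernel_def PiM_empty nn_integral_count_space_finite)
  finally show ?thesis .
qed

text \<open>Reflection \<open>U = r - T\<close> turns a walk from 0 staying below \<open>r\<close>
  into a nonnegative walk from \<open>r\<close>.\<close>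

lemma survival_eq_pers_p: "survival n r = ennreal (pers_p n r)"
proof (cases n)
  case 0
  interpret prob_space "normals 0" by (rule prob_space_normals)
  show ?thesis using 0 prob_space by (simp add: survival_def pers_p_def)
next
  case (Suc k)
  interpret prob_space "normals n" by (rule prob_space_normals)
  let ?Q = "\<lambda>T::nat \<Rightarrow> real. \<forall>i\<in>{1..n}. T i \<le> r"
  have Qm: "Measurable.pred (PiM {1..n} (\<lambda>_. lborel)) ?Q" by measurable
  have "ennreal (pers_p n r) = emeasure (normals n) {x \<in> space (normals n). ?Q (\<lambda>k\<in>{1..n}. \<Sum>i=1..k. x i)}"
    by (simp add: pers_p_def emeasure_eq_measure)
  also have "\<dots> = (\<integral>\<^sup>+T. (\<Prod>i=1..n. walk_weight 0 (\<lambda>i. i) T i) * of_bool (?Q T) \<partial>PiM {1..n} (\<lambda>_. lborel))"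
    by (rule emeasure_normals_positions[OF Qm])
  also have "\<dots> = (\<integral>\<^sup>+U. (\<Prod>i=1..n. walk_weight 0 (\<lambda>i. i) (\<lambda>j\<in>{1..n}. r - 1 * U j) i) * of_bool (?Q (\<lambda>j\<in>{1..n}. r - 1 * U j)) \<partial>PiM {1..n} (\<lambda>_. lborel))"
    by (subst nn_integral_PiM_affine[where s=1 and c="\<lambda>_. r"])
       (auto intro!: borel_measurable_times_ennreal borel_measurable_prod_ennreal measurable_walk_weight measurable_compose[OF Qm])
  also have "\<dots> = (\<integral>\<^sup>+U. (\<Prod>i=1..Suc k. walk_weight r (\<lambda>i. i) U i) * 1 * of_bool (\<forall>i\<in>{1..Suc k}. U i \<ge> 0) \<partial>PiM {1..Suc k} (\<lambda>_. lborel))"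
    unfolding Suc
  proof (intro nn_integral_cong)
    fix U :: "nat \<Rightarrow> real"
    have "walk_weight 0 (\<lambda>i. i) (\<lambda>j\<in>{1..Suc k}. r - 1 * U j) i = walk_weight r (\<lambda>i. i) U i" if "i \<in> {1..Suc k}" for i
    proof (cases "i = 1")
      case True
      then show ?thesis using std_normal_density_minus[of "U 1 - r"] by (simp add: walk_weight_def)
    next
      case False
      then show ?thesis using that std_normal_density_minus[of "U i - U (i - 1)"] by (auto simp: walk_weight_def)
    qed
    then have "(\<Prod>i=1..Suc k. walk_weight 0 (\<lambda>i. i) (\<lambda>j\<in>{1..Suc k}. r - 1 * U j) i) = (\<Prod>i=1..Suc k. walk_weight r (\<lambda>i. i) U i)"
      by (intro prod.cong) auto
    then show "(\<Prod>i=1..Suc k. walk_weight 0 (\<lambda>i. i) (\<lambda>j\<in>{1..Suc k}. r - 1 * U j) i) * of_bool (\<forall>i\<in>{1..Suc k}. (\<lambda>j\<in>{1..Suc k}. r - 1 * U j) i \<le> r)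
      = (\<Prod>i=1..Suc k. walk_weight r (\<lambda>i. i) U i) * 1 * of_bool (\<forall>i\<in>{1..Suc k}. U i \<ge> 0)"
      by simp
  qed
  also have "\<dots> = survival n r"
    by (subst walk_kernel_path_integral) (simp_all add: survival_def Suc)
  finally show ?thesis by simp
qed

text \<open>The increments of \<open>T\<close> are \<open>c\<close> minus those of \<open>U\<close>.
  After expanding the squares, the cross term involves only the sum of the increments of
  \<open>U\<close>, which telescopes to \<open>- r\<close> because \<open>U\<close> runs from
  \<open>r\<close> to 0.\<close>

lemma bridge_product:
  fixes T U :: "nat \<Rightarrow> real" and c r :: real
  assumes "n \<ge> 1" "U n = 0" and T: "\<And>j. j \<in> {1..n} \<Longrightarrow> T j = r + real j * c - U j"
  shows "(\<Prod>i=1..n. std_normal_density (T i - (if i = 1 then 0 else T (i - 1))))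
    = exp (- (real n * c\<^sup>2 + 2 * c * r) / 2) * (\<Prod>i=1..n. std_normal_density (U i - (if i = 1 then r else U (i - 1))))"
proof -
  define \<delta> where "\<delta> i = U i - (if i = 1 then r else U (i - 1))" for i
  have d: "T i - (if i = 1 then 0 else T (i - 1)) = c - \<delta> i" if "i \<in> {1..n}" for i
  proof (cases "i = 1")
    case True
    then show ?thesis using T[OF that] by (simp add: \<delta>_def)
  next
    case False
    then have "i - 1 \<in> {1..n}" "real (i - 1) = real i - 1" using that by auto
    then show ?thesis using T[OF that] T[of "i - 1"] False by (simp add: \<delta>_def algebra_simps)
  qed
  have tele: "(\<Sum>i=1..k. \<delta> i) = U k - r" if "k \<ge> 1" for k
    using that by (induction k rule: nat_induct_at_least) (auto simp: \<delta>_def)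
  have "(\<Prod>i=1..n. std_normal_density (T i - (if i = 1 then 0 else T (i - 1)))) = (\<Prod>i=1..n. std_normal_density (c - \<delta> i))"
    using d by (intro prod.cong) auto
  also have "\<dots> = (\<Prod>i=1..n. exp (- (c\<^sup>2 - 2 * c * \<delta> i) / 2) * std_normal_density (\<delta> i))"
    by (intro prod.cong refl) (simp add: std_normal_density_def exp_add[symmetric] power2_eq_square algebra_simps add_divide_distrib diff_divide_distrib)
  also have "\<dots> = exp (\<Sum>i=1..n. - (c\<^sup>2 - 2 * c * \<delta> i) / 2) * (\<Prod>i=1..n. std_normal_density (\<delta> i))"
    by (simp add: prod.distrib exp_sum)
  also have "(\<Sum>i=1..n. - (c\<^sup>2 - 2 * c * \<delta> i) / 2) = - (real n * c\<^sup>2 - 2 * c * (\<Sum>i=1..n. \<delta> i)) / 2"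
    by (simp add: sum_divide_distrib[symmetric] sum_subtractf sum_distrib_left)
  also have "\<dots> = - (real n * c\<^sup>2 + 2 * c * r) / 2"
    using assms(1,2) tele[of n] by simp
  finally show ?thesis by (simp add: \<delta>_def)
qed

text \<open>For each terminal value \<open>t\<close> of the walk, removing the line from
  \<open>r\<close> to \<open>t\<close> and reflecting gives a nonnegative path from \<open>r\<close>
  to 0. The dependence on \<open>t\<close> is a separate Gaussian factor, whose integral is the
  constant.\<close>

lemma pers_q_eq_kernel:
  assumes "n \<ge> 1"
  shows "ennreal (pers_q n r) = ennreal (sqrt (2 * pi * real n) * exp (r\<^sup>2 / (2 * real n))) * walk_kernel n r 0"
proof -
  obtain k where k: "n = Suc k" using assms by (cases n) auto
  interpret prob_space "normals n" by (rule prob_space_normals)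
  interpret L: product_sigma_finite "\<lambda>_::nat. lborel :: real measure" by (rule product_sigma_finite_lborel)
  let ?L = "PiM {1..k} (\<lambda>_::nat. lborel :: real measure)"
  let ?Q = "\<lambda>T::nat \<Rightarrow> real. \<forall>j\<in>{1..n}. T j - real j / real n * T n + real j / real n * r \<le> r"
  let ?W = "\<lambda>r T. \<Prod>i=1..n. walk_weight r (\<lambda>i. i) T i"
  \<comment> \<open>The factor of \<open>bridge_product\<close> for the drift
    \<open>c = (t - r) / n\<close>, since
    \<open>n * c^2 + 2 * c * r = (t^2 - r^2) / n\<close>.\<close>
  define D where "D t = exp (- (t\<^sup>2 - r\<^sup>2) / (2 * real n))" for t
  have ins: "{1..n} = insert n {1..k}" "n \<notin> {1..k}" unfolding k by auto
  have Qm: "Measurable.pred (PiM {1..n} (\<lambda>_. lborel)) ?Q" by measurable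
  have Wm: "?W r \<in> borel_measurable (PiM I (\<lambda>_. lborel))" for r I
    by (intro borel_measurable_prod_ennreal measurable_walk_weight) simp
  have WQ: "(\<lambda>T. ?W 0 T * of_bool (?Q T)) \<in> borel_measurable (PiM {1..n} (\<lambda>_. lborel))"
    using Wm Qm by measurable
  have "ennreal (pers_q n r) = emeasure (normals n) {x \<in> space (normals n). ?Q (\<lambda>k\<in>{1..n}. \<Sum>i=1..k. x i)}"
    using assms by (simp add: pers_q_def emeasure_eq_measure)
  also have "\<dots> = (\<integral>\<^sup>+T. ?W 0 T * of_bool (?Q T) \<partial>PiM {1..n} (\<lambda>_. lborel))"
    by (rule emeasure_normals_positions[OF Qm])
  also have "\<dots> = (\<integral>\<^sup>+t. \<integral>\<^sup>+T. ?W 0 (T(n := t)) * of_bool (?Q (T(n := t))) \<partial>?L \<partial>lborel)"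
    using L.product_nn_integral_insert_rev[OF _ ins(2) WQ[unfolded ins(1)]] unfolding ins(1)[symmetric] by simp
  also have "\<dots> = (\<integral>\<^sup>+t. ennreal (D t) * walk_kernel n r 0 \<partial>lborel)"
  proof (intro nn_integral_cong)
    fix t
    \<comment> \<open>The drift for which the reflected path ends at 0 at time
      \<open>n\<close>.\<close>
    define c where "c = (t - r) / real n"
    let ?T = "\<lambda>U. \<lambda>j\<in>{1..k}. (r + real j * c) - 1 * U j"
    have "(\<integral>\<^sup>+T. ?W 0 (T(n := t)) * of_bool (?Q (T(n := t))) \<partial>?L)
       = (\<integral>\<^sup>+U. ?W 0 ((?T U)(n := t)) * of_bool (?Q ((?T U)(n := t))) \<partial>?L)"
    proof (subst nn_integral_PiM_affine[where s=1 and c="\<lambda>j. r + real j * c"])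
      show "(\<lambda>T. ?W 0 (T(n := t)) * of_bool (?Q (T(n := t)))) \<in> borel_measurable ?L"
        by (rule measurable_compose[OF measurable_fun_upd[where J="{1..k}"] WQ]) (auto simp: k)
    qed auto
    also have "\<dots> = (\<integral>\<^sup>+U. ennreal (D t) * (?W r (U(n := 0)) * of_bool (\<forall>i\<in>{1..k}. U i \<ge> 0)) \<partial>?L)"
    proof (intro nn_integral_cong)
      fix U :: "nat \<Rightarrow> real"
      define V where "V = U(n := 0)"
      define S where "S = (?T U)(n := t)"
      have T: "S j = r + real j * c - V j" if "j \<in> {1..n}" for j
        using that assms ins by (auto simp: c_def V_def S_def)
      have "(\<Prod>i=1..n. std_normal_density (S i - (if i = 1 then 0 else S (i - 1))))
        = exp (- (real n * c\<^sup>2 + 2 * c * r) / 2) * (\<Prod>i=1..n. std_normal_density (V i - (if i = 1 then r else V (i - 1))))"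
        by (rule bridge_product[OF assms _ T]) (auto simp: V_def)
      also have "exp (- (real n * c\<^sup>2 + 2 * c * r) / 2) = D t"
      proof -
        have "- (real n * c\<^sup>2 + 2 * c * r) / 2 = - (t\<^sup>2 - r\<^sup>2) / (2 * real n)"
          using assms by (simp add: c_def power2_eq_square field_simps)
        then show ?thesis by (simp only: D_def)
      qed
      finally have "?W 0 S = ennreal (D t) * ?W r V"
        unfolding walk_weight_def by (simp add: prod_ennreal prod_nonneg ennreal_mult'[symmetric] D_def)
      moreover have "?Q S \<longleftrightarrow> (\<forall>i\<in>{1..k}. U i \<ge> 0)"
      proof -
        have "S j - real j / real n * S n + real j / real n * r \<le> r \<longleftrightarrow> V j \<ge> 0" if "j \<in> {1..n}" for j
        proof -
          have "S n = t" by (simp add: S_def)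
          then have "S j - real j / real n * S n + real j / real n * r = r - V j"
            unfolding T[OF that] by (simp add: c_def diff_divide_distrib algebra_simps)
          then show ?thesis by simp
        qed
        then have "?Q S \<longleftrightarrow> (\<forall>j\<in>{1..n}. V j \<ge> 0)" by (intro ball_cong refl)
        also have "\<dots> \<longleftrightarrow> (\<forall>i\<in>{1..k}. U i \<ge> 0)" unfolding ins(1) V_def using ins(2) by auto
        finally show ?thesis .
      qed
      ultimately have "?W 0 S * of_bool (?Q S) = ennreal (D t) * (?W r V * of_bool (\<forall>i\<in>{1..k}. U i \<ge> 0))"
        by (simp only: mult.assoc)
      then show "?W 0 ((?T U)(n := t)) * of_bool (?Q ((?T U)(n := t)))
        = ennreal (D t) * (?W r (U(n := 0)) * of_bool (\<forall>i\<in>{1..k}. U i \<ge> 0))"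
        unfolding S_def V_def .
    qed
    also have "\<dots> = ennreal (D t) * (\<integral>\<^sup>+U. ?W r (U(n := 0)) * of_bool (\<forall>i\<in>{1..k}. U i \<ge> 0) \<partial>?L)"
    proof (rule nn_integral_cmult)
      have "(\<lambda>U. ?W r (U(n := 0))) \<in> borel_measurable ?L"
        by (rule measurable_compose[OF measurable_fun_upd[where J="{1..k}"] Wm]) (auto simp: ins)
      then show "(\<lambda>U. ?W r (U(n := 0)) * of_bool (\<forall>i\<in>{1..k}. U i \<ge> 0)) \<in> borel_measurable ?L" by measurable
    qed
    also have "(\<integral>\<^sup>+U. ?W r (U(n := 0)) * of_bool (\<forall>i\<in>{1..k}. U i \<ge> 0) \<partial>?L) = walk_kernel n r 0"
    \<comment> \<open>For \<open>n = 1\<close> there are no interior positions and the kernel is a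
      single step density.\<close>
    proof (cases k)
      case 0
      then show ?thesis
        by (simp add: k PiM_empty nn_integral_count_space_finite walk_kernel_1 walk_weight_def)
    next
      case (Suc k')
      have "(\<integral>\<^sup>+U. ?W r (U(n := 0)) * of_bool (\<forall>i\<in>{1..k}. U i \<ge> 0) \<partial>?L)
        = (\<integral>\<^sup>+U. (\<Prod>i=1..k. walk_weight r (\<lambda>i. i) U i) * ennreal (std_normal_density (0 - U k)) * of_bool (\<forall>i\<in>{1..k}. U i \<ge> 0) \<partial>?L)"
      proof (intro nn_integral_cong)
        fix U :: "nat \<Rightarrow> real"
        have "?W r (U(n := 0)) = walk_weight r (\<lambda>i. i) (U(n := 0)) n * (\<Prod>i=1..k. walk_weight r (\<lambda>i. i) (U(n := 0)) i)"
          unfolding k by (subst prod.nat_ivl_Suc') simp_all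
        also have "(\<Prod>i=1..k. walk_weight r (\<lambda>i. i) (U(n := 0)) i) = (\<Prod>i=1..k. walk_weight r (\<lambda>i. i) U i)"
          unfolding k by (intro prod.cong) (auto simp: walk_weight_def)
        also have "walk_weight r (\<lambda>i. i) (U(n := 0)) n = ennreal (std_normal_density (0 - U k))"
          unfolding k using Suc by (simp add: walk_weight_def)
        finally show "?W r (U(n := 0)) * of_bool (\<forall>i\<in>{1..k}. U i \<ge> 0)
          = (\<Prod>i=1..k. walk_weight r (\<lambda>i. i) U i) * ennreal (std_normal_density (0 - U k)) * of_bool (\<forall>i\<in>{1..k}. U i \<ge> 0)"
          by (simp only: mult_ac)
      qed
      also have "\<dots> = (\<integral>\<^sup>+v. walk_kernel k r v * ennreal (std_normal_density (0 - v)) \<partial>halfline)"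
        unfolding Suc by (rule walk_kernel_path_integral) measurable
      also have "\<dots> = walk_kernel n r 0" unfolding k using Suc by (simp add: walk_kernel_Suc)
      finally show ?thesis .
    qed
    finally show "(\<integral>\<^sup>+T. ?W 0 (T(n := t)) * of_bool (?Q (T(n := t))) \<partial>?L) = ennreal (D t) * walk_kernel n r 0" .
  qed
  also have "\<dots> = (\<integral>\<^sup>+t. ennreal (D t) \<partial>lborel) * walk_kernel n r 0"
    by (rule nn_integral_multc) (simp add: D_def)
  also have "(\<integral>\<^sup>+t. ennreal (D t) \<partial>lborel) = ennreal (sqrt (2 * pi * real n) * exp (r\<^sup>2 / (2 * real n)))"
  proof -
    have n0: "sqrt (real n) > 0" using assms by simp
    have "(\<integral>\<^sup>+t. ennreal (D t) \<partial>lborel)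
        = (\<integral>\<^sup>+t. ennreal (sqrt (2 * pi * real n) * exp (r\<^sup>2 / (2 * real n))) * ennreal (normal_density 0 (sqrt (real n)) t) \<partial>lborel)"
    proof (intro nn_integral_cong)
      fix t
      have "D t = sqrt (2 * pi * real n) * exp (r\<^sup>2 / (2 * real n)) * normal_density 0 (sqrt (real n)) t"
        using assms unfolding D_def normal_density_def
        by (simp add: exp_add[symmetric] diff_divide_distrib)
      then show "ennreal (D t) = ennreal (sqrt (2 * pi * real n) * exp (r\<^sup>2 / (2 * real n))) * ennreal (normal_density 0 (sqrt (real n)) t)"
        by (simp add: ennreal_mult'[symmetric])
    qed
    also have "\<dots> = ennreal (sqrt (2 * pi * real n) * exp (r\<^sup>2 / (2 * real n))) * (\<integral>\<^sup>+t. ennreal (normal_density 0 (sqrt (real n)) t) \<partial>lborel)"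
      by (rule nn_integral_cmult) measurable
    also have "(\<integral>\<^sup>+t. ennreal (normal_density 0 (sqrt (real n)) t) \<partial>lborel) = 1"
      using prob_space.emeasure_space_1[OF prob_space_normal_density[OF n0, of 0]] by (simp add: emeasure_density)
    finally show ?thesis by simp
  qed
  finally show ?thesis .
qed

text \<open>The unconstrained density of going from \<open>r\<close> to 0 in \<open>n\<close> steps,
  times the conditional probability of staying nonnegative.\<close>

lemma walk_kernel_to_zero:
  assumes "n \<ge> 1"
  shows "walk_kernel n r 0 = ennreal (exp (- r\<^sup>2 / (2 * real n)) / sqrt (2 * pi * real n) * pers_q n r)"
proof -
  define c where "c = sqrt (2 * pi * real n) * exp (r\<^sup>2 / (2 * real n))"
  have c: "c > 0" using assms by (simp add: c_def)
  have "exp (- r\<^sup>2 / (2 * real n)) / sqrt (2 * pi * real n) = 1 / c"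
    by (simp add: c_def exp_minus field_simps)
  then have "ennreal (exp (- r\<^sup>2 / (2 * real n)) / sqrt (2 * pi * real n) * pers_q n r) = ennreal (1 / c) * ennreal (pers_q n r)"
    using c by (simp add: ennreal_mult' del: times_divide_eq_left)
  also have "\<dots> = ennreal (1 / c) * ennreal c * walk_kernel n r 0"
    unfolding pers_q_eq_kernel[OF assms] c_def by (simp only: mult.assoc)
  also have "ennreal (1 / c) * ennreal c = 1" using c by (simp add: ennreal_mult'[symmetric])
  finally show ?thesis by simp
qed

section \<open>Persistence probabilities at level zero\<close>

text \<open>With all coordinates but \<open>i0\<close> fixed, equality would pin coordinate
  \<open>i0\<close> to a single value, which has measure 0.\<close>

lemma AE_PiM_linear_neq:
  fixes M :: "'i \<Rightarrow> real measure" and c :: "'i \<Rightarrow> real"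
  assumes psf: "product_sigma_finite M" and sets: "\<And>i. sets (M i) = sets borel" and I: "finite I"
    and i0: "i0 \<in> I" "c i0 \<noteq> 0" and atomless: "\<And>v. AE y in M i0. y \<noteq> v"
  shows "AE x in PiM I M. (\<Sum>i\<in>I. c i * x i) \<noteq> b"
proof -
  interpret product_sigma_finite M by (rule psf)
  obtain J where I_eq: "I = insert i0 J" and J: "i0 \<notin> J" "finite J"
    using i0(1) I by (metis finite_insert mk_disjoint_insert)
  have co [measurable]: "(\<lambda>x. x j) \<in> borel_measurable (PiM I M)" for j
    by (rule measurable_PiM_coordinate) (rule sets)
  have m: "(\<lambda>x. of_bool ((\<Sum>i\<in>I. c i * x i) = b) :: ennreal) \<in> borel_measurable (PiM I M)"
    by measurable
  have "(\<integral>\<^sup>+x. of_bool ((\<Sum>i\<in>I. c i * x i) = b) \<partial>PiM I M)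
      = (\<integral>\<^sup>+x. \<integral>\<^sup>+y. of_bool ((\<Sum>i\<in>I. c i * (x(i0 := y)) i) = b) \<partial>M i0 \<partial>PiM J M)"
    using product_nn_integral_insert[OF J(2,1) m[unfolded I_eq]] unfolding I_eq .
  also have "\<dots> = (\<integral>\<^sup>+x. 0 \<partial>PiM J M)"
  proof (intro nn_integral_cong)
    fix x
    define s where "s = (\<Sum>i\<in>J. c i * x i)"
    have "(\<Sum>i\<in>I. c i * (x(i0 := y)) i) = c i0 * y + s" for y
    proof -
      have "(\<Sum>i\<in>J. c i * (x(i0 := y)) i) = s" unfolding s_def using J by (intro sum.cong) auto
      then show ?thesis unfolding I_eq using J by simp
    qed
    then have "AE y in M i0. (of_bool ((\<Sum>i\<in>I. c i * (x(i0 := y)) i) = b) :: ennreal) = 0"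
      using atomless[of "(b - s) / c i0"] i0(2) by (auto elim!: eventually_mono simp: field_simps)
    then have "(\<integral>\<^sup>+y. of_bool ((\<Sum>i\<in>I. c i * (x(i0 := y)) i) = b) \<partial>M i0) = (\<integral>\<^sup>+y. 0 \<partial>M i0)"
      by (rule nn_integral_cong_AE)
    then show "(\<integral>\<^sup>+y. of_bool ((\<Sum>i\<in>I. c i * (x(i0 := y)) i) = b) \<partial>M i0) = (0::ennreal)" by simp
  qed
  finally have "AE x in PiM I M. (of_bool ((\<Sum>i\<in>I. c i * x i) = b) :: ennreal) = 0"
    using nn_integral_0_iff_AE[OF m] by simp
  then show ?thesis by (auto elim!: eventually_mono)
qed

lemma AE_std_normal_neq: "AE y in std_normal_distribution. y \<noteq> v"
  by (subst AE_density) (use AE_lborel_singleton[of v] in \<open>auto elim!: eventually_mono\<close>)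

lemma AE_normals_linear_neq:
  assumes "i0 \<in> {1..n}" "c i0 \<noteq> 0"
  shows "AE x in normals n. (\<Sum>i=1..n. c i * x i) \<noteq> b"
  unfolding normals_def
  by (rule AE_PiM_linear_neq[where ?i0.0=i0])
     (use assms in \<open>auto intro: product_sigma_finite_std_normal AE_std_normal_neq\<close>)

section \<open>Cyclic shifts and the value of \<open>q\<close> at 0\<close>

lemma sum_of_bool_argmax:
  fixes f :: "'j \<Rightarrow> real"
  assumes "finite J" "J \<noteq> {}" "inj_on f J"
  shows "(\<Sum>j\<in>J. of_bool (\<forall>m\<in>J. f m \<le> f j) :: ennreal) = 1"
proof -
  have "Max (f ` J) \<in> f ` J" using assms by (intro Max_in) auto
  then obtain j0 where j0: "j0 \<in> J" "f j0 = Max (f ` J)" by (metis imageE)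
  have max: "f m \<le> f j0" if "m \<in> J" for m using that assms j0 by auto
  have "(\<forall>m\<in>J. f m \<le> f j) \<longleftrightarrow> j = j0" if "j \<in> J" for j
  proof
    assume "\<forall>m\<in>J. f m \<le> f j"
    then have "f j = f j0" using max[OF that] j0(1) by (intro antisym) auto
    then show "j = j0" using assms(3) that j0(1) by (auto dest: inj_onD)
  qed (use max in auto)
  then have "(\<Sum>j\<in>J. of_bool (\<forall>m\<in>J. f m \<le> f j) :: ennreal) = (\<Sum>j\<in>J. if j = j0 then 1 else 0)"
    by (intro sum.cong) auto
  then show ?thesis using assms(1) j0(1) by simp
qed

definition rotate_index :: "nat \<Rightarrow> nat \<Rightarrow> nat \<Rightarrow> nat" where
  "rotate_index n j i = (i - 1 + j) mod n + 1"

lemma rotate_index_range: "n \<ge> 1 \<Longrightarrow> rotate_index n j i \<in> {1..n}"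
  by (auto simp: rotate_index_def Suc_le_eq)

lemma inj_rotate_index: "inj_on (rotate_index n j) {1..n}"
proof (rule inj_onI)
  fix a b assume ab: "a \<in> {1..n}" "b \<in> {1..n}" and "rotate_index n j a = rotate_index n j b"
  then have eq: "(a - 1 + j) mod n = (b - 1 + j) mod n" by (simp add: rotate_index_def)
  have aux: "p = q" if "p \<le> q" "q < n" "(q + j) mod n = (p + j) mod n" for p q
  proof -
    have "n dvd (q + j) - (p + j)" using that by (subst mod_eq_dvd_iff_nat[symmetric]) auto
    then show ?thesis using that by (auto dest: dvd_imp_le)
  qed
  have "a - 1 < n" "b - 1 < n" using ab by auto
  then have "a - 1 = b - 1" using aux[of "a - 1" "b - 1"] aux[of "b - 1" "a - 1"] eq by (metis nat_le_linear)
  then show "a = b" using ab by auto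
qed

lemma sum_rotate_index:
  fixes x :: "nat \<Rightarrow> real"
  assumes "j < n" "k \<le> n"
  shows "(\<Sum>i=1..k. x (rotate_index n j i)) = (if j + k \<le> n then (\<Sum>i=1..j+k. x i) - (\<Sum>i=1..j. x i)
      else (\<Sum>i=1..n. x i) - (\<Sum>i=1..j. x i) + (\<Sum>i=1..j+k-n. x i))"
  using assms(2)
proof (induction k)
  case 0
  then show ?case using assms(1) by simp
next
  case (Suc k)
  have IH: "(\<Sum>i=1..k. x (rotate_index n j i)) = (if j + k \<le> n then (\<Sum>i=1..j+k. x i) - (\<Sum>i=1..j. x i)
      else (\<Sum>i=1..n. x i) - (\<Sum>i=1..j. x i) + (\<Sum>i=1..j+k-n. x i))"
    using Suc by simp
  consider "j + k < n" | "j + k = n" | "j + k > n" by linarith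
  then show ?case
  proof cases
    case 1
    then have "rotate_index n j (Suc k) = Suc (j + k)" by (simp add: rotate_index_def add.commute)
    then show ?thesis using 1 IH by simp
  next
    case 2
    then have "rotate_index n j (Suc k) = 1" by (simp add: rotate_index_def add.commute)
    then show ?thesis using 2 IH by simp
  next
    case 3
    then have "(k + j) mod n = k + j - n" using Suc.prems assms(1) by (simp add: le_mod_geq)
    then have "rotate_index n j (Suc k) = Suc (j + k - n)" by (simp add: rotate_index_def add.commute)
    moreover have "j + Suc k - n = Suc (j + k - n)" using 3 by simp
    ultimately show ?thesis using 3 IH by simp
  qed
qed

definition bridge :: "nat \<Rightarrow> (nat \<Rightarrow> real) \<Rightarrow> nat \<Rightarrow> real" where
  "bridge n x k = (\<Sum>i=1..k. x i) - real k / real n * (\<Sum>i=1..n. x i)"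

text \<open>The total of the steps is invariant under the shift, so the linear correction is too;
  the shifted bridge is the old one, continued periodically, read from time \<open>j\<close> on and
  relative to its value there.\<close>

lemma bridge_rotate:
  assumes j: "j < n" and k: "k \<in> {1..n}"
  shows "bridge n (\<lambda>i. x (rotate_index n j i)) k = bridge n x ((j + k) mod n) - bridge n x j"
proof -
  have n: "n > 0" using j by simp
  have tot: "(\<Sum>i=1..n. x (rotate_index n j i)) = (\<Sum>i=1..n. x i)"
    using sum_rotate_index[OF j, of n x] j by simp
  consider "j + k < n" | "j + k = n" | "j + k > n" by linarith
  then show ?thesis
  proof cases
    case 1
    then show ?thesis using sum_rotate_index[OF j, of k x] k n tot
      by (simp add: bridge_def add_divide_distrib algebra_simps)
  next
    case 2
    then have "real k = real n - real j" by simp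
    then have "real k / real n = 1 - real j / real n" using n by (simp add: diff_divide_distrib)
    then show ?thesis using sum_rotate_index[OF j, of k x] 2 k n tot
      by (simp add: bridge_def left_diff_distrib del: times_divide_eq_left)
  next
    case 3
    then have "(j + k) mod n = j + k - n" "real (j + k - n) = real j + real k - real n"
      using j k by (auto simp: le_mod_geq of_nat_diff)
    then show ?thesis using sum_rotate_index[OF j, of k x] 3 k n tot
      by (simp add: bridge_def add_divide_distrib diff_divide_distrib algebra_simps)
  qed
qed

text \<open>The shift by \<open>j\<close> yields a nonpositive bridge exactly when \<open>j\<close>
  is a time of maximum. Times run below \<open>n\<close> because the bridge takes the same value 0
  at times 0 and \<open>n\<close>.\<close>

lemma bridge_rotate_nonpos_iff:
  assumes j: "j < n"
  shows "(\<forall>k\<in>{1..n}. bridge n (\<lambda>i. x (rotate_index n j i)) k \<le> 0) \<longleftrightarrow> (\<forall>m\<in>{..<n}. bridge n x m \<le> bridge n x j)"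
proof
  assume *: "\<forall>k\<in>{1..n}. bridge n (\<lambda>i. x (rotate_index n j i)) k \<le> 0"
  show "\<forall>m\<in>{..<n}. bridge n x m \<le> bridge n x j"
  proof
    fix m assume m: "m \<in> {..<n}"
    \<comment> \<open>The shift in \<open>{1..n}\<close> that leads from \<open>j\<close> to
      \<open>m\<close> modulo \<open>n\<close>; \<open>m = j\<close> is reached after a full turn
      \<open>k = n\<close>.\<close>
    define k where "k = (if m > j then m - j else m + n - j)"
    have k: "k \<in> {1..n}" using m j by (auto simp: k_def)
    have "(j + k) mod n = m"
    proof (cases "m > j")
      case False
      then have "j + k = m + n" using j by (simp add: k_def)
      then show ?thesis using m by simp
    qed (use m in \<open>simp add: k_def\<close>)
    then show "bridge n x m \<le> bridge n x j" using *[rule_format, OF k] bridge_rotate[OF j k, of x] by simp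
  qed
next
  assume *: "\<forall>m\<in>{..<n}. bridge n x m \<le> bridge n x j"
  show "\<forall>k\<in>{1..n}. bridge n (\<lambda>i. x (rotate_index n j i)) k \<le> 0"
  proof
    fix k assume k: "k \<in> {1..n}"
    have "(j + k) mod n < n" using j by simp
    then show "bridge n (\<lambda>i. x (rotate_index n j i)) k \<le> 0" using * by (simp add: bridge_rotate[OF j k])
  qed
qed

lemma nn_integral_normals_reindex:
  assumes f: "inj_on f {1..k}" "f \<in> {1..k} \<rightarrow> K"
    and g: "g \<in> borel_measurable (PiM {1..k} (\<lambda>_. std_normal_distribution))"
  shows "(\<integral>\<^sup>+x. g (\<lambda>i\<in>{1..k}. x (f i)) \<partial>PiM K (\<lambda>_. std_normal_distribution)) = (\<integral>\<^sup>+x. g x \<partial>normals k)"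
proof -
  have "normals k = distr (PiM K (\<lambda>_. std_normal_distribution)) (PiM {1..k} (\<lambda>_. std_normal_distribution)) (\<lambda>\<omega>. \<lambda>n\<in>{1..k}. \<omega> (f n))"
    unfolding normals_def
    using distr_PiM_reindex[of K "\<lambda>_. std_normal_distribution" f "{1..k}"] f prob_space_std_normal by simp
  then have "(\<integral>\<^sup>+x. g x \<partial>normals k) = (\<integral>\<^sup>+x. g x \<partial>distr (PiM K (\<lambda>_. std_normal_distribution)) (PiM {1..k} (\<lambda>_. std_normal_distribution)) (\<lambda>\<omega>. \<lambda>n\<in>{1..k}. \<omega> (f n)))"
    by simp
  also have "\<dots> = (\<integral>\<^sup>+x. g (\<lambda>i\<in>{1..k}. x (f i)) \<partial>PiM K (\<lambda>_. std_normal_distribution))"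
    by (intro nn_integral_distr measurable_restrict measurable_component_singleton)
       (use f g in \<open>auto simp del: One_nat_def\<close>)
  finally show ?thesis by simp
qed

text \<open>Cyclic shifts of the steps preserve the law, and almost surely exactly one shift
  places the maximum of the bridge at the origin.\<close>

lemma pers_q_0:
  assumes n: "n \<ge> 1"
  shows "pers_q n 0 = 1 / real n"
proof -
  interpret prob_space "normals n" by (rule prob_space_normals)
  let ?ev = "\<lambda>x. \<forall>k\<in>{1..n}. bridge n x k \<le> 0"
  have bm: "(\<lambda>x. bridge n x k) \<in> borel_measurable (normals n)" for k
    unfolding bridge_def by measurable
  note bm' = bm[unfolded normals_def]
  have evm: "(\<lambda>x. of_bool (?ev x) :: ennreal) \<in> borel_measurable (normals n)"
    using bm by measurable
  have q: "ennreal (pers_q n 0) = (\<integral>\<^sup>+x. of_bool (?ev x) \<partial>normals n)"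
  proof -
    have m: "{x \<in> space (normals n). ?ev x} \<in> sets (normals n)" using bm by measurable
    have "ennreal (pers_q n 0) = emeasure (normals n) {x \<in> space (normals n). ?ev x}"
      by (simp add: pers_q_def bridge_def emeasure_eq_measure)
    also have "\<dots> = (\<integral>\<^sup>+x. of_bool (?ev x) \<partial>normals n)"
      unfolding nn_integral_indicator[OF m, symmetric] by (intro nn_integral_cong) (simp add: indicator_def)
    finally show ?thesis .
  qed
  have rot: "(\<integral>\<^sup>+x. of_bool (\<forall>m\<in>{..<n}. bridge n x m \<le> bridge n x j) \<partial>normals n) = ennreal (pers_q n 0)" if j: "j < n" for j
  proof -
    have "bridge n (\<lambda>i\<in>{1..n}. x (rotate_index n j i)) k = bridge n (\<lambda>i. x (rotate_index n j i)) k" if "k \<in> {1..n}" for x k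
      using that unfolding bridge_def by (intro arg_cong2[where f="(-)"] arg_cong2[where f="(*)"] refl sum.cong) auto
    then have "?ev (\<lambda>i\<in>{1..n}. x (rotate_index n j i)) \<longleftrightarrow> (\<forall>m\<in>{..<n}. bridge n x m \<le> bridge n x j)" for x
      unfolding bridge_rotate_nonpos_iff[OF j, symmetric] by (intro ball_cong) auto
    then have "(\<integral>\<^sup>+x. of_bool (\<forall>m\<in>{..<n}. bridge n x m \<le> bridge n x j) \<partial>normals n)
      = (\<integral>\<^sup>+x. of_bool (?ev (\<lambda>i\<in>{1..n}. x (rotate_index n j i))) \<partial>PiM {1..n} (\<lambda>_. std_normal_distribution))"
      by (simp only: normals_def)
    also have "\<dots> = (\<integral>\<^sup>+x. of_bool (?ev x) \<partial>normals n)"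
      by (rule nn_integral_normals_reindex[OF inj_rotate_index])
         (use rotate_index_range[OF n] evm in \<open>auto simp: normals_def\<close>)
    finally show ?thesis by (simp only: q)
  qed
  have dist: "AE x in normals n. inj_on (bridge n x) {..<n}"
  proof -
    have "AE x in normals n. bridge n x a \<noteq> bridge n x b" if ab: "a < b" "b < n" for a b
    proof -
      \<comment> \<open>Coefficients of the linear form \<open>bridge n x a - bridge n x b\<close>.
        At step \<open>n\<close> both indicators vanish, so the coefficient is
        \<open>(b - a) / n\<close>, which is not 0.\<close>
      let ?c = "\<lambda>i. of_bool (i \<le> a) - real a / real n - (of_bool (i \<le> b) - real b / real n)"
      have "?c n \<noteq> 0" using ab by (simp add: field_simps)
      then have "AE x in normals n. (\<Sum>i=1..n. ?c i * x i) \<noteq> 0"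
        using n by (intro AE_normals_linear_neq[of n]) auto
      moreover have "(\<Sum>i=1..n. ?c i * x i) = bridge n x a - bridge n x b" for x
      proof -
        have s: "(\<Sum>i=1..n. of_bool (i \<le> l) * x i) = (\<Sum>i=1..l. x i)" if "l < n" for l
        proof -
          have "(\<Sum>i=1..l. x i) = (\<Sum>i=1..l. of_bool (i \<le> l) * x i)" by (intro sum.cong) auto
          also have "\<dots> = (\<Sum>i=1..n. of_bool (i \<le> l) * x i)"
            using that by (intro sum.mono_neutral_left) auto
          finally show ?thesis by simp
        qed
        have "(\<Sum>i=1..n. ?c i * x i) = (\<Sum>i=1..n. of_bool (i \<le> a) * x i) - real a / real n * (\<Sum>i=1..n. x i)
           - ((\<Sum>i=1..n. of_bool (i \<le> b) * x i) - real b / real n * (\<Sum>i=1..n. x i))"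
          unfolding sum_distrib_left sum_subtractf[symmetric] by (intro sum.cong refl) (simp add: algebra_simps)
        also have "\<dots> = bridge n x a - bridge n x b"
          using ab by (simp only: s bridge_def less_trans[OF ab])
        finally show ?thesis .
      qed
      ultimately show ?thesis by (auto elim!: eventually_mono)
    qed
    then have "AE x in normals n. \<forall>a\<in>{..<n}. \<forall>b\<in>{..<n}. a < b \<longrightarrow> bridge n x a \<noteq> bridge n x b"
      by (intro AE_finite_allI) auto
    then show ?thesis
      by (elim eventually_mono) (rule linorder_inj_onI, auto)
  qed
  have "of_nat n * ennreal (pers_q n 0) = (\<Sum>j\<in>{..<n}. \<integral>\<^sup>+x. of_bool (\<forall>m\<in>{..<n}. bridge n x m \<le> bridge n x j) \<partial>normals n)"
    by (simp add: rot)
  also have "\<dots> = (\<integral>\<^sup>+x. (\<Sum>j\<in>{..<n}. of_bool (\<forall>m\<in>{..<n}. bridge n x m \<le> bridge n x j)) \<partial>normals n)"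
  proof (intro nn_integral_sum[symmetric])
    show "(\<lambda>x. of_bool (\<forall>m\<in>{..<n}. bridge n x m \<le> bridge n x j) :: ennreal) \<in> borel_measurable (normals n)" for j
      unfolding le_iff_diff_le_0[of "bridge n x m" "bridge n x j" for x m] using bm by measurable
  qed
  also have "\<dots> = (\<integral>\<^sup>+x. 1 \<partial>normals n)"
    by (intro nn_integral_cong_AE eventually_mono[OF dist] sum_of_bool_argmax) (use n in \<open>auto simp: lessThan_empty_iff\<close>)
  also have "\<dots> = 1" by (simp add: emeasure_space_1)
  finally have "ennreal (real n * pers_q n 0) = ennreal 1"
    by (simp add: ennreal_mult' ennreal_of_nat_eq_real_of_nat)
  then have "real n * pers_q n 0 = 1"
    by (subst (asm) ennreal_inj) (auto simp: pers_q_def)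
  then show ?thesis using n by (simp add: field_simps)
qed

section \<open>The maximum of the walk and the value of \<open>p\<close> at 0\<close>

lemma nn_integral_normals_neg:
  assumes "g \<in> borel_measurable (PiM {1..k} (\<lambda>_. std_normal_distribution))"
  shows "(\<integral>\<^sup>+x. g (\<lambda>i\<in>{1..k}. - x i) \<partial>normals k) = (\<integral>\<^sup>+x. g x \<partial>normals k)"
proof -
  have "(\<integral>\<^sup>+x. g x \<partial>PiM {1..k} (\<lambda>_. std_normal_distribution))
     = (\<integral>\<^sup>+x. (\<Prod>i\<in>{1..k}. 1) * g (\<lambda>i\<in>{1..k}. - x i) \<partial>PiM {1..k} (\<lambda>_. std_normal_distribution))"
  proof (rule nn_integral_PiM_transfer[OF product_sigma_finite_std_normal product_sigma_finite_std_normal])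
    fix f :: "real \<Rightarrow> ennreal" assume "f \<in> borel_measurable std_normal_distribution"
    then have [measurable]: "f \<in> borel_measurable borel" by simp
    have "(\<integral>\<^sup>+x. f x \<partial>std_normal_distribution) = (\<integral>\<^sup>+x. ennreal (std_normal_density x) * f x \<partial>lborel)"
      by (rule nn_integral_std_normal) measurable
    also have "\<dots> = (\<integral>\<^sup>+x. ennreal (std_normal_density x) * f (- x) \<partial>lborel)"
      by (subst nn_integral_real_affine[where c="-1" and t=0]) auto
    also have "\<dots> = (\<integral>\<^sup>+x. 1 * f (- x) \<partial>std_normal_distribution)"
      by (subst nn_integral_std_normal) auto
    finally show "(\<integral>\<^sup>+x. f x \<partial>std_normal_distribution) = (\<integral>\<^sup>+x. 1 * f (- x) \<partial>std_normal_distribution)" .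
  qed (use assms in \<open>auto simp del: One_nat_def\<close>)
  then show ?thesis by (simp add: normals_def)
qed

lemma pers_p_0_nn_integral:
  "ennreal (pers_p k 0) = (\<integral>\<^sup>+x. of_bool (\<forall>l\<in>{1..k}. (\<Sum>i=1..l. x i) \<le> 0) \<partial>normals k)"
proof -
  interpret prob_space "normals k" by (rule prob_space_normals)
  have m: "{x \<in> space (normals k). \<forall>l\<in>{1..k}. (\<Sum>i=1..l. x i) \<le> 0} \<in> sets (normals k)" by measurable
  have "ennreal (pers_p k 0) = emeasure (normals k) {x \<in> space (normals k). \<forall>l\<in>{1..k}. (\<Sum>i=1..l. x i) \<le> 0}"
    by (simp add: pers_p_def emeasure_eq_measure)
  also have "\<dots> = (\<integral>\<^sup>+x. of_bool (\<forall>l\<in>{1..k}. (\<Sum>i=1..l. x i) \<le> 0) \<partial>normals k)"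
    unfolding nn_integral_indicator[OF m, symmetric] by (intro nn_integral_cong) (simp add: indicator_def)
  finally show ?thesis .
qed

text \<open>The part of a walk before its maximum, read backwards: changing the sign of the steps
  and reversing their order both preserve the law.\<close>

lemma pers_p_0_reversed:
  "(\<integral>\<^sup>+x. of_bool (\<forall>j\<in>{..<k}. (\<Sum>i=Suc j..k. x i) \<ge> 0) \<partial>PiM {1..k} (\<lambda>_. std_normal_distribution)) = ennreal (pers_p k 0)"
proof -
  let ?N = "PiM {1..k} (\<lambda>_::nat. std_normal_distribution)"
  have co [measurable]: "(\<lambda>x. x j) \<in> borel_measurable ?N" for j by (rule measurable_PiM_coordinate) simp
  have "ennreal (pers_p k 0) = (\<integral>\<^sup>+x. of_bool (\<forall>l\<in>{1..k}. (\<Sum>i=1..l. (\<lambda>i\<in>{1..k}. - x i) i) \<le> 0) \<partial>normals k)"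
    unfolding pers_p_0_nn_integral by (rule nn_integral_normals_neg[symmetric]) measurable
  also have "\<dots> = (\<integral>\<^sup>+x. of_bool (\<forall>l\<in>{1..k}. (\<Sum>i=1..l. x i) \<ge> 0) \<partial>normals k)"
  proof (intro nn_integral_cong arg_cong[where f=of_bool] ball_cong refl)
    fix x :: "nat \<Rightarrow> real" and l assume "l \<in> {1..k}"
    then have "(\<Sum>i=1..l. (\<lambda>i\<in>{1..k}. - x i) i) = (\<Sum>i=1..l. - x i)" by (intro sum.cong) auto
    then show "((\<Sum>i=1..l. (\<lambda>i\<in>{1..k}. - x i) i) \<le> 0) = (0 \<le> (\<Sum>i=1..l. x i))" by (simp add: sum_negf)
  qed
  also have "\<dots> = (\<integral>\<^sup>+x. of_bool (\<forall>l\<in>{1..k}. (\<Sum>i=1..l. (\<lambda>i\<in>{1..k}. x (Suc k - i)) i) \<ge> 0) \<partial>?N)"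
  proof (rule nn_integral_normals_reindex[symmetric])
    show "(\<lambda>x. of_bool (\<forall>l\<in>{1..k}. (\<Sum>i=1..l. x i) \<ge> 0) :: ennreal) \<in> borel_measurable ?N" by measurable
  qed (auto simp: inj_on_def)
  also have "\<dots> = (\<integral>\<^sup>+x. of_bool (\<forall>j\<in>{..<k}. (\<Sum>i=Suc j..k. x i) \<ge> 0) \<partial>?N)"
  proof (intro nn_integral_cong arg_cong[where f=of_bool])
    fix x :: "nat \<Rightarrow> real"
    have eq: "(\<Sum>i=1..l. (\<lambda>i\<in>{1..k}. x (Suc k - i)) i) = (\<Sum>i=Suc (k - l)..k. x i)" if "l \<in> {1..k}" for l
      by (rule sum.reindex_bij_witness[where i="\<lambda>i. Suc k - i" and j="\<lambda>i. Suc k - i"]) (use that in auto)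
    show "(\<forall>l\<in>{1..k}. (\<Sum>i=1..l. (\<lambda>i\<in>{1..k}. x (Suc k - i)) i) \<ge> 0) \<longleftrightarrow> (\<forall>j\<in>{..<k}. (\<Sum>i=Suc j..k. x i) \<ge> 0)"
    proof
      assume *: "\<forall>l\<in>{1..k}. (\<Sum>i=1..l. (\<lambda>i\<in>{1..k}. x (Suc k - i)) i) \<ge> 0"
      show "\<forall>j\<in>{..<k}. (\<Sum>i=Suc j..k. x i) \<ge> 0"
      proof
        fix j assume "j \<in> {..<k}"
        then have "k - j \<in> {1..k}" "k - (k - j) = j" by auto
        then show "(\<Sum>i=Suc j..k. x i) \<ge> 0" using *[rule_format, of "k - j"] eq[of "k - j"] by (simp only:)
      qed
    next
      assume *: "\<forall>j\<in>{..<k}. (\<Sum>i=Suc j..k. x i) \<ge> 0"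
      show "\<forall>l\<in>{1..k}. (\<Sum>i=1..l. (\<lambda>i\<in>{1..k}. x (Suc k - i)) i) \<ge> 0"
      proof
        fix l assume l: "l \<in> {1..k}"
        then have "k - l \<in> {..<k}" by auto
        then show "(\<Sum>i=1..l. (\<lambda>i\<in>{1..k}. x (Suc k - i)) i) \<ge> 0" using * unfolding eq[OF l] by blast
      qed
    qed
  qed
  finally show ?thesis by simp
qed

text \<open>The part of a walk after its maximum is a fresh walk, up to renumbering its
  steps.\<close>

lemma pers_p_0_shifted:
  assumes "k \<le> n"
  shows "(\<integral>\<^sup>+x. of_bool (\<forall>j\<in>{Suc k..n}. (\<Sum>i=Suc k..j. x i) \<le> 0) \<partial>PiM {Suc k..n} (\<lambda>_. std_normal_distribution)) = ennreal (pers_p (n - k) 0)"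
proof -
  let ?N = "PiM {Suc k..n} (\<lambda>_::nat. std_normal_distribution)"
  have co [measurable]: "(\<lambda>x. x j) \<in> borel_measurable (PiM {1..n - k} (\<lambda>_::nat. std_normal_distribution))" for j by (rule measurable_PiM_coordinate) simp
  have "ennreal (pers_p (n - k) 0) = (\<integral>\<^sup>+x. of_bool (\<forall>l\<in>{1..n - k}. (\<Sum>i=1..l. (\<lambda>i\<in>{1..n - k}. x (i + k)) i) \<le> 0) \<partial>?N)"
    unfolding pers_p_0_nn_integral
  proof (rule nn_integral_normals_reindex[symmetric])
    show "(\<lambda>x. of_bool (\<forall>l\<in>{1..n - k}. (\<Sum>i=1..l. x i) \<le> 0) :: ennreal) \<in> borel_measurable (PiM {1..n - k} (\<lambda>_. std_normal_distribution))" by measurable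
  qed (auto simp: inj_on_def)
  also have "\<dots> = (\<integral>\<^sup>+x. of_bool (\<forall>j\<in>{Suc k..n}. (\<Sum>i=Suc k..j. x i) \<le> 0) \<partial>?N)"
  proof (intro nn_integral_cong arg_cong[where f=of_bool])
    fix x :: "nat \<Rightarrow> real"
    have eq: "(\<Sum>i=1..l. (\<lambda>i\<in>{1..n - k}. x (i + k)) i) = (\<Sum>i=Suc k..l + k. x i)" if "l \<in> {1..n - k}" for l
      by (rule sum.reindex_bij_witness[where i="\<lambda>i. i - k" and j="\<lambda>i. i + k"]) (use that in auto)
    show "(\<forall>l\<in>{1..n - k}. (\<Sum>i=1..l. (\<lambda>i\<in>{1..n - k}. x (i + k)) i) \<le> 0) \<longleftrightarrow> (\<forall>j\<in>{Suc k..n}. (\<Sum>i=Suc k..j. x i) \<le> 0)"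
    proof
      assume *: "\<forall>l\<in>{1..n - k}. (\<Sum>i=1..l. (\<lambda>i\<in>{1..n - k}. x (i + k)) i) \<le> 0"
      show "\<forall>j\<in>{Suc k..n}. (\<Sum>i=Suc k..j. x i) \<le> 0"
      proof
        fix j assume "j \<in> {Suc k..n}"
        then have "j - k \<in> {1..n - k}" "j - k + k = j" by auto
        then show "(\<Sum>i=Suc k..j. x i) \<le> 0" using *[rule_format, of "j - k"] eq[of "j - k"] by (simp only:)
      qed
    next
      assume *: "\<forall>j\<in>{Suc k..n}. (\<Sum>i=Suc k..j. x i) \<le> 0"
      show "\<forall>l\<in>{1..n - k}. (\<Sum>i=1..l. (\<lambda>i\<in>{1..n - k}. x (i + k)) i) \<le> 0"
      proof
        fix l assume l: "l \<in> {1..n - k}"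
        then have "l + k \<in> {Suc k..n}" by auto
        then show "(\<Sum>i=1..l. (\<lambda>i\<in>{1..n - k}. x (i + k)) i) \<le> 0" using * unfolding eq[OF l] by blast
      qed
    qed
  qed
  finally show ?thesis by simp
qed

text \<open>Decomposing the walk at the time of its maximum.\<close>

lemma pers_p_0_convolution: "(\<Sum>k\<le>n. pers_p k 0 * pers_p (n - k) 0) = 1"
proof -
  interpret prob_space "normals n" by (rule prob_space_normals)
  interpret N: product_sigma_finite "\<lambda>_::nat. std_normal_distribution" by (rule product_sigma_finite_std_normal)
  let ?S = "\<lambda>x j. \<Sum>i=1..j. x i :: real"
  let ?N = "\<lambda>I. PiM I (\<lambda>_::nat. std_normal_distribution)"
  have co [measurable]: "(\<lambda>x. x j) \<in> borel_measurable (?N I)" for j I by (rule measurable_PiM_coordinate) simp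
  have dist: "AE x in normals n. inj_on (?S x) {..n}"
  proof -
    have "AE x in normals n. ?S x a \<noteq> ?S x b" if ab: "a < b" "b \<le> n" for a b
    proof -
      let ?c = "\<lambda>i. of_bool (i \<le> b) - of_bool (i \<le> a) :: real"
      have "AE x in normals n. (\<Sum>i=1..n. ?c i * x i) \<noteq> 0"
        using ab by (intro AE_normals_linear_neq[of b]) auto
      moreover have "(\<Sum>i=1..n. ?c i * x i) = ?S x b - ?S x a" for x
      proof -
        have s: "(\<Sum>i=1..n. of_bool (i \<le> l) * x i) = (\<Sum>i=1..l. x i)" if "l \<le> n" for l
        proof -
          have "(\<Sum>i=1..l. x i) = (\<Sum>i=1..l. of_bool (i \<le> l) * x i)" by (intro sum.cong) auto
          also have "\<dots> = (\<Sum>i=1..n. of_bool (i \<le> l) * x i)"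
            using that by (intro sum.mono_neutral_left) auto
          finally show ?thesis by simp
        qed
        have "(\<Sum>i=1..n. ?c i * x i) = (\<Sum>i=1..n. of_bool (i \<le> b) * x i) - (\<Sum>i=1..n. of_bool (i \<le> a) * x i)"
          unfolding sum_subtractf[symmetric] by (intro sum.cong refl) (simp add: algebra_simps)
        then show ?thesis using ab by (simp only: s less_imp_le[OF less_le_trans[OF ab]])
      qed
      ultimately show ?thesis by (auto elim!: eventually_mono)
    qed
    then have "AE x in normals n. \<forall>a\<in>{..n}. \<forall>b\<in>{..n}. a < b \<longrightarrow> ?S x a \<noteq> ?S x b"
      by (intro AE_finite_allI) auto
    then show ?thesis
      by (elim eventually_mono) (rule linorder_inj_onI, auto)
  qed
  \<comment> \<open>A maximum at time \<open>k\<close> is a condition on the first \<open>k\<close>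
    steps and one on the remaining steps, hence the product.\<close>
  have argmax: "(\<integral>\<^sup>+x. of_bool (\<forall>m\<in>{..n}. ?S x m \<le> ?S x k) \<partial>normals n) = ennreal (pers_p k 0 * pers_p (n - k) 0)" if k: "k \<le> n" for k
  proof -
    let ?A = "\<lambda>x. \<forall>j\<in>{..<k}. (\<Sum>i=Suc j..k. x i :: real) \<ge> 0" and ?C = "\<lambda>x. \<forall>j\<in>{Suc k..n}. (\<Sum>i=Suc k..j. x i :: real) \<le> 0"
    have split: "{1..n} = {1..k} \<union> {Suc k..n}" using k by auto
    have diff: "?S x b - ?S x a = (\<Sum>i=Suc a..b. x i)" if "a \<le> b" for a b x
      using sum.ub_add_nat[of 1 a x "b - a"] that by simp
    have iff: "(\<forall>m\<in>{..n}. ?S x m \<le> ?S x k) \<longleftrightarrow> ?A x \<and> ?C x" for x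
    proof -
      have "{..n} = {..<k} \<union> {k} \<union> {Suc k..n}" using k by auto
      then have "(\<forall>m\<in>{..n}. ?S x m \<le> ?S x k) \<longleftrightarrow> (\<forall>m\<in>{..<k}. ?S x m \<le> ?S x k) \<and> (\<forall>m\<in>{Suc k..n}. ?S x m \<le> ?S x k)"
        by (simp only: ball_Un) simp
      moreover have "(\<forall>m\<in>{..<k}. ?S x m \<le> ?S x k) \<longleftrightarrow> ?A x"
      proof (intro ball_cong refl)
        fix m assume "m \<in> {..<k}"
        then show "(?S x m \<le> ?S x k) = ((\<Sum>i=Suc m..k. x i) \<ge> 0)" using diff[of m k x] by auto
      qed
      moreover have "(\<forall>m\<in>{Suc k..n}. ?S x m \<le> ?S x k) \<longleftrightarrow> ?C x"
      proof (intro ball_cong refl)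
        fix m assume "m \<in> {Suc k..n}"
        then show "(?S x m \<le> ?S x k) = ((\<Sum>i=Suc k..m. x i) \<le> 0)" using diff[of k m x] by auto
      qed
      ultimately show ?thesis by blast
    qed
    have m: "(\<lambda>x. of_bool (?A x) * of_bool (?C x) :: ennreal) \<in> borel_measurable (?N ({1..k} \<union> {Suc k..n}))" by measurable
    have "(\<integral>\<^sup>+x. of_bool (\<forall>m\<in>{..n}. ?S x m \<le> ?S x k) \<partial>normals n) = (\<integral>\<^sup>+x. of_bool (?A x) * of_bool (?C x) \<partial>?N ({1..k} \<union> {Suc k..n}))"
      unfolding normals_def split by (intro nn_integral_cong) (simp only: iff of_bool_conj)
    also have "\<dots> = (\<integral>\<^sup>+x. \<integral>\<^sup>+y. of_bool (?A (merge {1..k} {Suc k..n} (x, y))) * of_bool (?C (merge {1..k} {Suc k..n} (x, y))) \<partial>?N {Suc k..n} \<partial>?N {1..k})"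
      by (rule N.product_nn_integral_fold[OF _ _ _ m]) auto
    also have "\<dots> = (\<integral>\<^sup>+x. \<integral>\<^sup>+y. of_bool (?A x) * of_bool (?C y) \<partial>?N {Suc k..n} \<partial>?N {1..k})"
    proof (intro nn_integral_cong)
      fix x y :: "nat \<Rightarrow> real"
      have "(\<Sum>i=Suc j..k. merge {1..k} {Suc k..n} (x, y) i) = (\<Sum>i=Suc j..k. x i)" for j
        by (intro sum.cong) (auto simp: merge_def)
      moreover have "(\<Sum>i=Suc k..j. merge {1..k} {Suc k..n} (x, y) i) = (\<Sum>i=Suc k..j. y i)" if "j \<in> {Suc k..n}" for j
        using that by (intro sum.cong) (auto simp: merge_def)
      then have "?C (merge {1..k} {Suc k..n} (x, y)) \<longleftrightarrow> ?C y" by (intro ball_cong) auto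
      ultimately show "(of_bool (?A (merge {1..k} {Suc k..n} (x, y))) * of_bool (?C (merge {1..k} {Suc k..n} (x, y))) :: ennreal) = of_bool (?A x) * of_bool (?C y)"
        by (simp only:)
    qed
    also have "\<dots> = (\<integral>\<^sup>+x. of_bool (?A x) * ennreal (pers_p (n - k) 0) \<partial>?N {1..k})"
      by (intro nn_integral_cong) (subst nn_integral_cmult, measurable, simp only: pers_p_0_shifted[OF k])
    also have "\<dots> = ennreal (pers_p k 0) * ennreal (pers_p (n - k) 0)"
      by (subst nn_integral_multc, measurable, simp only: pers_p_0_reversed)
    finally show ?thesis by (simp add: ennreal_mult' pers_p_def)
  qed
  have "ennreal (\<Sum>k\<le>n. pers_p k 0 * pers_p (n - k) 0) = (\<Sum>k\<le>n. ennreal (pers_p k 0 * pers_p (n - k) 0))"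
    by (rule sum_ennreal[symmetric]) (simp add: pers_p_def)
  also have "\<dots> = (\<Sum>k\<le>n. \<integral>\<^sup>+x. of_bool (\<forall>m\<in>{..n}. ?S x m \<le> ?S x k) \<partial>normals n)"
    by (intro sum.cong) (simp_all only: argmax atMost_iff)
  also have "\<dots> = (\<integral>\<^sup>+x. (\<Sum>k\<le>n. of_bool (\<forall>m\<in>{..n}. ?S x m \<le> ?S x k)) \<partial>normals n)"
    unfolding le_iff_diff_le_0[of "sum f A" "sum g B" for f g :: "nat \<Rightarrow> real" and A B]
    by (intro nn_integral_sum[symmetric]) measurable
  also have "\<dots> = (\<integral>\<^sup>+x. 1 \<partial>normals n)"
    by (intro nn_integral_cong_AE eventually_mono[OF dist] sum_of_bool_argmax) auto
  also have "\<dots> = ennreal 1" by (simp add: emeasure_space_1)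
  finally show ?thesis by (subst (asm) ennreal_inj) (auto simp: pers_p_def intro!: sum_nonneg)
qed

text \<open>The ratio is the coefficient of \<open>x^n\<close> in
  \<open>(1 - x)^(-1/2)\<close>.\<close>

lemma odd_even_dfact_gbinomial: "odd_dfact n / even_dfact n = (- 1) ^ n * ((- 1 / 2 :: real) gchoose n)"
proof (induction n)
  case 0
  show ?case by (simp add: odd_dfact_def even_dfact_def)
next
  case (Suc n)
  have nz: "even_dfact n \<noteq> 0" by (auto simp: even_dfact_def)
  have o: "odd_dfact (Suc n) = odd_dfact n * (2 * real n + 1)" by (simp add: odd_dfact_def)
  have e: "even_dfact (Suc n) = even_dfact n * (2 * real n + 2)" by (simp add: even_dfact_def)
  have g': "((- 1 / 2 :: real) gchoose Suc n) = - ((2 * real n + 1) / (2 * real n + 2)) * ((- 1 / 2) gchoose n)"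
  proof -
    define G H where "G = ((- 1 / 2 :: real) gchoose n)" and "H = ((- 1 / 2 :: real) gchoose Suc n)"
    have "- 1 / 2 * G = real n * G + real (Suc n) * H"
      unfolding G_def H_def by (rule gbinomial_mult_1)
    then have "(2 * real n + 2) * H = - (2 * real n + 1) * G" by (simp add: algebra_simps)
    then have "H = - ((2 * real n + 1) / (2 * real n + 2)) * G" by (simp add: field_simps)
    then show ?thesis unfolding G_def H_def .
  qed
  have "odd_dfact (Suc n) / even_dfact (Suc n) = (odd_dfact n / even_dfact n) * ((2 * real n + 1) / (2 * real n + 2))"
    unfolding o e by simp
  also have "\<dots> = (- 1) ^ Suc n * ((- 1 / 2 :: real) gchoose Suc n)"
    unfolding g' Suc by simp
  finally show ?case .
qed

text \<open>The square of \<open>(1 - x)^(-1/2)\<close> is the geometric series, all of whose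
  coefficients are 1; in coefficients this is the Vandermonde identity.\<close>

lemma dfact_ratio_convolution:
  "(\<Sum>k\<le>n. (odd_dfact k / even_dfact k) * (odd_dfact (n - k) / even_dfact (n - k))) = 1"
proof -
  have "(\<Sum>k\<le>n. (odd_dfact k / even_dfact k) * (odd_dfact (n - k) / even_dfact (n - k)))
     = (\<Sum>k\<le>n. (- 1) ^ n * (((- 1 / 2 :: real) gchoose k) * ((- 1 / 2) gchoose (n - k))))"
  proof (intro sum.cong refl)
    fix k assume "k \<in> {..n}"
    then have "(- 1 :: real) ^ n = (- 1) ^ k * (- 1) ^ (n - k)" by (simp add: power_add[symmetric])
    then show "(odd_dfact k / even_dfact k) * (odd_dfact (n - k) / even_dfact (n - k)) = (- 1) ^ n * (((- 1 / 2 :: real) gchoose k) * ((- 1 / 2) gchoose (n - k)))"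
      unfolding odd_even_dfact_gbinomial by (simp only: mult_ac)
  qed
  also have "\<dots> = (- 1) ^ n * ((- 1 :: real) gchoose n)"
    unfolding sum_distrib_left[symmetric] using gbinomial_Vandermonde[of "- 1 / 2 :: real" "- 1 / 2" n] by (simp add: atLeast0AtMost)
  also have "\<dots> = 1"
    using gbinomial_minus[of "1::real" n] by (simp add: power_mult_distrib[symmetric] binomial_gbinomial[symmetric])
  finally show ?thesis .
qed

text \<open>Both sequences start with 1 and have constant self-convolution 1. That recursion
  determines the term \<open>n\<close> from the earlier ones, because it occurs only at the two ends
  of the sum, as \<open>2 * f n\<close>.\<close>

lemma pers_p_0: "pers_p n 0 = odd_dfact n / even_dfact n"
proof (induction n rule: less_induct)
  case (less n)
  have p0: "pers_p 0 0 = 1" using prob_space.prob_space[OF prob_space_normals[of 0]] by (simp add: pers_p_def)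
  show ?case
  proof (cases "n = 0")
    case True
    then show ?thesis by (simp add: p0 odd_dfact_def even_dfact_def)
  next
    case False
    have split: "(\<Sum>k\<le>n. f k * f (n - k)) = 2 * f n + (\<Sum>k=1..<n. f k * f (n - k))" if "f 0 = 1" for f :: "nat \<Rightarrow> real"
    proof -
      have "{..n} = insert 0 (insert n {1..<n})" using False by auto
      then show ?thesis using False that by simp
    qed
    have "(\<Sum>k=1..<n. pers_p k 0 * pers_p (n - k) 0)
      = (\<Sum>k=1..<n. (odd_dfact k / even_dfact k) * (odd_dfact (n - k) / even_dfact (n - k)))"
      using less by (intro sum.cong) auto
    then show ?thesis
      using pers_p_0_convolution[of n] dfact_ratio_convolution[of n]
        split[of "\<lambda>k. pers_p k 0"] split[of "\<lambda>k. odd_dfact k / even_dfact k"] p0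
      by (simp add: odd_dfact_def[of 0] even_dfact_def[of 0])
  qed
qed

section \<open>Regular triangulations\<close>

definition upper_face :: "'j set \<Rightarrow> ('j \<Rightarrow> 'a::euclidean_space) \<Rightarrow> ('j \<Rightarrow> real) \<Rightarrow> 'j set \<Rightarrow> bool" where
  "upper_face J x h I \<longleftrightarrow> (\<exists>a b. (\<forall>i\<in>I. h i = a \<bullet> x i + b) \<and> (\<forall>j\<in>J. h j \<le> a \<bullet> x j + b))"

text \<open>The weights sit on indices rather than points because vertices may coincide; one
  direction puts the weight of a point on a single representative index.\<close>

lemma convex_hull_image_iff:
  fixes x :: "'j \<Rightarrow> 'a::real_vector"
  assumes "finite I"
  shows "z \<in> convex hull (x ` I) \<longleftrightarrow> (\<exists>w. (\<forall>i\<in>I. w i \<ge> 0) \<and> sum w I = 1 \<and> (\<Sum>i\<in>I. w i *\<^sub>R x i) = z)"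
proof
  assume z: "z \<in> convex hull (x ` I)"
  obtain I' where I': "I' \<subseteq> I" "inj_on x I'" "x ` I = x ` I'"
    using subset_image_inj[of "x ` I" x I] by auto
  have fin: "finite I'" using I'(1) assms finite_subset by blast
  obtain u where u: "\<forall>v\<in>x ` I'. 0 \<le> u v" "sum u (x ` I') = 1" "(\<Sum>v\<in>x ` I'. u v *\<^sub>R v) = z"
    using z fin unfolding I'(3) by (auto simp: convex_hull_finite)
  define w where "w i = (if i \<in> I' then u (x i) else 0)" for i
  have "sum w I = sum w I'"
    using I'(1) assms by (intro sum.mono_neutral_right) (auto simp: w_def)
  also have "\<dots> = 1" using u(2) I'(2) by (simp add: sum.reindex w_def)
  finally have "sum w I = 1" .
  moreover have "(\<Sum>i\<in>I. w i *\<^sub>R x i) = (\<Sum>i\<in>I'. w i *\<^sub>R x i)"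
    using I'(1) assms by (intro sum.mono_neutral_right) (auto simp: w_def)
  moreover have "\<dots> = z" using u(3) I'(2) by (simp add: sum.reindex w_def)
  moreover have "\<forall>i\<in>I. w i \<ge> 0" using u(1) by (auto simp: w_def)
  ultimately show "\<exists>w. (\<forall>i\<in>I. w i \<ge> 0) \<and> sum w I = 1 \<and> (\<Sum>i\<in>I. w i *\<^sub>R x i) = z" by metis
next
  assume "\<exists>w. (\<forall>i\<in>I. w i \<ge> 0) \<and> sum w I = 1 \<and> (\<Sum>i\<in>I. w i *\<^sub>R x i) = z"
  then obtain w where w: "\<forall>i\<in>I. w i \<ge> 0" "sum w I = 1" "(\<Sum>i\<in>I. w i *\<^sub>R x i) = z" by blast
  have "(\<Sum>i\<in>I. w i *\<^sub>R x i) \<in> convex hull (x ` I)"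
    using w by (intro convex_sum[OF assms convex_convex_hull]) (auto intro: hull_inc)
  then show "z \<in> convex hull (x ` I)" using w(3) by simp
qed

text \<open>Take the highest point over \<open>z\<close> in the hull of the lifted points and
  separate that hull from the vertical ray above it. Since \<open>z\<close> is interior, the
  separating hyperplane is not vertical and hence is the graph of an affine function.\<close>

lemma exists_supporting_affine:
  fixes x :: "'j \<Rightarrow> 'a::euclidean_space" and h :: "'j \<Rightarrow> real"
  assumes J: "finite J" and z: "z \<in> interior (convex hull (x ` J))"
  shows "\<exists>a b. (\<forall>j\<in>J. h j \<le> a \<bullet> x j + b) \<and> z \<in> convex hull (x ` {j\<in>J. h j = a \<bullet> x j + b})"
proof -
  define P where "P j = (x j, h j)" for j
  define C where "C = convex hull (P ` J)"
  have Cc: "compact C" unfolding C_def using J by (intro finite_imp_compact_convex_hull) simp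
  have fstC: "fst ` C = convex hull (x ` J)"
    unfolding C_def by (subst convex_hull_linear_image[OF linear_fst]) (simp add: image_image P_def)
  have zc: "z \<in> convex hull (x ` J)" using z interior_subset by blast
  define S where "S = C \<inter> {p. fst p = z}"
  have "closed {p :: 'a \<times> real. fst p = z}"
    by (intro closed_Collect_eq continuous_on_fst continuous_on_id continuous_on_const)
  then have "compact S" unfolding S_def using Cc by (rule compact_Int_closed[rotated])
  moreover have "S \<noteq> {}" using zc fstC by (force simp: S_def)
  ultimately obtain p where p: "p \<in> S" "\<And>q. q \<in> S \<Longrightarrow> snd q \<le> snd p"
    using continuous_attains_sup[of S snd] continuous_on_snd[OF continuous_on_id] by blast
  define t where "t = snd p"
  have pt: "(z, t) \<in> C" using p(1) by (auto simp: S_def t_def)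
  have tmax: "s \<le> t" if "(z, s) \<in> C" for s using p(2)[of "(z, s)"] that by (auto simp: S_def t_def)
  \<comment> \<open>The open vertical ray above the highest point of the lifted hull over
    \<open>z\<close>.\<close>
  define R where "R = {z} \<times> {t<..}"
  have "convex R" unfolding R_def by (intro convex_Times) auto
  moreover have "R \<noteq> {}" by (auto simp: R_def)
  moreover have "C \<inter> R = {}" using tmax by (force simp: R_def)
  moreover have "convex C" "C \<noteq> {}" using pt by (auto simp: C_def)
  ultimately obtain v b where v: "v \<noteq> 0" "\<forall>q\<in>C. v \<bullet> q \<le> b" "\<forall>q\<in>R. v \<bullet> q \<ge> b"
    using separating_hyperplane_sets[of C R] by blast
  obtain \<alpha> \<beta> where v_eq: "v = (\<alpha>, \<beta>)" by (cases v)
  have le: "\<alpha> \<bullet> y + \<beta> * s \<le> b" if "(y, s) \<in> C" for y s using v(2) that by (force simp: v_eq)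
  have ge: "\<alpha> \<bullet> z + \<beta> * s \<ge> b" if "s > t" for s
    using v(3)[rule_format, of "(z, s)"] that by (simp add: v_eq R_def)
  have "\<beta> \<ge> 0" using le[OF pt] ge[of "t + 1"] by (simp add: algebra_simps)
  \<comment> \<open>A vertical hyperplane would support the hull of the \<open>x j\<close> at its
    interior point \<open>z\<close>; moving from \<open>z\<close> in the direction
    \<open>\<alpha>\<close> stays in that hull and violates it.\<close>
  moreover have "\<beta> \<noteq> 0"
  proof
    assume [simp]: "\<beta> = 0"
    obtain e where e: "e > 0" "ball z e \<subseteq> convex hull (x ` J)" using z mem_interior by blast
    have \<alpha>: "\<alpha> \<noteq> 0" using v(1) by (auto simp: v_eq zero_prod_def)
    define y where "y = z + (e / (2 * norm \<alpha>)) *\<^sub>R \<alpha>"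
    have "y \<in> ball z e" using e \<alpha> by (simp add: y_def dist_norm)
    then have "y \<in> fst ` C" using e fstC by blast
    then have "\<alpha> \<bullet> y \<le> b" using le by auto
    moreover have "b \<le> \<alpha> \<bullet> z" using ge[of "t + 1"] by simp
    moreover have "\<alpha> \<bullet> y = \<alpha> \<bullet> z + e / (2 * norm \<alpha>) * (\<alpha> \<bullet> \<alpha>)" by (simp add: y_def inner_add_right)
    moreover have "e / (2 * norm \<alpha>) * (\<alpha> \<bullet> \<alpha>) > 0" using e \<alpha> by (intro mult_pos_pos divide_pos_pos) auto
    ultimately show False by linarith
  qed
  ultimately have \<beta>: "\<beta> > 0" by simp
  have eq: "\<alpha> \<bullet> z + \<beta> * t = b"
  proof (rule antisym[OF le[OF pt]], rule ccontr)
    assume "\<not> b \<le> \<alpha> \<bullet> z + \<beta> * t"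
    define D where "D = b - (\<alpha> \<bullet> z + \<beta> * t)"
    have d: "D > 0" using \<open>\<not> b \<le> \<alpha> \<bullet> z + \<beta> * t\<close> by (simp add: D_def)
    then have "t + D / (2 * \<beta>) > t" using \<beta> by simp
    then have "\<alpha> \<bullet> z + \<beta> * (t + D / (2 * \<beta>)) \<ge> b" by (rule ge)
    moreover have "\<beta> * (t + D / (2 * \<beta>)) = \<beta> * t + D / 2" using \<beta> by (simp add: distrib_left)
    moreover have "b = D + (\<alpha> \<bullet> z + \<beta> * t)" by (simp add: D_def)
    ultimately show False using d by linarith
  qed
  define a' b' where "a' = (- 1 / \<beta>) *\<^sub>R \<alpha>" and "b' = b / \<beta>"
  have aff: "a' \<bullet> y + b' = (b - \<alpha> \<bullet> y) / \<beta>" for y by (simp add: a'_def b'_def diff_divide_distrib)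
  have up: "\<alpha> \<bullet> x j + \<beta> * h j \<le> b" if "j \<in> J" for j
    by (rule le) (use that in \<open>auto simp: C_def P_def intro!: hull_inc\<close>)
  have up': "h j \<le> a' \<bullet> x j + b'" if "j \<in> J" for j
    unfolding aff using up[OF that] \<beta> by (simp add: field_simps)
  have on: "h j = a' \<bullet> x j + b'" if "\<alpha> \<bullet> x j + \<beta> * h j = b" for j
    unfolding aff using that \<beta> by (simp add: field_simps)
  obtain w where w: "\<forall>j\<in>J. w j \<ge> 0" "sum w J = 1" "(\<Sum>j\<in>J. w j *\<^sub>R P j) = (z, t)"
    using pt convex_hull_image_iff[OF J] unfolding C_def by blast
  have wz: "(\<Sum>j\<in>J. w j *\<^sub>R x j) = z" and wt: "(\<Sum>j\<in>J. w j * h j) = t"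
    using arg_cong[OF w(3), of fst] arg_cong[OF w(3), of snd] by (simp_all add: fst_sum snd_sum P_def)
  \<comment> \<open>Complementary slackness: the highest point is a convex combination of lifted
    points and lies on the hyperplane, so only points on the hyperplane can carry weight.\<close>
  have "(\<Sum>j\<in>J. w j * (b - (\<alpha> \<bullet> x j + \<beta> * h j))) = b * sum w J - (\<alpha> \<bullet> (\<Sum>j\<in>J. w j *\<^sub>R x j) + \<beta> * (\<Sum>j\<in>J. w j * h j))"
    by (simp add: sum_subtractf sum.distrib sum_distrib_left inner_sum_right algebra_simps)
  also have "\<dots> = 0" unfolding w(2) wz wt using eq by simp
  finally have "\<forall>j\<in>J. w j * (b - (\<alpha> \<bullet> x j + \<beta> * h j)) = 0"
    using J w(1) up by (subst (asm) sum_nonneg_eq_0_iff) auto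
  then have supp: "w j = 0 \<or> h j = a' \<bullet> x j + b'" if "j \<in> J" for j using that on by auto
  let ?E = "{j\<in>J. h j = a' \<bullet> x j + b'}"
  have "sum w ?E = 1" using w(2) supp J by (subst sum.mono_neutral_left[of J]) auto
  moreover have "(\<Sum>j\<in>?E. w j *\<^sub>R x j) = z" unfolding wz[symmetric] using supp J by (intro sum.mono_neutral_left) auto
  ultimately have "z \<in> convex hull (x ` ?E)"
    using w(1) J by (subst convex_hull_image_iff) auto
  then show ?thesis using up' by blast
qed

text \<open>At \<open>z\<close> both affine functions equal the height of the upper hull. By
  \<open>pos\<close> all weights of \<open>z\<close> in \<open>I\<close> are positive, so the two
  functions agree on \<open>I\<close>; then \<open>I\<close> and a further vertex of
  \<open>I'\<close> give \<open>DIM('a) + 2\<close> lifted points on one hyperplane, against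
  \<open>gen\<close>.\<close>

lemma upper_face_unique:
  fixes x :: "'j \<Rightarrow> 'a::euclidean_space"
  assumes I: "I \<subseteq> J" "I' \<subseteq> J" "finite J" "card I = Suc DIM('a)" "card I' = Suc DIM('a)"
    and face: "upper_face J x h I" "upper_face J x h I'"
    and z: "z \<in> convex hull (x ` I)" "z \<in> convex hull (x ` I')"
    and pos: "\<And>K. K \<subseteq> J \<Longrightarrow> card K \<le> DIM('a) \<Longrightarrow> z \<notin> convex hull (x ` K)"
    and gen: "\<And>K a b. K \<subseteq> J \<Longrightarrow> card K = DIM('a) + 2 \<Longrightarrow> \<exists>i\<in>K. h i \<noteq> a \<bullet> x i + b"
  shows "I = I'"
proof (rule ccontr)
  assume neq: "I \<noteq> I'"
  obtain a b where ab: "\<forall>i\<in>I. h i = a \<bullet> x i + b" "\<forall>j\<in>J. h j \<le> a \<bullet> x j + b" using face(1) by (auto simp: upper_face_def)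
  obtain a' b' where ab': "\<forall>i\<in>I'. h i = a' \<bullet> x i + b'" "\<forall>j\<in>J. h j \<le> a' \<bullet> x j + b'" using face(2) by (auto simp: upper_face_def)
  have fin: "finite I" "finite I'" using I finite_subset by blast+
  obtain w where w: "\<forall>i\<in>I. w i \<ge> 0" "sum w I = 1" "(\<Sum>i\<in>I. w i *\<^sub>R x i) = z"
    using z(1) convex_hull_image_iff[OF fin(1)] by blast
  obtain w' where w': "\<forall>i\<in>I'. w' i \<ge> 0" "sum w' I' = 1" "(\<Sum>i\<in>I'. w' i *\<^sub>R x i) = z"
    using z(2) convex_hull_image_iff[OF fin(2)] by blast
  have wpos: "w i > 0" if i: "i \<in> I" for i
  proof (rule ccontr)
    assume "\<not> w i > 0"
    then have wi: "w i = 0" using w(1) i by force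
    have "sum w (I - {i}) = 1" "(\<Sum>i\<in>I - {i}. w i *\<^sub>R x i) = z"
      using w i fin wi by (simp_all add: sum.remove[of I i])
    then have "z \<in> convex hull (x ` (I - {i}))"
      using w(1) fin by (subst convex_hull_image_iff) auto
    moreover have "card (I - {i}) \<le> DIM('a)" using I(4) i fin by simp
    ultimately show False using pos[of "I - {i}"] I(1) by blast
  qed
  have val: "(\<Sum>i\<in>K. u i * (c \<bullet> x i + e)) = c \<bullet> z + e" if "sum u K = 1" "(\<Sum>i\<in>K. u i *\<^sub>R x i) = z" for u :: "'j \<Rightarrow> real" and K c e
  proof -
    have "(\<Sum>i\<in>K. u i * (c \<bullet> x i + e)) = c \<bullet> (\<Sum>i\<in>K. u i *\<^sub>R x i) + e * sum u K"
      by (simp add: inner_sum_right sum.distrib sum_distrib_left algebra_simps)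
    then show ?thesis using that by simp
  qed
  have "(\<Sum>i\<in>I'. w' i * (a' \<bullet> x i + b')) \<le> (\<Sum>i\<in>I'. w' i * (a \<bullet> x i + b))"
  proof (intro sum_mono mult_left_mono)
    fix i assume i: "i \<in> I'"
    show "a' \<bullet> x i + b' \<le> a \<bullet> x i + b" using ab'(1)[rule_format, OF i] ab(2)[rule_format, of i] i I(2) by auto
    show "0 \<le> w' i" using w' i by blast
  qed
  then have le: "a' \<bullet> z + b' \<le> a \<bullet> z + b" using val[OF w'(2,3)] by simp
  have nn: "w i * ((a' \<bullet> x i + b') - (a \<bullet> x i + b)) \<ge> 0" if i: "i \<in> I" for i
  proof -
    have "a \<bullet> x i + b \<le> a' \<bullet> x i + b'" using ab(1)[rule_format, OF i] ab'(2)[rule_format, of i] i I(1) by auto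
    then show ?thesis using wpos[OF i] by simp
  qed
  have "(\<Sum>i\<in>I. w i * ((a' \<bullet> x i + b') - (a \<bullet> x i + b))) = (a' \<bullet> z + b') - (a \<bullet> z + b)"
    using val[OF w(2,3), of a' b'] val[OF w(2,3), of a b] by (simp add: right_diff_distrib sum_subtractf)
  \<comment> \<open>The sum is nonnegative termwise because \<open>a'\<close> dominates the heights
    on \<open>I\<close>, and nonpositive because \<open>a\<close> dominates them on
    \<open>I'\<close>.\<close>
  moreover have "\<dots> \<le> 0" using le by simp
  ultimately have "(\<Sum>i\<in>I. w i * ((a' \<bullet> x i + b') - (a \<bullet> x i + b))) = 0"
    using sum_nonneg[of I "\<lambda>i. w i * ((a' \<bullet> x i + b') - (a \<bullet> x i + b))"] nn by (intro antisym) auto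
  then have zero: "w i * ((a' \<bullet> x i + b') - (a \<bullet> x i + b)) = 0" if "i \<in> I" for i
    using nn fin(1) that by (subst (asm) sum_nonneg_eq_0_iff) auto
  have on: "h i = a' \<bullet> x i + b'" if "i \<in> I \<union> I'" for i
    using that zero[of i] wpos[of i] ab(1) ab'(1) by auto
  have "\<not> I' \<subseteq> I" using neq I(4,5) fin by (metis card_subset_eq)
  then obtain k where k: "k \<in> I'" "k \<notin> I" by blast
  have "card (insert k I) = DIM('a) + 2" using k fin I by simp
  moreover have "insert k I \<subseteq> J" using k I by auto
  ultimately obtain i where "i \<in> insert k I" "h i \<noteq> a' \<bullet> x i + b'" using gen[of "insert k I" a' b'] by auto
  then show False using on[of i] k by auto
qed

lemma caratheodory_obtain:
  fixes z :: "'a::euclidean_space"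
  assumes "z \<in> convex hull p"
  obtains S where "finite S" "S \<subseteq> p" "card S \<le> DIM('a) + 1" "z \<in> convex hull S"
proof -
  have "z \<in> {x. \<exists>S. finite S \<and> S \<subseteq> p \<and> card S \<le> DIM('a) + 1 \<and> x \<in> convex hull S}"
    using assms by (rule subsetD[OF equalityD1[OF caratheodory]])
  then show ?thesis using that by (auto dest!: CollectD)
qed

lemma AE_not_in_negligible:
  assumes "negligible N" "N \<in> sets borel"
  shows "AE z in lborel. z \<notin> N"
proof -
  have "N \<in> null_sets lborel"
    using assms by (simp add: negligible_iff_null_sets null_sets_completion_iff)
  then show ?thesis by (rule AE_not_in)
qed

text \<open>Almost every point of the hull lies in exactly one upper simplex. The exceptional points
  are those on the frontier and those in the hull of at most \<open>DIM('a)\<close> vertices.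
  Existence combines the supporting function with Caratheodory's theorem, uniqueness is
  \<open>upper_face_unique\<close>.\<close>

lemma regular_triangulation:
  fixes x :: "'j \<Rightarrow> 'a::euclidean_space"
  assumes J: "finite J"
    and gen: "\<And>K a b. K \<subseteq> J \<Longrightarrow> card K = DIM('a) + 2 \<Longrightarrow> \<exists>i\<in>K. h i \<noteq> a \<bullet> x i + b"
  shows "emeasure lborel (convex hull (x ` J))
    = (\<Sum>I | I \<subseteq> J \<and> card I = Suc DIM('a). emeasure lborel (convex hull (x ` I)) * of_bool (upper_face J x h I))"
proof -
  let ?F = "{I. I \<subseteq> J \<and> card I = Suc DIM('a)}"
  have finF: "finite ?F" using J by (rule_tac finite_subset[of _ "Pow J"]) auto
  have cb: "convex hull (x ` I) \<in> sets borel" if "I \<subseteq> J" for I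
    using J that finite_subset by (intro borel_compact finite_imp_compact_convex_hull) blast
  have fr: "AE z in lborel. z \<notin> frontier (convex hull (x ` J))"
    by (intro AE_not_in_negligible negligible_convex_frontier) auto
  have small: "AE z in lborel. \<forall>K\<in>{K. K \<subseteq> J \<and> card K \<le> DIM('a)}. z \<notin> convex hull (x ` K)"
  proof (intro AE_finite_allI)
    show "finite {K. K \<subseteq> J \<and> card K \<le> DIM('a)}" using J by (rule_tac finite_subset[of _ "Pow J"]) auto
    fix K assume K: "K \<in> {K. K \<subseteq> J \<and> card K \<le> DIM('a)}"
    then have f: "finite K" using J finite_subset by blast
    have "card (x ` K) \<le> DIM('a)" using card_image_le[OF f, of x] K by simp
    then have "interior (convex hull (x ` K)) = {}" using f by (intro empty_interior_convex_hull) auto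
    then have "negligible (convex hull (x ` K))" by (simp add: negligible_convex_interior)
    then show "AE z in lborel. z \<notin> convex hull (x ` K)" using K cb by (intro AE_not_in_negligible) auto
  qed
  have key: "(\<Sum>I\<in>?F. indicator (convex hull (x ` I)) z * of_bool (upper_face J x h I)) = (indicator (convex hull (x ` J)) z :: ennreal)"
    if z1: "z \<notin> frontier (convex hull (x ` J))" and z2: "\<forall>K\<in>{K. K \<subseteq> J \<and> card K \<le> DIM('a)}. z \<notin> convex hull (x ` K)" for z
  proof (cases "z \<in> convex hull (x ` J)")
    case False
    have "z \<notin> convex hull (x ` I)" if "I \<subseteq> J" for I
      using False hull_mono[of "x ` I" "x ` J" convex] that by blast
    then show ?thesis using False by (simp add: sum.neutral)
  next
    case True
    then have zi: "z \<in> interior (convex hull (x ` J))"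
      using z1 J by (auto simp: frontier_def closure_closed compact_imp_closed finite_imp_compact_convex_hull)
    obtain a b where ab: "\<forall>j\<in>J. h j \<le> a \<bullet> x j + b" "z \<in> convex hull (x ` {j\<in>J. h j = a \<bullet> x j + b})"
      using exists_supporting_affine[OF J zi, of h] by (elim exE conjE) (rule that)
    obtain S where S: "finite S" "S \<subseteq> x ` {j\<in>J. h j = a \<bullet> x j + b}" "card S \<le> DIM('a) + 1" "z \<in> convex hull S"
      by (rule caratheodory_obtain[OF ab(2)])
    \<comment> \<open>One index per point, so that \<open>I0\<close> has the cardinality of
      \<open>S\<close>; fewer than \<open>DIM('a) + 1\<close> points are excluded by the choice of
      \<open>z\<close>.\<close>
    obtain I0 where I0: "I0 \<subseteq> {j\<in>J. h j = a \<bullet> x j + b}" "inj_on x I0" "S = x ` I0"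
      using subset_image_inj[THEN iffD1, OF S(2)] by (elim exE conjE) (rule that)
    have "card I0 = card S" using I0 by (simp add: card_image)
    moreover have "\<not> card I0 \<le> DIM('a)" using z2 I0 S(4) by auto
    ultimately have card: "card I0 = Suc DIM('a)" using S(3) by simp
    have mem: "I0 \<in> ?F" using I0 card by auto
    have face: "upper_face J x h I0" unfolding upper_face_def using I0 ab(1) by blast
    have "indicator (convex hull (x ` I)) z * of_bool (upper_face J x h I) = (if I = I0 then 1 else 0 :: ennreal)" if I: "I \<in> ?F" for I
    proof (cases "I = I0")
      case True
      then show ?thesis using face S(4) I0(3) by simp
    next
      case False
      have "\<not> (z \<in> convex hull (x ` I) \<and> upper_face J x h I)"
      proof
        assume *: "z \<in> convex hull (x ` I) \<and> upper_face J x h I"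
        have "I = I0"
          by (rule upper_face_unique[of I J I0 x h z]) (use I mem J face * S(4) I0(3) z2 gen in auto)
        then show False using False by simp
      qed
      then show ?thesis using False by (auto simp: indicator_def)
    qed
    then have "(\<Sum>I\<in>?F. indicator (convex hull (x ` I)) z * of_bool (upper_face J x h I)) = (\<Sum>I\<in>?F. if I = I0 then 1 else 0 :: ennreal)"
      by (intro sum.cong) auto
    also have "\<dots> = 1" using finF mem by simp
    finally show ?thesis using True by simp
  qed
  have "emeasure lborel (convex hull (x ` J)) = (\<integral>\<^sup>+z. indicator (convex hull (x ` J)) z \<partial>lborel)"
    using cb[of J] by simp
  also have "\<dots> = (\<integral>\<^sup>+z. (\<Sum>I\<in>?F. indicator (convex hull (x ` I)) z * of_bool (upper_face J x h I)) \<partial>lborel)"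
  proof (intro nn_integral_cong_AE)
    from fr small show "AE z in lborel. indicator (convex hull (x ` J)) z
        = (\<Sum>I\<in>?F. indicator (convex hull (x ` I)) z * of_bool (upper_face J x h I) :: ennreal)"
      by eventually_elim (rule key[symmetric])
  qed
  also have "\<dots> = (\<Sum>I\<in>?F. \<integral>\<^sup>+z. indicator (convex hull (x ` I)) z * of_bool (upper_face J x h I) \<partial>lborel)"
    using cb by (intro nn_integral_sum) auto
  also have "\<dots> = (\<Sum>I\<in>?F. emeasure lborel (convex hull (x ` I)) * of_bool (upper_face J x h I))"
    using cb by (intro sum.cong refl) (auto simp: nn_integral_multc)
  finally show ?thesis .
qed

text \<open>Too many distinct points are affinely dependent; if two indices carry the same point,
  the weights 1 and -1 on them already form a dependence.\<close>

lemma affine_dependence_indexed: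
  fixes x :: "'j \<Rightarrow> 'a::euclidean_space"
  assumes "finite K" "card K = DIM('a) + 2"
  obtains \<mu> where "\<exists>i\<in>K. \<mu> i \<noteq> 0" "sum \<mu> K = 0" "(\<Sum>i\<in>K. \<mu> i *\<^sub>R x i) = 0"
proof (cases "inj_on x K")
  case True
  then have "affine_dependent (x ` K)"
    using assms by (intro affine_dependent_biggerset) (auto simp: card_image)
  then obtain u where u: "sum u (x ` K) = 0" "\<exists>v\<in>x ` K. u v \<noteq> 0" "(\<Sum>v\<in>x ` K. u v *\<^sub>R v) = 0"
    using assms(1) by (auto simp: affine_dependent_explicit_finite)
  show ?thesis
    by (rule that[of "\<lambda>i. u (x i)"]) (use u True in \<open>auto simp: sum.reindex\<close>)
next
  case False
  then obtain i j where ij: "i \<in> K" "j \<in> K" "i \<noteq> j" "x i = x j" by (auto simp: inj_on_def)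
  define \<mu> where "\<mu> k = (if k = i then 1 else 0) - (if k = j then 1 else 0 :: real)" for k
  have "(\<Sum>k\<in>K. \<mu> k *\<^sub>R x k) = (\<Sum>k\<in>K. (if k = i then x k else 0) - (if k = j then x k else 0))"
    by (intro sum.cong) (auto simp: \<mu>_def)
  also have "\<dots> = 0" using ij assms(1) by (simp add: sum_subtractf)
  finally have 1: "(\<Sum>k\<in>K. \<mu> k *\<^sub>R x k) = 0" .
  have 2: "sum \<mu> K = 0" using ij assms(1) by (simp add: \<mu>_def sum_subtractf)
  have 3: "\<exists>k\<in>K. \<mu> k \<noteq> 0" using ij by (intro bexI[of _ i]) (auto simp: \<mu>_def)
  show ?thesis by (rule that[OF 3 2 1])
qed

section \<open>Gram determinants of configurations\<close>

text \<open>Coefficient of the step \<open>e\<close> in the walk position indexed by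
  \<open>p\<close>; it vanishes on all steps for \<open>p = (0, 0)\<close>.\<close>

definition cumul :: "nat \<times> nat \<Rightarrow> nat \<times> nat \<Rightarrow> real" where
  "cumul p e = of_bool (fst e = fst p \<and> snd e \<le> snd p)"

text \<open>The value 0 before the first contact makes the first segment begin at the start of the
  walk.\<close>

definition prev_contact :: "nat set \<Rightarrow> nat \<Rightarrow> nat" where
  "prev_contact A i = (if i = Min A then 0 else Max {j\<in>A. j < i})"

text \<open>The steps between consecutive contacts; for different contacts these sets are
  disjoint.\<close>

definition seg :: "(nat \<Rightarrow> nat set) \<Rightarrow> nat \<times> nat \<Rightarrow> (nat \<times> nat) set" where
  "seg K p = {fst p} \<times> {prev_contact (K (fst p)) (snd p)<..snd p}"

definition seg_len :: "(nat \<Rightarrow> nat set) \<Rightarrow> nat \<times> nat \<Rightarrow> nat" where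
  "seg_len K p = snd p - prev_contact (K (fst p)) (snd p)"

lemma prev_contact_less:
  assumes "finite A" "i \<in> A" "\<And>j. j \<in> A \<Longrightarrow> j \<ge> 1"
  shows "prev_contact A i < i"
proof (cases "i = Min A")
  case True
  have "0 < i" using assms(2,3) by fastforce
  then show ?thesis using True by (simp add: prev_contact_def)
next
  case False
  have "Min A \<in> A" "Min A \<le> i" using assms(1,2) by (auto intro: Min_in Min_le)
  then have "Min A \<in> {j\<in>A. j < i}" using False by auto
  then have "Max {j\<in>A. j < i} \<in> {j\<in>A. j < i}" using assms(1) by (intro Max_in) auto
  then show ?thesis using False by (simp add: prev_contact_def)
qed

lemma prev_contact_ge:
  assumes "finite A" "j \<in> A" "j < i"
  shows "j \<le> prev_contact A i"
proof -
  have "i \<noteq> Min A" using assms by (metis Min_le not_le)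
  then show ?thesis unfolding prev_contact_def using assms by simp
qed

lemma contact_telescope:
  fixes y :: "nat \<Rightarrow> real"
  assumes A: "finite A" and "j \<in> A"
  shows "(\<Sum>i\<in>{i\<in>A. i \<le> j}. y i - (if i = Min A then c else y (Max {k\<in>A. k < i}))) = y j - c"
  using assms(2)
proof (induction j rule: less_induct)
  case (less j)
  show ?case
  proof (cases "j = Min A")
    case True
    then have "{i\<in>A. i \<le> j} = {j}" using less.prems A by (auto intro: antisym)
    then show ?thesis using True by simp
  next
    case False
    define p where "p = Max {k\<in>A. k < j}"
    have "Min A \<in> A" "Min A \<le> j" using A less.prems by (auto intro: Min_in Min_le)
    then have "Min A \<in> {k\<in>A. k < j}" using False by auto
    then have "p \<in> {k\<in>A. k < j}" unfolding p_def using A by (intro Max_in) auto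
    then have p: "p \<in> A" "p < j" by auto
    have "{i\<in>A. i \<le> j} = insert j {i\<in>A. i \<le> p}"
    proof -
      have "i \<le> p" if "i \<in> A" "i < j" for i unfolding p_def using that A by simp
      then show ?thesis using less.prems p by (auto simp: le_less)
    qed
    moreover have "j \<notin> {i\<in>A. i \<le> p}" using p by simp
    ultimately have "(\<Sum>i\<in>{i\<in>A. i \<le> j}. y i - (if i = Min A then c else y (Max {k\<in>A. k < i})))
       = (y j - y p) + (\<Sum>i\<in>{i\<in>A. i \<le> p}. y i - (if i = Min A then c else y (Max {k\<in>A. k < i})))"
      using A False by (simp add: p_def)
    also have "(\<Sum>i\<in>{i\<in>A. i \<le> p}. y i - (if i = Min A then c else y (Max {k\<in>A. k < i}))) = y p - c"
      by (rule less.IH[OF p(2,1)])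
    finally show ?thesis by simp
  qed
qed

text \<open>Taking the square roots of the diagonal out on both sides leaves the identity plus a
  rank one matrix. In the application \<open>f\<close> is an indicator, hence idempotent.\<close>

lemma det_diag_plus_rank_one:
  fixes g f :: "'d::finite \<Rightarrow> real"
  assumes g: "\<And>k. g k > 0" and f: "\<And>k. f k * f k = f k"
  shows "det (\<chi> j k. of_bool (j = k) * g j + g0 * f j * f k) = (\<Prod>k\<in>UNIV. g k) * (1 + g0 * (\<Sum>k\<in>UNIV. f k / g k))"
proof -
  define u :: "real^'d" where "u = (\<chi> k. f k / sqrt (g k))"
  define S :: "real^'d^'d" where "S = (\<chi> j k. of_bool (j = k) * sqrt (g j))"
  define M :: "real^'d^'d" where "M = (\<chi> j k. of_bool (j = k) + g0 * u $ j * u $ k)"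
  have sq: "sqrt (g k) * sqrt (g k) = g k" "sqrt (g k) > 0" for k using g[of k] by auto
  have "(S ** M ** S) $ j $ k = of_bool (j = k) * g j + g0 * f j * f k" for j k
  proof -
    have SM: "(S ** M) $ j $ i = sqrt (g j) * M $ j $ i" for i
    proof -
      have "(S ** M) $ j $ i = (\<Sum>l\<in>UNIV. if l = j then sqrt (g j) * M $ j $ i else 0)"
        unfolding matrix_matrix_mult_def S_def vec_lambda_beta by (intro sum.cong) auto
      then show ?thesis by simp
    qed
    have "(S ** M ** S) $ j $ k = (\<Sum>i\<in>UNIV. (S ** M) $ j $ i * S $ i $ k)"
      by (simp add: matrix_matrix_mult_def)
    also have "\<dots> = (\<Sum>i\<in>UNIV. if i = k then sqrt (g j) * M $ j $ k * sqrt (g k) else 0)"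
      unfolding SM by (intro sum.cong) (auto simp: S_def)
    also have "\<dots> = sqrt (g j) * M $ j $ k * sqrt (g k)" by simp
    also have "\<dots> = of_bool (j = k) * g j + g0 * f j * f k"
      using sq[of j] sq[of k] by (cases "j = k") (auto simp: M_def u_def field_simps)
    finally show ?thesis .
  qed
  then have "(\<chi> j k. of_bool (j = k) * g j + g0 * f j * f k) = S ** M ** S" by (simp add: vec_eq_iff)
  then have "det (\<chi> j k. of_bool (j = k) * g j + g0 * f j * f k) = det S * det M * det S" by (simp add: det_mul)
  moreover have "det S = (\<Prod>k\<in>UNIV. sqrt (g k))"
    by (subst det_diagonal) (auto simp: S_def)
  moreover have "det M = 1 + g0 * (u \<bullet> u)" unfolding M_def by (rule det_rank_one_update)
  moreover have "u \<bullet> u = (\<Sum>k\<in>UNIV. f k / g k)"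
    unfolding inner_vec_def u_def using f sq by (intro sum.cong) (auto simp: field_simps)
  moreover have "(\<Prod>k\<in>UNIV. sqrt (g k)) * (\<Prod>k\<in>UNIV. sqrt (g k)) = (\<Prod>k\<in>UNIV. g k)"
    by (simp add: prod.distrib[symmetric] abs_of_pos[OF g])
  ultimately show ?thesis by (simp add: mult_ac)
qed

text \<open>Subtracting from each contact the previous one on its walk is a unipotent change of the
  vertices. It turns the coefficient vectors into indicators of disjoint segments, which are
  orthogonal; only the first contact of each walk still involves the base vector \<open>c0\<close>.
  So the Gram matrix becomes diagonal plus rank one. The base is either the origin or the first
  contact of some walk.\<close>

lemma gram_det:
  fixes \<beta> :: "'d::finite \<Rightarrow> nat \<times> nat" and K :: "nat \<Rightarrow> nat set" and c0 :: "nat \<times> nat \<Rightarrow> real"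
  assumes K: "\<And>l. l \<in> {1..m} \<Longrightarrow> K l \<subseteq> {1..n l}"
    and \<beta>: "bij_betw \<beta> UNIV I0"
    and base: "(c0 = (\<lambda>_. 0) \<and> I0 = Sigma {1..m} K \<and> g0 = 0)
      \<or> (\<exists>l0\<in>{1..m}. K l0 \<noteq> {} \<and> c0 = cumul (l0, Min (K l0)) \<and> I0 = Sigma {1..m} K - {(l0, Min (K l0))} \<and> g0 = real (Min (K l0)))"
  shows "det (\<chi> j k. \<Sum>e\<in>steps m n. (cumul (\<beta> j) e - c0 e) * (cumul (\<beta> k) e - c0 e))
     = (\<Prod>p\<in>I0. real (seg_len K p)) * (1 + g0 * (\<Sum>p\<in>I0. of_bool (snd p = Min (K (fst p))) / real (seg_len K p)))"
proof -
  define I where "I = Sigma {1..m} K"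
  define E where "E = steps m n"
  have E: "E = Sigma {1..m} (\<lambda>l. {1..n l})" by (auto simp: E_def steps_def)
  have finE: "finite E" unfolding E by simp
  have IE: "I \<subseteq> E" unfolding I_def E using K by blast
  have finI: "finite I" using finite_subset[OF IE finE] .
  have finK: "finite (K l)" if "l \<in> {1..m}" for l using K[OF that] finite_subset by blast
  have K1: "i \<ge> 1" if "l \<in> {1..m}" "i \<in> K l" for l i using K[OF that(1)] that(2) by auto
  have I0I: "I0 \<subseteq> I" using base by (auto simp: I_def)
  have \<beta>I0: "\<beta> k \<in> I0" for k using \<beta> by (auto simp: bij_betw_def)
  have \<beta>I: "\<beta> k \<in> I" for k using \<beta>I0 I0I by blast
  have inj: "\<beta> j = \<beta> k \<longleftrightarrow> j = k" for j k using \<beta> by (auto simp: bij_betw_def inj_on_def)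
  define fi where "fi p = (of_bool (snd p = Min (K (fst p))) :: real)" for p
  define bl where "bl p e = (of_bool (e \<in> seg K p) :: real)" for p e
  define D2 where "D2 p e = cumul p e - (if snd p = Min (K (fst p)) then c0 e else cumul (fst p, Max {j\<in>K (fst p). j < snd p}) e)" for p e
  \<comment> \<open>Summation along a walk: each vertex relative to the base is the sum of the
    differences \<open>D2\<close> up to its time.\<close>
  define L :: "real^'d^'d" where "L = (\<chi> j k. of_bool (fst (\<beta> k) = fst (\<beta> j) \<and> snd (\<beta> k) \<le> snd (\<beta> j)))"
  have detL: "det L = 1"
  proof (rule det_unipotent[of L "\<lambda>k. snd (\<beta> k)"])
    fix j k assume jk: "j \<noteq> k" "L $ j $ k \<noteq> 0"
    then have "fst (\<beta> k) = fst (\<beta> j)" "snd (\<beta> k) \<le> snd (\<beta> j)" by (auto simp: L_def)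
    moreover have "\<beta> k \<noteq> \<beta> j" using inj jk by metis
    ultimately show "snd (\<beta> k) < snd (\<beta> j)" by (auto simp: prod_eq_iff)
  qed (simp add: L_def)
  have LD: "cumul (\<beta> j) e - c0 e = (\<Sum>k\<in>UNIV. L $ j $ k * D2 (\<beta> k) e)" for j e
  proof -
    obtain l i where li: "\<beta> j = (l, i)" by (cases "\<beta> j")
    have l: "l \<in> {1..m}" "i \<in> K l" using \<beta>I[of j] li by (auto simp: I_def)
    let ?t = "\<lambda>p. of_bool (fst p = l \<and> snd p \<le> i) * D2 p e"
    have "(\<Sum>k\<in>UNIV. L $ j $ k * D2 (\<beta> k) e) = (\<Sum>k\<in>UNIV. ?t (\<beta> k))" by (simp add: L_def li)
    also have "\<dots> = (\<Sum>p\<in>I0. ?t p)" by (rule sum.reindex_bij_betw[OF \<beta>])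
    \<comment> \<open>The base vertex, absent from \<open>I0\<close>, may be added, since its
      difference to itself is 0.\<close>
    also have "\<dots> = (\<Sum>p\<in>I. ?t p)"
    proof (rule sum.mono_neutral_left[OF finI I0I], rule ballI)
      fix p assume "p \<in> I - I0"
      then show "?t p = 0" using base by (auto simp: I_def D2_def)
    qed
    also have "\<dots> = (\<Sum>p\<in>Pair l ` {i'\<in>K l. i' \<le> i}. ?t p)"
      by (rule sum.mono_neutral_right[OF finI]) (use l in \<open>auto simp: I_def\<close>)
    also have "\<dots> = (\<Sum>i'\<in>{i'\<in>K l. i' \<le> i}. cumul (l, i') e - (if i' = Min (K l) then c0 e else cumul (l, Max {k\<in>K l. k < i'}) e))"
      by (subst sum.reindex) (auto simp: inj_on_def D2_def cong: if_cong)
    also have "\<dots> = cumul (l, i) e - c0 e"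
      by (rule contact_telescope[of "K l" i "\<lambda>i. cumul (l, i) e"]) (use l finK in auto)
    finally show ?thesis using li by simp
  qed
  have D2: "D2 p e = bl p e - fi p * c0 e" if p: "p \<in> I" and e: "e \<in> E" for p e
  proof -
    obtain l i where li: "p = (l, i)" by (cases p)
    have l: "l \<in> {1..m}" "i \<in> K l" using p li by (auto simp: I_def)
    have e1: "snd e \<ge> 1" using e by (auto simp: E)
    have lt: "prev_contact (K l) i < i" using prev_contact_less[OF finK[OF l(1)] l(2)] K1[OF l(1)] by blast
    show ?thesis
    proof (cases "i = Min (K l)")
      case True
      then show ?thesis using e1 by (auto simp: D2_def bl_def fi_def li seg_def prev_contact_def cumul_def mem_Times_iff)
    next
      case False
      then have "prev_contact (K l) i = Max {j\<in>K l. j < i}" by (simp add: prev_contact_def)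
      then show ?thesis using False lt by (auto simp: D2_def bl_def fi_def li seg_def cumul_def mem_Times_iff)
    qed
  qed
  have disj: "seg K p \<inter> seg K q = {}" if pq: "p \<in> I" "q \<in> I" "p \<noteq> q" for p q
  proof -
    have *: "seg K (l, i) \<inter> seg K (l, i') = {}" if "l \<in> {1..m}" "i \<in> K l" "i' \<in> K l" "i < i'" for l i i'
      using prev_contact_ge[OF finK[OF that(1)] that(2,4)] by (auto simp: seg_def)
    obtain l i l' i' where eq: "p = (l, i)" "q = (l', i')" by (cases p, cases q)
    show ?thesis
    proof (cases "l = l'")
      case False
      then show ?thesis by (auto simp: seg_def eq)
    next
      case True
      then have "i < i' \<or> i' < i" using pq eq by auto
      then show ?thesis using *[of l i i'] *[of l i' i] pq eq True by (auto simp: I_def)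
    qed
  qed
  have segE: "seg K p \<subseteq> E" "card (seg K p) = seg_len K p" if "p \<in> I" for p
  proof -
    obtain l i where li: "p = (l, i)" by (cases p)
    have "p \<in> E" using that IE by blast
    then have l: "l \<in> {1..m}" "i \<in> {1..n l}" by (auto simp: E li)
    then show "seg K p \<subseteq> E" unfolding E seg_def li by auto
    show "card (seg K p) = seg_len K p" by (simp add: seg_def seg_len_def card_cartesian_product_singleton)
  qed
  have blbl: "(\<Sum>e\<in>E. bl p e * bl q e) = of_bool (p = q) * real (seg_len K p)" if pq: "p \<in> I" "q \<in> I" for p q
  proof (cases "p = q")
    case True
    have "(\<Sum>e\<in>E. bl p e * bl q e) = (\<Sum>e\<in>E. of_bool (e \<in> seg K p))" by (intro sum.cong) (auto simp: bl_def True)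
    also have "\<dots> = real (card (E \<inter> seg K p))" using finE by (simp add: Int_def)
    also have "E \<inter> seg K p = seg K p" using segE(1)[OF pq(1)] by blast
    finally show ?thesis using segE(2)[OF pq(1)] True by simp
  next
    case False
    then have "(\<Sum>e\<in>E. bl p e * bl q e) = 0"
      using disj[OF pq False] by (intro sum.neutral) (auto simp: bl_def)
    then show ?thesis using False by simp
  qed
  have cc: "(\<forall>p\<in>I0. (\<Sum>e\<in>E. bl p e * c0 e) = 0) \<and> (\<Sum>e\<in>E. c0 e * c0 e) = g0"
  proof -
    from base show "(\<forall>p\<in>I0. (\<Sum>e\<in>E. bl p e * c0 e) = 0) \<and> (\<Sum>e\<in>E. c0 e * c0 e) = g0"
    proof
      assume "\<exists>l0\<in>{1..m}. K l0 \<noteq> {} \<and> c0 = cumul (l0, Min (K l0)) \<and> I0 = Sigma {1..m} K - {(l0, Min (K l0))} \<and> g0 = real (Min (K l0))"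
      then obtain l0 where l0: "l0 \<in> {1..m}" "K l0 \<noteq> {}" "c0 = cumul (l0, Min (K l0))" "I0 = I - {(l0, Min (K l0))}" "g0 = real (Min (K l0))"
        unfolding I_def by blast
      define q where "q = (l0, Min (K l0))"
      have q: "q \<in> I" using l0 finK[OF l0(1)] by (auto simp: I_def q_def)
      \<comment> \<open>The base vector is the indicator of the first segment of its walk, hence
        orthogonal to all segments of \<open>I0\<close>, with squared norm
        \<open>Min (K l0)\<close>.\<close>
      have cq: "c0 e = bl q e" if "e \<in> E" for e
        using that by (auto simp: l0(3) bl_def q_def seg_def prev_contact_def cumul_def E)
      have "(\<Sum>e\<in>E. bl p e * c0 e) = 0" if "p \<in> I0" for p
      proof -
        have "p \<in> I" "p \<noteq> q" using that l0(4) by (auto simp: q_def)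
        then show ?thesis using blbl[of p q] q cq by (simp cong: sum.cong)
      qed
      moreover have "(\<Sum>e\<in>E. c0 e * c0 e) = g0"
      proof -
        have "(\<Sum>e\<in>E. c0 e * c0 e) = real (seg_len K q)" using blbl[OF q q] cq by (simp cong: sum.cong)
        also have "seg_len K q = Min (K l0)" by (simp add: seg_len_def q_def prev_contact_def)
        finally show ?thesis using l0(5) by simp
      qed
      ultimately show ?thesis by blast
    qed simp
  qed
  have c0: "(\<Sum>e\<in>E. bl p e * c0 e) = 0" if "p \<in> I0" for p using cc that by blast
  have c00: "(\<Sum>e\<in>E. c0 e * c0 e) = g0" using cc by blast
  define G :: "real^'d^'d" where "G = (\<chi> j k. \<Sum>e\<in>E. D2 (\<beta> j) e * D2 (\<beta> k) e)"
  have G: "G $ j $ k = of_bool (j = k) * real (seg_len K (\<beta> j)) + g0 * fi (\<beta> j) * fi (\<beta> k)" for j k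
  proof -
    have "G $ j $ k = (\<Sum>e\<in>E. (bl (\<beta> j) e - fi (\<beta> j) * c0 e) * (bl (\<beta> k) e - fi (\<beta> k) * c0 e))"
      unfolding G_def by (simp, intro sum.cong) (auto simp: D2[OF \<beta>I])
    also have "\<dots> = (\<Sum>e\<in>E. bl (\<beta> j) e * bl (\<beta> k) e) - fi (\<beta> k) * (\<Sum>e\<in>E. bl (\<beta> j) e * c0 e)
        - fi (\<beta> j) * (\<Sum>e\<in>E. bl (\<beta> k) e * c0 e) + fi (\<beta> j) * fi (\<beta> k) * (\<Sum>e\<in>E. c0 e * c0 e)"
      unfolding sum_distrib_left sum_subtractf[symmetric] sum.distrib[symmetric]
      by (intro sum.cong refl) (simp add: algebra_simps)
    also have "\<dots> = of_bool (j = k) * real (seg_len K (\<beta> j)) + g0 * fi (\<beta> j) * fi (\<beta> k)"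
      unfolding blbl[OF \<beta>I \<beta>I] c0[OF \<beta>I0] c00 inj by simp
    finally show ?thesis .
  qed
  have "(\<chi> j k. \<Sum>e\<in>E. (cumul (\<beta> j) e - c0 e) * (cumul (\<beta> k) e - c0 e)) = L ** G ** transpose L"
  proof -
    have "(L ** G ** transpose L) $ j $ k = (\<Sum>e\<in>E. (cumul (\<beta> j) e - c0 e) * (cumul (\<beta> k) e - c0 e))" for j k
    proof -
      have "(L ** G ** transpose L) $ j $ k = (\<Sum>b\<in>UNIV. (\<Sum>a\<in>UNIV. L $ j $ a * (\<Sum>e\<in>E. D2 (\<beta> a) e * D2 (\<beta> b) e)) * L $ k $ b)"
        by (simp add: matrix_matrix_mult_def Finite_Cartesian_Product.transpose_def G_def)
      also have "\<dots> = (\<Sum>b\<in>UNIV. \<Sum>a\<in>UNIV. \<Sum>e\<in>E. L $ j $ a * D2 (\<beta> a) e * (L $ k $ b * D2 (\<beta> b) e))"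
        by (simp add: sum_distrib_left sum_distrib_right mult_ac)
      also have "\<dots> = (\<Sum>b\<in>UNIV. \<Sum>e\<in>E. \<Sum>a\<in>UNIV. L $ j $ a * D2 (\<beta> a) e * (L $ k $ b * D2 (\<beta> b) e))"
        by (intro sum.cong refl sum.swap)
      also have "\<dots> = (\<Sum>e\<in>E. \<Sum>b\<in>UNIV. \<Sum>a\<in>UNIV. L $ j $ a * D2 (\<beta> a) e * (L $ k $ b * D2 (\<beta> b) e))"
        by (rule sum.swap)
      also have "\<dots> = (\<Sum>e\<in>E. (\<Sum>a\<in>UNIV. L $ j $ a * D2 (\<beta> a) e) * (\<Sum>b\<in>UNIV. L $ k $ b * D2 (\<beta> b) e))"
        by (intro sum.cong refl) (simp add: sum_distrib_left sum_distrib_right)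
      finally show ?thesis by (simp only: LD)
    qed
    then show ?thesis by (simp add: vec_eq_iff)
  qed
  then have "det (\<chi> j k. \<Sum>e\<in>E. (cumul (\<beta> j) e - c0 e) * (cumul (\<beta> k) e - c0 e)) = det G"
    by (simp add: det_mul detL)
  also have "G = (\<chi> j k. of_bool (j = k) * real (seg_len K (\<beta> j)) + g0 * fi (\<beta> j) * fi (\<beta> k))"
    by (simp add: vec_eq_iff G)
  also have "det \<dots> = (\<Prod>k\<in>UNIV. real (seg_len K (\<beta> k))) * (1 + g0 * (\<Sum>k\<in>UNIV. fi (\<beta> k) / real (seg_len K (\<beta> k))))"
  proof (rule det_diag_plus_rank_one)
    fix k
    obtain l i where li: "\<beta> k = (l, i)" by (cases "\<beta> k")
    have l: "l \<in> {1..m}" "i \<in> K l" using \<beta>I[of k] li by (auto simp: I_def)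
    have "prev_contact (K l) i < i" using prev_contact_less[OF finK[OF l(1)] l(2)] K1[OF l(1)] by blast
    then show "0 < real (seg_len K (\<beta> k))" by (simp add: seg_len_def li)
  qed (simp add: fi_def)
  also have "(\<Prod>k\<in>UNIV. real (seg_len K (\<beta> k))) = (\<Prod>p\<in>I0. real (seg_len K p))"
    by (rule prod.reindex_bij_betw[OF \<beta>])
  also have "(\<Sum>k\<in>UNIV. fi (\<beta> k) / real (seg_len K (\<beta> k))) = (\<Sum>p\<in>I0. fi p / real (seg_len K p))"
    by (rule sum.reindex_bij_betw[OF \<beta>])
  finally show ?thesis by (simp add: E_def fi_def)
qed

lemma prod_seg_len:
  assumes "\<And>l. l \<in> {1..m} \<Longrightarrow> finite (K l)"
  shows "(\<Prod>p\<in>Sigma {1..m} K. real (seg_len K p)) = (\<Prod>l\<in>{l\<in>{1..m}. K l \<noteq> {}}. real (Min (K l)) * cfg_Delta (K l))"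
proof -
  have "(\<Prod>p\<in>Sigma {1..m} K. real (seg_len K p)) = (\<Prod>l=1..m. \<Prod>i\<in>K l. real (seg_len K (l, i)))"
    using assms by (subst prod.Sigma) auto
  also have "\<dots> = (\<Prod>l\<in>{l\<in>{1..m}. K l \<noteq> {}}. \<Prod>i\<in>K l. real (seg_len K (l, i)))"
    by (rule prod.mono_neutral_right) auto
  also have "\<dots> = (\<Prod>l\<in>{l\<in>{1..m}. K l \<noteq> {}}. real (Min (K l)) * cfg_Delta (K l))"
  proof (intro prod.cong refl)
    fix l assume l: "l \<in> {l\<in>{1..m}. K l \<noteq> {}}"
    then have "(\<Prod>i\<in>K l. real (seg_len K (l, i))) = real (seg_len K (l, Min (K l))) * (\<Prod>i\<in>K l - {Min (K l)}. real (seg_len K (l, i)))"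
      using assms by (intro prod.remove) auto
    also have "(\<Prod>i\<in>K l - {Min (K l)}. real (seg_len K (l, i))) = cfg_Delta (K l)"
      unfolding cfg_Delta_def by (intro prod.cong) (auto simp: seg_len_def prev_contact_def)
    also have "seg_len K (l, Min (K l)) = Min (K l)" by (simp add: seg_len_def prev_contact_def)
    finally show "(\<Prod>i\<in>K l. real (seg_len K (l, i))) = real (Min (K l)) * cfg_Delta (K l)" .
  qed
  finally show ?thesis .
qed

lemma gram_det_origin:
  fixes \<beta> :: "'d::finite \<Rightarrow> nat \<times> nat"
  assumes K: "\<And>l. l \<in> {1..m} \<Longrightarrow> K l \<subseteq> {1..n l}" and \<beta>: "bij_betw \<beta> UNIV (Sigma {1..m} K)"
  shows "det (\<chi> j k. \<Sum>e\<in>steps m n. cumul (\<beta> j) e * cumul (\<beta> k) e)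
     = (\<Prod>l\<in>{l\<in>{1..m}. K l \<noteq> {}}. real (Min (K l)) * cfg_Delta (K l))"
proof -
  have "finite (K l)" if "l \<in> {1..m}" for l using K[OF that] finite_subset by blast
  then show ?thesis
    using gram_det[OF K \<beta>, where ?c0.0="\<lambda>_. 0" and ?g0.0=0] prod_seg_len[of m K] by simp
qed

text \<open>The origin of the factor \<open>s\<close>: restoring the missing first segment of length
  \<open>Min (K l0)\<close> turns the rank one correction into the sum of the reciprocal first
  contact times over all walks with contacts, whatever the base walk.\<close>

lemma gram_det_affine:
  fixes \<beta> :: "'d::finite \<Rightarrow> nat \<times> nat"
  assumes K: "\<And>l. l \<in> {1..m} \<Longrightarrow> K l \<subseteq> {1..n l}" and l0: "l0 \<in> {1..m}" "K l0 \<noteq> {}"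
    and \<beta>: "bij_betw \<beta> UNIV (Sigma {1..m} K - {(l0, Min (K l0))})"
  defines "i0 \<equiv> (l0, Min (K l0))"
  shows "det (\<chi> j k. \<Sum>e\<in>steps m n. (cumul (\<beta> j) e - cumul i0 e) * (cumul (\<beta> k) e - cumul i0 e))
     = cfg_s m K * (\<Prod>l\<in>{l\<in>{1..m}. K l \<noteq> {}}. real (Min (K l)) * cfg_Delta (K l))"
proof -
  have fin: "finite (K l)" if "l \<in> {1..m}" for l using K[OF that] finite_subset by blast
  let ?I = "Sigma {1..m} K"
  let ?f = "\<lambda>p. of_bool (snd p = Min (K (fst p))) / real (seg_len K p)"
  have finI: "finite ?I" using fin by auto
  have i0: "i0 \<in> ?I" using l0 fin by (auto simp: i0_def)
  have len: "seg_len K (l, Min (K l)) = Min (K l)" for l by (simp add: seg_len_def prev_contact_def)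
  have "Min (K l0) \<in> K l0" using l0 fin by (intro Min_in) auto
  then have pos: "real (Min (K l0)) > 0" using K[OF l0(1)] by auto
  have "det (\<chi> j k. \<Sum>e\<in>steps m n. (cumul (\<beta> j) e - cumul i0 e) * (cumul (\<beta> k) e - cumul i0 e))
    = (\<Prod>p\<in>?I - {i0}. real (seg_len K p)) * (1 + real (Min (K l0)) * (\<Sum>p\<in>?I - {i0}. ?f p))"
    unfolding i0_def by (rule gram_det[OF K \<beta>]) (use l0 in auto)
  also have "\<dots> = (real (Min (K l0)) * (\<Prod>p\<in>?I - {i0}. real (seg_len K p))) * (1 / real (Min (K l0)) + (\<Sum>p\<in>?I - {i0}. ?f p))"
    using pos by (simp add: algebra_simps)
  also have "real (Min (K l0)) * (\<Prod>p\<in>?I - {i0}. real (seg_len K p)) = (\<Prod>p\<in>?I. real (seg_len K p))"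
    using finI i0 len[of l0] by (subst (2) prod.remove[of _ i0]) (auto simp: i0_def)
  also have "1 / real (Min (K l0)) + (\<Sum>p\<in>?I - {i0}. ?f p) = (\<Sum>p\<in>?I. ?f p)"
    using finI i0 len[of l0] by (subst (2) sum.remove[of _ i0]) (auto simp: i0_def)
  also have "(\<Sum>p\<in>?I. ?f p) = cfg_s m K"
  proof -
    have "(\<Sum>p\<in>?I. ?f p) = (\<Sum>p\<in>(\<lambda>l. (l, Min (K l))) ` {l\<in>{1..m}. K l \<noteq> {}}. ?f p)"
      by (rule sum.mono_neutral_right[OF finI]) (use fin in \<open>auto simp: image_iff intro!: Min_in\<close>)
    also have "\<dots> = cfg_s m K"
      unfolding cfg_s_def by (subst sum.reindex) (auto simp: inj_on_def len)
    finally show ?thesis .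
  qed
  finally show ?thesis using prod_seg_len[of m K] fin by (simp add: mult.commute)
qed

text \<open>A configuration lists, walk by walk, the vertices of a face. Since
  \<open>configs\<close> forces \<open>K l = {}\<close> outside \<open>{1..m}\<close>, the sections
  of the vertex set recover \<open>K\<close> exactly.\<close>

lemma bij_betw_configs:
  "bij_betw (\<lambda>K. Sigma {1..m} K) (configs m n k) {I. I \<subseteq> steps m n \<and> card I = k}"
proof (rule bij_betwI[where g="\<lambda>I l. {i. (l, i) \<in> I}"])
  show "(\<lambda>K. Sigma {1..m} K) \<in> configs m n k \<rightarrow> {I. I \<subseteq> steps m n \<and> card I = k}"
  proof
    fix K assume "K \<in> configs m n k"
    then have K: "K l \<subseteq> (if l \<in> {1..m} then {1..n l} else {})" "(\<Sum>l=1..m. card (K l)) = k" for l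
      by (auto simp: configs_def)
    have "finite (K l)" for l by (rule finite_subset[OF K(1)]) simp
    then have "card (Sigma {1..m} K) = k" using K(2) by (simp add: card_SigmaI)
    moreover have "Sigma {1..m} K \<subseteq> steps m n" using K(1) by (fastforce simp: steps_def)
    ultimately show "Sigma {1..m} K \<in> {I. I \<subseteq> steps m n \<and> card I = k}" by blast
  qed
  show "(\<lambda>I l. {i. (l, i) \<in> I}) \<in> {I. I \<subseteq> steps m n \<and> card I = k} \<rightarrow> configs m n k"
  proof
    fix I assume I: "I \<in> {I. I \<subseteq> steps m n \<and> card I = k}"
    have eq: "Sigma {1..m} (\<lambda>l. {i. (l, i) \<in> I}) = I" using I by (auto simp: steps_def)
    have sub: "{i. (l, i) \<in> I} \<subseteq> (if l \<in> {1..m} then {1..n l} else {})" for l using I by (auto simp: steps_def)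
    have "finite {i. (l, i) \<in> I}" for l by (rule finite_subset[OF sub[of l]]) simp
    then have "(\<Sum>l=1..m. card {i. (l, i) \<in> I}) = card (Sigma {1..m} (\<lambda>l. {i. (l, i) \<in> I}))"
      by (simp add: card_SigmaI)
    then show "(\<lambda>l. {i. (l, i) \<in> I}) \<in> configs m n k" using sub I by (simp add: configs_def eq[simplified])
  qed
  show "(\<lambda>l. {i. (l, i) \<in> Sigma {1..m} K}) = K" if "K \<in> configs m n k" for K
    using that by (fastforce simp: configs_def fun_eq_iff split: if_splits)
  show "Sigma {1..m} (\<lambda>l. {i. (l, i) \<in> I}) = I" if "I \<in> {I. I \<subseteq> steps m n \<and> card I = k}" for I
    using that by (auto simp: steps_def)
qed

section \<open>Change of variables for a facet\<close>

lemma measurable_fst_PiM_coordinate: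
    "(\<lambda>p. fst p j) \<in> borel_measurable (PiM I (\<lambda>_. lborel :: real measure) \<Otimes>\<^sub>M N)"
  and measurable_snd_PiM_coordinate:
    "(\<lambda>p. snd p j) \<in> borel_measurable (N \<Otimes>\<^sub>M PiM I (\<lambda>_. lborel :: real measure))"
  by (rule measurable_compose[OF measurable_fst measurable_PiM_lborel_coordinate],
      rule measurable_compose[OF measurable_snd measurable_PiM_lborel_coordinate])

lemma measurable_fst_vec_nth:
    "(\<lambda>p. fst p $ i) \<in> borel_measurable ((borel :: (real^'d) measure) \<Otimes>\<^sub>M N)"
  and measurable_fst_fst_vec_nth:
    "(\<lambda>p. fst (fst p) $ i) \<in> borel_measurable (((borel :: (real^'d) measure) \<Otimes>\<^sub>M N) \<Otimes>\<^sub>M N')"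
proof -
  have nth: "(\<lambda>v::real^'d. v $ i) \<in> borel_measurable borel" by simp
  show "(\<lambda>p. fst p $ i) \<in> borel_measurable ((borel :: (real^'d) measure) \<Otimes>\<^sub>M N)"
    by (rule measurable_compose[OF measurable_fst nth])
  show "(\<lambda>p. fst (fst p) $ i) \<in> borel_measurable (((borel :: (real^'d) measure) \<Otimes>\<^sub>M N) \<Otimes>\<^sub>M N')"
    by (rule measurable_compose[OF measurable_compose[OF measurable_fst measurable_fst] nth])
qed

text \<open>Separates the heights of the vertices labelled by \<open>\<beta>\<close>, collected in
  one vector, from all other heights.\<close>

lemma nn_integral_PiM_split_vec:
  fixes \<beta> :: "'d::finite \<Rightarrow> 'i" and g :: "('i \<Rightarrow> real) \<Rightarrow> ennreal"
  assumes E: "finite E" and \<beta>: "inj \<beta>" "range \<beta> \<subseteq> E"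
    and g: "g \<in> borel_measurable (PiM E (\<lambda>_. lborel))"
  shows "(\<integral>\<^sup>+T. g T \<partial>PiM E (\<lambda>_. lborel))
    = (\<integral>\<^sup>+(v::real^'d). \<integral>\<^sup>+y. g (\<lambda>j\<in>E. if j \<in> range \<beta> then v $ inv \<beta> j else y j) \<partial>PiM (E - range \<beta>) (\<lambda>_. lborel) \<partial>lborel)"
proof -
  interpret L: product_sigma_finite "\<lambda>_::'i. lborel :: real measure" by (rule product_sigma_finite_lborel)
  let ?A = "range \<beta>" and ?R = "E - range \<beta>"
  let ?PR = "PiM ?R (\<lambda>_. lborel :: real measure)" and ?PA = "PiM ?A (\<lambda>_. lborel :: real measure)"
  interpret R: finite_product_sigma_finite "\<lambda>_::'i. lborel :: real measure" ?R by standard (use E in auto)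
  have EU: "E = ?A \<union> ?R" using \<beta> by auto
  define H where "H t = (\<integral>\<^sup>+y. g (\<lambda>j\<in>E. if j \<in> ?A then t j else y j) \<partial>?PR)" for t
  have m1: "(\<lambda>p. \<lambda>j\<in>E. if j \<in> ?A then fst p j else snd p j) \<in> measurable (?PA \<Otimes>\<^sub>M ?PR) (PiM E (\<lambda>_. lborel :: real measure))"
  proof (rule measurable_restrict)
    fix j assume "j \<in> E"
    show "(\<lambda>p. if j \<in> ?A then fst p j else snd p j) \<in> measurable (?PA \<Otimes>\<^sub>M ?PR) lborel"
      by (cases "j \<in> ?A") (simp_all add: measurable_fst_PiM_coordinate measurable_snd_PiM_coordinate)
  qed
  have Hm: "H \<in> borel_measurable ?PA"
    unfolding H_def using measurable_compose[OF m1 g]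
    by (intro R.borel_measurable_nn_integral) (simp add: split_beta')
  have vm: "(\<lambda>v::real^'d. \<lambda>i\<in>?A. v $ inv \<beta> i) \<in> measurable borel ?PA"
    by (intro measurable_restrict) simp
  have "(\<integral>\<^sup>+T. g T \<partial>PiM E (\<lambda>_. lborel)) = (\<integral>\<^sup>+t. \<integral>\<^sup>+y. g (merge ?A ?R (t, y)) \<partial>?PR \<partial>?PA)"
    using L.product_nn_integral_fold[of ?A ?R g] g E EU by (metis Diff_disjoint finite finite_Diff finite_imageI)
  also have "\<dots> = (\<integral>\<^sup>+t. H t \<partial>?PA)"
    unfolding H_def using \<beta>(2) by (intro nn_integral_cong arg_cong[where f=g]) (auto simp: merge_def fun_eq_iff)
  also have "\<dots> = (\<integral>\<^sup>+t. H (\<lambda>i\<in>?A. (\<chi> k. t (\<beta> k)) $ inv \<beta> i) \<partial>?PA)"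
  proof (intro nn_integral_cong arg_cong[where f=H])
    fix t :: "'i \<Rightarrow> real" assume "t \<in> space ?PA"
    then have "t i = undefined" if "i \<notin> ?A" for i using that by (auto simp: space_PiM PiE_def extensional_def)
    then show "t = (\<lambda>i\<in>?A. (\<chi> k. t (\<beta> k)) $ inv \<beta> i)"
      using \<beta>(1) by (auto simp: fun_eq_iff f_inv_into_f)
  qed
  also have "\<dots> = (\<integral>\<^sup>+(v::real^'d). H (\<lambda>i\<in>?A. v $ inv \<beta> i) \<partial>lborel)"
    by (rule nn_integral_lborel_vec[OF measurable_compose[OF vm Hm] \<beta>(1), symmetric])
  also have "\<dots> = (\<integral>\<^sup>+(v::real^'d). \<integral>\<^sup>+y. g (\<lambda>j\<in>E. if j \<in> range \<beta> then v $ inv \<beta> j else y j) \<partial>?PR \<partial>lborel)"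
    unfolding H_def by (intro nn_integral_cong arg_cong[where f=g]) (auto simp: fun_eq_iff)
  finally show ?thesis .
qed

text \<open>A hyperplane through the origin is given by its slope alone. The heights over
  \<open>I\<close> are the linear image of the slope under the matrix with rows
  \<open>x (\<beta> k)\<close>, and each other height is replaced by its gap in units of
  \<open>slope_norm\<close>.\<close>

lemma change_of_variables_origin:
  fixes \<beta> :: "'d::finite \<Rightarrow> 'i" and x :: "'i \<Rightarrow> real^'d" and g :: "('i \<Rightarrow> real) \<Rightarrow> ennreal"
  assumes E: "finite E" and \<beta>: "bij_betw \<beta> UNIV I" "I \<subseteq> E"
    and det: "det (\<chi> k. x (\<beta> k)) \<noteq> 0"
    and g: "g \<in> borel_measurable (PiM E (\<lambda>_. lborel))"
  shows "(\<integral>\<^sup>+T. g T \<partial>PiM E (\<lambda>_. lborel)) = ennreal \<bar>det (\<chi> k. x (\<beta> k))\<bar> *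
    (\<integral>\<^sup>+z. ennreal (slope_norm (fst z) ^ card (E - I))
        * g (\<lambda>j\<in>E. fst z \<bullet> x j - slope_norm (fst z) * (if j \<in> I then 0 else snd z j))
      \<partial>(lborel \<Otimes>\<^sub>M PiM (E - I) (\<lambda>_. lborel)))"
proof -
  let ?A = "\<chi> k. x (\<beta> k) :: real^'d^'d" and ?R = "E - I"
  let ?PR = "PiM ?R (\<lambda>_. lborel :: real measure)"
  interpret L: product_sigma_finite "\<lambda>_::'i. lborel :: real measure" by (rule product_sigma_finite_lborel)
  interpret R: finite_product_sigma_finite "\<lambda>_::'i. lborel :: real measure" ?R by standard (use E in auto)
  have inj: "inj \<beta>" and rng: "range \<beta> = I" using \<beta>(1) by (auto simp: bij_betw_def)
  have inv: "inv \<beta> (\<beta> k) = k" for k using inj by simp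
  define \<Phi> where "\<Phi> v = (\<integral>\<^sup>+y. g (\<lambda>j\<in>E. if j \<in> I then v $ inv \<beta> j else y j) \<partial>?PR)" for v :: "real^'d"
  have cm: "(\<lambda>p. \<lambda>j\<in>E. if j \<in> I then fst p $ inv \<beta> j else snd p j) \<in> measurable (borel \<Otimes>\<^sub>M ?PR) (PiM E (\<lambda>_. lborel :: real measure))"
  proof (rule measurable_restrict)
    fix j assume "j \<in> E"
    show "(\<lambda>p. if j \<in> I then fst p $ inv \<beta> j else snd p j) \<in> measurable ((borel :: (real^'d) measure) \<Otimes>\<^sub>M ?PR) lborel"
      by (cases "j \<in> I") (simp_all add: measurable_snd_PiM_coordinate measurable_fst_vec_nth measurable_fst_fst_vec_nth)
  qed
  have \<Phi>m: "\<Phi> \<in> borel_measurable borel"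
    unfolding \<Phi>_def using measurable_compose[OF cm g] by (intro R.borel_measurable_nn_integral) (simp add: split_beta')
  have tm: "(\<lambda>z. \<lambda>j\<in>E. fst z \<bullet> x j - slope_norm (fst z) * (if j \<in> I then 0 else snd z j)) \<in> measurable (borel \<Otimes>\<^sub>M ?PR) (PiM E (\<lambda>_. lborel :: real measure))"
  proof (rule measurable_restrict)
    fix j assume "j \<in> E"
    have [measurable]: "(\<lambda>z. snd z j) \<in> borel_measurable ((borel :: (real^'d) measure) \<Otimes>\<^sub>M ?PR)"
      by (rule measurable_compose[OF measurable_snd measurable_PiM_lborel_coordinate])
    show "(\<lambda>z. fst z \<bullet> x j - slope_norm (fst z) * (if j \<in> I then 0 else snd z j)) \<in> measurable (borel \<Otimes>\<^sub>M ?PR) lborel"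
      by (cases "j \<in> I") simp_all
  qed
  have "(\<integral>\<^sup>+T. g T \<partial>PiM E (\<lambda>_. lborel)) = (\<integral>\<^sup>+v. \<Phi> v \<partial>lborel)"
    using nn_integral_PiM_split_vec[OF E inj _ g] \<beta>(2) unfolding \<Phi>_def rng by simp
  also have "\<dots> = ennreal \<bar>det ?A\<bar> * (\<integral>\<^sup>+a. \<Phi> (?A *v a) \<partial>lborel)"
    by (rule nn_integral_lborel_matrix[OF det \<Phi>m])
  also have "(\<integral>\<^sup>+a. \<Phi> (?A *v a) \<partial>lborel) = (\<integral>\<^sup>+a. \<integral>\<^sup>+V. ennreal (slope_norm a ^ card ?R)
        * g (\<lambda>j\<in>E. a \<bullet> x j - slope_norm a * (if j \<in> I then 0 else V j)) \<partial>?PR \<partial>lborel)"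
  proof (intro nn_integral_cong)
    fix a :: "real^'d"
    let ?v = "?A *v a"
    have v: "?v $ inv \<beta> j = a \<bullet> x j" if j: "j \<in> I" for j
    proof -
      obtain k where k: "j = \<beta> k" using j unfolding rng[symmetric] by (rule rangeE)
      show ?thesis by (simp add: k inv matrix_vector_mult_def inner_vec_def mult.commute)
    qed
    have gm: "(\<lambda>y. g (\<lambda>j\<in>E. if j \<in> I then ?v $ inv \<beta> j else y j)) \<in> borel_measurable ?PR"
      using measurable_compose[OF measurable_Pair1'[of ?v borel ?PR] measurable_compose[OF cm g]] by (simp cong: if_cong)
    have gm2: "(\<lambda>V. g (\<lambda>j\<in>E. a \<bullet> x j - slope_norm a * (if j \<in> I then 0 else V j))) \<in> borel_measurable ?PR"
      using measurable_compose[OF measurable_Pair1'[of a borel ?PR] measurable_compose[OF tm g]] by (simp cong: if_cong)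
    have "\<Phi> ?v = ennreal (slope_norm a ^ card ?R) * (\<integral>\<^sup>+V. g (\<lambda>j\<in>E. if j \<in> I then ?v $ inv \<beta> j else (\<lambda>j\<in>?R. a \<bullet> x j - slope_norm a * V j) j) \<partial>?PR)"
      unfolding \<Phi>_def using nn_integral_PiM_affine[of ?R "slope_norm a" _ "\<lambda>j. a \<bullet> x j", OF _ _ gm] E by simp
    also have "(\<integral>\<^sup>+V. g (\<lambda>j\<in>E. if j \<in> I then ?v $ inv \<beta> j else (\<lambda>j\<in>?R. a \<bullet> x j - slope_norm a * V j) j) \<partial>?PR)
      = (\<integral>\<^sup>+V. g (\<lambda>j\<in>E. a \<bullet> x j - slope_norm a * (if j \<in> I then 0 else V j)) \<partial>?PR)"
      by (intro nn_integral_cong arg_cong[where f=g]) (auto simp: fun_eq_iff v)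
    finally show "\<Phi> ?v = (\<integral>\<^sup>+V. ennreal (slope_norm a ^ card ?R) * g (\<lambda>j\<in>E. a \<bullet> x j - slope_norm a * (if j \<in> I then 0 else V j)) \<partial>?PR)"
      using gm2 by (simp add: nn_integral_cmult)
  qed
  also have "\<dots> = (\<integral>\<^sup>+z. ennreal (slope_norm (fst z) ^ card (E - I))
        * g (\<lambda>j\<in>E. fst z \<bullet> x j - slope_norm (fst z) * (if j \<in> I then 0 else snd z j)) \<partial>(lborel \<Otimes>\<^sub>M ?PR))"
    using measurable_compose[OF tm g] by (subst R.nn_integral_fst[symmetric]) (simp_all cong: if_cong)
  finally show ?thesis .
qed

text \<open>Relative to the base vertex \<open>i0\<close> the slope enters as in the case through
  the origin. The height of \<open>i0\<close> itself is replaced by the offset in units of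
  \<open>slope_norm\<close>, which accounts for the additional power.\<close>

lemma change_of_variables_affine:
  fixes \<beta> :: "'d::finite \<Rightarrow> 'i" and x :: "'i \<Rightarrow> real^'d" and g :: "('i \<Rightarrow> real) \<Rightarrow> ennreal"
  assumes E: "finite E" and \<beta>: "bij_betw \<beta> UNIV (I - {i0})" "I \<subseteq> E" "i0 \<in> I"
    and det: "det (\<chi> k. x (\<beta> k) - x i0) \<noteq> 0"
    and g: "g \<in> borel_measurable (PiM E (\<lambda>_. lborel))"
  shows "(\<integral>\<^sup>+T. g T \<partial>PiM E (\<lambda>_. lborel)) = ennreal \<bar>det (\<chi> k. x (\<beta> k) - x i0)\<bar> *
    (\<integral>\<^sup>+z. ennreal (slope_norm (fst z) ^ Suc (card (E - I)))
        * g (\<lambda>j\<in>E. fst z \<bullet> x j + slope_norm (fst z) * (fst (snd z) - (if j \<in> I then 0 else snd (snd z) j)))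
      \<partial>(lborel \<Otimes>\<^sub>M (lborel \<Otimes>\<^sub>M PiM (E - I) (\<lambda>_. lborel))))"
proof -
  let ?A = "\<chi> k. x (\<beta> k) - x i0 :: real^'d^'d" and ?R = "E - I"
  let ?PR = "PiM ?R (\<lambda>_. lborel :: real measure)"
  let ?\<sigma> = "slope_norm :: real^'d \<Rightarrow> real"
  interpret L: product_sigma_finite "\<lambda>_::'i. lborel :: real measure" by (rule product_sigma_finite_lborel)
  interpret R: finite_product_sigma_finite "\<lambda>_::'i. lborel :: real measure" ?R by standard (use E in auto)
  interpret rR: pair_sigma_finite "lborel :: real measure" ?PR ..
  have inj: "inj \<beta>" and rng: "range \<beta> = I - {i0}" using \<beta>(1) by (auto simp: bij_betw_def)
  have inv: "inv \<beta> (\<beta> k) = k" for k using inj by simp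
  have Ri: "E - range \<beta> = insert i0 ?R" "i0 \<notin> ?R" "finite ?R" using rng \<beta> E by auto
  define comb where "comb v s y = (\<lambda>j\<in>E. if j \<in> range \<beta> then v $ inv \<beta> j else if j = i0 then s else y j)" for v :: "real^'d" and s y
  define \<Phi> where "\<Phi> v s = (\<integral>\<^sup>+y. g (comb v s y) \<partial>?PR)" for v s
  have cm: "(\<lambda>p. comb (fst (fst p)) (snd (fst p)) (snd p)) \<in> measurable ((borel \<Otimes>\<^sub>M borel) \<Otimes>\<^sub>M ?PR) (PiM E (\<lambda>_. lborel :: real measure))"
    unfolding comb_def
  proof (rule measurable_restrict)
    fix j assume "j \<in> E"
    show "(\<lambda>p. if j \<in> range \<beta> then fst (fst p) $ inv \<beta> j else if j = i0 then snd (fst p) else snd p j) \<in> measurable (((borel :: (real^'d) measure) \<Otimes>\<^sub>M borel) \<Otimes>\<^sub>M ?PR) lborel"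
      by (cases "j \<in> range \<beta>"; cases "j = i0") (simp_all add: measurable_snd_PiM_coordinate measurable_fst_vec_nth measurable_fst_fst_vec_nth)
  qed
  have \<Phi>m: "(\<lambda>q. \<Phi> (fst q) (snd q)) \<in> borel_measurable (borel \<Otimes>\<^sub>M borel)"
    unfolding \<Phi>_def using measurable_compose[OF cm g] by (intro R.borel_measurable_nn_integral) (simp add: split_beta')
  have tm: "(\<lambda>z. \<lambda>j\<in>E. fst z \<bullet> x j + ?\<sigma> (fst z) * (fst (snd z) - (if j \<in> I then 0 else snd (snd z) j))) \<in> measurable (borel \<Otimes>\<^sub>M (borel \<Otimes>\<^sub>M ?PR)) (PiM E (\<lambda>_. lborel :: real measure))"
  proof (rule measurable_restrict)
    fix j assume "j \<in> E"
    have [measurable]: "(\<lambda>z. snd (snd z) j) \<in> borel_measurable ((borel :: (real^'d) measure) \<Otimes>\<^sub>M ((borel :: real measure) \<Otimes>\<^sub>M ?PR))"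
      by (rule measurable_compose[OF measurable_compose[OF measurable_snd measurable_snd] measurable_PiM_lborel_coordinate])
    show "(\<lambda>z. fst z \<bullet> x j + ?\<sigma> (fst z) * (fst (snd z) - (if j \<in> I then 0 else snd (snd z) j))) \<in> measurable (borel \<Otimes>\<^sub>M (borel \<Otimes>\<^sub>M ?PR)) lborel"
      by (cases "j \<in> I") simp_all
  qed
  have "(\<integral>\<^sup>+T. g T \<partial>PiM E (\<lambda>_. lborel)) = (\<integral>\<^sup>+v. \<integral>\<^sup>+s. \<Phi> v s \<partial>lborel \<partial>lborel)"
  proof -
    have "(\<integral>\<^sup>+T. g T \<partial>PiM E (\<lambda>_. lborel)) = (\<integral>\<^sup>+v. \<integral>\<^sup>+y. g (\<lambda>j\<in>E. if j \<in> range \<beta> then v $ inv \<beta> j else y j) \<partial>PiM (insert i0 ?R) (\<lambda>_. lborel) \<partial>lborel)"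
      using nn_integral_PiM_split_vec[OF E inj _ g] \<beta>(2) rng unfolding Ri(1) by auto
    also have "\<dots> = (\<integral>\<^sup>+v. \<integral>\<^sup>+s. \<Phi> v s \<partial>lborel \<partial>lborel)"
    proof (rule nn_integral_cong)
      fix v :: "real^'d"
      have m: "(\<lambda>y. g (\<lambda>j\<in>E. if j \<in> range \<beta> then v $ inv \<beta> j else y j)) \<in> borel_measurable (PiM (insert i0 ?R) (\<lambda>_. lborel))"
      proof (rule measurable_compose[OF measurable_restrict g])
        fix j assume "j \<in> E"
        show "(\<lambda>y. if j \<in> range \<beta> then v $ inv \<beta> j else y j) \<in> measurable (PiM (insert i0 ?R) (\<lambda>_. lborel)) lborel"
          using measurable_PiM_lborel_coordinate[of j "insert i0 ?R"] by (cases "j \<in> range \<beta>") simp_all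
      qed
      show "(\<integral>\<^sup>+y. g (\<lambda>j\<in>E. if j \<in> range \<beta> then v $ inv \<beta> j else y j) \<partial>PiM (insert i0 ?R) (\<lambda>_. lborel)) = (\<integral>\<^sup>+s. \<Phi> v s \<partial>lborel)"
        unfolding \<Phi>_def comb_def L.product_nn_integral_insert_rev[OF Ri(3,2) m]
        by (intro nn_integral_cong arg_cong[where f=g]) (auto simp: fun_eq_iff)
    qed
    finally show ?thesis .
  qed
  \<comment> \<open>The height \<open>s\<close> of the base vertex is held fixed while the heights
    of the other face vertices are replaced by the slope; afterwards the order is exchanged again
    and, for fixed slope, \<open>s\<close> is replaced by the offset.\<close>
  also have "\<dots> = (\<integral>\<^sup>+s. \<integral>\<^sup>+v. \<Phi> v s \<partial>lborel \<partial>lborel)"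
    by (rule lborel_pair.Fubini'[symmetric]) (use \<Phi>m in \<open>simp add: split_beta'\<close>)
  also have "\<dots> = (\<integral>\<^sup>+s. ennreal \<bar>det ?A\<bar> * (\<integral>\<^sup>+a. \<Phi> ((\<chi> k. s) + ?A *v a) s \<partial>lborel) \<partial>lborel)"
  proof (rule nn_integral_cong)
    fix s
    have "(\<lambda>v. \<Phi> v s) \<in> borel_measurable borel"
      using measurable_compose[OF measurable_Pair2'[of s borel borel] \<Phi>m] by simp
    then show "(\<integral>\<^sup>+v. \<Phi> v s \<partial>lborel) = ennreal \<bar>det ?A\<bar> * (\<integral>\<^sup>+a. \<Phi> ((\<chi> k. s) + ?A *v a) s \<partial>lborel)"
      by (rule nn_integral_lborel_affine_matrix[OF det])
  qed
  also have "\<dots> = ennreal \<bar>det ?A\<bar> * (\<integral>\<^sup>+s. (\<integral>\<^sup>+a. \<Phi> ((\<chi> k. s) + ?A *v a) s \<partial>lborel) \<partial>lborel)"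
  proof (rule nn_integral_cmult)
    have "(\<lambda>q. \<Phi> ((\<chi> k. fst q) + ?A *v snd q) (fst q)) \<in> borel_measurable (borel \<Otimes>\<^sub>M borel)"
      by (rule measurable_compose[of "\<lambda>q. ((\<chi> k. fst q) + ?A *v snd q, fst q)", OF _ \<Phi>m, simplified])
         (auto intro!: measurable_Pair borel_measurable_add borel_measurable_vec_lambda measurable_compose[OF measurable_snd borel_measurable_matrix_vector_mult])
    then show "(\<lambda>s. \<integral>\<^sup>+a. \<Phi> ((\<chi> k. s) + ?A *v a) s \<partial>lborel) \<in> borel_measurable lborel"
      by (intro lborel.borel_measurable_nn_integral) (simp add: split_beta')
  qed
  also have "(\<integral>\<^sup>+s. (\<integral>\<^sup>+a. \<Phi> ((\<chi> k. s) + ?A *v a) s \<partial>lborel) \<partial>lborel) = (\<integral>\<^sup>+a. (\<integral>\<^sup>+s. \<Phi> ((\<chi> k. s) + ?A *v a) s \<partial>lborel) \<partial>lborel)"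
  proof (rule lborel_pair.Fubini')
    have "(\<lambda>q. \<Phi> ((\<chi> k. snd q) + ?A *v fst q) (snd q)) \<in> borel_measurable (borel \<Otimes>\<^sub>M borel)"
      by (rule measurable_compose[of "\<lambda>q. ((\<chi> k. snd q) + ?A *v fst q, snd q)", OF _ \<Phi>m, simplified])
         (auto intro!: measurable_Pair borel_measurable_add borel_measurable_vec_lambda measurable_compose[OF measurable_fst borel_measurable_matrix_vector_mult])
    then show "(\<lambda>(a, s). \<Phi> ((\<chi> k. s) + ?A *v a) s) \<in> borel_measurable (lborel \<Otimes>\<^sub>M lborel)"
      by (simp add: split_beta')
  qed
  also have "\<dots> = (\<integral>\<^sup>+a. \<integral>\<^sup>+r. \<integral>\<^sup>+V. ennreal (?\<sigma> a ^ Suc (card ?R))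
        * g (\<lambda>j\<in>E. a \<bullet> x j + ?\<sigma> a * (r - (if j \<in> I then 0 else V j))) \<partial>?PR \<partial>lborel \<partial>lborel)"
  proof (rule nn_integral_cong)
    fix a :: "real^'d"
    let ?v = "\<lambda>s. (\<chi> k. s) + ?A *v a" and ?s = "\<lambda>r. a \<bullet> x i0 + ?\<sigma> a * r"
    have v: "?v (?s r) $ inv \<beta> j = a \<bullet> x j + ?\<sigma> a * r" if j: "j \<in> range \<beta>" for j r
    proof -
      obtain k where k: "j = \<beta> k" using j by (rule rangeE)
      have "(?A *v a) $ k = a \<bullet> (x (\<beta> k) - x i0)"
        by (simp add: matrix_vector_mult_def inner_vec_def mult.commute)
      then show ?thesis by (simp add: k inv inner_diff_right)
    qed
    have m1: "(\<lambda>s. \<Phi> (?v s) s) \<in> borel_measurable borel"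
      by (rule measurable_compose[of "\<lambda>s. (?v s, s)", OF _ \<Phi>m, simplified])
         (auto intro!: measurable_Pair borel_measurable_add borel_measurable_vec_lambda)
    have "(\<integral>\<^sup>+s. \<Phi> (?v s) s \<partial>lborel) = ennreal (?\<sigma> a) * (\<integral>\<^sup>+r. \<Phi> (?v (?s r)) (?s r) \<partial>lborel)"
      using nn_integral_real_affine[OF m1, of "?\<sigma> a" "a \<bullet> x i0"] slope_norm_pos[of a] by (simp add: less_imp_le)
    also have "\<dots> = (\<integral>\<^sup>+r. ennreal (?\<sigma> a) * \<Phi> (?v (?s r)) (?s r) \<partial>lborel)"
      by (rule nn_integral_cmult[symmetric]) (auto intro!: measurable_compose[OF _ m1])
    also have "\<dots> = (\<integral>\<^sup>+r. \<integral>\<^sup>+V. ennreal (?\<sigma> a ^ Suc (card ?R)) * g (\<lambda>j\<in>E. a \<bullet> x j + ?\<sigma> a * (r - (if j \<in> I then 0 else V j))) \<partial>?PR \<partial>lborel)"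
    proof (rule nn_integral_cong)
      fix r
      have gm: "(\<lambda>y. g (comb (?v (?s r)) (?s r) y)) \<in> borel_measurable ?PR"
        using measurable_compose[OF measurable_Pair1'[of "(?v (?s r), ?s r)" "borel \<Otimes>\<^sub>M borel" ?PR] measurable_compose[OF cm g]]
        by (simp add: space_pair_measure)
      have gm2: "(\<lambda>V. g (\<lambda>j\<in>E. a \<bullet> x j + ?\<sigma> a * (r - (if j \<in> I then 0 else V j)))) \<in> borel_measurable ?PR"
        using measurable_compose[OF measurable_Pair1'[of r borel ?PR] measurable_compose[OF measurable_Pair1'[of a borel "borel \<Otimes>\<^sub>M ?PR"] measurable_compose[OF tm g]]]
        by (simp cong: if_cong)
      have "\<Phi> (?v (?s r)) (?s r) = ennreal (?\<sigma> a ^ card ?R) * (\<integral>\<^sup>+V. g (comb (?v (?s r)) (?s r) (\<lambda>j\<in>?R. (a \<bullet> x j + ?\<sigma> a * r) - ?\<sigma> a * V j)) \<partial>?PR)"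
        unfolding \<Phi>_def by (rule nn_integral_PiM_affine[OF Ri(3) _ gm]) simp
      also have "(\<integral>\<^sup>+V. g (comb (?v (?s r)) (?s r) (\<lambda>j\<in>?R. (a \<bullet> x j + ?\<sigma> a * r) - ?\<sigma> a * V j)) \<partial>?PR)
         = (\<integral>\<^sup>+V. g (\<lambda>j\<in>E. a \<bullet> x j + ?\<sigma> a * (r - (if j \<in> I then 0 else V j))) \<partial>?PR)"
      proof (intro nn_integral_cong arg_cong[where f=g] ext)
        fix V and j
        show "comb (?v (?s r)) (?s r) (\<lambda>j\<in>?R. (a \<bullet> x j + ?\<sigma> a * r) - ?\<sigma> a * V j) j = (\<lambda>j\<in>E. a \<bullet> x j + ?\<sigma> a * (r - (if j \<in> I then 0 else V j))) j"
        proof (cases "j \<in> range \<beta>")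
          case True
          then show ?thesis using v[OF True, of r] rng by (auto simp: comb_def)
        next
          case False
          then show ?thesis using rng by (cases "j = i0") (auto simp: comb_def right_diff_distrib \<beta>(3))
        qed
      qed
      finally show "ennreal (?\<sigma> a) * \<Phi> (?v (?s r)) (?s r) = (\<integral>\<^sup>+V. ennreal (?\<sigma> a ^ Suc (card ?R)) * g (\<lambda>j\<in>E. a \<bullet> x j + ?\<sigma> a * (r - (if j \<in> I then 0 else V j))) \<partial>?PR)"
        using gm2 by (simp add: nn_integral_cmult ennreal_mult less_imp_le mult.assoc)
    qed
    finally show "(\<integral>\<^sup>+s. \<Phi> (?v s) s \<partial>lborel) = (\<integral>\<^sup>+r. \<integral>\<^sup>+V. ennreal (?\<sigma> a ^ Suc (card ?R)) * g (\<lambda>j\<in>E. a \<bullet> x j + ?\<sigma> a * (r - (if j \<in> I then 0 else V j))) \<partial>?PR \<partial>lborel)" .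
  qed
  also have "\<dots> = (\<integral>\<^sup>+a. \<integral>\<^sup>+q. ennreal (?\<sigma> a ^ Suc (card ?R))
        * g (\<lambda>j\<in>E. a \<bullet> x j + ?\<sigma> a * (fst q - (if j \<in> I then 0 else snd q j))) \<partial>(lborel \<Otimes>\<^sub>M ?PR) \<partial>lborel)"
  proof (rule nn_integral_cong)
    fix a :: "real^'d"
    have "(\<lambda>q. g (\<lambda>j\<in>E. a \<bullet> x j + ?\<sigma> a * (fst q - (if j \<in> I then 0 else snd q j)))) \<in> borel_measurable (lborel \<Otimes>\<^sub>M ?PR)"
      using measurable_compose[OF measurable_Pair1'[of a borel "borel \<Otimes>\<^sub>M ?PR"] measurable_compose[OF tm g]] by (simp cong: if_cong)
    then show "(\<integral>\<^sup>+r. \<integral>\<^sup>+V. ennreal (?\<sigma> a ^ Suc (card ?R)) * g (\<lambda>j\<in>E. a \<bullet> x j + ?\<sigma> a * (r - (if j \<in> I then 0 else V j))) \<partial>?PR \<partial>lborel)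
      = (\<integral>\<^sup>+q. ennreal (?\<sigma> a ^ Suc (card ?R)) * g (\<lambda>j\<in>E. a \<bullet> x j + ?\<sigma> a * (fst q - (if j \<in> I then 0 else snd q j))) \<partial>(lborel \<Otimes>\<^sub>M ?PR))"
      by (subst R.nn_integral_fst[symmetric]) (simp_all cong: if_cong)
  qed
  also have "\<dots> = (\<integral>\<^sup>+z. ennreal (?\<sigma> (fst z) ^ Suc (card ?R))
        * g (\<lambda>j\<in>E. fst z \<bullet> x j + ?\<sigma> (fst z) * (fst (snd z) - (if j \<in> I then 0 else snd (snd z) j))) \<partial>(lborel \<Otimes>\<^sub>M (lborel \<Otimes>\<^sub>M ?PR)))"
    using measurable_compose[OF tm g] by (subst rR.nn_integral_fst[symmetric]) (simp_all cong: if_cong)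
  finally show ?thesis .
qed

section \<open>Expected contribution of a facet\<close>

lemma borel_measurable_det_linear [measurable]:
  fixes D :: "'d::finite \<Rightarrow> 'e \<Rightarrow> real"
  shows "(\<lambda>X. det (\<chi> k. \<Sum>e\<in>E. D k e *\<^sub>R X e :: real^'d^'d)) \<in> borel_measurable (PiM E (\<lambda>_. std_gauss))"
proof -
  have c: "(\<lambda>X. X e $ i) \<in> borel_measurable (PiM E (\<lambda>_. std_gauss :: (real^'d) measure))" for e i
    by (rule measurable_compose[OF measurable_PiM_coordinate]) simp_all
  have "(\<lambda>X. (\<Sum>e\<in>E. D k e *\<^sub>R X e :: real^'d) $ i) \<in> borel_measurable (PiM E (\<lambda>_. std_gauss))" for k i
    using c by simp
  then show ?thesis unfolding det_def by simp
qed

text \<open>Integrand after the change of variables. The point \<open>z\<close> pairs the slope with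
  the remaining parameters, the power \<open>c\<close> is the Jacobian of the scaling,
  \<open>u\<close> the constraint of being an upper face and \<open>w\<close> the scaled height
  increments.\<close>

definition facet_density ::
    "'e set \<Rightarrow> nat \<Rightarrow> ('q \<Rightarrow> ennreal) \<Rightarrow> ('q \<Rightarrow> 'e \<Rightarrow> real) \<Rightarrow> ('e \<Rightarrow> real^'d) \<Rightarrow> (real^'d) \<times> 'q \<Rightarrow> ennreal" where
  "facet_density E c u w X z = ennreal (slope_norm (fst z) ^ c) * u (snd z)
     * (\<Prod>e\<in>E. ennreal (std_normal_density (fst z \<bullet> X e - slope_norm (fst z) * w (snd z) e)))"

lemma facet_density_measurable:
  fixes w :: "'q \<Rightarrow> 'e \<Rightarrow> real"
  assumes w: "\<And>e. (\<lambda>\<rho>. w \<rho> e) \<in> borel_measurable Q" and u: "u \<in> borel_measurable Q"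
  shows "(\<lambda>p. facet_density E c u w (fst p) (snd p))
    \<in> borel_measurable (PiM E (\<lambda>_. std_gauss :: (real^'d) measure) \<Otimes>\<^sub>M (lborel \<Otimes>\<^sub>M Q))"
proof -
  let ?M = "PiM E (\<lambda>_. std_gauss :: (real^'d) measure)"
  have c: "(\<lambda>X. X e) \<in> borel_measurable ?M" for e
    by (rule measurable_PiM_coordinate) simp
  let ?N = "?M \<Otimes>\<^sub>M ((lborel :: (real^'d) measure) \<Otimes>\<^sub>M Q)"
  have e1: "(\<lambda>p. fst p e) \<in> borel_measurable ?N" for e
    by (rule measurable_compose[OF measurable_fst c])
  have e2: "(\<lambda>p. w (snd (snd p)) e) \<in> borel_measurable ?N" for e
    by (rule measurable_compose[OF _ w[of e]]) measurable
  have e4: "(\<lambda>p. fst (snd p)) \<in> borel_measurable ?N" by simp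
  have e5: "(\<lambda>p. slope_norm (fst (snd p))) \<in> borel_measurable ?N"
    by (rule measurable_compose[OF e4 borel_measurable_slope_norm])
  have e6: "(\<lambda>p. u (snd (snd p))) \<in> borel_measurable ?N"
    by (rule measurable_compose[OF _ u]) measurable
  show ?thesis unfolding facet_density_def
    by (intro borel_measurable_times_ennreal borel_measurable_prod_ennreal e6 measurable_compose[OF _ measurable_ennreal]
        borel_measurable_times borel_measurable_power e5
        measurable_compose[OF _ borel_measurable_normal_density] borel_measurable_diff borel_measurable_inner e1 e2 e4)
qed

lemma facet_volume_measurable:
  fixes D :: "'d::finite \<Rightarrow> 'e \<Rightarrow> real" and w :: "'q \<Rightarrow> 'e \<Rightarrow> real"
  assumes Q: "sigma_finite_measure Q"
    and w: "\<And>e. (\<lambda>\<rho>. w \<rho> e) \<in> borel_measurable Q" and u: "u \<in> borel_measurable Q"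
  shows "(\<lambda>X. ennreal ((det (\<chi> k. \<Sum>e\<in>E. D k e *\<^sub>R X e :: real^'d^'d))\<^sup>2 / fact CARD('d)) * (\<integral>\<^sup>+z. facet_density E c u w X z \<partial>(lborel \<Otimes>\<^sub>M Q)))
    \<in> borel_measurable (PiM E (\<lambda>_. std_gauss))"
proof -
  interpret Q: sigma_finite_measure Q by (rule Q)
  interpret lQ: pair_sigma_finite "lborel :: (real^'d) measure" Q ..
  have "(\<lambda>X. \<integral>\<^sup>+z. facet_density E c u w X z \<partial>(lborel \<Otimes>\<^sub>M Q)) \<in> borel_measurable (PiM E (\<lambda>_. std_gauss :: (real^'d) measure))"
    using facet_density_measurable[OF w u, of E c] by (intro lQ.borel_measurable_nn_integral) (simp add: split_beta')
  then show ?thesis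
    by (intro borel_measurable_times_ennreal measurable_compose[OF _ measurable_ennreal] borel_measurable_divide borel_measurable_power
        borel_measurable_det_linear borel_measurable_const)
qed

text \<open>After exchanging integrals, \<open>gaussian_shear\<close> frees the steps from
  \<open>w\<close>. The powers of \<open>slope_norm\<close> are \<open>c\<close> from the density,
  \<open>- card E\<close> from the steps and \<open>-2\<close> from the squared determinant, which
  makes \<open>- (CARD('d) + 2)\<close>. The hypothesis \<open>flat\<close> expresses that all
  vertices of the face have the same gap.\<close>

lemma expected_facet:
  fixes D :: "'d::finite \<Rightarrow> 'e \<Rightarrow> real" and w :: "'q \<Rightarrow> 'e \<Rightarrow> real" and u :: "'q \<Rightarrow> ennreal"
  assumes E: "finite E" and Q: "sigma_finite_measure Q"
    and w: "\<And>e. (\<lambda>\<rho>. w \<rho> e) \<in> borel_measurable Q" and u: "u \<in> borel_measurable Q"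
    and flat: "\<And>\<rho> k. (\<Sum>e\<in>E. D k e * w \<rho> e) = 0" and card: "card E = c + CARD('d)"
  shows "(\<integral>\<^sup>+X. ennreal ((det (\<chi> k. \<Sum>e\<in>E. D k e *\<^sub>R X e :: real^'d^'d))\<^sup>2 / fact CARD('d)) * (\<integral>\<^sup>+z. facet_density E c u w X z \<partial>(lborel \<Otimes>\<^sub>M Q)) \<partial>PiM E (\<lambda>_. std_gauss))
    = ennreal (det (\<chi> j k. \<Sum>e\<in>E. D j e * D k e)) * ennreal (pi powr (real CARD('d) / 2) / Gamma (real CARD('d) / 2 + 1))
      * (\<integral>\<^sup>+\<rho>. u \<rho> * (\<Prod>e\<in>E. ennreal (std_normal_density (w \<rho> e))) \<partial>Q)"
proof -
  let ?M = "PiM E (\<lambda>_. std_gauss :: (real^'d) measure)"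
  let ?A = "\<lambda>X. \<chi> k. \<Sum>e\<in>E. D k e *\<^sub>R X e :: real^'d^'d"
  let ?\<phi> = "\<lambda>x. ennreal (std_normal_density x)"
  interpret Q: sigma_finite_measure Q by (rule Q)
  interpret lQ: pair_sigma_finite "lborel :: (real^'d) measure" Q ..
  interpret M: product_sigma_finite "\<lambda>_::'e. std_gauss :: (real^'d) measure" by (rule product_sigma_finite_std_gauss)
  interpret M: finite_product_sigma_finite "\<lambda>_::'e. std_gauss :: (real^'d) measure" E by standard (rule E)
  interpret P: pair_sigma_finite ?M "(lborel :: (real^'d) measure) \<Otimes>\<^sub>M Q" ..
  note [measurable] = w u
  have c [measurable]: "(\<lambda>X. X e) \<in> borel_measurable ?M" for e
    by (rule measurable_PiM_coordinate) simp
  let ?N = "?M \<Otimes>\<^sub>M ((lborel :: (real^'d) measure) \<Otimes>\<^sub>M Q)"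
  have e3: "(\<lambda>p. ennreal ((det (?A (fst p)))\<^sup>2 / fact CARD('d))) \<in> borel_measurable ?N"
    by (intro measurable_compose[OF _ measurable_ennreal] borel_measurable_divide borel_measurable_power
        measurable_compose[OF measurable_fst borel_measurable_det_linear] borel_measurable_const)
  note fd = facet_density_measurable[OF w u, of E c]
  have fdX: "facet_density E c u w X \<in> borel_measurable (lborel \<Otimes>\<^sub>M Q)" if "X \<in> space ?M" for X
    using measurable_compose[OF measurable_Pair1'[OF that] fd] by simp
  have split: "ennreal ((det (?A X))\<^sup>2 / fact CARD('d)) * facet_density E c u w X z
     = ennreal (slope_norm (fst z) ^ c * ((det (?A X))\<^sup>2 / fact CARD('d))) * u (snd z)
        * (\<Prod>e\<in>E. ?\<phi> (fst z \<bullet> X e - slope_norm (fst z) * w (snd z) e))" for X z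
    unfolding facet_density_def by (subst ennreal_mult) (simp_all add: mult_ac less_imp_le)
  have "(\<integral>\<^sup>+X. ennreal ((det (?A X))\<^sup>2 / fact CARD('d)) * (\<integral>\<^sup>+z. facet_density E c u w X z \<partial>(lborel \<Otimes>\<^sub>M Q)) \<partial>?M)
    = (\<integral>\<^sup>+X. \<integral>\<^sup>+z. ennreal ((det (?A X))\<^sup>2 / fact CARD('d)) * facet_density E c u w X z \<partial>(lborel \<Otimes>\<^sub>M Q) \<partial>?M)"
    by (intro nn_integral_cong nn_integral_cmult[symmetric] fdX)
  also have "\<dots> = (\<integral>\<^sup>+z. \<integral>\<^sup>+X. ennreal ((det (?A X))\<^sup>2 / fact CARD('d)) * facet_density E c u w X z \<partial>?M \<partial>(lborel \<Otimes>\<^sub>M Q))"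
    using borel_measurable_times_ennreal[OF e3 fd] by (intro P.Fubini'[symmetric]) (simp add: split_beta')
  also have "\<dots> = (\<integral>\<^sup>+z. ennreal (det (\<chi> j k. \<Sum>e\<in>E. D j e * D k e)) * (ennreal ((1 / slope_norm (fst z :: real^'d)) ^ (CARD('d) + 2)) * (u (snd z) * (\<Prod>e\<in>E. ?\<phi> (w (snd z) e)))) \<partial>(lborel \<Otimes>\<^sub>M Q))"
    unfolding split
  proof (rule nn_integral_cong)
    fix z :: "(real^'d) \<times> 'q"
    obtain a \<rho> where z: "z = (a, \<rho>)" by (cases z)
    let ?\<sigma> = "slope_norm a"
    have \<sigma>: "?\<sigma> > 0" by simp
    define F where "F X = ennreal ((det (?A X))\<^sup>2)" for X
    have Fm: "F \<in> borel_measurable ?M" unfolding F_def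
      by (intro measurable_compose[OF _ measurable_ennreal] borel_measurable_power borel_measurable_det_linear)
    \<comment> \<open>By \<open>flat\<close> the shifts along \<open>a\<close> cancel in every row,
      so the rows are merely multiplied by \<open>shear a\<close>.\<close>
    have shift: "F (\<lambda>e\<in>E. (w \<rho> e / ?\<sigma>) *\<^sub>R a + shear a *v Y e) = ennreal ((1 / ?\<sigma>)\<^sup>2) * F Y" for Y
    proof -
      have "(\<Sum>e\<in>E. D k e *\<^sub>R (\<lambda>e\<in>E. (w \<rho> e / ?\<sigma>) *\<^sub>R a + shear a *v Y e) e) = shear a *v (\<Sum>e\<in>E. D k e *\<^sub>R Y e)" for k
      proof -
        have "(\<Sum>e\<in>E. D k e *\<^sub>R (\<lambda>e\<in>E. (w \<rho> e / ?\<sigma>) *\<^sub>R a + shear a *v Y e) e)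
          = (\<Sum>e\<in>E. (D k e * w \<rho> e / ?\<sigma>) *\<^sub>R a + shear a *v (D k e *\<^sub>R Y e))"
          by (intro sum.cong) (auto simp: scaleR_add_right matrix_vector_mult_scaleR)
        also have "\<dots> = ((\<Sum>e\<in>E. D k e * w \<rho> e) / ?\<sigma>) *\<^sub>R a + (\<Sum>e\<in>E. shear a *v (D k e *\<^sub>R Y e))"
          by (simp add: sum.distrib scaleR_sum_left sum_divide_distrib)
        also have "\<dots> = shear a *v (\<Sum>e\<in>E. D k e *\<^sub>R Y e)"
          unfolding flat by (simp add: linear_sum[OF matrix_vector_mul_linear])
        finally show ?thesis .
      qed
      then have "?A (\<lambda>e\<in>E. (w \<rho> e / ?\<sigma>) *\<^sub>R a + shear a *v Y e) = (\<chi> k. shear a *v (\<Sum>e\<in>E. D k e *\<^sub>R Y e))" by simp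
      also have "\<dots> = ?A Y ** transpose (shear a)"
        by (simp add: vec_eq_iff matrix_matrix_mult_def matrix_vector_mult_def Finite_Cartesian_Product.transpose_def mult.commute)
      finally have "det (?A (\<lambda>e\<in>E. (w \<rho> e / ?\<sigma>) *\<^sub>R a + shear a *v Y e)) = det (?A Y) * (1 / ?\<sigma>)"
        by (simp only: det_mul det_transpose det_shear)
      then have "(det (?A (\<lambda>e\<in>E. (w \<rho> e / ?\<sigma>) *\<^sub>R a + shear a *v Y e)))\<^sup>2 = (1 / ?\<sigma>)\<^sup>2 * (det (?A Y))\<^sup>2"
        by (simp only: power_mult_distrib mult.commute)
      then show ?thesis unfolding F_def by (simp only: ennreal_mult zero_le_power2)
    qed
    have int: "(\<integral>\<^sup>+X. F X * (\<Prod>e\<in>E. ?\<phi> (a \<bullet> X e - ?\<sigma> * w \<rho> e)) \<partial>?M)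
       = ennreal ((1 / ?\<sigma>) ^ card E) * (\<Prod>e\<in>E. ?\<phi> (w \<rho> e)) * (ennreal ((1 / ?\<sigma>)\<^sup>2) * ennreal (fact CARD('d) * det (\<chi> j k. \<Sum>e\<in>E. D j e * D k e)))"
    proof -
      have "integral\<^sup>N ?M F = ennreal (fact CARD('d) * det (\<chi> j k. \<Sum>e\<in>E. D j e * D k e))"
        unfolding F_def by (rule second_moment_gauss_det[OF E])
      then show ?thesis unfolding gaussian_shear[OF E Fm] shift nn_integral_cmult[OF Fm] by (simp only:)
    qed
    \<comment> \<open>A negative Gram determinant would make both sides 0 in \<open>ennreal\<close>,
      so its sign need not be settled here.\<close>
    have nonneg: "det (\<chi> j k. \<Sum>e\<in>E. D j e * D k e) \<ge> 0 \<or> ennreal (fact CARD('d) * det (\<chi> j k. \<Sum>e\<in>E. D j e * D k e)) = 0 \<and> ennreal (det (\<chi> j k. \<Sum>e\<in>E. D j e * D k e)) = 0"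
      by (cases "det (\<chi> j k. \<Sum>e\<in>E. D j e * D k e) \<ge> 0") (auto simp: ennreal_neg mult_nonneg_nonpos)
    have "(\<integral>\<^sup>+X. ennreal (?\<sigma> ^ c * ((det (?A X))\<^sup>2 / fact CARD('d))) * u \<rho> * (\<Prod>e\<in>E. ?\<phi> (a \<bullet> X e - ?\<sigma> * w \<rho> e)) \<partial>?M)
      = (\<integral>\<^sup>+X. (ennreal (?\<sigma> ^ c / fact CARD('d)) * u \<rho>) * (F X * (\<Prod>e\<in>E. ?\<phi> (a \<bullet> X e - ?\<sigma> * w \<rho> e))) \<partial>?M)"
    proof (rule nn_integral_cong)
      fix X
      have "ennreal (?\<sigma> ^ c * ((det (?A X))\<^sup>2 / fact CARD('d))) = ennreal (?\<sigma> ^ c / fact CARD('d)) * F X"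
        unfolding F_def using \<sigma> by (simp add: ennreal_mult'[symmetric] less_imp_le)
      then show "ennreal (?\<sigma> ^ c * ((det (?A X))\<^sup>2 / fact CARD('d))) * u \<rho> * (\<Prod>e\<in>E. ?\<phi> (a \<bullet> X e - ?\<sigma> * w \<rho> e))
        = (ennreal (?\<sigma> ^ c / fact CARD('d)) * u \<rho>) * (F X * (\<Prod>e\<in>E. ?\<phi> (a \<bullet> X e - ?\<sigma> * w \<rho> e)))"
        by (simp add: mult_ac)
    qed
    also have "\<dots> = (ennreal (?\<sigma> ^ c / fact CARD('d)) * u \<rho>) * (\<integral>\<^sup>+X. F X * (\<Prod>e\<in>E. ?\<phi> (a \<bullet> X e - ?\<sigma> * w \<rho> e)) \<partial>?M)"
      by (intro nn_integral_cmult borel_measurable_times_ennreal borel_measurable_prod_ennreal Fm measurable_compose[OF _ measurable_ennreal]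
          measurable_compose[OF _ borel_measurable_normal_density] borel_measurable_diff borel_measurable_inner borel_measurable_const c)
    also have "\<dots> = (ennreal (?\<sigma> ^ c / fact CARD('d)) * ennreal ((1 / ?\<sigma>) ^ card E) * ennreal ((1 / ?\<sigma>)\<^sup>2) * ennreal (fact CARD('d) * det (\<chi> j k. \<Sum>e\<in>E. D j e * D k e))) * (u \<rho> * (\<Prod>e\<in>E. ?\<phi> (w \<rho> e)))"
      unfolding int by (simp add: mult_ac)
    also have "ennreal (?\<sigma> ^ c / fact CARD('d)) * ennreal ((1 / ?\<sigma>) ^ card E) * ennreal ((1 / ?\<sigma>)\<^sup>2) * ennreal (fact CARD('d) * det (\<chi> j k. \<Sum>e\<in>E. D j e * D k e))
      = ennreal (det (\<chi> j k. \<Sum>e\<in>E. D j e * D k e)) * ennreal ((1 / ?\<sigma>) ^ (CARD('d) + 2))"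
      using nonneg
    proof
      define G where "G = det (\<chi> j k. \<Sum>e\<in>E. D j e * D k e)"
      assume "det (\<chi> j k. \<Sum>e\<in>E. D j e * D k e) \<ge> 0"
      then have G: "G \<ge> 0" by (simp add: G_def)
      have one: "?\<sigma> ^ c * (1 / ?\<sigma>) ^ c = 1" using less_imp_neq[OF \<sigma>] by (simp add: power_one_over)
      have "(?\<sigma> ^ c / fact CARD('d)) * (1 / ?\<sigma>) ^ card E * (1 / ?\<sigma>)\<^sup>2 * (fact CARD('d) * G)
        = (?\<sigma> ^ c * (1 / ?\<sigma>) ^ c) * (fact CARD('d) / fact CARD('d)) * (G * (1 / ?\<sigma>) ^ (CARD('d) + 2))"
        unfolding card power_add by (simp only: mult_ac times_divide_eq_right times_divide_eq_left)
      then have eq: "(?\<sigma> ^ c / fact CARD('d)) * (1 / ?\<sigma>) ^ card E * (1 / ?\<sigma>)\<^sup>2 * (fact CARD('d) * G) = G * (1 / ?\<sigma>) ^ (CARD('d) + 2)"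
        unfolding one by simp
      have nn: "0 \<le> ?\<sigma> ^ c / fact CARD('d)" "0 \<le> (1 / ?\<sigma>) ^ card E" "0 \<le> (1 / ?\<sigma>)\<^sup>2" "0 \<le> (1 / ?\<sigma>) ^ (CARD('d) + 2)"
        using \<sigma> by (auto intro!: divide_nonneg_pos zero_le_power less_imp_le)
      show ?thesis
        unfolding G_def[symmetric] ennreal_mult[OF G nn(4), symmetric] eq[symmetric]
        using nn G by (simp only: ennreal_mult mult_nonneg_nonneg fact_ge_zero)
    qed simp
    finally show "(\<integral>\<^sup>+X. ennreal (slope_norm (fst z) ^ c * ((det (?A X))\<^sup>2 / fact CARD('d))) * u (snd z)
        * (\<Prod>e\<in>E. ?\<phi> (fst z \<bullet> X e - slope_norm (fst z) * w (snd z) e)) \<partial>?M)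
      = ennreal (det (\<chi> j k. \<Sum>e\<in>E. D j e * D k e)) * (ennreal ((1 / slope_norm (fst z :: real^'d)) ^ (CARD('d) + 2)) * (u (snd z) * (\<Prod>e\<in>E. ?\<phi> (w (snd z) e))))"
      unfolding z by (simp only: fst_conv snd_conv mult.assoc)
  qed
  also have "\<dots> = ennreal (det (\<chi> j k. \<Sum>e\<in>E. D j e * D k e)) * (\<integral>\<^sup>+z. ennreal ((1 / slope_norm (fst z :: real^'d)) ^ (CARD('d) + 2)) * (u (snd z) * (\<Prod>e\<in>E. ?\<phi> (w (snd z) e))) \<partial>(lborel \<Otimes>\<^sub>M Q))"
    by (rule nn_integral_cmult) measurable
  also have "(\<integral>\<^sup>+z. ennreal ((1 / slope_norm (fst z :: real^'d)) ^ (CARD('d) + 2)) * (u (snd z) * (\<Prod>e\<in>E. ?\<phi> (w (snd z) e))) \<partial>(lborel \<Otimes>\<^sub>M Q))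
     = (\<integral>\<^sup>+(a::real^'d). \<integral>\<^sup>+\<rho>. ennreal ((1 / slope_norm a) ^ (CARD('d) + 2)) * (u \<rho> * (\<Prod>e\<in>E. ?\<phi> (w \<rho> e))) \<partial>Q \<partial>lborel)"
    by (subst Q.nn_integral_fst[symmetric]) simp_all
  also have "\<dots> = (\<integral>\<^sup>+(a::real^'d). ennreal ((1 / slope_norm a) ^ (CARD('d) + 2)) * (\<integral>\<^sup>+\<rho>. u \<rho> * (\<Prod>e\<in>E. ?\<phi> (w \<rho> e)) \<partial>Q) \<partial>lborel)"
    by (intro nn_integral_cong nn_integral_cmult) measurable
  also have "\<dots> = (\<integral>\<^sup>+(a::real^'d). ennreal ((1 / slope_norm a) ^ (CARD('d) + 2)) \<partial>lborel) * (\<integral>\<^sup>+\<rho>. u \<rho> * (\<Prod>e\<in>E. ?\<phi> (w \<rho> e)) \<partial>Q)"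
    by (intro nn_integral_multc measurable_compose[OF _ measurable_ennreal] borel_measurable_power borel_measurable_divide borel_measurable_const) simp
  finally show ?thesis by (simp only: nn_integral_slope_norm_power mult.assoc)
qed

text \<open>An affine function is determined by its values at the vertices of a nondegenerate
  simplex, so the existential quantifier in \<open>upper_face\<close> has only one
  candidate.\<close>

lemma upper_face_iff:
  fixes x :: "'j \<Rightarrow> real^'d"
  assumes \<beta>: "bij_betw \<beta> UNIV (I - {i0})" "i0 \<in> I"
    and det: "det (\<chi> k. x (\<beta> k) - x i0) \<noteq> 0"
    and h: "\<And>i. i \<in> I \<Longrightarrow> h i = a \<bullet> x i + b"
  shows "upper_face J x h I \<longleftrightarrow> (\<forall>j\<in>J. h j \<le> a \<bullet> x j + b)"
proof
  assume "upper_face J x h I"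
  then obtain a' b' where ab: "\<forall>i\<in>I. h i = a' \<bullet> x i + b'" "\<forall>j\<in>J. h j \<le> a' \<bullet> x j + b'"
    by (auto simp: upper_face_def)
  let ?A = "\<chi> k. x (\<beta> k) - x i0 :: real^'d^'d"
  have \<beta>I: "\<beta> k \<in> I" for k using \<beta>(1) by (auto simp: bij_betw_def)
  have row: "(?A *v c) $ k = c \<bullet> (x (\<beta> k) - x i0)" for c k
    by (simp add: matrix_vector_mult_def inner_vec_def mult.commute)
  have "?A *v a' = ?A *v a"
  proof (subst vec_eq_iff, rule allI)
    fix k
    have "a' \<bullet> x (\<beta> k) + b' = a \<bullet> x (\<beta> k) + b" "a' \<bullet> x i0 + b' = a \<bullet> x i0 + b"
      using ab(1) h \<beta>I[of k] \<beta>(2) by metis+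
    then show "(?A *v a') $ k = (?A *v a) $ k" unfolding row by (simp add: inner_diff_right)
  qed
  moreover have "inj ((*v) ?A)" using det det_nz_iff_inj[of "(*v) ?A"] by simp
  ultimately have "a' = a" by (auto dest: injD)
  moreover have "b' = b" using ab(1) h[OF \<beta>(2)] \<beta>(2) calculation by auto
  ultimately show "\<forall>j\<in>J. h j \<le> a \<bullet> x j + b" using ab(2) by simp
next
  assume "\<forall>j\<in>J. h j \<le> a \<bullet> x j + b"
  then show "upper_face J x h I" unfolding upper_face_def using h by blast
qed

lemma emeasure_simplex:
  fixes x :: "'j \<Rightarrow> real^'d"
  assumes \<beta>: "bij_betw \<beta> UNIV (I - {i0})" "i0 \<in> I"
  shows "emeasure lborel (convex hull (x ` I)) = ennreal (\<bar>det (\<chi> k. x (\<beta> k) - x i0)\<bar> / fact CARD('d))"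
proof -
  have "I = insert i0 (range \<beta>)" using \<beta> by (auto simp: bij_betw_def)
  then have I: "x ` I = insert (x i0) (range (\<lambda>k. x (\<beta> k)))" by auto
  have "bounded (convex hull (x ` I))"
    unfolding I by (intro finite_imp_bounded_convex_hull) simp
  then have "emeasure lborel (convex hull (x ` I)) \<noteq> top"
    using emeasure_bounded_finite by (metis infinity_ennreal_def less_irrefl)
  then show ?thesis
    using measure_simplex[of "x i0" "\<lambda>k. x (\<beta> k)"] unfolding I[symmetric]
    by (simp add: emeasure_eq_ennreal_measure)
qed

section \<open>Lifting the hull of the walks\<close>

text \<open>The existential quantifier over slopes hides measurability. For a nondegenerate simplex
  the slope is a linear function of the heights, found by inverting the edge matrix, and finitely
  many inequalities remain.\<close>

lemma measurable_upper_face: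
  fixes x :: "'j \<Rightarrow> real^'d"
  assumes J: "finite J" and \<beta>: "bij_betw \<beta> UNIV (I - {i0})" "i0 \<in> I"
    and det: "det (\<chi> k. x (\<beta> k) - x i0) \<noteq> 0"
    and h: "\<And>j. (\<lambda>\<omega>. h \<omega> j) \<in> borel_measurable M"
  shows "Measurable.pred M (\<lambda>\<omega>. upper_face J x (h \<omega>) I)"
proof -
  let ?A = "\<chi> k. x (\<beta> k) - x i0 :: real^'d^'d"
  obtain B where B: "?A ** B = mat 1" using det invertible_det_nz[of ?A] by (auto simp: invertible_def)
  define a where "a \<omega> = B *v (\<chi> k. h \<omega> (\<beta> k) - h \<omega> i0)" for \<omega>
  have row: "(?A *v c) $ k = c \<bullet> (x (\<beta> k) - x i0)" for c k
    by (simp add: matrix_vector_mult_def inner_vec_def mult.commute)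
  have on: "h \<omega> i = a \<omega> \<bullet> x i + (h \<omega> i0 - a \<omega> \<bullet> x i0)" if i: "i \<in> I" for \<omega> i
  proof (cases "i = i0")
    case False
    then have "i \<in> range \<beta>" using i \<beta>(1) by (auto simp: bij_betw_def)
    then obtain k where k: "i = \<beta> k" by (rule rangeE)
    have "?A *v a \<omega> = (\<chi> k. h \<omega> (\<beta> k) - h \<omega> i0)"
      unfolding a_def by (simp only: matrix_vector_mul_assoc B matrix_vector_mul_lid)
    then have "a \<omega> \<bullet> (x (\<beta> k) - x i0) = h \<omega> (\<beta> k) - h \<omega> i0" unfolding row[symmetric] by simp
    then show ?thesis by (simp add: k inner_diff_right)
  qed simp
  have am [measurable]: "a \<in> borel_measurable M" unfolding a_def
    by (intro measurable_compose[OF _ borel_measurable_matrix_vector_mult] borel_measurable_vec_lambda borel_measurable_diff h)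
  note [measurable] = h
  have "Measurable.pred M (\<lambda>\<omega>. h \<omega> j \<le> a \<omega> \<bullet> x j + (h \<omega> i0 - a \<omega> \<bullet> x i0))" for j by measurable
  then have "Measurable.pred M (\<lambda>\<omega>. \<forall>j\<in>J. h \<omega> j \<le> a \<omega> \<bullet> x j + (h \<omega> i0 - a \<omega> \<bullet> x i0))"
    using J by (intro pred_intros_finite) auto
  then show ?thesis using upper_face_iff[OF \<beta> det on] by simp
qed

definition walk_vertex :: "(nat \<times> nat \<Rightarrow> real^'d) \<Rightarrow> nat \<times> nat \<Rightarrow> real^'d" where
  "walk_vertex X p = walk_pt X (fst p) (snd p)"

text \<open>Counterpart of \<open>walk_weight\<close> for all walks at once: every walk starts at
  the same height \<open>r\<close>.\<close>

definition increment :: "real \<Rightarrow> (nat \<times> nat \<Rightarrow> real) \<Rightarrow> nat \<times> nat \<Rightarrow> real" where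
  "increment r U e = U e - (if snd e = 1 then r else U (fst e, snd e - 1))"

definition walk_density :: "(nat \<times> nat) set \<Rightarrow> real \<Rightarrow> (nat \<times> nat \<Rightarrow> real) \<Rightarrow> ennreal" where
  "walk_density E r U = (\<Prod>e\<in>E. ennreal (std_normal_density (increment r U e)))"

definition contact_path :: "(nat \<times> nat) set \<Rightarrow> (nat \<times> nat \<Rightarrow> real) \<Rightarrow> nat \<times> nat \<Rightarrow> real" where
  "contact_path I V j = (if j \<in> I then 0 else V j)"

text \<open>The index \<open>(0, 0)\<close>, which is not a step, stands for the origin, at height \<open>0\<close>.\<close>

definition site_height :: "(nat \<times> nat) set \<Rightarrow> (nat \<times> nat \<Rightarrow> real) \<Rightarrow> nat \<times> nat \<Rightarrow> real" where
  "site_height E T p = (if p \<in> E then T p else 0)"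

lemma finite_steps [simp]: "finite (steps m n)"
proof -
  have "steps m n = Sigma {1..m} (\<lambda>l. {1..n l})" by (auto simp: steps_def)
  then show ?thesis by simp
qed

lemma origin_notin_steps [simp]: "(0, 0) \<notin> steps m n" "(0, i) \<notin> steps m n" by (auto simp: steps_def)

lemma steps_pred: "e \<in> steps m n \<Longrightarrow> snd e \<noteq> 1 \<Longrightarrow> (fst e, snd e - 1) \<in> steps m n"
  by (auto simp: steps_def)

lemma sum_cumul:
  fixes f :: "nat \<times> nat \<Rightarrow> 'a::real_vector"
  assumes "p \<in> insert (0, 0) (steps m n)"
  shows "(\<Sum>e\<in>steps m n. cumul p e *\<^sub>R f e) = (\<Sum>j=1..snd p. f (fst p, j))"
proof -
  have "(\<Sum>e\<in>steps m n. cumul p e *\<^sub>R f e) = (\<Sum>e\<in>steps m n \<inter> {e. fst e = fst p \<and> snd e \<le> snd p}. f e)"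
    by (subst sum.inter_restrict) (auto intro!: sum.cong simp: cumul_def)
  also have "steps m n \<inter> {e. fst e = fst p \<and> snd e \<le> snd p} = Pair (fst p) ` {1..snd p}"
    using assms by (auto simp: steps_def)
  also have "(\<Sum>e\<in>Pair (fst p) ` {1..snd p}. f e) = (\<Sum>j=1..snd p. f (fst p, j))"
    by (subst sum.reindex) (auto simp: inj_on_def)
  finally show ?thesis .
qed

lemma walk_vertex_eq_sum:
  assumes "p \<in> insert (0, 0) (steps m n)"
  shows "walk_vertex X p = (\<Sum>e\<in>steps m n. cumul p e *\<^sub>R X e)"
  by (simp add: sum_cumul[OF assms] walk_vertex_def walk_pt_def)

lemma walk_vertex_origin [simp]: "walk_vertex X (0, 0) = 0"
  by (simp add: walk_vertex_def walk_pt_def)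

lemma sum_increment: "(\<Sum>j=1..Suc i. increment r U (l, j)) = U (l, Suc i) - r"
  by (induction i) (auto simp: increment_def)

lemma sum_cumul_increment:
  assumes "p \<in> steps m n"
  shows "(\<Sum>e\<in>steps m n. cumul p e * increment r U e) = U p - r"
proof -
  obtain i where i: "snd p = Suc i" using assms by (cases "snd p") (auto simp: steps_def)
  have "(\<Sum>e\<in>steps m n. cumul p e * increment r U e) = (\<Sum>j=1..snd p. increment r U (fst p, j))"
    using sum_cumul[of p m n "increment r U"] assms by simp
  also have "\<dots> = U (fst p, snd p) - r" unfolding i by (rule sum_increment)
  finally show ?thesis by simp
qed

lemma walk_density_cong:
  assumes "\<And>e. e \<in> steps m n \<Longrightarrow> U e = U' e"
  shows "walk_density (steps m n) r U = walk_density (steps m n) r U'"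
  unfolding walk_density_def increment_def
  by (intro prod.cong refl arg_cong[where f="\<lambda>x. ennreal (std_normal_density x)"]) (auto simp: assms dest: steps_pred)

lemma walk_density_measurable:
  assumes r: "r \<in> borel_measurable N" and U: "\<And>e. (\<lambda>\<omega>. U \<omega> e) \<in> borel_measurable N"
  shows "(\<lambda>\<omega>. walk_density E (r \<omega>) (U \<omega>)) \<in> borel_measurable N"
    and "(\<lambda>\<omega>. increment (r \<omega>) (U \<omega>) e) \<in> borel_measurable N"
proof -
  note [measurable] = r U
  show i: "(\<lambda>\<omega>. increment (r \<omega>) (U \<omega>) e) \<in> borel_measurable N" for e
    unfolding increment_def by (cases "snd e = 1") simp_all
  show "(\<lambda>\<omega>. walk_density E (r \<omega>) (U \<omega>)) \<in> borel_measurable N"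
    unfolding walk_density_def
    by (intro borel_measurable_prod_ennreal measurable_compose[OF i measurable_compose[OF borel_measurable_normal_density measurable_ennreal]])
qed

text \<open>The offset cancels in increments except at the first step, where it becomes the start
  \<open>r\<close> of the gap walk. Hence the gaps of each walk form a walk from
  \<open>r\<close>.\<close>

lemma increment_lift:
  assumes T: "\<And>j. j \<in> steps m n \<Longrightarrow> T j = a \<bullet> walk_vertex X j + s * (r - U j)" and e: "e \<in> steps m n"
  shows "increment 0 T e = a \<bullet> X e - s * increment r U e"
proof -
  obtain l i where li: "e = (l, i)" "l \<in> {1..m}" "1 \<le> i" "i \<le> n l" using e by (auto simp: steps_def)
  show ?thesis
  proof (cases "i = 1")
    case True
    then show ?thesis using T[OF e] by (simp add: increment_def li walk_vertex_def walk_pt_def algebra_simps)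
  next
    case False
    then obtain k where k: "i = Suc k" "k \<ge> 1" using li by (cases i) auto
    have "(l, k) \<in> steps m n" using li k by (auto simp: steps_def)
    then show ?thesis using T[OF e] T[of "(l, k)"] k(2)
      by (simp add: increment_def li(1) k(1) walk_vertex_def walk_pt_def algebra_simps inner_add_right)
  qed
qed

text \<open>Volume of the simplex on \<open>I\<close> times the probability, with respect to the
  heights alone, that it is an upper face; the steps \<open>X\<close> are kept fixed.\<close>

definition facet_term :: "(nat \<times> nat) set \<Rightarrow> (nat \<times> nat) set \<Rightarrow> (nat \<times> nat \<Rightarrow> real^'d) \<Rightarrow> (nat \<times> nat) set \<Rightarrow> ennreal" where
  "facet_term E J X I = emeasure lborel (convex hull (walk_vertex X ` I))
     * (\<integral>\<^sup>+T. walk_density E 0 T * of_bool (upper_face J (walk_vertex X) (site_height E T) I) \<partial>PiM E (\<lambda>_. lborel))"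

lemma site_height_measurable: "(\<lambda>T. site_height E T j) \<in> borel_measurable (PiM E (\<lambda>_. lborel))"
  unfolding site_height_def by (cases "j \<in> E") (simp_all add: measurable_PiM_lborel_coordinate)

lemma facet_integrand_measurable:
  fixes X :: "nat \<times> nat \<Rightarrow> real^'d"
  assumes J: "finite J" and \<beta>: "bij_betw \<beta> UNIV (I - {i0})" "i0 \<in> I"
    and det: "det (\<chi> k. walk_vertex X (\<beta> k) - walk_vertex X i0) \<noteq> 0"
  shows "(\<lambda>T. walk_density E 0 T * of_bool (upper_face J (walk_vertex X) (site_height E T) I)) \<in> borel_measurable (PiM E (\<lambda>_. lborel))"
proof -
  have "Measurable.pred (PiM E (\<lambda>_. lborel)) (\<lambda>T. upper_face J (walk_vertex X) (site_height E T) I)"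
    by (rule measurable_upper_face[OF J \<beta> det site_height_measurable])
  then have "(\<lambda>T. of_bool (upper_face J (walk_vertex X) (site_height E T) I) :: ennreal) \<in> borel_measurable (PiM E (\<lambda>_. lborel))"
    by measurable
  then show ?thesis
    by (intro borel_measurable_times_ennreal walk_density_measurable(1) borel_measurable_const measurable_PiM_lborel_coordinate)
qed

text \<open>In the new variables the face condition says that all gaps are nonnegative. If the
  origin is a site, its height 0 must lie below the hyperplane value
  \<open>slope_norm a * r\<close>, which is the condition on the sign of \<open>r\<close>. Volume
  and Jacobian combine to the squared determinant.\<close>

lemma facet_term_affine:
  fixes X :: "nat \<times> nat \<Rightarrow> real^'d" and \<beta> :: "'d \<Rightarrow> nat \<times> nat"
  assumes J: "J = steps m n \<or> J = insert (0, 0) (steps m n)"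
    and \<beta>: "bij_betw \<beta> UNIV (I - {i0})" "i0 \<in> I" and I: "I \<subseteq> steps m n"
  shows "facet_term (steps m n) J X I
    = ennreal ((det (\<chi> k. \<Sum>e\<in>steps m n. (cumul (\<beta> k) e - cumul i0 e) *\<^sub>R X e :: real^'d^'d))\<^sup>2 / fact CARD('d))
      * (\<integral>\<^sup>+z. facet_density (steps m n) (Suc (card (steps m n - I)))
            (\<lambda>\<rho>. of_bool ((\<forall>j\<in>steps m n - I. snd \<rho> j \<ge> 0) \<and> ((0, 0) \<in> J \<longrightarrow> fst \<rho> \<ge> 0)))
            (\<lambda>\<rho>. increment (fst \<rho>) (contact_path I (snd \<rho>))) X z
          \<partial>(lborel \<Otimes>\<^sub>M (lborel \<Otimes>\<^sub>M PiM (steps m n - I) (\<lambda>_. lborel))))"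
proof -
  let ?E = "steps m n" and ?x = "walk_vertex X"
  have A: "(\<chi> k. \<Sum>e\<in>?E. (cumul (\<beta> k) e - cumul i0 e) *\<^sub>R X e :: real^'d^'d) = (\<chi> k. ?x (\<beta> k) - ?x i0)"
  proof -
    have "\<beta> k \<in> I" for k using \<beta>(1) by (auto simp: bij_betw_def)
    then have "\<beta> k \<in> insert (0, 0) ?E" for k using I by blast
    moreover have "i0 \<in> insert (0, 0) ?E" using I \<beta> by blast
    ultimately have "(\<Sum>e\<in>?E. (cumul (\<beta> k) e - cumul i0 e) *\<^sub>R X e) = ?x (\<beta> k) - ?x i0" for k
      by (simp only: walk_vertex_eq_sum[of _ m n] scaleR_diff_left sum_subtractf)
    then show ?thesis by simp
  qed
  define A where "A = det (\<chi> k. ?x (\<beta> k) - ?x i0)"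
  show ?thesis
  proof (cases "A = 0")
    \<comment> \<open>A degenerate simplex has no volume, and the right side carries the same
      vanishing determinant.\<close>
    case True
    then show ?thesis unfolding facet_term_def emeasure_simplex[OF \<beta>] A A_def[symmetric] by simp
  next
    case False
    define g where "g T = walk_density ?E 0 T * of_bool (upper_face J ?x (site_height ?E T) I)" for T
    have gm: "g \<in> borel_measurable (PiM ?E (\<lambda>_. lborel))"
      unfolding g_def by (rule facet_integrand_measurable[OF _ \<beta>]) (use J False in \<open>auto simp: A_def\<close>)
    have pw: "ennreal (slope_norm a ^ Suc (card (?E - I))) * g (\<lambda>j\<in>?E. a \<bullet> ?x j + slope_norm a * (r - (if j \<in> I then 0 else V j)))
      = facet_density ?E (Suc (card (?E - I))) (\<lambda>\<rho>. of_bool ((\<forall>j\<in>?E - I. snd \<rho> j \<ge> 0) \<and> ((0, 0) \<in> J \<longrightarrow> fst \<rho> \<ge> 0)))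
            (\<lambda>\<rho>. increment (fst \<rho>) (contact_path I (snd \<rho>))) X (a, r, V)" for a r V
    proof -
      define T where "T = (\<lambda>j\<in>?E. a \<bullet> ?x j + slope_norm a * (r - contact_path I V j))"
      have T: "T j = a \<bullet> ?x j + slope_norm a * (r - contact_path I V j)" if "j \<in> ?E" for j
        using that by (simp add: T_def)
      have pos: "0 \<le> slope_norm a" "\<not> slope_norm a \<le> 0" using slope_norm_pos[of a] by linarith+
      have "upper_face J ?x (site_height ?E T) I \<longleftrightarrow> (\<forall>j\<in>J. site_height ?E T j \<le> a \<bullet> ?x j + slope_norm a * r)"
      proof (rule upper_face_iff[OF \<beta> False[unfolded A_def]])
        fix i assume "i \<in> I"
        then show "site_height ?E T i = a \<bullet> ?x i + slope_norm a * r"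
          using I T[of i] by (auto simp: site_height_def contact_path_def)
      qed
      also have "\<dots> \<longleftrightarrow> (\<forall>j\<in>?E. contact_path I V j \<ge> 0) \<and> ((0, 0) \<in> J \<longrightarrow> r \<ge> 0)"
      proof -
        have 1: "site_height ?E T j \<le> a \<bullet> ?x j + slope_norm a * r \<longleftrightarrow> contact_path I V j \<ge> 0" if "j \<in> ?E" for j
          using that T[OF that] pos by (simp add: site_height_def right_diff_distrib zero_le_mult_iff)
        have 2: "site_height ?E T (0, 0) \<le> a \<bullet> ?x (0, 0) + slope_norm a * r \<longleftrightarrow> r \<ge> 0"
          using pos by (simp add: site_height_def zero_le_mult_iff)
        show ?thesis using J 1 2 by auto
      qed
      also have "(\<forall>j\<in>?E. contact_path I V j \<ge> 0) \<longleftrightarrow> (\<forall>j\<in>?E - I. V j \<ge> 0)"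
        by (auto simp: contact_path_def)
      finally have up: "upper_face J ?x (site_height ?E T) I \<longleftrightarrow> (\<forall>j\<in>?E - I. V j \<ge> 0) \<and> ((0, 0) \<in> J \<longrightarrow> r \<ge> 0)" .
      have "walk_density ?E 0 T = (\<Prod>e\<in>?E. ennreal (std_normal_density (a \<bullet> X e - slope_norm a * increment r (contact_path I V) e)))"
        unfolding walk_density_def using increment_lift[OF T] by (intro prod.cong) auto
      then have "ennreal (slope_norm a ^ Suc (card (?E - I))) * g T = facet_density ?E (Suc (card (?E - I))) (\<lambda>\<rho>. of_bool ((\<forall>j\<in>?E - I. snd \<rho> j \<ge> 0) \<and> ((0, 0) \<in> J \<longrightarrow> fst \<rho> \<ge> 0)))
            (\<lambda>\<rho>. increment (fst \<rho>) (contact_path I (snd \<rho>))) X (a, r, V)"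
        unfolding g_def up facet_density_def fst_conv snd_conv by (simp only: mult_ac)
      then show ?thesis unfolding T_def contact_path_def .
    qed
    have "facet_term ?E J X I = ennreal (\<bar>A\<bar> / fact CARD('d)) * (\<integral>\<^sup>+T. g T \<partial>PiM ?E (\<lambda>_. lborel))"
      unfolding facet_term_def emeasure_simplex[OF \<beta>] A_def g_def ..
    also have "\<dots> = ennreal (\<bar>A\<bar> / fact CARD('d)) * (ennreal \<bar>A\<bar> * (\<integral>\<^sup>+z. ennreal (slope_norm (fst z) ^ Suc (card (?E - I)))
        * g (\<lambda>j\<in>?E. fst z \<bullet> ?x j + slope_norm (fst z) * (fst (snd z) - (if j \<in> I then 0 else snd (snd z) j)))
      \<partial>(lborel \<Otimes>\<^sub>M (lborel \<Otimes>\<^sub>M PiM (?E - I) (\<lambda>_. lborel)))))"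
      by (subst change_of_variables_affine[OF finite_steps \<beta>(1) I \<beta>(2) False[unfolded A_def] gm]) (simp only: A_def)
    also have "\<dots> = ennreal (\<bar>A\<bar> / fact CARD('d)) * ennreal \<bar>A\<bar> * (\<integral>\<^sup>+z. facet_density ?E (Suc (card (?E - I)))
            (\<lambda>\<rho>. of_bool ((\<forall>j\<in>?E - I. snd \<rho> j \<ge> 0) \<and> ((0, 0) \<in> J \<longrightarrow> fst \<rho> \<ge> 0)))
            (\<lambda>\<rho>. increment (fst \<rho>) (contact_path I (snd \<rho>))) X z \<partial>(lborel \<Otimes>\<^sub>M (lborel \<Otimes>\<^sub>M PiM (?E - I) (\<lambda>_. lborel))))"
      unfolding pw prod.collapse mult.assoc ..
    also have "ennreal (\<bar>A\<bar> / fact CARD('d)) * ennreal \<bar>A\<bar> = ennreal (A\<^sup>2 / fact CARD('d))"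
      by (simp add: ennreal_mult'[symmetric] power2_eq_square)
    finally show ?thesis unfolding A A_def .
  qed
qed

text \<open>The hyperplane passes through the lifted origin, so there is no offset to integrate over
  and the gap walks start at 0.\<close>

lemma facet_term_origin:
  fixes X :: "nat \<times> nat \<Rightarrow> real^'d" and \<beta> :: "'d \<Rightarrow> nat \<times> nat"
  assumes \<beta>: "bij_betw \<beta> UNIV I" and I: "I \<subseteq> steps m n"
  shows "facet_term (steps m n) (insert (0, 0) (steps m n)) X (insert (0, 0) I)
    = ennreal ((det (\<chi> k. \<Sum>e\<in>steps m n. cumul (\<beta> k) e *\<^sub>R X e :: real^'d^'d))\<^sup>2 / fact CARD('d))
      * (\<integral>\<^sup>+z. facet_density (steps m n) (card (steps m n - I))
            (\<lambda>\<rho>. of_bool (\<forall>j\<in>steps m n - I. \<rho> j \<ge> 0)) (\<lambda>\<rho>. increment 0 (contact_path I \<rho>)) X z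
          \<partial>(lborel \<Otimes>\<^sub>M PiM (steps m n - I) (\<lambda>_. lborel)))"
proof -
  let ?E = "steps m n" and ?x = "walk_vertex X"
  let ?J = "insert (0, 0) ?E" and ?I = "insert (0, 0) I"
  have I0: "(0, 0) \<notin> I" using I by auto
  then have "?I - {(0, 0)} = I" by auto
  then have \<beta>': "bij_betw \<beta> UNIV (?I - {(0, 0)})" "(0, 0) \<in> ?I" using \<beta> by simp_all
  have A: "(\<chi> k. \<Sum>e\<in>?E. cumul (\<beta> k) e *\<^sub>R X e :: real^'d^'d) = (\<chi> k. ?x (\<beta> k))"
  proof -
    have "\<beta> k \<in> I" for k using \<beta>(1) by (auto simp: bij_betw_def)
    then have "\<beta> k \<in> insert (0, 0) ?E" for k using I by blast
    then have "(\<Sum>e\<in>?E. cumul (\<beta> k) e *\<^sub>R X e) = ?x (\<beta> k)" for k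
      by (simp only: walk_vertex_eq_sum[of _ m n])
    then show ?thesis by simp
  qed
  define A where "A = det (\<chi> k. ?x (\<beta> k))"
  have A': "A = det (\<chi> k. ?x (\<beta> k) - ?x (0, 0))" by (simp add: A_def)
  show ?thesis
  proof (cases "A = 0")
    case True
    then show ?thesis unfolding facet_term_def emeasure_simplex[OF \<beta>'] A A_def[symmetric] A'[symmetric] by simp
  next
    case False
    define g where "g T = walk_density ?E 0 T * of_bool (upper_face ?J ?x (site_height ?E T) ?I)" for T
    have gm: "g \<in> borel_measurable (PiM ?E (\<lambda>_. lborel))"
      unfolding g_def by (rule facet_integrand_measurable[OF _ \<beta>']) (use False in \<open>auto simp: A_def\<close>)
    have pw: "ennreal (slope_norm a ^ card (?E - I)) * g (\<lambda>j\<in>?E. a \<bullet> ?x j - slope_norm a * (if j \<in> I then 0 else V j))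
      = facet_density ?E (card (?E - I)) (\<lambda>\<rho>. of_bool (\<forall>j\<in>?E - I. \<rho> j \<ge> 0)) (\<lambda>\<rho>. increment 0 (contact_path I \<rho>)) X (a, V)" for a V
    proof -
      define T where "T = (\<lambda>j\<in>?E. a \<bullet> ?x j - slope_norm a * contact_path I V j)"
      have T: "T j = a \<bullet> ?x j + slope_norm a * (0 - contact_path I V j)" if "j \<in> ?E" for j
        using that by (simp add: T_def)
      have pos: "0 \<le> slope_norm a" "\<not> slope_norm a \<le> 0" using slope_norm_pos[of a] by linarith+
      have "upper_face ?J ?x (site_height ?E T) ?I \<longleftrightarrow> (\<forall>j\<in>?J. site_height ?E T j \<le> a \<bullet> ?x j + 0)"
      proof (rule upper_face_iff[OF \<beta>' False[unfolded A']])
        fix i assume "i \<in> ?I"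
        then show "site_height ?E T i = a \<bullet> ?x i + 0"
          using I T[of i] by (auto simp: site_height_def contact_path_def)
      qed
      also have "\<dots> \<longleftrightarrow> (\<forall>j\<in>?E. contact_path I V j \<ge> 0)"
      proof -
        have 1: "site_height ?E T j \<le> a \<bullet> ?x j + 0 \<longleftrightarrow> contact_path I V j \<ge> 0" if "j \<in> ?E" for j
          using that T[OF that] pos by (simp add: site_height_def zero_le_mult_iff)
        have 2: "site_height ?E T (0, 0) \<le> a \<bullet> ?x (0, 0) + 0" by (simp add: site_height_def)
        show ?thesis using 1 2 by auto
      qed
      also have "(\<forall>j\<in>?E. contact_path I V j \<ge> 0) \<longleftrightarrow> (\<forall>j\<in>?E - I. V j \<ge> 0)"
        by (auto simp: contact_path_def)
      finally have up: "upper_face ?J ?x (site_height ?E T) ?I \<longleftrightarrow> (\<forall>j\<in>?E - I. V j \<ge> 0)" .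
      have "walk_density ?E 0 T = (\<Prod>e\<in>?E. ennreal (std_normal_density (a \<bullet> X e - slope_norm a * increment 0 (contact_path I V) e)))"
        unfolding walk_density_def using increment_lift[OF T] by (intro prod.cong) auto
      then have "ennreal (slope_norm a ^ card (?E - I)) * g T = facet_density ?E (card (?E - I)) (\<lambda>\<rho>. of_bool (\<forall>j\<in>?E - I. \<rho> j \<ge> 0)) (\<lambda>\<rho>. increment 0 (contact_path I \<rho>)) X (a, V)"
        unfolding g_def up facet_density_def fst_conv snd_conv by (simp only: mult_ac)
      then show ?thesis unfolding T_def contact_path_def .
    qed
    have "facet_term ?E ?J X ?I = ennreal (\<bar>A\<bar> / fact CARD('d)) * (\<integral>\<^sup>+T. g T \<partial>PiM ?E (\<lambda>_. lborel))"
      unfolding facet_term_def emeasure_simplex[OF \<beta>'] A' g_def ..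
    also have "\<dots> = ennreal (\<bar>A\<bar> / fact CARD('d)) * (ennreal \<bar>A\<bar> * (\<integral>\<^sup>+z. ennreal (slope_norm (fst z) ^ card (?E - I))
        * g (\<lambda>j\<in>?E. fst z \<bullet> ?x j - slope_norm (fst z) * (if j \<in> I then 0 else snd z j))
      \<partial>(lborel \<Otimes>\<^sub>M PiM (?E - I) (\<lambda>_. lborel))))"
      by (subst change_of_variables_origin[OF finite_steps \<beta> I False[unfolded A_def] gm]) (simp only: A_def)
    also have "\<dots> = ennreal (\<bar>A\<bar> / fact CARD('d)) * ennreal \<bar>A\<bar> * (\<integral>\<^sup>+z. facet_density ?E (card (?E - I))
            (\<lambda>\<rho>. of_bool (\<forall>j\<in>?E - I. \<rho> j \<ge> 0)) (\<lambda>\<rho>. increment 0 (contact_path I \<rho>)) X z \<partial>(lborel \<Otimes>\<^sub>M PiM (?E - I) (\<lambda>_. lborel)))"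
      unfolding pw prod.collapse mult.assoc ..
    also have "ennreal (\<bar>A\<bar> / fact CARD('d)) * ennreal \<bar>A\<bar> = ennreal (A\<^sup>2 / fact CARD('d))"
      by (simp add: ennreal_mult'[symmetric] power2_eq_square)
    finally show ?thesis unfolding A A_def .
  qed
qed

section \<open>Integration over the walks\<close>

lemma prod_steps_Suc:
  "(\<Prod>e\<in>steps (Suc m) n. f e) = (\<Prod>e\<in>steps m n. f e) * (\<Prod>i=1..n (Suc m). f (Suc m, i))"
proof -
  have st: "steps (Suc m) n = steps m n \<union> Pair (Suc m) ` {1..n (Suc m)}" by (auto simp: steps_def le_Suc_eq)
  have "steps m n \<inter> Pair (Suc m) ` {1..n (Suc m)} = {}" by (auto simp: steps_def)
  then show ?thesis unfolding st by (subst prod.union_disjoint) (auto simp: prod.reindex inj_on_def)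
qed

text \<open>The walks are independent given the common start \<open>r\<close>;
  \<open>chain_integral\<close> splits off the last one, with all the others in the role of
  \<open>G\<close>.\<close>

lemma walks_integral:
  assumes psf: "product_sigma_finite M" and sets: "\<And>e. sets (M e) = sets borel"
    and n: "\<And>l. l \<in> {1..m} \<Longrightarrow> n l \<ge> 1"
  shows "(\<integral>\<^sup>+U. walk_density (steps m n) r U \<partial>PiM (steps m n) M)
    = (\<Prod>l=1..m. \<integral>\<^sup>+v. chain (\<lambda>i. M (l, i)) r (n l - 1) v \<partial>M (l, n l))"
  using n
proof (induction m)
  case 0
  interpret product_sigma_finite M by (rule psf)
  have "steps 0 n = {}" by (auto simp: steps_def)
  then show ?case by (simp add: walk_density_def PiM_empty nn_integral_count_space_finite)
next
  case (Suc m)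
  obtain k where k: "n (Suc m) = Suc k" using Suc.prems[of "Suc m"] by (cases "n (Suc m)") auto
  have st: "steps (Suc m) n = steps m n \<union> Pair (Suc m) ` {1..Suc k}" by (auto simp: steps_def le_Suc_eq k)
  have w: "walk_density (steps (Suc m) n) r U = walk_density (steps m n) r U * (\<Prod>i=1..Suc k. walk_weight r (Pair (Suc m)) U i)" for U
    unfolding walk_density_def prod_steps_Suc k walk_weight_def increment_def by (simp only: fst_conv snd_conv cong: if_cong)
  have "(\<integral>\<^sup>+U. walk_density (steps (Suc m) n) r U \<partial>PiM (steps (Suc m) n) M)
    = (\<integral>\<^sup>+U. walk_density (steps m n) r U * (\<Prod>i=1..Suc k. walk_weight r (Pair (Suc m)) U i) * (\<lambda>_. 1) (U (Suc m, Suc k))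
        \<partial>PiM (steps m n \<union> Pair (Suc m) ` {1..Suc k}) M)"
    unfolding st[symmetric] w by (simp only: mult_1_right)
  also have "\<dots> = (\<integral>\<^sup>+U. walk_density (steps m n) r U \<partial>PiM (steps m n) M) * (\<integral>\<^sup>+v. chain (\<lambda>i. M (Suc m, i)) r k v * (\<lambda>_. 1) v \<partial>M (Suc m, Suc k))"
  proof (rule chain_integral[OF psf sets finite_steps])
    show "walk_density (steps m n) r \<in> borel_measurable (PiM (steps m n) M)"
      by (rule walk_density_measurable(1)) (simp_all add: measurable_PiM_coordinate sets)
    show "walk_density (steps m n) r x = walk_density (steps m n) r y" if "\<And>j. j \<in> steps m n \<Longrightarrow> x j = y j" for x y
      using that by (rule walk_density_cong)
  qed (auto simp: inj_on_def steps_def)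
  also have "(\<integral>\<^sup>+U. walk_density (steps m n) r U \<partial>PiM (steps m n) M) = (\<Prod>l=1..m. \<integral>\<^sup>+v. chain (\<lambda>i. M (l, i)) r (n l - 1) v \<partial>M (l, n l))"
    by (rule Suc.IH) (use Suc.prems in auto)
  finally show ?case by (simp add: k)
qed

lemma nn_integral_shifted_normal: "(\<integral>\<^sup>+u. ennreal (std_normal_density (u - v)) \<partial>lborel) = 1"
proof -
  have "(\<integral>\<^sup>+u. ennreal (std_normal_density u) \<partial>lborel) = (\<integral>\<^sup>+u. ennreal (std_normal_density (u - v)) \<partial>lborel)"
    using nn_integral_real_affine[of "\<lambda>u. ennreal (std_normal_density u)" 1 "- v"] by (simp add: add.commute)
  then show ?thesis using nn_integral_std_normal_density by simp
qed

lemma nn_integral_chain_lborel: "(\<integral>\<^sup>+v. chain (\<lambda>_. lborel) r k v \<partial>lborel) = 1"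
proof (induction k)
  case 0
  show ?case by (simp add: nn_integral_shifted_normal)
next
  case (Suc k)
  have [measurable]: "chain (\<lambda>_. lborel) r k \<in> borel_measurable borel"
    by (rule chain_measurable) (auto intro: lborel.sigma_finite_measure_axioms)
  have n: "(\<integral>\<^sup>+u. ennreal (std_normal_density (u - v)) \<partial>lborel) = 1" for v
    by (rule nn_integral_shifted_normal)
  have "(\<integral>\<^sup>+u. chain (\<lambda>_. lborel) r (Suc k) u \<partial>lborel)
    = (\<integral>\<^sup>+u. \<integral>\<^sup>+v. chain (\<lambda>_. lborel) r k v * ennreal (std_normal_density (u - v)) \<partial>lborel \<partial>lborel)" by simp
  also have "\<dots> = (\<integral>\<^sup>+v. \<integral>\<^sup>+u. chain (\<lambda>_. lborel) r k v * ennreal (std_normal_density (u - v)) \<partial>lborel \<partial>lborel)"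
    by (rule lborel_pair.Fubini'[symmetric]) simp
  also have "\<dots> = (\<integral>\<^sup>+v. chain (\<lambda>_. lborel) r k v * (\<integral>\<^sup>+u. ennreal (std_normal_density (u - v)) \<partial>lborel) \<partial>lborel)"
    by (intro nn_integral_cong nn_integral_cmult) simp
  finally show ?case unfolding n using Suc by simp
qed

lemma nn_integral_walk_density:
  assumes "\<And>l. l \<in> {1..m} \<Longrightarrow> n l \<ge> 1"
  shows "(\<integral>\<^sup>+T. walk_density (steps m n) r T \<partial>PiM (steps m n) (\<lambda>_. lborel)) = 1"
  by (subst walks_integral) (use assms in \<open>auto simp: nn_integral_chain_lborel intro: product_sigma_finite_lborel\<close>)

definition contact_total :: "nat \<Rightarrow> (nat \<Rightarrow> nat) \<Rightarrow> (nat \<Rightarrow> nat set) \<Rightarrow> real \<Rightarrow> ennreal" where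
  "contact_total m n K r = (\<Prod>l=1..m. if K l = {} then survival (n l) r else contact_weight (K l) r * survival (n l - Max (K l)) 0)"

text \<open>The contact positions are not integration variables. They are put back as coordinates
  with a point mass at 0, so that all positions carry a product measure and the walks
  factor.\<close>

lemma nn_integral_contact_path:
  assumes n: "\<And>l. l \<in> {1..m} \<Longrightarrow> n l \<ge> 1" and K: "\<And>l. l \<in> {1..m} \<Longrightarrow> K l \<subseteq> {1..n l}"
    and I: "I = Sigma {1..m} K"
  shows "(\<integral>\<^sup>+V. of_bool (\<forall>j\<in>steps m n - I. V j \<ge> 0) * walk_density (steps m n) r (contact_path I V) \<partial>PiM (steps m n - I) (\<lambda>_. lborel))
    = contact_total m n K r"
proof -
  let ?E = "steps m n"
  define \<nu> where "\<nu> e = contact_measure (K (fst e)) (snd e)" for e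
  have IE: "I \<subseteq> ?E" using K by (fastforce simp: I steps_def)
  have psf: "product_sigma_finite \<nu>"
    by (simp add: product_sigma_finite_def \<nu>_def sigma_finite_contact_measure)
  interpret product_sigma_finite \<nu> by (rule psf)
  have fin: "finite I" using IE finite_subset finite_steps by blast
  have E: "?E - I \<union> I = ?E" using IE by auto
  have wm: "walk_density ?E r \<in> borel_measurable (PiM ?E \<nu>)"
    by (rule walk_density_measurable(1)) (auto intro!: measurable_PiM_coordinate simp: \<nu>_def)
  have cm: "(\<lambda>V. walk_density ?E r (contact_path I V)) \<in> borel_measurable (PiM (?E - I) (\<lambda>_. lborel))"
  proof (rule walk_density_measurable(1))
    show "(\<lambda>V. contact_path I V e) \<in> borel_measurable (PiM (?E - I) (\<lambda>_. lborel))" for e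
      unfolding contact_path_def by (cases "e \<in> I") (simp_all add: measurable_PiM_lborel_coordinate)
  qed simp
  have nuI: "PiM I \<nu> = return (PiM I (\<lambda>_. borel)) (\<lambda>_\<in>I. 0)"
  proof -
    have "PiM I \<nu> = PiM I (\<lambda>_. return borel 0)" by (rule PiM_cong) (auto simp: \<nu>_def contact_measure_def I)
    also have "\<dots> = return (PiM I (\<lambda>_. borel)) (\<lambda>_\<in>I. 0)" using fin by (subst PiM_return) auto
    finally show ?thesis .
  qed
  have nuR: "PiM (?E - I) \<nu> = PiM (?E - I) (\<lambda>_. halfline)"
    by (rule PiM_cong) (auto simp: \<nu>_def contact_measure_def I steps_def)
  have inner: "(\<integral>\<^sup>+y. walk_density ?E r (merge (?E - I) I (V, y)) \<partial>PiM I \<nu>) = walk_density ?E r (contact_path I V)" if V: "V \<in> space (PiM (?E - I) \<nu>)" for V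
  proof -
    have "(\<lambda>y. merge (?E - I) I (V, y)) \<in> measurable (PiM I \<nu>) (PiM ?E \<nu>)"
      using measurable_compose[OF measurable_Pair1'[OF V] measurable_merge[of "?E - I" I \<nu>]] by (simp only: E)
    from measurable_compose[OF this wm]
    have "(\<lambda>y. walk_density ?E r (merge (?E - I) I (V, y))) \<in> borel_measurable (PiM I (\<lambda>_. borel))"
      by (subst (asm) measurable_cong_sets[OF sets_PiM_cong[of I I \<nu> "\<lambda>_. borel"] refl]) (simp_all add: \<nu>_def)
    then have "(\<integral>\<^sup>+y. walk_density ?E r (merge (?E - I) I (V, y)) \<partial>PiM I \<nu>) = walk_density ?E r (merge (?E - I) I (V, \<lambda>_\<in>I. 0))"
      unfolding nuI by (intro nn_integral_return) (auto simp: space_PiM)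
    also have "\<dots> = walk_density ?E r (contact_path I V)"
      by (rule walk_density_cong) (auto simp: merge_def contact_path_def)
    finally show ?thesis .
  qed
  have "(\<integral>\<^sup>+V. of_bool (\<forall>j\<in>?E - I. V j \<ge> 0) * walk_density ?E r (contact_path I V) \<partial>PiM (?E - I) (\<lambda>_. lborel))
     = (\<integral>\<^sup>+V. walk_density ?E r (contact_path I V) \<partial>PiM (?E - I) (\<lambda>_. halfline))"
    using nn_integral_halfline_PiM[OF _ cm] by (simp add: mult.commute)
  also have "\<dots> = (\<integral>\<^sup>+V. \<integral>\<^sup>+y. walk_density ?E r (merge (?E - I) I (V, y)) \<partial>PiM I \<nu> \<partial>PiM (?E - I) \<nu>)"
    unfolding nuR[symmetric] by (intro nn_integral_cong) (simp add: inner)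
  also have "\<dots> = (\<integral>\<^sup>+U. walk_density ?E r U \<partial>PiM ?E \<nu>)"
    using product_nn_integral_fold[of "?E - I" I "walk_density ?E r"] fin wm unfolding E by (simp add: Diff_Int_distrib2)
  also have "\<dots> = (\<Prod>l=1..m. \<integral>\<^sup>+v. chain (\<lambda>i. \<nu> (l, i)) r (n l - 1) v \<partial>\<nu> (l, n l))"
    by (rule walks_integral[OF psf _ n]) (simp_all add: \<nu>_def)
  also have "\<dots> = contact_total m n K r"
    unfolding contact_total_def
  proof (rule prod.cong)
    fix l assume l: "l \<in> {1..m}"
    then obtain k where k: "n l = Suc k" using n[OF l] by (cases "n l") auto
    have "(\<lambda>i. \<nu> (l, i)) = contact_measure (K l)" by (auto simp: \<nu>_def)
    then show "(\<integral>\<^sup>+v. chain (\<lambda>i. \<nu> (l, i)) r (n l - 1) v \<partial>\<nu> (l, n l))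
      = (if K l = {} then survival (n l) r else contact_weight (K l) r * survival (n l - Max (K l)) 0)"
      using chain_contact_total[of "K l" k r] K[OF l] by (simp add: k \<nu>_def)
  qed simp
  finally show ?thesis .
qed

text \<open>Any \<open>DIM('a) + 2\<close> points have an affine dependence \<open>\<mu>\<close>.
  Lying on one hyperplane would force the same linear relation on their heights, which fails almost
  surely once the relation involves a random height.\<close>

lemma AE_heights_generic:
  fixes x :: "nat \<times> nat \<Rightarrow> 'a::euclidean_space"
  assumes J: "J \<subseteq> insert p0 E" and E: "finite E" "p0 \<notin> E"
  shows "AE T in PiM E (\<lambda>_. lborel). \<forall>K a b. K \<subseteq> J \<longrightarrow> card K = DIM('a) + 2 \<longrightarrow> (\<exists>i\<in>K. site_height E T i \<noteq> a \<bullet> x i + b)"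
proof -
  have "AE T in PiM E (\<lambda>_. lborel). \<forall>a b. \<exists>i\<in>K. site_height E T i \<noteq> a \<bullet> x i + b" if K: "K \<subseteq> J" "card K = DIM('a) + 2" for K
  proof -
    have finK: "finite K" using K(2) card.infinite by fastforce
    obtain \<mu> where \<mu>: "\<exists>i\<in>K. \<mu> i \<noteq> 0" "sum \<mu> K = 0" "(\<Sum>i\<in>K. \<mu> i *\<^sub>R x i) = 0"
      using affine_dependence_indexed[OF finK K(2), of x] by blast
    \<comment> \<open>The weights sum to 0 without all vanishing, so they cannot be concentrated on
      the one site \<open>p0\<close> of fixed height.\<close>
    have ex: "\<exists>i\<in>K \<inter> E. \<mu> i \<noteq> 0"
    proof (rule ccontr)
      assume neg: "\<not> ?thesis"
      have "K \<subseteq> insert p0 E" using K J by auto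
      then have z: "\<mu> i = 0" if "i \<in> K - {p0}" for i using that neg by auto
      obtain i where i: "i \<in> K" "\<mu> i \<noteq> 0" using \<mu>(1) by blast
      then have "i = p0" using z by blast
      then have "sum \<mu> K = \<mu> p0" using i z finK by (simp add: sum.remove[of K p0])
      then show False using \<mu>(2) i \<open>i = p0\<close> by simp
    qed
    then obtain i1 where i1: "i1 \<in> K" "i1 \<in> E" "\<mu> i1 \<noteq> 0" by auto
    define c where "c i = (if i \<in> K then \<mu> i else 0)" for i
    have "AE T in PiM E (\<lambda>_. lborel). (\<Sum>i\<in>E. c i * T i) \<noteq> 0"
      by (rule AE_PiM_linear_neq[where ?i0.0=i1]) (use i1 E in \<open>auto simp: c_def product_sigma_finite_lborel AE_lborel_singleton\<close>)
    then show ?thesis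
    proof (rule eventually_mono, intro allI)
      fix T a b assume T: "(\<Sum>i\<in>E. c i * T i) \<noteq> 0"
      show "\<exists>i\<in>K. site_height E T i \<noteq> a \<bullet> x i + b"
      proof (rule ccontr)
        assume "\<not> ?thesis"
        then have eq: "site_height E T i = a \<bullet> x i + b" if "i \<in> K" for i using that by auto
        have "(\<Sum>i\<in>E. c i * T i) = (\<Sum>i\<in>E \<inter> K. \<mu> i * T i)"
          by (subst sum.inter_restrict[OF E(1)]) (auto intro!: sum.cong simp: c_def)
        also have "\<dots> = (\<Sum>i\<in>K. \<mu> i * site_height E T i)"
          by (rule sum.mono_neutral_cong_left) (use finK in \<open>auto simp: site_height_def\<close>)
        also have "\<dots> = (\<Sum>i\<in>K. a \<bullet> (\<mu> i *\<^sub>R x i) + \<mu> i * b)"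
          by (intro sum.cong) (auto simp: eq algebra_simps)
        also have "\<dots> = a \<bullet> (\<Sum>i\<in>K. \<mu> i *\<^sub>R x i) + sum \<mu> K * b"
          by (simp add: sum.distrib inner_sum_right sum_distrib_right)
        finally show False using T \<mu> by simp
      qed
    qed
  qed
  moreover have "finite {K. K \<subseteq> J \<and> card K = DIM('a) + 2}"
    by (rule finite_subset[of _ "Pow (insert p0 E)"]) (use J E in auto)
  ultimately have "AE T in PiM E (\<lambda>_. lborel). \<forall>K\<in>{K. K \<subseteq> J \<and> card K = DIM('a) + 2}. \<forall>a b. \<exists>i\<in>K. site_height E T i \<noteq> a \<bullet> x i + b"
    by (intro AE_finite_allI) auto
  then show ?thesis by (rule eventually_mono) blast
qed

text \<open>The volume of the hull does not depend on the auxiliary heights. Since their law has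
  total mass 1, the volume equals its own average, and the triangulation holds for almost all
  heights.\<close>

lemma hull_volume_eq_sum_facet_terms:
  fixes X :: "nat \<times> nat \<Rightarrow> real^'d"
  assumes n: "\<And>l. l \<in> {1..m} \<Longrightarrow> n l \<ge> 1"
    and J: "J = steps m n \<or> J = insert (0, 0) (steps m n)"
  shows "emeasure lborel (convex hull (walk_vertex X ` J)) = (\<Sum>I | I \<subseteq> J \<and> card I = Suc CARD('d). facet_term (steps m n) J X I)"
proof -
  let ?E = "steps m n" and ?x = "walk_vertex X"
  let ?P = "PiM ?E (\<lambda>_. lborel :: real measure)"
  let ?v = "\<lambda>I. emeasure lborel (convex hull (?x ` I))"
  let ?F = "{I. I \<subseteq> J \<and> card I = Suc CARD('d)}"
  let ?g = "\<lambda>I T. walk_density ?E 0 T * of_bool (upper_face J ?x (site_height ?E T) I) :: ennreal"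
  have wm: "walk_density ?E 0 \<in> borel_measurable ?P"
    by (rule walk_density_measurable(1)) (simp_all add: measurable_PiM_lborel_coordinate)
  have finJ: "finite J" using J by auto
  \<comment> \<open>Measurability of the face event is available for nondegenerate simplices; the
    others have volume 0.\<close>
  have gm: "?g I \<in> borel_measurable ?P \<or> ?v I = 0" if I: "I \<in> ?F" for I
  proof -
    have "I \<noteq> {}" using I by auto
    then obtain i0 where i0: "i0 \<in> I" by blast
    have "finite I" using I finJ finite_subset by blast
    then have "card (I - {i0}) = CARD('d)" using I i0 by simp
    then obtain \<beta> :: "'d \<Rightarrow> nat \<times> nat" where \<beta>: "bij_betw \<beta> UNIV (I - {i0})"
      using finite_same_card_bij[of "UNIV :: 'd set" "I - {i0}"] \<open>finite I\<close> by auto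
    show ?thesis
    proof (cases "det (\<chi> k. ?x (\<beta> k) - ?x i0) = 0")
      case True
      then show ?thesis unfolding emeasure_simplex[OF \<beta> i0] by simp
    next
      case False
      then show ?thesis using facet_integrand_measurable[OF finJ \<beta> i0 False] by blast
    qed
  qed
  have vgm: "(\<lambda>T. ?v I * ?g I T) \<in> borel_measurable ?P" if "I \<in> ?F" for I
    using gm[OF that] by auto
  have ft: "facet_term ?E J X I = (\<integral>\<^sup>+T. ?v I * ?g I T \<partial>?P)" if "I \<in> ?F" for I
    unfolding facet_term_def using gm[OF that] by (auto simp: nn_integral_cmult)
  have "emeasure lborel (convex hull (?x ` J)) = emeasure lborel (convex hull (?x ` J)) * (\<integral>\<^sup>+T. walk_density ?E 0 T \<partial>?P)"
    using nn_integral_walk_density[of m n 0] n by simp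
  also have "\<dots> = (\<integral>\<^sup>+T. emeasure lborel (convex hull (?x ` J)) * walk_density ?E 0 T \<partial>?P)"
    using wm by (simp add: nn_integral_cmult)
  also have "\<dots> = (\<integral>\<^sup>+T. (\<Sum>I\<in>?F. ?v I * ?g I T) \<partial>?P)"
  proof (rule nn_integral_cong_AE)
    have "AE T in ?P. \<forall>K a b. K \<subseteq> J \<longrightarrow> card K = DIM(real^'d) + 2 \<longrightarrow> (\<exists>i\<in>K. site_height ?E T i \<noteq> a \<bullet> ?x i + b)"
      by (rule AE_heights_generic[where ?p0.0="(0, 0)"]) (use J in auto)
    then show "AE T in ?P. emeasure lborel (convex hull (?x ` J)) * walk_density ?E 0 T = (\<Sum>I\<in>?F. ?v I * ?g I T)"
    proof (rule eventually_mono)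
      fix T assume "\<forall>K a b. K \<subseteq> J \<longrightarrow> card K = DIM(real^'d) + 2 \<longrightarrow> (\<exists>i\<in>K. site_height ?E T i \<noteq> a \<bullet> ?x i + b)"
      then have "emeasure lborel (convex hull (?x ` J)) = (\<Sum>I | I \<subseteq> J \<and> card I = Suc DIM(real^'d). ?v I * of_bool (upper_face J ?x (site_height ?E T) I))"
        by (intro regular_triangulation[OF finJ]) blast
      then show "emeasure lborel (convex hull (?x ` J)) * walk_density ?E 0 T = (\<Sum>I\<in>?F. ?v I * ?g I T)"
        by (simp add: sum_distrib_right sum_distrib_left mult_ac)
    qed
  qed
  also have "\<dots> = (\<Sum>I\<in>?F. \<integral>\<^sup>+T. ?v I * ?g I T \<partial>?P)"
    by (rule nn_integral_sum) (rule vgm)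
  also have "\<dots> = (\<Sum>I\<in>?F. facet_term ?E J X I)"
    by (rule sum.cong) (simp_all add: ft)
  finally show ?thesis .
qed

section \<open>Expected facet terms in terms of contacts\<close>

lemma contact_path_measurable [measurable]:
  "(\<lambda>\<rho>. contact_path I (snd \<rho>) e) \<in> borel_measurable (N \<Otimes>\<^sub>M PiM S (\<lambda>_. lborel))"
  "(\<lambda>V. contact_path I V e) \<in> borel_measurable (PiM S (\<lambda>_. lborel))"
  unfolding contact_path_def
  by (cases "e \<in> I"; simp add: measurable_PiM_lborel_coordinate measurable_snd_PiM_coordinate)+

lemma ex_bij_betw_UNIV:
  assumes "card A = CARD('d::finite)"
  shows "\<exists>\<beta> :: 'd \<Rightarrow> 'a. bij_betw \<beta> UNIV A"
proof -
  have "finite A" using assms card.infinite by fastforce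
  then show ?thesis using finite_same_card_bij[of "UNIV :: 'd set" A] assms by auto
qed

definition cfg_gram :: "nat \<Rightarrow> (nat \<Rightarrow> nat set) \<Rightarrow> real" where
  "cfg_gram m K = (\<Prod>l\<in>{l\<in>{1..m}. K l \<noteq> {}}. real (Min (K l)) * cfg_Delta (K l))"

lemma nn_integral_facet_term_affine:
  fixes m :: nat and n :: "nat \<Rightarrow> nat"
  assumes n: "\<And>l. l \<in> {1..m} \<Longrightarrow> n l \<ge> 1" and K: "K \<in> configs m n (Suc CARD('d::finite))"
    and J: "J = steps m n \<or> J = insert (0, 0) (steps m n)"
  defines "I \<equiv> Sigma {1..m} K"
  shows "(\<lambda>X :: _ \<Rightarrow> real^'d. facet_term (steps m n) J X I) \<in> borel_measurable (steps_law m n)" (is ?meas)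
    and "(\<integral>\<^sup>+X. facet_term (steps m n) J (X :: _ \<Rightarrow> real^'d) I \<partial>steps_law m n)
      = ennreal (cfg_s m K * cfg_gram m K) * ennreal (pi powr (real CARD('d) / 2) / Gamma (real CARD('d) / 2 + 1))
        * (\<integral>\<^sup>+r. of_bool ((0, 0) \<in> J \<longrightarrow> r \<ge> 0) * contact_total m n K r \<partial>lborel)" (is ?int)
proof -
  let ?E = "steps m n"
  let ?PR = "PiM (?E - I) (\<lambda>_. lborel :: real measure)"
  interpret L: product_sigma_finite "\<lambda>_::nat \<times> nat. lborel :: real measure" by (rule product_sigma_finite_lborel)
  interpret R: finite_product_sigma_finite "\<lambda>_::nat \<times> nat. lborel :: real measure" "?E - I" by standard simp
  interpret rR: pair_sigma_finite "lborel :: real measure" ?PR ..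
  have Kl: "K l \<subseteq> {1..n l}" if "l \<in> {1..m}" for l using K that unfolding configs_def by (auto split: if_splits)
  have IE: "I \<subseteq> ?E" and cI: "card I = Suc CARD('d)"
    using bij_betw_apply[OF bij_betw_configs K] unfolding I_def by auto
  have finI: "finite I" by (rule finite_subset[OF IE]) simp
  have "I \<noteq> {}" using cI by auto
  then obtain l0 where l0: "l0 \<in> {1..m}" "K l0 \<noteq> {}" unfolding I_def by blast
  \<comment> \<open>The base vertex must be the first contact of its walk, the form of base that
    \<open>gram_det_affine\<close> handles.\<close>
  define i0 where "i0 = (l0, Min (K l0))"
  have "finite (K l0)" by (rule finite_subset[OF Kl[OF l0(1)]]) simp
  then have i0: "i0 \<in> I" using l0 by (auto simp: I_def i0_def)
  have "card (I - {i0}) = CARD('d)" using cI i0 finI by simp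
  then obtain \<beta> :: "'d \<Rightarrow> nat \<times> nat" where \<beta>: "bij_betw \<beta> UNIV (I - {i0})" using ex_bij_betw_UNIV by blast
  have \<beta>I: "\<beta> k \<in> I" for k using \<beta> by (auto simp: bij_betw_def)
  let ?u = "\<lambda>\<rho>. of_bool ((\<forall>j\<in>?E - I. snd \<rho> j \<ge> 0) \<and> ((0, 0) \<in> J \<longrightarrow> fst \<rho> \<ge> (0::real))) :: ennreal"
  let ?w = "\<lambda>\<rho>. increment (fst \<rho>) (contact_path I (snd \<rho>))"
  let ?D = "\<lambda>k e. cumul (\<beta> k) e - cumul i0 e"
  have wm: "(\<lambda>\<rho>. ?w \<rho> e) \<in> borel_measurable (lborel \<Otimes>\<^sub>M ?PR)" for e
    by (rule walk_density_measurable(2)) simp_all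
  have um: "?u \<in> borel_measurable (lborel \<Otimes>\<^sub>M ?PR)"
  proof -
    have [measurable]: "(\<lambda>\<rho>. snd \<rho> j) \<in> borel_measurable (lborel \<Otimes>\<^sub>M ?PR)" for j
      by (rule measurable_snd_PiM_coordinate)
    have V: "Measurable.pred ((lborel :: real measure) \<Otimes>\<^sub>M ?PR) (\<lambda>\<rho>. \<forall>j\<in>?E - I. snd \<rho> j \<ge> 0)"
      by (intro pred_intros_finite) auto
    have nonneg: "Measurable.pred lborel (\<lambda>r::real. 0 \<le> r)" by measurable
    have "Measurable.pred ((lborel :: real measure) \<Otimes>\<^sub>M ?PR) (\<lambda>\<rho>. (0, 0) \<in> J \<longrightarrow> 0 \<le> fst \<rho>)"
      by (intro pred_intros_imp' measurable_compose[OF measurable_fst nonneg])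
    with V have "Measurable.pred ((lborel :: real measure) \<Otimes>\<^sub>M ?PR) (\<lambda>\<rho>. (\<forall>j\<in>?E - I. snd \<rho> j \<ge> 0) \<and> ((0, 0) \<in> J \<longrightarrow> fst \<rho> \<ge> 0))"
      by (rule pred_intros_logic(3))
    then show ?thesis by (rule measurable_compose) simp
  qed
  \<comment> \<open>Each position of the gap walk is the start \<open>r\<close> plus the sum of its
    increments; all face vertices have gap 0, so every such sum is \<open>- r\<close> and
    differences vanish.\<close>
  have flat: "(\<Sum>e\<in>?E. ?D k e * ?w \<rho> e) = 0" for \<rho> k
  proof -
    have "\<beta> k \<in> ?E" "i0 \<in> ?E" using \<beta>I i0 IE by auto
    then show ?thesis
      by (simp only: left_diff_distrib sum_subtractf sum_cumul_increment) (simp add: contact_path_def \<beta>I i0)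
  qed
  have card: "card ?E = Suc (card (?E - I)) + CARD('d)"
    using card_Diff_subset[OF finI IE] card_mono[OF finite_steps IE] cI by simp
  note ft = facet_term_affine[OF J \<beta> i0 IE]
  show ?meas unfolding ft steps_law_def by (rule facet_volume_measurable[OF rR.sigma_finite_measure_axioms wm um])
  have g: "det (\<chi> j k. \<Sum>e\<in>?E. ?D j e * ?D k e) = cfg_s m K * cfg_gram m K"
    using gram_det_affine[of m K n l0 \<beta>, OF Kl l0] \<beta> unfolding cfg_gram_def i0_def I_def by simp
  have "(\<integral>\<^sup>+X. facet_term ?E J (X :: _ \<Rightarrow> real^'d) I \<partial>steps_law m n)
    = ennreal (cfg_s m K * cfg_gram m K) * ennreal (pi powr (real CARD('d) / 2) / Gamma (real CARD('d) / 2 + 1))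
        * (\<integral>\<^sup>+\<rho>. ?u \<rho> * (\<Prod>e\<in>?E. ennreal (std_normal_density (?w \<rho> e))) \<partial>(lborel \<Otimes>\<^sub>M ?PR))"
    unfolding ft steps_law_def expected_facet[OF finite_steps rR.sigma_finite_measure_axioms wm um flat card] g ..
  also have "(\<integral>\<^sup>+\<rho>. ?u \<rho> * (\<Prod>e\<in>?E. ennreal (std_normal_density (?w \<rho> e))) \<partial>(lborel \<Otimes>\<^sub>M ?PR))
    = (\<integral>\<^sup>+r. \<integral>\<^sup>+V. ?u (r, V) * walk_density ?E r (contact_path I V) \<partial>?PR \<partial>lborel)"
    unfolding walk_density_def
    by (subst R.nn_integral_fst[symmetric])
       (auto intro!: borel_measurable_times_ennreal um borel_measurable_prod_ennreal measurable_compose[OF wm measurable_compose[OF borel_measurable_normal_density measurable_ennreal]])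
  also have "\<dots> = (\<integral>\<^sup>+r. of_bool ((0, 0) \<in> J \<longrightarrow> r \<ge> 0) * contact_total m n K r \<partial>lborel)"
  proof (rule nn_integral_cong)
    fix r :: real
    show "(\<integral>\<^sup>+V. ?u (r, V) * walk_density ?E r (contact_path I V) \<partial>?PR) = of_bool ((0, 0) \<in> J \<longrightarrow> r \<ge> 0) * contact_total m n K r"
      using nn_integral_contact_path[of m n K I r] n Kl I_def
      by (cases "(0, 0) \<in> J \<longrightarrow> r \<ge> 0") auto
  qed
  finally show ?int .
qed

lemma nn_integral_facet_term_origin:
  fixes m :: nat and n :: "nat \<Rightarrow> nat"
  assumes n: "\<And>l. l \<in> {1..m} \<Longrightarrow> n l \<ge> 1" and K: "K \<in> configs m n CARD('d::finite)"
  defines "I \<equiv> Sigma {1..m} K" and "J \<equiv> insert (0, 0) (steps m n)"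
  shows "(\<lambda>X :: _ \<Rightarrow> real^'d. facet_term (steps m n) J X (insert (0, 0) I)) \<in> borel_measurable (steps_law m n)" (is ?meas)
    and "(\<integral>\<^sup>+X. facet_term (steps m n) J (X :: _ \<Rightarrow> real^'d) (insert (0, 0) I) \<partial>steps_law m n)
      = ennreal (cfg_gram m K) * ennreal (pi powr (real CARD('d) / 2) / Gamma (real CARD('d) / 2 + 1)) * contact_total m n K 0" (is ?int)
proof -
  let ?E = "steps m n"
  let ?PR = "PiM (?E - I) (\<lambda>_. lborel :: real measure)"
  interpret L: product_sigma_finite "\<lambda>_::nat \<times> nat. lborel :: real measure" by (rule product_sigma_finite_lborel)
  interpret R: finite_product_sigma_finite "\<lambda>_::nat \<times> nat. lborel :: real measure" "?E - I" by standard simp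
  have Kl: "K l \<subseteq> {1..n l}" if "l \<in> {1..m}" for l using K that unfolding configs_def by (auto split: if_splits)
  have IE: "I \<subseteq> ?E" and cI: "card I = CARD('d)"
    using bij_betw_apply[OF bij_betw_configs K] unfolding I_def by auto
  have finI: "finite I" by (rule finite_subset[OF IE]) simp
  obtain \<beta> :: "'d \<Rightarrow> nat \<times> nat" where \<beta>: "bij_betw \<beta> UNIV I" using ex_bij_betw_UNIV cI by blast
  have \<beta>I: "\<beta> k \<in> I" for k using \<beta> by (auto simp: bij_betw_def)
  let ?u = "\<lambda>\<rho>. of_bool (\<forall>j\<in>?E - I. \<rho> j \<ge> 0) :: ennreal"
  let ?w = "\<lambda>\<rho>. increment 0 (contact_path I \<rho>)"
  let ?D = "\<lambda>k e. cumul (\<beta> k) e"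
  have wm: "(\<lambda>\<rho>. ?w \<rho> e) \<in> borel_measurable ?PR" for e
    by (rule walk_density_measurable(2)) simp_all
  have um: "?u \<in> borel_measurable ?PR"
  proof -
    have [measurable]: "Measurable.pred ?PR (\<lambda>\<rho>. \<forall>j\<in>?E - I. \<rho> j \<ge> 0)"
      by (intro pred_intros_finite) (auto simp: measurable_PiM_lborel_coordinate)
    show ?thesis by measurable
  qed
  \<comment> \<open>Here the start is 0 as well as the gap at each face vertex, so the sums of
    increments themselves vanish.\<close>
  have flat: "(\<Sum>e\<in>?E. ?D k e * ?w \<rho> e) = 0" for \<rho> k
  proof -
    have "\<beta> k \<in> ?E" using \<beta>I IE by auto
    then show ?thesis by (simp only: sum_cumul_increment) (simp add: contact_path_def \<beta>I)
  qed
  have card: "card ?E = card (?E - I) + CARD('d)"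
    using card_Diff_subset[OF finI IE] card_mono[OF finite_steps IE] cI by simp
  note ft = facet_term_origin[OF \<beta> IE, folded J_def]
  show ?meas unfolding ft steps_law_def by (rule facet_volume_measurable[OF R.sigma_finite_measure_axioms wm um])
  have g: "det (\<chi> j k. \<Sum>e\<in>?E. ?D j e * ?D k e) = cfg_gram m K"
    using gram_det_origin[of m K n \<beta>, OF Kl] \<beta> unfolding cfg_gram_def I_def by simp
  have "(\<integral>\<^sup>+X. facet_term ?E J (X :: _ \<Rightarrow> real^'d) (insert (0, 0) I) \<partial>steps_law m n)
    = ennreal (cfg_gram m K) * ennreal (pi powr (real CARD('d) / 2) / Gamma (real CARD('d) / 2 + 1))
        * (\<integral>\<^sup>+\<rho>. ?u \<rho> * (\<Prod>e\<in>?E. ennreal (std_normal_density (?w \<rho> e))) \<partial>?PR)"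
    unfolding ft steps_law_def expected_facet[OF finite_steps R.sigma_finite_measure_axioms wm um flat card] g ..
  then show ?int
    using nn_integral_contact_path[of m n K I 0] n Kl I_def unfolding walk_density_def by simp
qed

section \<open>Evaluation of the constants\<close>

lemma contact_gap_pos:
  assumes "finite A" "i \<in> A - {Min A}"
  shows "contact_gap A i \<ge> 1"
proof -
  have "A \<noteq> {}" using assms by auto
  then have "Min A \<in> A" "Min A \<le> i" "Min A \<noteq> i" using assms Min_in[of A] Min_le[of A i] by auto
  then have "Min A \<in> {j\<in>A. j < i}" by simp
  then have "Max {j\<in>A. j < i} \<in> {j\<in>A. j < i}" using assms(1) by (intro Max_in) auto
  then show ?thesis by (auto simp: contact_gap_def)
qed

lemma cfg_Delta_pos:
  assumes "finite A"
  shows "cfg_Delta A > 0"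
  unfolding cfg_Delta_def contact_gap_def[symmetric]
  using contact_gap_pos[OF assms] by (intro prod_pos) fastforce

text \<open>A return to 0 across a gap \<open>g\<close> has weight \<open>1 / sqrt (2 * pi)\<close>
  times \<open>g^(-3/2)\<close>: the exponent \<open>-1/2\<close> comes from the Gaussian density at
  0, the exponent \<open>-1\<close> from \<open>pers_q_0\<close>.\<close>

lemma contact_weight_eq:
  assumes A: "finite A" "A \<noteq> {}" "\<And>i. i \<in> A \<Longrightarrow> i \<ge> 1"
  shows "contact_weight A r = ennreal ((1 / sqrt (2 * pi)) ^ card A * exp (- r\<^sup>2 / (2 * real (Min A))) * pers_q (Min A) r
      / (sqrt (real (Min A)) * (cfg_Delta A * sqrt (cfg_Delta A))))"
proof -
  have q: "pers_q k s \<ge> 0" for k s by (simp add: pers_q_def)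
  note gap = contact_gap_pos[OF A(1)]
  have "walk_kernel (contact_gap A i) 0 0 = ennreal (1 / sqrt (2 * pi) * (1 / (real (contact_gap A i) * sqrt (real (contact_gap A i)))))"
    if "i \<in> A - {Min A}" for i
    using walk_kernel_to_zero[OF gap[OF that], of 0] pers_q_0[OF gap[OF that]] by (simp add: real_sqrt_mult mult_ac)
  then have "(\<Prod>i\<in>A - {Min A}. walk_kernel (contact_gap A i) 0 0)
     = ennreal (\<Prod>i\<in>A - {Min A}. 1 / sqrt (2 * pi) * (1 / (real (contact_gap A i) * sqrt (real (contact_gap A i)))))"
    by (subst prod_ennreal[symmetric]) auto
  also have "(\<Prod>i\<in>A - {Min A}. 1 / sqrt (2 * pi) * (1 / (real (contact_gap A i) * sqrt (real (contact_gap A i)))))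
     = (1 / sqrt (2 * pi)) ^ (card A - 1) * (1 / (cfg_Delta A * sqrt (cfg_Delta A)))"
  proof -
    have "sqrt (\<Prod>i\<in>S. f i) = (\<Prod>i\<in>S. sqrt (f i))" for S :: "nat set" and f :: "nat \<Rightarrow> real"
      by (induction S rule: infinite_finite_induct) (auto simp: real_sqrt_mult)
    then show ?thesis using A(1,2)
      unfolding cfg_Delta_def contact_gap_def[symmetric] prod.distrib prod_dividef by (simp add: prod.distrib power_one_over)
  qed
  finally have P: "(\<Prod>i\<in>A - {Min A}. walk_kernel (contact_gap A i) 0 0) = ennreal ((1 / sqrt (2 * pi)) ^ (card A - 1) * (1 / (cfg_Delta A * sqrt (cfg_Delta A))))" .
  have k: "card A = Suc (card A - 1)" using A by (metis Suc_diff_1 card_gt_0_iff)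
  have pw: "(1 / sqrt (2 * pi)) ^ card A = 1 / sqrt (2 * pi) * (1 / sqrt (2 * pi)) ^ (card A - 1)"
    by (subst k) (rule power_Suc)
  have sq: "sqrt (2 * pi * real (Min A)) = sqrt (2 * pi) * sqrt (real (Min A))" by (rule real_sqrt_mult)
  have D: "cfg_Delta A \<ge> 0" unfolding cfg_Delta_def by (intro prod_nonneg) auto
  have "Min A \<ge> 1" using A by auto
  from walk_kernel_to_zero[OF this, of r]
  have "contact_weight A r = ennreal (exp (- r\<^sup>2 / (2 * real (Min A))) / sqrt (2 * pi * real (Min A)) * pers_q (Min A) r)
     * ennreal ((1 / sqrt (2 * pi)) ^ (card A - 1) * (1 / (cfg_Delta A * sqrt (cfg_Delta A))))"
    unfolding contact_weight_def P by simp
  also have "\<dots> = ennreal (exp (- r\<^sup>2 / (2 * real (Min A))) / sqrt (2 * pi * real (Min A)) * pers_q (Min A) r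
     * ((1 / sqrt (2 * pi)) ^ (card A - 1) * (1 / (cfg_Delta A * sqrt (cfg_Delta A)))))"
    using D q by (intro ennreal_mult[symmetric] mult_nonneg_nonneg) auto
  also have "exp (- r\<^sup>2 / (2 * real (Min A))) / sqrt (2 * pi * real (Min A)) * pers_q (Min A) r
     * ((1 / sqrt (2 * pi)) ^ (card A - 1) * (1 / (cfg_Delta A * sqrt (cfg_Delta A))))
     = (1 / sqrt (2 * pi)) ^ card A * exp (- r\<^sup>2 / (2 * real (Min A))) * pers_q (Min A) r / (sqrt (real (Min A)) * (cfg_Delta A * sqrt (cfg_Delta A)))"
    unfolding pw sq by (simp only: times_divide_eq_left times_divide_eq_right divide_divide_eq_left mult_1_left mult_1_right mult_ac)
  finally show ?thesis .
qed

lemma powr_minus_half: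
  fixes x :: real
  assumes "x > 0"
  shows "x powr (-1/2) = 1 / sqrt x" "x powr - (1/2) = 1 / sqrt x"
  using powr_minus[of x "1/2"] assms by (simp_all add: powr_half_sqrt inverse_eq_divide)

text \<open>The Gram factor raises \<open>\<Delta>^(-3/2)\<close> to \<open>\<Delta>^(-1/2)\<close>
  and the first contact time from the exponent \<open>-1/2\<close> to \<open>1/2\<close>. Survival
  after the last contact is \<open>pers_p\<close> at 0 and gives \<open>cfg_c\<close>; each of the
  \<open>k\<close> contacts leaves one factor \<open>1 / sqrt (2 * pi)\<close>.\<close>

lemma cfg_gram_contact_total:
  assumes K: "K \<in> configs m n k"
  shows "ennreal (cfg_gram m K) * contact_total m n K r
    = ennreal ((1 / sqrt (2 * pi)) ^ k * (\<Prod>l=1..m. if K l = {} then pers_p (n l) r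
        else exp (- r\<^sup>2 / (2 * real (Min (K l)))) * pers_q (Min (K l)) r * (sqrt (real (Min (K l))) / sqrt (cfg_Delta (K l)) * cfg_c (n l) (K l))))"
proof -
  let ?c = "1 / sqrt (2 * pi)"
  have Kl: "K l \<subseteq> {1..n l}" if "l \<in> {1..m}" for l using K that unfolding configs_def by (auto split: if_splits)
  have fin: "finite (K l)" if "l \<in> {1..m}" for l by (rule finite_subset[OF Kl[OF that]]) simp
  have q: "pers_q j s \<ge> 0" "pers_p j s \<ge> 0" for j s by (simp_all add: pers_q_def pers_p_def)
  have c: "cfg_c j A \<ge> 0" for j A
    unfolding cfg_c_def odd_dfact_def even_dfact_def by (intro divide_nonneg_nonneg prod_nonneg) auto
  have D: "cfg_Delta (K l) > 0" if "l \<in> {1..m}" for l using cfg_Delta_pos[OF fin[OF that]] .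
  have k: "(\<Sum>l=1..m. card (K l)) = k" using K by (simp add: configs_def)
  have "cfg_gram m K = (\<Prod>l=1..m. if K l = {} then 1 else real (Min (K l)) * cfg_Delta (K l))"
    unfolding cfg_gram_def
    by (rule prod.mono_neutral_cong_left) auto
  moreover have "\<dots> \<ge> 0 \<and> ennreal \<dots> = (\<Prod>l=1..m. ennreal (if K l = {} then 1 else real (Min (K l)) * cfg_Delta (K l)))"
  proof
    have "(if K l = {} then 1 else real (Min (K l)) * cfg_Delta (K l)) \<ge> 0" if "l \<in> {1..m}" for l
      using D[OF that] by simp
    then show "0 \<le> (\<Prod>l=1..m. if K l = {} then 1 else real (Min (K l)) * cfg_Delta (K l))"
      "ennreal (\<Prod>l=1..m. if K l = {} then 1 else real (Min (K l)) * cfg_Delta (K l)) = (\<Prod>l=1..m. ennreal (if K l = {} then 1 else real (Min (K l)) * cfg_Delta (K l)))"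
      by (auto intro!: prod_nonneg prod_ennreal[symmetric])
  qed
  ultimately have "ennreal (cfg_gram m K) * contact_total m n K r
    = (\<Prod>l=1..m. ennreal (if K l = {} then 1 else real (Min (K l)) * cfg_Delta (K l))
        * (if K l = {} then survival (n l) r else contact_weight (K l) r * survival (n l - Max (K l)) 0))"
    unfolding contact_total_def by (simp only: prod.distrib)
  also have "\<dots> = (\<Prod>l=1..m. ennreal (?c ^ card (K l) * (if K l = {} then pers_p (n l) r
        else exp (- r\<^sup>2 / (2 * real (Min (K l)))) * pers_q (Min (K l)) r * (sqrt (real (Min (K l))) / sqrt (cfg_Delta (K l)) * cfg_c (n l) (K l)))))"
  proof (rule prod.cong)
    fix l assume l: "l \<in> {1..m}"
    show "ennreal (if K l = {} then 1 else real (Min (K l)) * cfg_Delta (K l))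
        * (if K l = {} then survival (n l) r else contact_weight (K l) r * survival (n l - Max (K l)) 0)
      = ennreal (?c ^ card (K l) * (if K l = {} then pers_p (n l) r
        else exp (- r\<^sup>2 / (2 * real (Min (K l)))) * pers_q (Min (K l)) r * (sqrt (real (Min (K l))) / sqrt (cfg_Delta (K l)) * cfg_c (n l) (K l))))"
    proof (cases "K l = {}")
      case True
      then show ?thesis by (simp add: survival_eq_pers_p)
    next
      case False
      let ?i = "real (Min (K l))" and ?D = "cfg_Delta (K l)"
      let ?e = "?c ^ card (K l) * exp (- r\<^sup>2 / (2 * ?i)) * pers_q (Min (K l)) r"
      have "Min (K l) \<in> K l" using False fin[OF l] by simp
      then have i: "?i > 0" using Kl[OF l] by auto
      note D = D[OF l]
      have surv: "survival (n l - Max (K l)) 0 = ennreal (cfg_c (n l) (K l))"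
        by (simp add: survival_eq_pers_p pers_p_0 cfg_c_def)
      have cw: "contact_weight (K l) r = ennreal (?e / (sqrt ?i * (?D * sqrt ?D)))"
        by (rule contact_weight_eq[OF fin[OF l] False]) (use Kl[OF l] in auto)
      have e0: "?e \<ge> 0" using q by simp
      have nn: "0 \<le> ?i * ?D" "0 \<le> ?e / (sqrt ?i * (?D * sqrt ?D))"
        using i D by (simp, intro divide_nonneg_nonneg[OF e0]) simp
      \<comment> \<open>Stated for arbitrary \<open>E\<close> and \<open>C\<close>, so that only the
        powers of \<open>?i\<close> and \<open>?D\<close> are rearranged.\<close>
      have ident: "(?i * ?D) * (E / (sqrt ?i * (?D * sqrt ?D)) * C) = E * (sqrt ?i / sqrt ?D * C)" for E C
      proof -
        have "(?i * ?D) * (E / (sqrt ?i * (?D * sqrt ?D)) * C) = (?i / sqrt ?i) * (?D / ?D) * E * C / sqrt ?D"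
          by (simp add: mult_ac)
        also have "?i / sqrt ?i = sqrt ?i" using i by (simp add: real_div_sqrt)
        finally show ?thesis using D by simp
      qed
      have "ennreal (?i * ?D) * (contact_weight (K l) r * survival (n l - Max (K l)) 0)
        = ennreal ((?i * ?D) * (?e / (sqrt ?i * (?D * sqrt ?D)) * cfg_c (n l) (K l)))"
        unfolding cw surv by (subst ennreal_mult[OF nn(1) mult_nonneg_nonneg[OF nn(2) c]], subst ennreal_mult[OF nn(2) c]) simp
      also have "(?i * ?D) * (?e / (sqrt ?i * (?D * sqrt ?D)) * cfg_c (n l) (K l)) = ?e * (sqrt ?i / sqrt ?D * cfg_c (n l) (K l))"
        by (rule ident)
      finally show ?thesis using False by (simp only: if_False mult.assoc)
    qed
  qed simp
  also have "\<dots> = ennreal (\<Prod>l=1..m. ?c ^ card (K l) * (if K l = {} then pers_p (n l) r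
        else exp (- r\<^sup>2 / (2 * real (Min (K l)))) * pers_q (Min (K l)) r * (sqrt (real (Min (K l))) / sqrt (cfg_Delta (K l)) * cfg_c (n l) (K l))))"
  proof (rule prod_ennreal)
    fix l assume l: "l \<in> {1..m}"
    show "0 \<le> ?c ^ card (K l) * (if K l = {} then pers_p (n l) r
        else exp (- r\<^sup>2 / (2 * real (Min (K l)))) * pers_q (Min (K l)) r * (sqrt (real (Min (K l))) / sqrt (cfg_Delta (K l)) * cfg_c (n l) (K l)))"
      using q c D[OF l] by (auto intro!: mult_nonneg_nonneg)
  qed
  also have "(\<Prod>l=1..m. ?c ^ card (K l) * (if K l = {} then pers_p (n l) r
        else exp (- r\<^sup>2 / (2 * real (Min (K l)))) * pers_q (Min (K l)) r * (sqrt (real (Min (K l))) / sqrt (cfg_Delta (K l)) * cfg_c (n l) (K l))))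
    = ?c ^ k * (\<Prod>l=1..m. if K l = {} then pers_p (n l) r
        else exp (- r\<^sup>2 / (2 * real (Min (K l)))) * pers_q (Min (K l)) r * (sqrt (real (Min (K l))) / sqrt (cfg_Delta (K l)) * cfg_c (n l) (K l)))"
    unfolding prod.distrib k[symmetric] by (simp only: power_sum)
  finally show ?thesis .
qed

lemma prod_if_split:
  fixes f g :: "'a \<Rightarrow> real"
  assumes "finite S"
  shows "(\<Prod>l\<in>S. if P l then f l else g l) = (\<Prod>l\<in>{l\<in>S. P l}. f l) * (\<Prod>l\<in>{l\<in>S. \<not> P l}. g l)"
  using prod.If_cases[OF assms, of P f g] by (simp add: Int_def Collect_neg_eq[symmetric] conj_commute)

text \<open>The Gaussian factors of the first contacts multiply to
  \<open>exp (- s * r^2 / 2)\<close>, with \<open>s\<close> the sum of their reciprocal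
  times.\<close>

lemma cfg_gram_contact_total_integrand:
  assumes K: "K \<in> configs m n k"
  shows "ennreal (cfg_gram m K) * contact_total m n K r
    = ennreal ((1 / sqrt (2 * pi)) ^ k * (cfg_weight m n K * cfg_integrand m n K r))"
proof -
  let ?L = "{l\<in>{1..m}. K l \<noteq> {}}"
  have fin: "finite (K l)" if "l \<in> {1..m}" for l
    using K that unfolding configs_def by (auto split: if_splits intro: finite_subset)
  have e: "(\<Prod>l\<in>?L. exp (- r\<^sup>2 / (2 * real (Min (K l))))) = exp (- cfg_s m K * r\<^sup>2 / 2)"
  proof -
    have "- cfg_s m K * r\<^sup>2 / 2 = (\<Sum>l\<in>?L. - (1 / real (Min (K l))) * r\<^sup>2 / 2)"
      unfolding cfg_s_def by (simp add: sum_negf sum_distrib_right sum_divide_distrib)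
    also have "\<dots> = (\<Sum>l\<in>?L. - r\<^sup>2 / (2 * real (Min (K l))))" by (intro sum.cong) simp_all
    finally show ?thesis by (simp add: exp_sum)
  qed
  have w: "(\<Prod>l\<in>?L. sqrt (real (Min (K l))) / sqrt (cfg_Delta (K l)) * cfg_c (n l) (K l)) = cfg_weight m n K"
    unfolding cfg_weight_def by (rule prod.cong) (simp_all add: powr_minus_half cfg_Delta_pos[OF fin])
  have "(\<Prod>l=1..m. if K l = {} then pers_p (n l) r
        else exp (- r\<^sup>2 / (2 * real (Min (K l)))) * pers_q (Min (K l)) r * (sqrt (real (Min (K l))) / sqrt (cfg_Delta (K l)) * cfg_c (n l) (K l)))
    = (\<Prod>l\<in>{l\<in>{1..m}. K l = {}}. pers_p (n l) r) * ((\<Prod>l\<in>?L. exp (- r\<^sup>2 / (2 * real (Min (K l))))) * (\<Prod>l\<in>?L. pers_q (Min (K l)) r)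
       * (\<Prod>l\<in>?L. sqrt (real (Min (K l))) / sqrt (cfg_Delta (K l)) * cfg_c (n l) (K l)))"
    unfolding prod_if_split[OF finite_atLeastAtMost] prod.distrib ..
  also have "\<dots> = cfg_weight m n K * cfg_integrand m n K r"
    unfolding e w cfg_integrand_def by (simp only: mult_ac)
  finally show ?thesis unfolding cfg_gram_contact_total[OF K] by simp
qed

text \<open>At \<open>r = 0\<close> the bridge probability of the first contact is the reciprocal of
  its time, which turns the exponent \<open>1/2\<close> into \<open>-1/2\<close>.\<close>

lemma cfg_gram_contact_total_0:
  assumes K: "K \<in> configs m n k"
  shows "ennreal (cfg_gram m K) * contact_total m n K 0 = ennreal ((1 / sqrt (2 * pi)) ^ k * (\<Prod>l=1..m. cfg_e n K l))"
proof -
  have Kl: "K l \<subseteq> {1..n l}" if "l \<in> {1..m}" for l using K that unfolding configs_def by (auto split: if_splits)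
  have fin: "finite (K l)" if "l \<in> {1..m}" for l by (rule finite_subset[OF Kl[OF that]]) simp
  have "(\<Prod>l=1..m. if K l = {} then pers_p (n l) 0
        else exp (- 0\<^sup>2 / (2 * real (Min (K l)))) * pers_q (Min (K l)) 0 * (sqrt (real (Min (K l))) / sqrt (cfg_Delta (K l)) * cfg_c (n l) (K l)))
    = (\<Prod>l=1..m. cfg_e n K l)"
  proof (rule prod.cong)
    fix l assume l: "l \<in> {1..m}"
    show "(if K l = {} then pers_p (n l) 0
        else exp (- 0\<^sup>2 / (2 * real (Min (K l)))) * pers_q (Min (K l)) 0 * (sqrt (real (Min (K l))) / sqrt (cfg_Delta (K l)) * cfg_c (n l) (K l)))
      = cfg_e n K l"
    proof (cases "K l = {}")
      case True
      then show ?thesis by (simp add: cfg_e_def pers_p_0)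
    next
      case False
      have "Min (K l) \<in> K l" using False fin[OF l] by simp
      then have i: "Min (K l) \<ge> 1" using Kl[OF l] by auto
      have D: "cfg_Delta (K l) > 0" by (rule cfg_Delta_pos[OF fin[OF l]])
      have "sqrt (real (Min (K l))) / real (Min (K l)) = 1 / sqrt (real (Min (K l)))"
        using i by (metis inverse_eq_divide real_sqrt_ge_0_iff sqrt_divide_self_eq of_nat_0_le_iff)
      moreover have "(real (Min (K l)) * cfg_Delta (K l)) powr (-1/2) = 1 / sqrt (real (Min (K l))) * (1 / sqrt (cfg_Delta (K l)))"
        using i D by (subst powr_minus_half(1)) (auto simp: real_sqrt_mult)
      ultimately show ?thesis using False pers_q_0[OF i] by (simp add: cfg_e_def mult_ac)
    qed
  qed simp
  then show ?thesis unfolding cfg_gram_contact_total[OF K] by simp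
qed

text \<open>As the measure of an event depending on \<open>r\<close> it is not visibly measurable;
  as \<open>survival\<close> it is an integral with parameter.\<close>

lemma pers_p_measurable [measurable]: "pers_p k \<in> borel_measurable borel"
proof -
  interpret sigma_finite_measure halfline by (rule sigma_finite_halfline)
  have "survival k \<in> borel_measurable borel"
  proof (cases "k = 0")
    case False
    have "(\<lambda>r. \<integral>\<^sup>+v. walk_kernel k r v \<partial>halfline) \<in> borel_measurable borel"
    proof (rule borel_measurable_nn_integral)
      have "sets (borel \<Otimes>\<^sub>M halfline) = sets (borel \<Otimes>\<^sub>M borel :: (real \<times> real) measure)" by (intro sets_pair_measure_cong) auto
      then show "(\<lambda>(r, v). walk_kernel k r v) \<in> borel_measurable (borel \<Otimes>\<^sub>M halfline)"
        using walk_kernel_measurable_pair[of k] by (simp add: split_beta' cong: measurable_cong_sets)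
    qed
    then show ?thesis using False by (simp add: survival_def[abs_def])
  qed (simp add: survival_def[abs_def])
  then have "(\<lambda>r. enn2real (survival k r)) \<in> borel_measurable borel" by measurable
  moreover have "enn2real (survival k r) = pers_p k r" for r unfolding survival_eq_pers_p by (simp add: pers_p_def)
  ultimately show ?thesis by simp
qed

lemma pers_q_measurable:
  assumes "k \<ge> 1"
  shows "pers_q k \<in> borel_measurable borel"
proof -
  have "(\<lambda>r. walk_kernel k r 0) \<in> borel_measurable borel"
    using measurable_compose[OF measurable_Pair2'[of 0 borel borel] walk_kernel_measurable_pair[of k]] by simp
  then have m: "(\<lambda>r. enn2real (walk_kernel k r 0) * (sqrt (2 * pi * real k) * exp (r\<^sup>2 / (2 * real k)))) \<in> borel_measurable borel"
    by measurable
  have "enn2real (walk_kernel k r 0) * (sqrt (2 * pi * real k) * exp (r\<^sup>2 / (2 * real k))) = pers_q k r" for r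
  proof -
    have "enn2real (walk_kernel k r 0) = exp (- (r\<^sup>2 / (2 * real k))) / sqrt (2 * pi * real k) * pers_q k r"
      unfolding walk_kernel_to_zero[OF assms] by (subst enn2real_ennreal) (auto simp: pers_q_def)
    then show ?thesis using assms by (simp add: exp_minus field_simps)
  qed
  then show ?thesis using m by simp
qed

text \<open>Probabilities are at most 1, so the Gaussian factor dominates; it is integrable because
  a configuration of positive size has \<open>cfg_s > 0\<close>.\<close>

lemma cfg_integrand_properties:
  assumes K: "K \<in> configs m n k" "k \<ge> 1"
  shows "0 \<le> cfg_integrand m n K r" "0 < cfg_s m K" "integrable lborel (cfg_integrand m n K)"
proof -
  let ?L = "{l\<in>{1..m}. K l \<noteq> {}}"
  have Kl: "K l \<subseteq> {1..n l}" if "l \<in> {1..m}" for l using K that unfolding configs_def by (auto split: if_splits)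
  have fin: "finite (K l)" if "l \<in> {1..m}" for l by (rule finite_subset[OF Kl[OF that]]) simp
  have Min: "Min (K l) \<ge> 1" if "l \<in> ?L" for l
  proof -
    have "Min (K l) \<in> K l" using that fin[of l] by simp
    then show ?thesis using that Kl[of l] by auto
  qed
  interpret N: prob_space "normals j" for j by (rule prob_space_normals)
  have q: "0 \<le> pers_q j s" "pers_q j s \<le> 1" "0 \<le> pers_p j s" "pers_p j s \<le> 1" for j s
    by (simp_all add: pers_q_def pers_p_def)
  show nn: "0 \<le> cfg_integrand m n K r" for r
    unfolding cfg_integrand_def using q by (intro mult_nonneg_nonneg prod_nonneg) auto
  have "?L \<noteq> {}"
  proof
    assume "?L = {}"
    then have "(\<Sum>l=1..m. card (K l)) = 0" by (intro sum.neutral) auto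
    then show False using K by (simp add: configs_def)
  qed
  then show s: "0 < cfg_s m K" unfolding cfg_s_def by (intro sum_pos) (use Min in \<open>auto simp: Suc_le_eq\<close>)
  \<comment> \<open>The dominating function, written as a multiple of the normal density with
    variance \<open>1 / cfg_s m K\<close>.\<close>
  have "integrable lborel (\<lambda>r. sqrt (2 * pi / cfg_s m K) * normal_density 0 (1 / sqrt (cfg_s m K)) r)"
    using s by (intro integrable_mult_right integrable_normal_density) auto
  also have "(\<lambda>r. sqrt (2 * pi / cfg_s m K) * normal_density 0 (1 / sqrt (cfg_s m K)) r) = (\<lambda>r. exp (- cfg_s m K * r\<^sup>2 / 2))"
    using s by (auto simp: normal_density_def fun_eq_iff real_sqrt_divide real_sqrt_mult power_divide field_simps)
  finally show "integrable lborel (cfg_integrand m n K)"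
  proof (rule Bochner_Integration.integrable_bound)
    have "(\<lambda>r. \<Prod>l\<in>?L. pers_q (Min (K l)) r) \<in> borel_measurable borel"
      by (intro borel_measurable_prod pers_q_measurable Min)
    then show "cfg_integrand m n K \<in> borel_measurable lborel"
      unfolding cfg_integrand_def[abs_def] by measurable
    have "cfg_integrand m n K r \<le> exp (- cfg_s m K * r\<^sup>2 / 2) * 1 * 1" for r
      unfolding cfg_integrand_def using q by (intro mult_mono prod_le_1 prod_nonneg mult_nonneg_nonneg) auto
    then show "AE r in lborel. norm (cfg_integrand m n K r) \<le> norm (exp (- cfg_s m K * r\<^sup>2 / 2))"
      using nn by simp
  qed
qed

text \<open>On the left stands the constant of the theorem, in which
  \<open>Gamma ((real d + 1) / 2)\<close> cancels. On the right stands the integral over the slope,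
  times one factor \<open>1 / sqrt (2 * pi)\<close> for each of \<open>d + 1\<close>
  contacts.\<close>

lemma volume_constant:
  assumes "d \<ge> 1"
  shows "Gamma ((real d + 1) / 2) / (real d * sqrt pi * Gamma (real d / 2)) / (2 powr ((real d + 1) / 2 - 1) * Gamma ((real d + 1) / 2))
    = pi powr (real d / 2) / Gamma (real d / 2 + 1) * (1 / sqrt (2 * pi)) ^ Suc d"
proof -
  have g: "Gamma (real d / 2 + 1) = real d / 2 * Gamma (real d / 2)" using assms by (intro Gamma_plus1) (auto dest: nonpos_Ints_nonpos)
  have pos: "Gamma (real d / 2) > 0" "Gamma ((real d + 1) / 2) > 0" using assms by (auto intro!: Gamma_real_pos)
  have "(1 / sqrt (2 * pi)) ^ Suc d = (2 * pi) powr (- (real d + 1) / 2)"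
  proof -
    have "1 / sqrt (2 * pi) = (2 * pi) powr (-1/2)" by (simp add: powr_minus_half)
    moreover have "(1 / sqrt (2 * pi)) ^ Suc d = (1 / sqrt (2 * pi)) powr real (Suc d)" by (rule powr_realpow[symmetric]) simp
    ultimately have "(1 / sqrt (2 * pi)) ^ Suc d = ((2 * pi) powr (-1/2)) powr real (Suc d)" by (simp only:)
    also have "\<dots> = (2 * pi) powr (- (real d + 1) / 2)"
      unfolding powr_powr by (rule arg_cong[where f="\<lambda>x. (2 * pi) powr x"]) (simp add: field_simps)
    finally show ?thesis .
  qed
  also have "\<dots> = 2 powr (- (real d + 1) / 2) * pi powr (- (real d + 1) / 2)" by (simp add: powr_mult)
  finally have e: "(1 / sqrt (2 * pi)) ^ Suc d = 2 powr (- (real d + 1) / 2) * pi powr (- (real d + 1) / 2)" .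
  have p: "pi powr (real d / 2) * pi powr (- (real d + 1) / 2) = 1 / sqrt pi"
  proof -
    have "pi powr (real d / 2) * pi powr (- (real d + 1) / 2) = pi powr (-1/2)"
      unfolding powr_add[symmetric] by (rule arg_cong[where f="\<lambda>x. pi powr x"]) (simp add: field_simps)
    then show ?thesis by (simp add: powr_minus_half)
  qed
  have t: "2 * 2 powr (- (real d + 1) / 2) = 1 / 2 powr ((real d + 1) / 2 - 1)"
  proof -
    have "2 * 2 powr (- (real d + 1) / 2) = 2 powr 1 * 2 powr (- (real d + 1) / 2)" by simp
    also have "\<dots> = 2 powr (- ((real d + 1) / 2 - 1))"
      unfolding powr_add[symmetric] by (rule arg_cong[where f="\<lambda>x. 2 powr x"]) (simp add: field_simps)
    finally show ?thesis by (simp only: powr_minus inverse_eq_divide)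
  qed
  have "pi powr (real d / 2) / Gamma (real d / 2 + 1) * (1 / sqrt (2 * pi)) ^ Suc d
    = (2 * 2 powr (- (real d + 1) / 2)) * (pi powr (real d / 2) * pi powr (- (real d + 1) / 2)) / (real d * Gamma (real d / 2))"
    unfolding e g by simp
  also have "\<dots> = 1 / (real d * sqrt pi * Gamma (real d / 2)) / 2 powr ((real d + 1) / 2 - 1)"
    unfolding p t by simp
  finally have R: "pi powr (real d / 2) / Gamma (real d / 2 + 1) * (1 / sqrt (2 * pi)) ^ Suc d
    = 1 / (real d * sqrt pi * Gamma (real d / 2)) / 2 powr ((real d + 1) / 2 - 1)" .
  have "a / b / (c * a) = 1 / b / c" if "a > 0" for a b c :: real using that by simp
  from this[OF pos(2)] show ?thesis unfolding R .
qed

section \<open>Assembling the two expectations\<close>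

lemma hull_volume_expectation:
  fixes V :: "(nat \<times> nat \<Rightarrow> real^'d) \<Rightarrow> (real^'d) set"
  assumes V: "\<And>X. bounded (V X)" and meas: "(\<lambda>X. emeasure lborel (V X)) \<in> borel_measurable M"
    and int: "(\<integral>\<^sup>+X. emeasure lborel (V X) \<partial>M) = ennreal c" and c: "c \<ge> 0"
  shows "integrable M (\<lambda>X. measure lborel (V X))" "(\<integral>X. measure lborel (V X) \<partial>M) = c"
proof -
  have e: "emeasure lborel (V X) = ennreal (measure lborel (V X))" for X
    using emeasure_bounded_finite[OF V[of X]] by (intro emeasure_eq_ennreal_measure) auto
  have m: "(\<lambda>X. measure lborel (V X)) \<in> borel_measurable M"
    using meas unfolding measure_def by measurable
  have i: "(\<integral>\<^sup>+X. ennreal (measure lborel (V X)) \<partial>M) = ennreal c"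
    using int unfolding e .
  show "integrable M (\<lambda>X. measure lborel (V X))"
    by (rule integrableI_nn_integral_finite[OF m _ i]) simp
  show "(\<integral>X. measure lborel (V X) \<partial>M) = c"
    by (subst integral_eq_nn_integral[OF m]) (simp_all add: i c)
qed

text \<open>The set \<open>S\<close> stands for the range of the offset up to null sets, so that one
  statement serves both the whole line and the positive half line.\<close>

lemma expected_facet_term_affine:
  fixes m :: nat and n :: "nat \<Rightarrow> nat"
  assumes n: "\<And>l. l \<in> {1..m} \<Longrightarrow> n l \<ge> 1" and K: "K \<in> configs m n (Suc CARD('d::finite))"
    and S: "S \<in> sets borel" "J = steps m n \<or> J = insert (0, 0) (steps m n)" "AE r in lborel. r \<in> S \<longleftrightarrow> ((0, 0) \<in> J \<longrightarrow> r \<ge> 0)"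
  defines "\<kappa> \<equiv> pi powr (real CARD('d) / 2) / Gamma (real CARD('d) / 2 + 1) * (1 / sqrt (2 * pi)) ^ Suc CARD('d)"
  shows "(\<integral>\<^sup>+X. facet_term (steps m n) J (X :: _ \<Rightarrow> real^'d) (Sigma {1..m} K) \<partial>steps_law m n)
    = ennreal (\<kappa> * (cfg_s m K * cfg_weight m n K * (LINT r:S|lborel. cfg_integrand m n K r)))"
proof -
  let ?g = "pi powr (real CARD('d) / 2) / Gamma (real CARD('d) / 2 + 1)"
  let ?c = "(1 / sqrt (2 * pi)) ^ Suc CARD('d)"
  note p = cfg_integrand_properties[OF K, simplified]
  have fin: "finite (K l)" if "l \<in> {1..m}" for l
    using K that unfolding configs_def by (auto split: if_splits intro: finite_subset)
  have w0: "cfg_weight m n K \<ge> 0"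
    unfolding cfg_weight_def cfg_c_def odd_dfact_def even_dfact_def
    by (intro prod_nonneg ballI mult_nonneg_nonneg divide_nonneg_nonneg) auto
  have gp: "cfg_gram m K > 0"
    unfolding cfg_gram_def
  proof (rule prod_pos)
    fix l assume l: "l \<in> {l\<in>{1..m}. K l \<noteq> {}}"
    then have "Min (K l) \<in> K l" using fin by simp
    moreover have "K l \<subseteq> {1..n l}" using K l unfolding configs_def by (auto split: if_splits)
    ultimately show "0 < real (Min (K l)) * cfg_Delta (K l)" using cfg_Delta_pos[OF fin, of l] l by auto
  qed
  then have g0: "cfg_gram m K \<ge> 0" by simp
  have c0: "?g \<ge> 0" "?c \<ge> 0" by (auto intro!: divide_nonneg_nonneg less_imp_le[OF Gamma_real_pos] add_nonneg_pos)
  let ?f = "\<lambda>r. indicator S r * cfg_integrand m n K r"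
  have im: "integrable lborel ?f" using S(1) p(3) integrable_mult_indicator[of S lborel "cfg_integrand m n K"] by simp
  have [measurable]: "cfg_integrand m n K \<in> borel_measurable borel" using p(3) by auto
  \<comment> \<open>The value of \<open>contact_total\<close> is known after multiplication by the
    positive Gram determinant, which is divided out here and cancels at the end.\<close>
  let ?B = "?c * cfg_weight m n K / cfg_gram m K"
  have B0: "?B \<ge> 0" using c0 w0 g0 by (intro divide_nonneg_nonneg mult_nonneg_nonneg) auto
  have ct: "contact_total m n K r = ennreal (?B * cfg_integrand m n K r)" for r
  proof -
    have "contact_total m n K r = ennreal (1 / cfg_gram m K) * (ennreal (cfg_gram m K) * contact_total m n K r)"
      unfolding mult.assoc[symmetric] using gp by (subst ennreal_mult[symmetric]) simp_all
    also have "\<dots> = ennreal (1 / cfg_gram m K * (?c * (cfg_weight m n K * cfg_integrand m n K r)))"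
      unfolding cfg_gram_contact_total_integrand[OF K] using g0 by (subst ennreal_mult') simp_all
    also have "1 / cfg_gram m K * (?c * (cfg_weight m n K * cfg_integrand m n K r)) = ?B * cfg_integrand m n K r"
      by (simp only: times_divide_eq_left mult_1_left mult.assoc)
    finally show ?thesis .
  qed
  have "(\<integral>\<^sup>+r. of_bool ((0, 0) \<in> J \<longrightarrow> r \<ge> 0) * contact_total m n K r \<partial>lborel) = (\<integral>\<^sup>+r. ennreal (?B * ?f r) \<partial>lborel)"
    by (rule nn_integral_cong_AE) (use S(3) in \<open>eventually_elim, simp add: ct split: split_indicator\<close>)
  also have "\<dots> = ennreal (\<integral>r. ?B * ?f r \<partial>lborel)"
    using im B0 p(1) by (intro nn_integral_eq_integral integrable_mult_right AE_I2 mult_nonneg_nonneg) auto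
  also have "(\<integral>r. ?B * ?f r \<partial>lborel) = ?B * (LINT r:S|lborel. cfg_integrand m n K r)"
    by (simp add: set_lebesgue_integral_def)
  finally have "(\<integral>\<^sup>+X. facet_term (steps m n) J (X :: _ \<Rightarrow> real^'d) (Sigma {1..m} K) \<partial>steps_law m n)
    = ennreal (cfg_s m K * cfg_gram m K) * ennreal ?g * ennreal (?B * (LINT r:S|lborel. cfg_integrand m n K r))"
    using nn_integral_facet_term_affine(2)[OF n K S(2)] by simp
  also have "\<dots> = ennreal (cfg_s m K * cfg_gram m K * ?g * (?B * (LINT r:S|lborel. cfg_integrand m n K r)))"
    using p(2) g0 c0 by (simp only: ennreal_mult' ennreal_mult less_imp_le mult_nonneg_nonneg order_less_imp_le)
  also have "cfg_s m K * cfg_gram m K * ?g * (?B * (LINT r:S|lborel. cfg_integrand m n K r))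
    = \<kappa> * (cfg_s m K * cfg_weight m n K * (LINT r:S|lborel. cfg_integrand m n K r))"
  proof -
    have "s * \<gamma> * g * (c * w / \<gamma> * L) = g * c * (s * w * L)" if "\<gamma> > 0" for s \<gamma> g c w L :: real
      using that by simp
    from this[OF gp] show ?thesis unfolding \<kappa>_def .
  qed
  finally show ?thesis .
qed

text \<open>Only \<open>d\<close> contacts occur here, hence \<open>d\<close> density factors
  \<open>1 / sqrt (2 * pi)\<close>. Writing the result with the constant for \<open>d + 1\<close>
  contacts produces the \<open>sqrt (2 * pi)\<close> of the second sum.\<close>

lemma expected_facet_term_origin:
  fixes m :: nat and n :: "nat \<Rightarrow> nat"
  assumes n: "\<And>l. l \<in> {1..m} \<Longrightarrow> n l \<ge> 1" and K: "K \<in> configs m n CARD('d::finite)"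
  defines "\<kappa> \<equiv> pi powr (real CARD('d) / 2) / Gamma (real CARD('d) / 2 + 1) * (1 / sqrt (2 * pi)) ^ Suc CARD('d)"
  shows "(\<integral>\<^sup>+X. facet_term (steps m n) (insert (0, 0) (steps m n)) (X :: _ \<Rightarrow> real^'d) (insert (0, 0) (Sigma {1..m} K)) \<partial>steps_law m n)
    = ennreal (\<kappa> * (sqrt (2 * pi) * (\<Prod>l=1..m. cfg_e n K l)))"
proof -
  let ?g = "pi powr (real CARD('d) / 2) / Gamma (real CARD('d) / 2 + 1)"
  have g0: "?g \<ge> 0" by (auto intro!: divide_nonneg_nonneg less_imp_le[OF Gamma_real_pos] add_nonneg_pos)
  have "(\<integral>\<^sup>+X. facet_term (steps m n) (insert (0, 0) (steps m n)) (X :: _ \<Rightarrow> real^'d) (insert (0, 0) (Sigma {1..m} K)) \<partial>steps_law m n)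
    = ennreal ?g * (ennreal (cfg_gram m K) * contact_total m n K 0)"
    using nn_integral_facet_term_origin(2)[of m n K] n K by (simp add: mult_ac)
  also have "\<dots> = ennreal (?g * ((1 / sqrt (2 * pi)) ^ CARD('d) * (\<Prod>l=1..m. cfg_e n K l)))"
    unfolding cfg_gram_contact_total_0[OF K] using g0 by (rule ennreal_mult'[symmetric])
  also have "?g * ((1 / sqrt (2 * pi)) ^ CARD('d) * (\<Prod>l=1..m. cfg_e n K l)) = \<kappa> * (sqrt (2 * pi) * (\<Prod>l=1..m. cfg_e n K l))"
  proof -
    have "\<kappa> * (sqrt (2 * pi) * (\<Prod>l=1..m. cfg_e n K l)) = ?g * ((1 / sqrt (2 * pi)) ^ CARD('d) * (1 / sqrt (2 * pi) * sqrt (2 * pi)) * (\<Prod>l=1..m. cfg_e n K l))"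
      unfolding \<kappa>_def power_Suc by (simp only: mult_ac)
    also have "1 / sqrt (2 * pi) * sqrt (2 * pi) = 1" by simp
    finally show ?thesis by simp
  qed
  finally show ?thesis .
qed

theorem theorem5:
  fixes m :: nat and n :: "nat \<Rightarrow> nat"
  assumes "m \<ge> 1" and "\<forall>l\<in>{1..m}. n l \<ge> 1"
  defines "d \<equiv> CARD('d::finite)"
  defines "C \<equiv> Gamma ((real d + 1) / 2) / (real d * sqrt pi * Gamma (real d / 2))"
  defines "G \<equiv> 2 powr ((real d + 1) / 2 - 1) * Gamma ((real d + 1) / 2)"
  shows
    "integrable (steps_law m n) (\<lambda>X. measure lborel (hullQ m n X :: (real^'d) set))
     \<and> (\<integral>X. measure lborel (hullQ m n X :: (real^'d) set) \<partial>steps_law m n)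
       = C * (\<Sum>K\<in>configs m n (d + 1).
                cfg_s m K / G * cfg_weight m n K * cfg_J_full m n K)
     \<and> integrable (steps_law m n) (\<lambda>X. measure lborel (hullQ0 m n X :: (real^'d) set))
     \<and> (\<integral>X. measure lborel (hullQ0 m n X :: (real^'d) set) \<partial>steps_law m n)
       = C * ((\<Sum>K\<in>configs m n (d + 1).
                 cfg_s m K / G * cfg_weight m n K * cfg_J_pos m n K)
              + (\<Sum>K\<in>configs m n d.
                 sqrt (2 * pi) / G * (\<Prod>l=1..m. cfg_e n K l)))"
proof -
  have n: "\<And>l. l \<in> {1..m} \<Longrightarrow> n l \<ge> 1" using assms(2) by blast
  let ?E = "steps m n" and ?J = "insert (0, 0) (steps m n)"
  let ?pick = "\<lambda>K. Sigma {1..m} K"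
  define \<kappa> where "\<kappa> = pi powr (real d / 2) / Gamma (real d / 2 + 1) * (1 / sqrt (2 * pi)) ^ Suc d"
  have d1: "d \<ge> 1" unfolding d_def by (simp add: Suc_le_eq)
  have CG: "C / G = \<kappa>" unfolding C_def G_def \<kappa>_def by (rule volume_constant[OF d1])
  have \<kappa>0: "\<kappa> \<ge> 0" unfolding \<kappa>_def by (auto intro!: mult_nonneg_nonneg divide_nonneg_nonneg less_imp_le[OF Gamma_real_pos] add_nonneg_pos)
  have pts: "{walk_pt X l i | l i. (l, i) \<in> ?E} = walk_vertex X ` ?E" for X :: "_ \<Rightarrow> real^'d"
    by (force simp: walk_vertex_def)
  have hull: "hullQ m n X = convex hull (walk_vertex X ` ?E)" "hullQ0 m n X = convex hull (walk_vertex X ` ?J)" for X :: "_ \<Rightarrow> real^'d"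
    unfolding hullQ_def hullQ0_def pts by simp_all
  have bdd: "bounded (hullQ m n X)" "bounded (hullQ0 m n X)" for X :: "_ \<Rightarrow> real^'d"
    unfolding hull by (intro finite_imp_bounded_convex_hull; simp)+
  let ?A = "\<lambda>J X. \<Sum>K\<in>configs m n (Suc d). facet_term ?E J (X :: _ \<Rightarrow> real^'d) (?pick K)"
  let ?B = "\<lambda>X. \<Sum>K\<in>configs m n d. facet_term ?E ?J (X :: _ \<Rightarrow> real^'d) (insert (0, 0) (?pick K))"
  have reindexA: "(\<Sum>I | I \<subseteq> ?E \<and> card I = Suc d. f I) = (\<Sum>K\<in>configs m n (Suc d). f (?pick K))" for f :: "_ \<Rightarrow> ennreal"
    by (rule sum.reindex_bij_betw[OF bij_betw_configs, symmetric])
  \<comment> \<open>A face of the hull with origin either avoids \<open>(0, 0)\<close> or, after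
    removing it, consists of \<open>d\<close> walk positions.\<close>
  have reindexB: "(\<Sum>I | I \<subseteq> ?J \<and> card I = Suc d. f I)
     = (\<Sum>K\<in>configs m n (Suc d). f (?pick K)) + (\<Sum>K\<in>configs m n d. f (insert (0, 0) (?pick K)))" for f :: "_ \<Rightarrow> ennreal"
  proof -
    let ?F = "{I. I \<subseteq> ?E \<and> card I = Suc d}" and ?F' = "{I. I \<subseteq> ?E \<and> card I = d}"
    have finF: "finite ?F" "finite ?F'" by (rule finite_subset[of _ "Pow ?E"]; auto)+
    have z: "(0, 0) \<notin> I" if "I \<subseteq> ?E" for I using that by auto
    have fin: "finite I" if "I \<subseteq> ?E" for I using that finite_subset finite_steps by blast
    have "{I. I \<subseteq> ?J \<and> card I = Suc d} = ?F \<union> insert (0, 0) ` ?F'"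
    proof (intro equalityI subsetI)
      fix I assume I: "I \<in> {I. I \<subseteq> ?J \<and> card I = Suc d}"
      show "I \<in> ?F \<union> insert (0, 0) ` ?F'"
      proof (cases "(0, 0) \<in> I")
        case True
        then have "I - {(0, 0)} \<in> ?F'" "I = insert (0, 0) (I - {(0, 0)})" using I by auto
        then show ?thesis by blast
      next
        case False
        then show ?thesis using I by auto
      qed
    next
      fix I assume "I \<in> ?F \<union> insert (0, 0) ` ?F'"
      then show "I \<in> {I. I \<subseteq> ?J \<and> card I = Suc d}" using z fin by auto
    qed
    moreover have "?F \<inter> insert (0, 0) ` ?F' = {}" using z by auto
    ultimately have "(\<Sum>I | I \<subseteq> ?J \<and> card I = Suc d. f I) = sum f ?F + sum f (insert (0, 0) ` ?F')"
      using finF by (simp only:) (rule sum.union_disjoint; simp)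
    also have "sum f (insert (0, 0) ` ?F') = (\<Sum>I\<in>?F'. f (insert (0, 0) I))"
      by (rule sum.reindex_cong[OF _ refl refl]) (use z in \<open>auto simp: inj_on_def dest!: insert_ident[THEN iffD1, rotated 2]\<close>)
    also have "\<dots> = (\<Sum>K\<in>configs m n d. f (insert (0, 0) (?pick K)))"
      by (rule sum.reindex_bij_betw[OF bij_betw_configs, symmetric])
    finally show ?thesis unfolding reindexA .
  qed
  have vol: "emeasure lborel (hullQ m n X) = ?A ?E X" "emeasure lborel (hullQ0 m n X) = ?A ?J X + ?B X" for X :: "_ \<Rightarrow> real^'d"
    using hull_volume_eq_sum_facet_terms[where J="?E" and X=X, OF n] hull_volume_eq_sum_facet_terms[where J="?J" and X=X, OF n]
    unfolding hull d_def[symmetric] reindexA reindexB by simp_all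
  have mA: "(\<lambda>X. facet_term ?E J (X :: _ \<Rightarrow> real^'d) (?pick K)) \<in> borel_measurable (steps_law m n)" if "J = ?E \<or> J = ?J" "K \<in> configs m n (Suc d)" for J K
    by (rule nn_integral_facet_term_affine(1)[OF n that(2)[unfolded d_def] that(1)])
  have mB: "(\<lambda>X. facet_term ?E ?J (X :: _ \<Rightarrow> real^'d) (insert (0, 0) (?pick K))) \<in> borel_measurable (steps_law m n)" if "K \<in> configs m n d" for K
    by (rule nn_integral_facet_term_origin(1)[OF n that[unfolded d_def]])
  have meas: "?A ?E \<in> borel_measurable (steps_law m n)" "?A ?J \<in> borel_measurable (steps_law m n)" "?B \<in> borel_measurable (steps_law m n)"
    by (intro borel_measurable_sum mA mB; simp)+
  have w0: "cfg_weight m n K \<ge> 0" "(\<Prod>l=1..m. cfg_e n K l) \<ge> 0" for K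
    unfolding cfg_weight_def cfg_e_def cfg_c_def odd_dfact_def even_dfact_def
    by (intro prod_nonneg ballI mult_nonneg_nonneg divide_nonneg_nonneg; auto intro!: mult_nonneg_nonneg divide_nonneg_nonneg prod_nonneg)+
  have int0: "0 \<le> (LINT r:S|lborel. cfg_integrand m n K r)" if "K \<in> configs m n (Suc d)" for S K
    unfolding set_lebesgue_integral_def
    by (intro integral_nonneg_AE AE_I2 scaleR_nonneg_nonneg) (use cfg_integrand_properties(1)[OF that] in auto)
  have s0: "cfg_s m K \<ge> 0" for K unfolding cfg_s_def by (intro sum_nonneg) auto
  define wA where "wA S K = \<kappa> * (cfg_s m K * cfg_weight m n K * (LINT r:S|lborel. cfg_integrand m n K r))" for S K
  define wB where "wB K = \<kappa> * (sqrt (2 * pi) * (\<Prod>l=1..m. cfg_e n K l))" for K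
  have wA0: "wA S K \<ge> 0" if "K \<in> configs m n (Suc d)" for S K
    unfolding wA_def using \<kappa>0 s0 w0 int0[OF that] by (intro mult_nonneg_nonneg)
  have wB0: "wB K \<ge> 0" for K
    unfolding wB_def using \<kappa>0 w0 by (intro mult_nonneg_nonneg) auto
  have iA: "(\<integral>\<^sup>+X. ?A J X \<partial>steps_law m n) = ennreal (\<Sum>K\<in>configs m n (Suc d). wA S K)"
    if J: "J = ?E \<or> J = ?J" and S: "S \<in> sets borel" "AE r in lborel. r \<in> S \<longleftrightarrow> ((0, 0) \<in> J \<longrightarrow> r \<ge> 0)" for J S
  proof -
    have "(\<integral>\<^sup>+X. ?A J X \<partial>steps_law m n) = (\<Sum>K\<in>configs m n (Suc d). \<integral>\<^sup>+X. facet_term ?E J (X :: _ \<Rightarrow> real^'d) (?pick K) \<partial>steps_law m n)"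
      by (rule nn_integral_sum) (rule mA[OF J])
    also have "\<dots> = (\<Sum>K\<in>configs m n (Suc d). ennreal (wA S K))"
      unfolding wA_def \<kappa>_def d_def by (intro sum.cong refl expected_facet_term_affine[OF n _ S(1) J S(2)])
    also have "\<dots> = ennreal (\<Sum>K\<in>configs m n (Suc d). wA S K)" by (rule sum_ennreal) (rule wA0)
    finally show ?thesis .
  qed
  have iB: "(\<integral>\<^sup>+X. ?B X \<partial>steps_law m n) = ennreal (\<Sum>K\<in>configs m n d. wB K)"
  proof -
    have "(\<integral>\<^sup>+X. ?B X \<partial>steps_law m n) = (\<Sum>K\<in>configs m n d. \<integral>\<^sup>+X. facet_term ?E ?J (X :: _ \<Rightarrow> real^'d) (insert (0, 0) (?pick K)) \<partial>steps_law m n)"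
      by (rule nn_integral_sum) (rule mB)
    also have "\<dots> = (\<Sum>K\<in>configs m n d. ennreal (wB K))"
      unfolding wB_def \<kappa>_def d_def by (intro sum.cong refl expected_facet_term_origin[OF n])
    also have "\<dots> = ennreal (\<Sum>K\<in>configs m n d. wB K)" by (rule sum_ennreal) (rule wB0)
    finally show ?thesis .
  qed
  have iQ: "(\<integral>\<^sup>+X. emeasure lborel (hullQ m n X :: (real^'d) set) \<partial>steps_law m n) = ennreal (\<Sum>K\<in>configs m n (Suc d). wA UNIV K)"
    unfolding vol by (rule iA) auto
  \<comment> \<open>The face condition yields \<open>r \<ge> 0\<close>, the integral of the theorem
    runs over \<open>r > 0\<close>; they differ by one point.\<close>
  have AE0: "AE r in lborel. r \<in> {0<..} \<longleftrightarrow> ((0, 0) \<in> ?J \<longrightarrow> r \<ge> (0::real))"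
    using AE_lborel_singleton[of "0::real"] by eventually_elim auto
  have iQ0: "(\<integral>\<^sup>+X. emeasure lborel (hullQ0 m n X :: (real^'d) set) \<partial>steps_law m n)
    = ennreal ((\<Sum>K\<in>configs m n (Suc d). wA {0<..} K) + (\<Sum>K\<in>configs m n d. wB K))"
  proof -
    have "(\<integral>\<^sup>+X. emeasure lborel (hullQ0 m n X :: (real^'d) set) \<partial>steps_law m n) = (\<integral>\<^sup>+X. ?A ?J X \<partial>steps_law m n) + (\<integral>\<^sup>+X. ?B X \<partial>steps_law m n)"
      unfolding vol by (intro nn_integral_add meas)
    also have "\<dots> = ennreal (\<Sum>K\<in>configs m n (Suc d). wA {0<..} K) + ennreal (\<Sum>K\<in>configs m n d. wB K)"
      unfolding iB by (subst iA[OF _ _ AE0]) simp_all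
    finally show ?thesis using wA0 wB0 by (simp add: ennreal_plus sum_nonneg)
  qed
  have valA: "(\<Sum>K\<in>configs m n (Suc d). wA S K) = C * (\<Sum>K\<in>configs m n (d + 1). cfg_s m K / G * cfg_weight m n K * (LINT r:S|lborel. cfg_integrand m n K r))" for S
    unfolding wA_def CG[symmetric] sum_distrib_left by (simp add: mult_ac)
  have valB: "(\<Sum>K\<in>configs m n d. wB K) = C * (\<Sum>K\<in>configs m n d. sqrt (2 * pi) / G * (\<Prod>l=1..m. cfg_e n K l))"
    unfolding wB_def CG[symmetric] sum_distrib_left by (simp add: mult_ac)
  have full: "(LINT r:UNIV|lborel. cfg_integrand m n K r) = cfg_J_full m n K" for K
    by (simp add: cfg_J_full_def set_lebesgue_integral_def)
  have mQ: "(\<lambda>X. emeasure lborel (hullQ m n X :: (real^'d) set)) \<in> borel_measurable (steps_law m n)"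
    "(\<lambda>X. emeasure lborel (hullQ0 m n X :: (real^'d) set)) \<in> borel_measurable (steps_law m n)"
    unfolding vol by (intro borel_measurable_add meas)+
  have nnA: "(\<Sum>K\<in>configs m n (Suc d). wA S K) \<ge> 0" for S by (intro sum_nonneg wA0)
  have nnB: "(\<Sum>K\<in>configs m n d. wB K) \<ge> 0" by (intro sum_nonneg wB0)
  note Q = hull_volume_expectation[OF bdd(1) mQ(1) iQ nnA]
  note Q0 = hull_volume_expectation[OF bdd(2) mQ(2) iQ0 add_nonneg_nonneg[OF nnA nnB]]
  show ?thesis
    using Q Q0 unfolding valA valB full cfg_J_pos_def[symmetric] distrib_left[symmetric] by blast
qed

end
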